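(* Let $(X_t)$ be a $p$-dimensional time series satisfying the autoregressive equation $X_t=\sum_{l=1}^{K}A_lX_{t-l}+\mu D_t+\varepsilon_t$, $t=1,2,\dots$, with true order $k_0$, as described in the context. Suppose: (1) $(\varepsilon_t)$ is a martingale difference sequence with respect to the filtration $(\mathcal F_t)$ and $\sup_t \mathsf E\{(\varepsilon_t'\varepsilon_t)^{\lambda/2}\mid\mathcal F_{t-1}\}<\infty$ almost surely for some $\lambda>2$; (2) $\liminf_{t\to\infty}\lambda_{\min}\,\mathsf E(\varepsilon_t\varepsilon_t'\mid\mathcal F_{t-1})>0$ almost surely, where $\lambda_{\min}$ denotes the smallest eigenvalue; (3) all eigenvalues of $\mathbf D$ have modulus one and $\operatorname{rank}(D_1,\dots,D_{\dim\mathbf D})=\dim\mathbf D$; (4) the penalty function satisfies $f(T)=\mathrm o(T)$ as $T\to\infty$. Let $\hat k$ be the minimiser over $j\in\{0,\dots,K\}$ of $\Phi_j=\log\det\hat\Omega_j+j f(T)/T$. Then $\liminf_{T\to\infty}\hat k\ge k_0$ almost surely.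
   Context: Model. Let $p\ge 1$ and $K\ge 1$ be fixed integers. The $p$-dimensional process $X_t$, with initial values $X_{1-K},\dots,X_0$, satisfies $X_t=\sum_{l=1}^{K}A_lX_{t-l}+\mu D_t+\varepsilon_t$ for $t=1,2,\dots$, where $A_1,\dots,A_K$ are real $p\times p$ matrices, $\mu$ is a real $p\times\dim\mathbf D$ matrix, and the deterministic vector $D_t\in\mathbb R^{\dim\mathbf D}$ satisfies $D_t=\mathbf D D_{t-1}$ for a real square matrix $\mathbf D$ (of size $\dim\mathbf D\ge0$; $\dim\mathbf D=0$ means no deterministic terms). The initial values are $\mathcal F_0$-measurable, where $(\mathcal F_t)$ is an increasing sequence of $\sigma$-fields, $\varepsilon_t$ is $\mathcal F_t$-measurable, and $\mathsf E(\varepsilon_t\mid\mathcal F_{t-1})=0$ almost surely (martingale difference sequence). Order. $k_0\in\{0,\dots,K\}$ is the largest non-trivial lag: $A_{k_0}\neq0$ (if $k_0\ge1$) and $A_j=0$ for $j>k_0$. Estimators. For $0\le j\le K$, $\hat\Omega_j=T^{-1}\sum_{t=1}^T r_{j,t}r_{j,t}'$, where $r_{j,t}$ is the residual from the least squares regression of $X_t$ on $(X_{t-1}',\dots,X_{t-j}',D_t')'$ over $t=1,\dots,T$ (the effective sample is $X_1,\dots,X_T$ for every $j$). The penalty $f$ is a deterministic real function of $T$, and $\hat k=\hat k_T$ depends on $T$. *)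

theory Defs
  imports
    "HOL-Probability.Probability"
    "HOL-Library.Landau_Symbols"
    "Jordan_Normal_Form.Spectral_Radius"
    "Jordan_Normal_Form.DL_Rank"
begin

unbundle no vec_syntax

(* Vectors and matrices are those of Jordan_Normal_Form, whose dimensions are natural numbers and
   may be zero: the deterministic component may be absent and the number of regressors depends on
   the fitted order.  From here on, $ is indexing of these vectors. *)

text \<open>Martingale difference sequence \<open>eps 1, eps 2, \<dots>\<close> of \<open>p\<close>-dimensional random vectors.
  Integrability is part of the notion.\<close>

definition martingale_difference ::
  "'w measure \<Rightarrow> (nat \<Rightarrow> 'w measure) \<Rightarrow> nat \<Rightarrow> (nat \<Rightarrow> 'w \<Rightarrow> real vec) \<Rightarrow> bool" where
  "martingale_difference M F p eps \<longleftrightarrow>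
     (\<forall>t\<ge>1. (\<forall>\<omega>\<in>space M. eps t \<omega> \<in> carrier_vec p) \<and>
       (\<forall>i<p. (\<lambda>\<omega>. eps t \<omega> $ i) \<in> borel_measurable (F t) \<and>
              integrable M (\<lambda>\<omega>. eps t \<omega> $ i) \<and>
              (AE \<omega> in M. real_cond_exp M (F (t - 1)) (\<lambda>\<omega>'. eps t \<omega>' $ i) \<omega> = 0)))"

text \<open>The entries of \<open>E(e e' | G)\<close> are differences of the conditional expectations of
  positive and negative parts, so the products need not be integrable unconditionally.\<close>

definition cond_second_moment ::
  "'w measure \<Rightarrow> 'w measure \<Rightarrow> nat \<Rightarrow> ('w \<Rightarrow> real vec) \<Rightarrow> 'w \<Rightarrow> real mat" where
  "cond_second_moment M G p e \<omega> =
     mat p p (\<lambda>(a, b). real_cond_exp M G (\<lambda>\<omega>'. e \<omega>' $ a * e \<omega>' $ b) \<omega>)"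

text \<open>Only meant for matrices with real spectrum, in particular symmetric ones.\<close>

definition smallest_eigenvalue :: "real mat \<Rightarrow> real" where
  "smallest_eigenvalue A = Min (spectrum A)"

text \<open>\<open>lag_vec x t j\<close> stacks \<open>x (t - 1), \<dots>, x (t - j)\<close>.\<close>

primrec lag_vec :: "(int \<Rightarrow> real vec) \<Rightarrow> int \<Rightarrow> nat \<Rightarrow> real vec" where
  "lag_vec x t 0 = vNil"
| "lag_vec x t (Suc j) = lag_vec x t j @\<^sub>v x (t - int (Suc j))"

text \<open>In the following, \<open>x\<close> is an observed path, \<open>D\<close> the deterministic vectors, \<open>j\<close> the fitted
  order and \<open>T\<close> the sample size.\<close>

definition regressor :: "(int \<Rightarrow> real vec) \<Rightarrow> (nat \<Rightarrow> real vec) \<Rightarrow> nat \<Rightarrow> nat \<Rightarrow> real vec" where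
  "regressor x D j t = lag_vec x (int t) j @\<^sub>v D t"

definition sum_of_squares ::
  "(int \<Rightarrow> real vec) \<Rightarrow> (nat \<Rightarrow> real vec) \<Rightarrow> nat \<Rightarrow> nat \<Rightarrow> real mat \<Rightarrow> real" where
  "sum_of_squares x D j T B =
     (\<Sum>t = 1..T. let e = x (int t) - B *\<^sub>v regressor x D j t in scalar_prod e e)"

text \<open>If the regressors are collinear, the least squares coefficient is not unique, but
  the fitted values, and hence the residuals, are.\<close>

definition ls_coeff ::
  "nat \<Rightarrow> nat \<Rightarrow> (int \<Rightarrow> real vec) \<Rightarrow> (nat \<Rightarrow> real vec) \<Rightarrow> nat \<Rightarrow> nat \<Rightarrow> real mat" where
  "ls_coeff p d x D j T =
     arg_min (sum_of_squares x D j T) (\<lambda>B. B \<in> carrier_mat p (p * j + d))"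

definition ls_residual ::
  "nat \<Rightarrow> nat \<Rightarrow> (int \<Rightarrow> real vec) \<Rightarrow> (nat \<Rightarrow> real vec) \<Rightarrow> nat \<Rightarrow> nat \<Rightarrow> nat \<Rightarrow> real vec" where
  "ls_residual p d x D j T t = x (int t) - ls_coeff p d x D j T *\<^sub>v regressor x D j t"

definition Omega_hat ::
  "nat \<Rightarrow> nat \<Rightarrow> (int \<Rightarrow> real vec) \<Rightarrow> (nat \<Rightarrow> real vec) \<Rightarrow> nat \<Rightarrow> nat \<Rightarrow> real mat" where
  "Omega_hat p d x D j T = mat p p (\<lambda>(a, b).
     (\<Sum>t = 1..T. ls_residual p d x D j T t $ a * ls_residual p d x D j T t $ b) / real T)"

text \<open>The determinant of a sample covariance matrix can vanish in small samples; its
  logarithm is then \<open>- \<infinity>\<close>, whereas \<open>ln 0 = 0\<close> on the reals.\<close>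

definition log_det :: "real mat \<Rightarrow> ereal" where
  "log_det A = (if Determinant.det A > 0 then ereal (ln (Determinant.det A)) else - \<infinity>)"

definition info_criterion ::
  "nat \<Rightarrow> nat \<Rightarrow> (int \<Rightarrow> real vec) \<Rightarrow> (nat \<Rightarrow> real vec) \<Rightarrow> (nat \<Rightarrow> real) \<Rightarrow> nat \<Rightarrow> nat \<Rightarrow> ereal" where
  "info_criterion p d x D f T j =
     log_det (Omega_hat p d x D j T) + ereal (real j * f T / real T)"

end

theory Submission
  imports Defs "HOL-Library.Diagonal_Subsequence" "HOL-Library.Discrete_Functions"
begin

text \<open>The argument is pathwise. Almost surely the innovations form an empirical white noise: their
  sample autocovariances at nonzero lags tend to zero and their sample covariance matrix is bounded
  and bounded away from singularity. Nothing else about the probability space is used afterwards.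

  Suppose that along a subsequence the criterion prefers an order \<open>j\<close> below the true order \<open>k\<close>.
  Since \<open>f(T) = o(T)\<close>, the ratio of the two determinants is at most \<open>1 + o(1)\<close>. It dominates the
  ratio of the traces, so the residuals \<open>r\<close> of order \<open>j\<close> and those of order \<open>k\<close> coincide
  asymptotically in mean square; hence \<open>r\<close> is asymptotically orthogonal to all regressors of order \<open>k\<close>.
  Pass to a further subsequence along which the sample covariances \<open>\<gamma>\<^sub>i\<close> of \<open>r\<close> with the innovations
  lagged by \<open>i\<close> converge for every integer \<open>i\<close>. With \<open>A(L)\<close> the autoregressive polynomial, \<open>B(L)\<close> the
  limit of the fitted ones and \<open>\<Sigma>\<close> the limiting covariance of the innovations, the square summable
  sequence \<open>g = \<gamma> \<Sigma>\<^sup>-\<^sup>1\<close> solves \<open>g * A = B\<close>, while the normal equations force \<open>g\<^sub>i = 0\<close> for \<open>i \<ge> 1\<close>.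
  The coefficient at lag \<open>k\<close> reads \<open>g\<^sub>0 A\<^sub>k = 0\<close> with \<open>g\<^sub>0\<close> invertible, which contradicts \<open>A\<^sub>k \<noteq> 0\<close>.
  Working with covariances against the innovations, rather than with the regressors themselves,
  makes unit roots, explosive roots and asymptotically collinear regressors harmless.\<close>

section \<open>Lag operators\<close>

text \<open>With unit or explosive roots the regressors have no common rate, so the fitted
  coefficients cannot be bounded directly. The remedy is the polynomial \<open>\<chi>\<close>, the
  product of \<open>PD\<close> and det A: \<open>\<chi>(L)\<close> turns every residual, whatever
  its coefficients and drift, into a finite moving average of innovations, and a bounded mean square
  of the residual bounds that moving average. The fitted polynomials are recovered by cancelling
  \<open>\<chi>\<close>, whose constant term is 1. The delicate step is the one from the normal
  equations to g_i = 0 for i >= 1, because only k lags are orthogonal while g has infinitely many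
  coefficients. As g * A = B stops before lag k, the sum over i >= 1 of g_i (A(L)X)_{t-i} collapses
  to a combination of X_{t-1}, ..., X_{t-k}. Its drift part is a linear image of D_t, and the rest
  is the sum of g_i eps_{t-i} up to an exponentially small error. The residual is thus
  asymptotically orthogonal to its own causal part, whose size is the sum of g_i Sigma g_i'. The
  exponential rate comes from the finite support of \<open>\<chi>\<close> * g together with g_i ->
  0.\<close>

definition lag_op :: "'a::comm_ring_1 poly \<Rightarrow> (int \<Rightarrow> 'a) \<Rightarrow> int \<Rightarrow> 'a" where
  "lag_op q x t = (\<Sum>i\<le>degree q. coeff q i * x (t - int i))"

lemma lag_op_eq_sum:
  assumes "degree q \<le> n"
  shows "lag_op q x t = (\<Sum>i\<le>n. coeff q i * x (t - int i))"
  unfolding lag_op_def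
  by (rule sum.mono_neutral_left) (use assms in \<open>auto simp: coeff_eq_0\<close>)

lemma lag_op_0 [simp]: "lag_op 0 x t = 0"
  by (simp add: lag_op_def)

lemma lag_op_const [simp]: "lag_op [:c:] x t = c * x t"
  by (simp add: lag_op_def)

lemma lag_op_1 [simp]: "lag_op 1 x t = x t"
  by (simp add: lag_op_def)

lemma lag_op_add: "lag_op (q + r) x t = lag_op q x t + lag_op r x t"
proof -
  define n where "n = max (degree q) (degree r)"
  have "degree (q + r) \<le> n" "degree q \<le> n" "degree r \<le> n"
    by (auto simp: n_def degree_add_le_max)
  then show ?thesis by (simp add: lag_op_eq_sum sum.distrib algebra_simps)
qed

lemma lag_op_smult: "lag_op (Polynomial.smult c q) x t = c * lag_op q x t"
  using degree_smult_le[of c q]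
  by (simp add: lag_op_eq_sum[of _ "degree q"] sum_distrib_left mult.assoc)

lemma lag_op_sum: "lag_op (\<Sum>i\<in>I. q i) x t = (\<Sum>i\<in>I. lag_op (q i) x t)"
  by (induction I rule: infinite_finite_induct) (auto simp: lag_op_add)

lemma lag_op_pCons: "lag_op (pCons c q) x t = c * x t + lag_op q x (t - 1)"
proof -
  have "lag_op (pCons c q) x t = (\<Sum>i\<le>Suc (degree q). coeff (pCons c q) i * x (t - int i))"
    by (rule lag_op_eq_sum) (simp add: degree_pCons_le)
  also have "\<dots> = c * x t + lag_op q x (t - 1)"
    by (subst sum.atMost_Suc_shift) (simp add: lag_op_def algebra_simps)
  finally show ?thesis .
qed

lemma lag_op_fun_add: "lag_op q (\<lambda>s. x s + y s) t = lag_op q x t + lag_op q y t"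
  by (simp add: lag_op_def algebra_simps sum.distrib)

lemma lag_op_fun_diff: "lag_op q (\<lambda>s. x s - y s) t = lag_op q x t - lag_op q y t"
  by (simp add: lag_op_def algebra_simps sum_subtractf)

lemma lag_op_fun_cmult: "lag_op q (\<lambda>s. c * x s) t = c * lag_op q x t"
  by (simp add: lag_op_def sum_distrib_left algebra_simps)

lemma lag_op_fun_sum: "lag_op q (\<lambda>s. \<Sum>i\<in>I. x i s) t = (\<Sum>i\<in>I. lag_op q (x i) t)"
  by (simp add: lag_op_def sum_distrib_left) (rule sum.swap)

lemma lag_op_shift: "lag_op q (\<lambda>s. x (s - c)) t = lag_op q x (t - c)"
  by (simp add: lag_op_def algebra_simps)

text \<open>Polynomials act on sequences as a ring. Factorisations into linear factors, adjugates
  and determinants of polynomial matrices therefore all translate into identities between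
  filters.\<close>

lemma lag_op_mult: "lag_op (q * r) x t = lag_op q (lag_op r x) t"
proof (induction q arbitrary: t)
  case 0
  then show ?case by simp
next
  case (pCons a q)
  then show ?case
    by (simp add: lag_op_add lag_op_smult lag_op_pCons)
qed

lemma lag_op_commute: "lag_op q (lag_op r x) t = lag_op r (lag_op q x) t"
  by (metis lag_op_mult mult.commute)

lemma lag_op_cong_le:
  assumes "\<And>s. s \<le> t \<Longrightarrow> t - int (degree q) \<le> s \<Longrightarrow> x s = y s"
  shows "lag_op q x t = lag_op q y t"
  unfolding lag_op_def by (rule sum.cong) (use assms in auto)

text \<open>The extension by zero to negative indices puts fitted polynomials and the two-sided
  correlations with the noise into the same space, where multiplying polynomials is
  filtering.\<close>

definition coeff_seq :: "'a::comm_ring_1 poly \<Rightarrow> int \<Rightarrow> 'a" where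
  "coeff_seq q i = (if i \<ge> 0 then coeff q (nat i) else 0)"

lemma lag_op_coeff_seq: "lag_op q (coeff_seq r) i = coeff_seq (q * r) i"
proof (induction q arbitrary: i)
  case 0
  then show ?case by (simp add: coeff_seq_def)
next
  case (pCons a q)
  have "coeff_seq (pCons 0 (q * r)) i = coeff_seq (q * r) (i - 1)"
  proof (cases "i \<ge> 1")
    case True
    then have "nat i = Suc (nat (i - 1))" by simp
    then show ?thesis using True by (simp add: coeff_seq_def)
  next
    case False
    then have "i < 0 \<or> i = 0" by linarith
    then show ?thesis by (auto simp: coeff_seq_def)
  qed
  moreover have "coeff_seq (Polynomial.smult a r + pCons 0 (q * r)) i
      = a * coeff_seq r i + coeff_seq (pCons 0 (q * r)) i"
    by (simp add: coeff_seq_def)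
  ultimately show ?case using pCons by (simp add: lag_op_pCons)
qed

lemma lag_op_tendsto:
  fixes q :: "'a::{comm_ring_1,real_normed_algebra} poly"
  assumes "\<And>i. ((\<lambda>n. x n i) \<longlongrightarrow> y i) F"
  shows "((\<lambda>n. lag_op q (x n) i) \<longlongrightarrow> lag_op q y i) F"
  unfolding lag_op_def by (intro tendsto_sum tendsto_mult tendsto_const assms)

lemma lag_op_tendsto_0_at_top:
  fixes x :: "int \<Rightarrow> 'a::{comm_ring_1,real_normed_algebra}"
  assumes "(\<lambda>n. x (int n)) \<longlonglongrightarrow> 0"
  shows "(\<lambda>n. lag_op q x (int n)) \<longlonglongrightarrow> 0"
proof -
  have "(\<lambda>n. x (int n - int i)) \<longlonglongrightarrow> 0" for i
  proof (rule LIMSEQ_offset[of _ i])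
    show "(\<lambda>n. x (int (n + i) - int i)) \<longlonglongrightarrow> 0" using assms by simp
  qed
  then have "(\<lambda>n. \<Sum>i\<le>degree q. coeff q i * x (int n - int i)) \<longlonglongrightarrow> (\<Sum>i\<le>degree q. coeff q i * 0)"
    by (intro tendsto_sum tendsto_mult tendsto_const)
  then show ?thesis by (simp add: lag_op_def)
qed

lemma lag_op_tendsto_0_at_bot:
  fixes x :: "int \<Rightarrow> 'a::{comm_ring_1,real_normed_algebra}"
  assumes "(\<lambda>n. x (- int n)) \<longlonglongrightarrow> 0"
  shows "(\<lambda>n. lag_op q x (- int n)) \<longlonglongrightarrow> 0"
proof -
  have "(\<lambda>n. x (- int n - int i)) \<longlonglongrightarrow> 0" for i
    using LIMSEQ_ignore_initial_segment[OF assms, of i] by (simp add: algebra_simps)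
  then have "(\<lambda>n. \<Sum>i\<le>degree q. coeff q i * x (- int n - int i)) \<longlonglongrightarrow> (\<Sum>i\<le>degree q. coeff q i * 0)"
    by (intro tendsto_sum tendsto_mult tendsto_const)
  then show ?thesis by (simp add: lag_op_def)
qed

section \<open>Decaying solutions of linear difference equations\<close>

lemma complex_poly_linear_factor:
  fixes q :: "complex poly"
  assumes "degree q > 0"
  obtains z r where "q = [:- z, 1:] * r" "degree r < degree q" "r \<noteq> 0"
proof -
  have "\<not> constant (poly q)" using assms by (simp add: constant_degree)
  then obtain z where "poly q z = 0" using fundamental_theorem_of_algebra by blast
  then obtain r where r: "q = [:- z, 1:] * r" by (metis dvdE poly_eq_0_iff_dvd)
  have "r \<noteq> 0" using assms r by auto
  then have "degree q = 1 + degree r" unfolding r by (subst degree_mult_eq) auto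
  then show ?thesis using r \<open>r \<noteq> 0\<close> that by auto
qed

text \<open>Splitting off a root \<open>z\<close> leaves \<open>x (t - 1) = z * x t\<close>, a
  geometric sequence. It fails to decrease towards the future if \<open>norm z \<le> 1\<close> and
  towards the past otherwise, so vanishing at both ends leaves only zero. Roots on the unit circle
  are included, which is what makes unit roots harmless later.\<close>

lemma lag_op_eq_0_imp_0:
  fixes q :: "complex poly"
  assumes "q \<noteq> 0" and "(\<lambda>n. x (int n)) \<longlonglongrightarrow> 0" and "(\<lambda>n. x (- int n)) \<longlonglongrightarrow> 0"
    and "\<And>t. lag_op q x t = 0"
  shows "x t = 0"
  using assms
proof (induction "degree q" arbitrary: q x t rule: less_induct)
  case less
  show ?case
  proof (cases "degree q > 0")
    case False
    then obtain c where "q = [:c:]" "c \<noteq> 0"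
      using less.prems(1) by (metis degree_eq_zeroE gr0I pCons_0_0)
    then show ?thesis using less.prems(4)[of t] by simp
  next
    case True
    then obtain z r where r: "q = [:- z, 1:] * r" "degree r < degree q" "r \<noteq> 0"
      by (rule complex_poly_linear_factor)
    define y where "y = lag_op [:- z, 1:] x"
    have y0: "y t = 0" for t
    proof (rule less.hyps[OF r(2,3)])
      show "(\<lambda>n. y (int n)) \<longlonglongrightarrow> 0" "(\<lambda>n. y (- int n)) \<longlonglongrightarrow> 0"
        unfolding y_def using less.prems by (auto intro!: lag_op_tendsto_0_at_top lag_op_tendsto_0_at_bot)
      show "lag_op r y t = 0" for t
        unfolding y_def using less.prems(4)[of t] r(1) by (metis lag_op_mult mult.commute)
    qed
    have step: "x (t - 1) = z * x t" for t
      using y0[of t] by (simp add: y_def lag_op_pCons)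
    have pow: "x (t - int n) = z ^ n * x t" for t n
    proof (induction n)
      case (Suc n)
      have "x (t - int (Suc n)) = x (t - int n - 1)" by (simp add: algebra_simps)
      then show ?case using Suc step[of "t - int n"] by simp
    qed simp
    show "x t = 0"
    proof (cases "norm z \<le> 1")
      case True
      have "norm (x t) \<le> norm (x (t + int n))" for n
        using pow[of "t + int n" n] True
        by (simp add: norm_mult norm_power mult_left_le_one_le power_le_one)
      moreover have "(\<lambda>n. x (t + int n)) \<longlonglongrightarrow> 0"
      proof (rule LIMSEQ_offset[of _ "nat (- t)"])
        have "(\<lambda>n. x (int (n + nat t))) \<longlonglongrightarrow> 0"
          using less.prems(2) by (rule LIMSEQ_ignore_initial_segment)
        moreover have "t + int (n + nat (- t)) = int (n + nat t)" for n by simp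
        ultimately show "(\<lambda>n. x (t + int (n + nat (- t)))) \<longlonglongrightarrow> 0" by (simp only:)
      qed
      then have "(\<lambda>n. norm (x (t + int n))) \<longlonglongrightarrow> 0" by (rule tendsto_norm_zero)
      ultimately have "norm (x t) \<le> 0"
        by (intro LIMSEQ_le_const) auto
      then show ?thesis by simp
    next
      case False
      have "norm (x t) \<le> norm (x (t - int n))" for n
        using pow[of t n] False one_le_power[of "norm z" n]
        by (simp add: norm_mult norm_power mult_le_cancel_right1)
      moreover have "(\<lambda>n. x (t - int n)) \<longlonglongrightarrow> 0"
      proof (rule LIMSEQ_offset[of _ "nat t"])
        have "(\<lambda>n. x (- int (n + nat (- t)))) \<longlonglongrightarrow> 0"
          using less.prems(3) by (rule LIMSEQ_ignore_initial_segment)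
        moreover have "t - int (n + nat t) = - int (n + nat (- t))" for n by simp
        ultimately show "(\<lambda>n. x (t - int (n + nat t))) \<longlonglongrightarrow> 0" by (simp only:)
      qed
      then have "(\<lambda>n. norm (x (t - int n))) \<longlonglongrightarrow> 0" by (rule tendsto_norm_zero)
      ultimately have "norm (x t) \<le> 0"
        by (intro LIMSEQ_le_const) auto
      then show ?thesis by simp
    qed
  qed
qed

text \<open>The recurrence is solved in its stable direction. For \<open>norm z \<le> 1\<close> it
  is iterated towards infinity, where \<open>x\<close> vanishes and only a geometric tail of
  \<open>h\<close> remains; for \<open>norm z > 1\<close> it is divided by \<open>z\<close> and
  becomes a contraction from one index to the next.\<close>

lemma recurrence_exp_decay_step:
  fixes x h :: "nat \<Rightarrow> complex"
  assumes x: "x \<longlonglongrightarrow> 0" and h: "\<And>n. norm (h n) \<le> C * \<rho> ^ n" and \<rho>: "0 < \<rho>" "\<rho> < 1"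
    and rec: "\<And>n. n \<ge> N \<Longrightarrow> x n = z * x (Suc n) + h (Suc n)"
  shows "\<exists>C' \<rho>'. 0 < \<rho>' \<and> \<rho>' < 1 \<and> (\<forall>n. norm (x n) \<le> C' * \<rho>' ^ n)" (is ?thesis)
proof -
  \<comment> \<open>A bound from \<open>N\<close> on suffices: the finitely many earlier terms only
    enlarge the constant.\<close>
  have ev: ?thesis if "0 < \<rho>'" "\<rho>' < 1" and b: "\<And>n. n \<ge> N \<Longrightarrow> norm (x n) \<le> D * \<rho>' ^ n" for D \<rho>'
  proof -
    define D' where "D' = Max (insert D ((\<lambda>n. norm (x n) / \<rho>' ^ n) ` {..<N}))"
    have "norm (x n) \<le> D' * \<rho>' ^ n" for n
    proof (cases "n < N")
      case True
      then have "norm (x n) / \<rho>' ^ n \<le> D'" unfolding D'_def by (intro Max_ge) auto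
      then show ?thesis using that(1) by (simp add: field_simps)
    next
      case False
      have "D \<le> D'" unfolding D'_def by (intro Max_ge) auto
      then have "D * \<rho>' ^ n \<le> D' * \<rho>' ^ n" using that(1) by (intro mult_right_mono) auto
      then show ?thesis using b[of n] False by linarith
    qed
    then show ?thesis using that(1,2) by blast
  qed
  have C: "0 \<le> C" using h[of 0] norm_ge_zero[of "h 0"] by (simp del: norm_ge_zero)
  show ?thesis
  proof (cases "norm z \<le> 1")
    case True
    \<comment> \<open>The full geometric majorant of the inhomogeneity. The factor
      \<open>1 - \<rho> ^ m\<close> below turns it into the sum of the first \<open>m\<close> terms,
      which makes the induction close with equality.\<close>
    define S where "S = C / (1 - \<rho>)"
    have bd: "norm (x n) \<le> norm (x (n + m)) + S * \<rho> ^ n * (1 - \<rho> ^ m)" if "n \<ge> N" for n m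
    proof (induction m)
      case (Suc m)
      have "norm (x (n + m)) \<le> norm (z * x (Suc (n + m))) + norm (h (Suc (n + m)))"
        using rec[of "n + m"] that norm_triangle_ineq by simp
      also have "norm (z * x (Suc (n + m))) \<le> norm (x (Suc (n + m)))"
        using True by (simp add: norm_mult mult_left_le_one_le)
      also have "norm (h (Suc (n + m))) \<le> C * \<rho> ^ (n + m)"
      proof -
        have "C * \<rho> ^ Suc (n + m) \<le> C * \<rho> ^ (n + m)"
          using C \<rho> by (intro mult_left_mono) (auto intro!: power_decreasing)
        then show ?thesis using h[of "Suc (n + m)"] by linarith
      qed
      finally have "norm (x (n + m)) \<le> norm (x (n + Suc m)) + C * \<rho> ^ (n + m)" by simp
      moreover have "S * \<rho> ^ n * (1 - \<rho> ^ Suc m) = S * \<rho> ^ n * (1 - \<rho> ^ m) + C * \<rho> ^ (n + m)"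
      proof -
        have C_eq: "C = S * (1 - \<rho>)" using \<rho> by (simp add: S_def)
        show ?thesis unfolding C_eq power_add power_Suc by (simp add: algebra_simps)
      qed
      ultimately show ?case using Suc by simp
    qed simp
    have "norm (x n) \<le> S * \<rho> ^ n" if "n \<ge> N" for n
    proof -
      have "(\<lambda>m. norm (x (n + m)) + S * \<rho> ^ n * (1 - \<rho> ^ m)) \<longlonglongrightarrow> 0 + S * \<rho> ^ n * (1 - 0)"
      proof (intro tendsto_intros)
        have "(\<lambda>m. x (m + n)) \<longlonglongrightarrow> 0" using x by (rule LIMSEQ_ignore_initial_segment)
        then show "(\<lambda>m. norm (x (n + m))) \<longlonglongrightarrow> 0" by (simp add: add.commute tendsto_norm_zero)
        show "norm \<rho> < 1" using \<rho> by simp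
      qed
      then show ?thesis using bd[OF that] by (intro LIMSEQ_le_const[where a = "norm (x n)"]) auto
    qed
    then show ?thesis using ev[of \<rho> S] \<rho> by blast
  next
    case False
    then have z: "norm z > 1" by simp
    \<comment> \<open>The midpoint between 1 and the larger of the two natural rates. Exceeding
      \<open>1 / norm z\<close> strictly leaves the room \<open>norm z * \<rho>' - 1 > 0\<close> for
      the inhomogeneity.\<close>
    define \<rho>' where "\<rho>' = (max \<rho> (1 / norm z) + 1) / 2"
    have m1: "max \<rho> (1 / norm z) < 1" using \<rho> z by (simp add: divide_less_eq)
    then have r1: "\<rho>' < 1" "max \<rho> (1 / norm z) < \<rho>'" by (auto simp: \<rho>'_def)
    then have r2: "\<rho> \<le> \<rho>'" "1 / norm z < \<rho>'" "0 < \<rho>'" using \<rho> by auto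
    then have zr: "norm z * \<rho>' > 1"
    proof -
      have "norm z * (1 / norm z) < norm z * \<rho>'"
        by (rule mult_strict_left_mono) (use r2 z in linarith)+
      moreover have "norm z * (1 / norm z) = 1" using z by auto
      ultimately show ?thesis by linarith
    qed
    \<comment> \<open>The first entry starts the induction at \<open>N\<close>; the second is the
      least constant satisfying \<open>D1\<close>, the inequality that the induction step
      consumes.\<close>
    define D where "D = max (norm (x N) / \<rho>' ^ N) (C * \<rho>' / (norm z * \<rho>' - 1))"
    have D1: "C * \<rho>' + D \<le> D * (norm z * \<rho>')"
    proof -
      have "C * \<rho>' / (norm z * \<rho>' - 1) \<le> D" by (simp add: D_def)
      then show ?thesis using zr by (simp add: field_simps)
    qed
    have "norm (x n) \<le> D * \<rho>' ^ n" if "n \<ge> N" for n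
      using that
    proof (induction n rule: dec_induct)
      case base
      have "norm (x N) / \<rho>' ^ N \<le> D" by (simp add: D_def)
      then show ?case using r2 by (simp add: field_simps)
    next
      case (step n)
      have "norm z * norm (x (Suc n)) = norm (x n - h (Suc n))"
        using rec[of n] step by (simp flip: norm_mult)
      also have "\<dots> \<le> norm (x n) + norm (h (Suc n))" by (rule norm_triangle_ineq4)
      also have "\<dots> \<le> D * \<rho>' ^ n + C * \<rho> ^ Suc n" using step.IH h[of "Suc n"] by (intro add_mono) auto
      also have "\<dots> \<le> D * \<rho>' ^ n + C * \<rho>' ^ Suc n"
        using C \<rho> r2 by (intro add_left_mono mult_left_mono power_mono) auto
      also have "\<dots> = (C * \<rho>' + D) * \<rho>' ^ n" by (simp add: algebra_simps)
      also have "\<dots> \<le> (D * (norm z * \<rho>')) * \<rho>' ^ n" using D1 r2 by (intro mult_right_mono) auto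
      finally have "norm z * norm (x (Suc n)) \<le> norm z * (D * \<rho>' ^ Suc n)" by (simp add: algebra_simps)
      then show ?case by (rule mult_left_le_imp_le) (use z in linarith)
    qed
    then show ?thesis using ev[of \<rho>' D] r1 r2 by blast
  qed
qed

text \<open>Each linear factor is a first order recurrence with an inhomogeneity that already decays
  exponentially, so the rate is passed up one factor at a time. Convergence to zero excludes the
  persistent solutions belonging to the other roots.\<close>

lemma lag_op_exp_decay:
  fixes q :: "complex poly"
  assumes "q \<noteq> 0" and "(\<lambda>n. x (int n)) \<longlonglongrightarrow> 0" and "\<And>t. t \<ge> N \<Longrightarrow> lag_op q x t = 0"
  obtains C \<rho> where "0 < \<rho>" "\<rho> < 1" "\<And>n. norm (x (int n)) \<le> C * \<rho> ^ n"
proof -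
  have "\<exists>C \<rho>. 0 < \<rho> \<and> \<rho> < 1 \<and> (\<forall>n. norm (x (int n)) \<le> C * \<rho> ^ n)"
    using assms
  proof (induction "degree q" arbitrary: q x rule: less_induct)
    case less
    show ?case
    proof (cases "degree q > 0")
      case False
      then obtain c where c: "q = [:c:]" "c \<noteq> 0"
        using less.prems(1) by (metis degree_eq_zeroE gr0I pCons_0_0)
      have zero: "x t = 0" if "t \<ge> N" for t using less.prems(3)[OF that] c by simp
      \<comment> \<open>For a nonzero constant polynomial the sequence is zero from \<open>N\<close>
        on; the weights \<open>2 ^ n\<close> fit the remaining terms under the rate 1/2.\<close>
      define C where "C = (\<Sum>n\<le>nat N. norm (x (int n)) * 2 ^ n)"
      have "norm (x (int n)) \<le> C * (1/2) ^ n" for n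
      proof (cases "int n \<ge> N")
        case True
        have "0 \<le> C" unfolding C_def by (intro sum_nonneg) auto
        then show ?thesis using zero[OF True] by simp
      next
        case False
        have "norm (x (int n)) * 2 ^ n \<le> C" unfolding C_def
          using False by (intro member_le_sum) auto
        then show ?thesis by (simp add: power_one_over field_simps)
      qed
      then show ?thesis by (intro exI[of _ C] exI[of _ "1/2"]) auto
    next
      case True
      then obtain z r where r: "q = [:- z, 1:] * r" "degree r < degree q" "r \<noteq> 0"
        by (rule complex_poly_linear_factor)
      define y where "y = lag_op [:- z, 1:] x"
      have "\<exists>C \<rho>. 0 < \<rho> \<and> \<rho> < 1 \<and> (\<forall>n. norm (y (int n)) \<le> C * \<rho> ^ n)"
      proof (rule less.hyps[OF r(2,3)])
        show "(\<lambda>n. y (int n)) \<longlonglongrightarrow> 0"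
          unfolding y_def using less.prems by (auto intro!: lag_op_tendsto_0_at_top)
        show "lag_op r y t = 0" if "t \<ge> N" for t
          unfolding y_def using less.prems(3)[OF that] r(1) by (metis lag_op_mult mult.commute)
      qed
      then obtain C \<rho> where C: "0 < \<rho>" "\<rho> < 1" "\<And>n. norm (y (int n)) \<le> C * \<rho> ^ n" by blast
      show ?thesis
      proof (rule recurrence_exp_decay_step[where x = "\<lambda>n. x (int n)" and h = "\<lambda>n. y (int n)" and N = 0])
        show "(\<lambda>n. x (int n)) \<longlonglongrightarrow> 0" by fact
        show "x (int n) = z * x (int (Suc n)) + y (int (Suc n))" for n
          by (simp add: y_def lag_op_pCons)
      qed (use C in auto)
    qed
  qed
  then show ?thesis using that by blast
qed

lemma lag_op_map_poly_of_real:
  "lag_op (map_poly complex_of_real q) (\<lambda>t. complex_of_real (x t)) t = complex_of_real (lag_op q x t)"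
  by (simp add: lag_op_def degree_map_poly coeff_map_poly)

lemma lag_op_eq_0_imp_0_real:
  fixes q :: "real poly"
  assumes "q \<noteq> 0" and "(\<lambda>n. x (int n)) \<longlonglongrightarrow> 0" and "(\<lambda>n. x (- int n)) \<longlonglongrightarrow> 0"
    and "\<And>t. lag_op q x t = 0"
  shows "x t = 0"
proof -
  have "complex_of_real (x t) = 0"
  proof (rule lag_op_eq_0_imp_0[where q = "map_poly complex_of_real q"])
    show "map_poly complex_of_real q \<noteq> 0" using assms(1) by (simp add: map_poly_eq_0_iff)
    show "(\<lambda>n. complex_of_real (x (int n))) \<longlonglongrightarrow> 0" "(\<lambda>n. complex_of_real (x (- int n))) \<longlonglongrightarrow> 0"
      using tendsto_of_real[OF assms(2), where 'a = complex] tendsto_of_real[OF assms(3), where 'a = complex] by simp_all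
  qed (simp add: lag_op_map_poly_of_real assms)
  then show ?thesis by simp
qed

lemma lag_op_exp_decay_real:
  fixes q :: "real poly"
  assumes "q \<noteq> 0" and "(\<lambda>n. x (int n)) \<longlonglongrightarrow> 0" and "\<And>t. t \<ge> N \<Longrightarrow> lag_op q x t = 0"
  obtains C \<rho> where "0 < \<rho>" "\<rho> < 1" "\<And>n. \<bar>x (int n)\<bar> \<le> C * \<rho> ^ n"
proof (rule lag_op_exp_decay[where q = "map_poly complex_of_real q" and x = "\<lambda>t. complex_of_real (x t)" and N = N])
  show "map_poly complex_of_real q \<noteq> 0" using assms(1) by (simp add: map_poly_eq_0_iff)
  show "(\<lambda>n. complex_of_real (x (int n))) \<longlonglongrightarrow> 0"
    using tendsto_of_real[OF assms(2), where 'a = complex] by simp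
qed (use that in \<open>auto simp: lag_op_map_poly_of_real assms\<close>)

text \<open>On sequences that start at index 0 a filter with constant term 1 is unit lower
  triangular, so each value is a filtered value minus finitely many earlier ones. This gives the
  convergence of the fitted coefficients once their filtered versions converge.\<close>

lemma lag_op_tendsto_cancel:
  fixes q :: "real poly"
  assumes "coeff q 0 = 1" and "\<And>n i. i < 0 \<Longrightarrow> b n i = 0"
    and "\<And>i. convergent (\<lambda>n. lag_op q (b n) i)"
  shows "convergent (\<lambda>n. b n i)"
proof -
  have "convergent (\<lambda>n. b n (int m))" for m
  proof (induction m rule: less_induct)
    case (less m)
    have eq: "b n (int m) = lag_op q (b n) (int m) - (\<Sum>i\<in>{1..degree q}. coeff q i * b n (int m - int i))" for n
    proof -
      have "{..degree q} = insert 0 {1..degree q}" by auto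
      then show ?thesis using assms(1) by (simp add: lag_op_def)
    qed
    have "convergent (\<lambda>n. b n (int m - int i))" if "i \<in> {1..degree q}" for i
    proof (cases "i \<le> m")
      case True
      then have "int m - int i = int (m - i)" by simp
      then show ?thesis using less[of "m - i"] that True by simp
    next
      case False
      then show ?thesis using assms(2) by (simp add: convergent_const)
    qed
    then show ?case unfolding eq
      by (intro convergent_diff assms(3) convergent_sum convergent_mult convergent_const)
  qed
  then show ?thesis
    by (cases "i < 0") (use assms(2) in \<open>auto simp: convergent_const\<close>, metis int_nat_eq not_less)
qed

section \<open>Sample means and white noise\<close>

definition mean :: "nat \<Rightarrow> (int \<Rightarrow> real) \<Rightarrow> real" where
  "mean T u = (\<Sum>t = 1..T. u (int t)) / real T"

lemma mean_add: "mean T (\<lambda>t. u t + v t) = mean T u + mean T v"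
  by (simp add: mean_def sum.distrib add_divide_distrib)

lemma mean_diff: "mean T (\<lambda>t. u t - v t) = mean T u - mean T v"
  by (simp add: mean_def sum_subtractf diff_divide_distrib)

lemma mean_cmult: "mean T (\<lambda>t. c * u t) = c * mean T u"
  by (simp add: mean_def sum_distrib_left)

lemma mean_sum: "mean T (\<lambda>t. \<Sum>i\<in>I. u i t) = (\<Sum>i\<in>I. mean T (u i))"
  unfolding mean_def by (subst sum.swap) (simp add: sum_divide_distrib)

lemma mean_cong: "(\<And>t. 1 \<le> t \<Longrightarrow> t \<le> int T \<Longrightarrow> u t = v t) \<Longrightarrow> mean T u = mean T v"
  unfolding mean_def by (intro arg_cong2[where f = "(/)"] sum.cong) auto

lemma mean_nonneg: "(\<And>t. 1 \<le> t \<Longrightarrow> t \<le> int T \<Longrightarrow> 0 \<le> u t) \<Longrightarrow> 0 \<le> mean T u"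
  unfolding mean_def by (intro divide_nonneg_nonneg sum_nonneg) auto

lemma mean_mono: "(\<And>t. 1 \<le> t \<Longrightarrow> t \<le> int T \<Longrightarrow> u t \<le> v t) \<Longrightarrow> mean T u \<le> mean T v"
  unfolding mean_def by (intro divide_right_mono sum_mono) auto

lemma mean_square_sum:
  "mean T (\<lambda>t. (\<Sum>x\<in>I. v x * w x t)\<^sup>2) = (\<Sum>x\<in>I. \<Sum>y\<in>I. v x * v y * mean T (\<lambda>t. w x t * w y t))"
  by (simp add: power2_eq_square sum_product mean_sum mult.assoc mult.left_commute flip: mean_cmult)

lemma mean_Cauchy_Schwarz:
  "(mean T (\<lambda>t. u t * v t))\<^sup>2 \<le> mean T (\<lambda>t. (u t)\<^sup>2) * mean T (\<lambda>t. (v t)\<^sup>2)"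
proof -
  have "(\<Sum>t = 1..T. u (int t) * v (int t))\<^sup>2 \<le> (\<Sum>t = 1..T. (u (int t))\<^sup>2) * (\<Sum>t = 1..T. (v (int t))\<^sup>2)"
    by (rule Cauchy_Schwarz_ineq_sum)
  then show ?thesis
    by (cases "T = 0") (auto simp: mean_def power_divide power2_eq_square field_simps)
qed

lemma sum_Times: "(\<Sum>x\<in>A \<times> B. h x) = (\<Sum>i\<in>A. \<Sum>a\<in>B. h (i, a))"
  by (simp add: sum.cartesian_product)

lemma mean_square_le:
  assumes "finite I"
  shows "mean T (\<lambda>t. (\<Sum>x\<in>I. v x * w x t)\<^sup>2) \<le> (\<Sum>x\<in>I. (v x)\<^sup>2) * (\<Sum>x\<in>I. mean T (\<lambda>t. (w x t)\<^sup>2))"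
proof -
  have "mean T (\<lambda>t. (\<Sum>x\<in>I. v x * w x t)\<^sup>2) \<le> mean T (\<lambda>t. (\<Sum>x\<in>I. (v x)\<^sup>2) * (\<Sum>x\<in>I. (w x t)\<^sup>2))"
    by (intro mean_mono Cauchy_Schwarz_ineq_sum)
  then show ?thesis by (simp add: mean_cmult mean_sum)
qed

section \<open>Time shifts of sample means\<close>

definition sublinear :: "(int \<Rightarrow> real) \<Rightarrow> bool" where
  "sublinear w \<longleftrightarrow> (\<lambda>n. w (int n) / real n) \<longlonglongrightarrow> 0"

lemma sublinear_shift:
  assumes "sublinear w"
  shows "sublinear (\<lambda>t. w (t - i))"
proof -
  have up: "sublinear (\<lambda>t. w (t + 1))" if "sublinear w" for w
  proof -
    have "(\<lambda>n. w (int (Suc n)) / real (Suc n)) \<longlonglongrightarrow> 0"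
      using that unfolding sublinear_def by (rule LIMSEQ_Suc)
    moreover have "(\<lambda>n. real (Suc n) / real n) \<longlonglongrightarrow> 1"
      by (rule LIMSEQ_Suc_n_over_n)
    ultimately have "(\<lambda>n. w (int (Suc n)) / real (Suc n) * (real (Suc n) / real n)) \<longlonglongrightarrow> 0 * 1"
      by (rule tendsto_mult)
    then show ?thesis by (simp add: sublinear_def add.commute)
  qed
  have down: "sublinear (\<lambda>t. w (t - 1))" if "sublinear w" for w
  proof -
    have "(\<lambda>n. w (int n) / real n * (real n / real (Suc n))) \<longlonglongrightarrow> 0 * 1"
      using that unfolding sublinear_def by (intro tendsto_mult LIMSEQ_n_over_Suc_n)
    moreover have "w (int n) / real n * (real n / real (Suc n)) = w (int n) / real (Suc n)" if "n > 0" for n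
      using that by simp
    ultimately have "(\<lambda>n. w (int n) / real (Suc n)) \<longlonglongrightarrow> 0"
      by (auto intro: Lim_transform_eventually[OF _ eventually_mono[OF eventually_gt_at_top[of 0]]])
    then show ?thesis unfolding sublinear_def by (subst filterlim_sequentially_Suc[symmetric]) simp
  qed
  show ?thesis
  proof (induction i rule: int_induct[where k = 0])
    case base
    then show ?case using assms by simp
  next
    case (step1 i)
    have "sublinear (\<lambda>t. w (t - 1 - i))" by (rule down[OF step1(2)])
    then show ?case by (simp add: algebra_simps)
  next
    case (step2 i)
    have "sublinear (\<lambda>t. w (t + 1 - i))" by (rule up[OF step2(2)])
    then show ?case by (simp add: algebra_simps)
  qed
qed

lemma sublinear_mult:
  assumes "sublinear (\<lambda>t. (u t)\<^sup>2)" "sublinear (\<lambda>t. (v t)\<^sup>2)"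
  shows "sublinear (\<lambda>t. u t * v t)"
proof -
  have lim: "(\<lambda>n. ((u (int n))\<^sup>2 / real n + (v (int n))\<^sup>2 / real n)) \<longlonglongrightarrow> 0 + 0"
    using assms unfolding sublinear_def by (rule tendsto_add)
  have bd: "\<bar>u (int n) * v (int n) / real n\<bar> \<le> ((u (int n))\<^sup>2 / real n + (v (int n))\<^sup>2 / real n)" for n
  proof -
    have "\<bar>u (int n) * v (int n)\<bar> \<le> (u (int n))\<^sup>2 + (v (int n))\<^sup>2"
    proof -
      have "2 * \<bar>u (int n)\<bar> * \<bar>v (int n)\<bar> \<le> \<bar>u (int n)\<bar>\<^sup>2 + \<bar>v (int n)\<bar>\<^sup>2"
        by (rule sum_squares_bound)
      moreover have "0 \<le> \<bar>u (int n)\<bar> * \<bar>v (int n)\<bar>" by simp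
      ultimately show ?thesis unfolding abs_mult power2_abs by linarith
    qed
    then have "\<bar>u (int n) * v (int n)\<bar> / real n \<le> ((u (int n))\<^sup>2 + (v (int n))\<^sup>2) / real n"
      by (rule divide_right_mono) simp
    then show ?thesis by (simp only: abs_divide add_divide_distrib abs_of_nat)
  qed
  show ?thesis unfolding sublinear_def
  proof (rule Lim_null_comparison)
    show "\<forall>\<^sub>F n in sequentially. norm (u (int n) * v (int n) / real n)
        \<le> (u (int n))\<^sup>2 / real n + (v (int n))\<^sup>2 / real n"
      unfolding real_norm_def by (intro always_eventually allI bd)
    show "(\<lambda>n. (u (int n))\<^sup>2 / real n + (v (int n))\<^sup>2 / real n) \<longlonglongrightarrow> 0"
      using lim by simp
  qed
qed

text \<open>A shift by one telescopes to the two boundary terms \<open>w 0\<close> and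
  \<open>w (int T)\<close>, both negligible against the sample size; larger shifts in either
  direction follow by iteration.\<close>

lemma mean_shift_tendsto:
  assumes "sublinear w"
  shows "(\<lambda>T. mean T (\<lambda>t. w (t - i)) - mean T w) \<longlonglongrightarrow> 0"
proof -
  have one: "(\<lambda>T. mean T (\<lambda>t. w (t - 1)) - mean T w) \<longlonglongrightarrow> 0" if "sublinear w" for w
  proof -
    have "(\<Sum>t = 1..T. w (int t - 1)) - (\<Sum>t = 1..T. w (int t)) = w 0 - w (int T)" for T
      by (induction T) auto
    then have "mean T (\<lambda>t. w (t - 1)) - mean T w = w 0 / real T - w (int T) / real T" for T
      by (simp add: mean_def flip: diff_divide_distrib)
    moreover have "(\<lambda>T. w 0 / real T - w (int T) / real T) \<longlonglongrightarrow> 0 - 0"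
      using that unfolding sublinear_def by (intro tendsto_diff lim_const_over_n)
    ultimately show ?thesis by simp
  qed
  show ?thesis
  proof (induction i rule: int_induct[where k = 0])
    case base
    then show ?case by simp
  next
    case (step1 i)
    have "(\<lambda>T. (mean T (\<lambda>t. w (t - 1 - i)) - mean T (\<lambda>t. w (t - i))) + (mean T (\<lambda>t. w (t - i)) - mean T w)) \<longlonglongrightarrow> 0 + 0"
      by (intro tendsto_add step1 one[of "\<lambda>t. w (t - i)"] sublinear_shift assms)
    then show ?case by (simp add: algebra_simps)
  next
    case (step2 i)
    have "(\<lambda>T. (mean T (\<lambda>t. w (t - i)) - mean T w) - (mean T (\<lambda>t. w (t - 1 - (i - 1))) - mean T (\<lambda>t. w (t - (i - 1))))) \<longlonglongrightarrow> 0 - 0"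
      by (intro tendsto_diff step2 one[of "\<lambda>t. w (t - (i - 1))"] sublinear_shift assms)
    then show ?case by (simp add: algebra_simps)
  qed
qed

text \<open>Entries that are \<open>\<delta>\<close>-close move the form by at most
  \<open>\<delta>\<close> times the squared sum of the \<open>\<bar>v x\<bar>\<close>, and
  Cauchy-Schwarz compares that with the squared norm. The threshold in \<open>n\<close> is the same
  for all \<open>v\<close>, so \<open>v\<close> may depend on the sample size.\<close>

lemma eventually_quadratic_form_ge:
  fixes M N :: "nat \<Rightarrow> 'i \<Rightarrow> 'i \<Rightarrow> real"
  assumes I: "finite I" and "c > 0"
    and lim: "\<And>x y. x \<in> I \<Longrightarrow> y \<in> I \<Longrightarrow> (\<lambda>n. M n x y - N n x y) \<longlonglongrightarrow> 0"
    and N: "\<forall>\<^sub>F n in sequentially. \<forall>v. c * (\<Sum>x\<in>I. (v x)\<^sup>2) \<le> (\<Sum>x\<in>I. \<Sum>y\<in>I. v x * v y * N n x y)"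
  shows "\<forall>\<^sub>F n in sequentially. \<forall>v. c / 2 * (\<Sum>x\<in>I. (v x)\<^sup>2) \<le> (\<Sum>x\<in>I. \<Sum>y\<in>I. v x * v y * M n x y)"
proof -
  \<comment> \<open>Spends half of \<open>c\<close> on the perturbation; the added 1 keeps the
    denominator positive for empty \<open>I\<close>.\<close>
  define \<delta> where "\<delta> = c / (2 * (real (card I) + 1))"
  have d: "\<delta> > 0" using \<open>c > 0\<close> by (simp add: \<delta>_def)
  have "\<forall>\<^sub>F n in sequentially. \<forall>x\<in>I. \<forall>y\<in>I. \<bar>M n x y - N n x y\<bar> < \<delta>"
    using lim d by (intro eventually_ball_finite I ballI) (auto simp: tendsto_iff dist_real_def)
  with N show ?thesis
  proof eventually_elim
    case (elim n)
    show ?case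
    proof
      fix v
      have "(\<Sum>x\<in>I. \<Sum>y\<in>I. v x * v y * N n x y) - (\<Sum>x\<in>I. \<Sum>y\<in>I. v x * v y * M n x y)
          = (\<Sum>x\<in>I. \<Sum>y\<in>I. v x * v y * (N n x y - M n x y))"
        by (simp add: sum_subtractf right_diff_distrib)
      also have "\<dots> \<le> (\<Sum>x\<in>I. \<Sum>y\<in>I. \<bar>v x\<bar> * \<bar>v y\<bar> * \<delta>)"
      proof (intro sum_mono)
        fix x y assume "x \<in> I" "y \<in> I"
        then have "\<bar>N n x y - M n x y\<bar> \<le> \<delta>" using elim by (simp add: abs_minus_commute less_imp_le)
        then have "\<bar>v x * v y\<bar> * \<bar>N n x y - M n x y\<bar> \<le> \<bar>v x * v y\<bar> * \<delta>" by (intro mult_left_mono) auto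
        then show "v x * v y * (N n x y - M n x y) \<le> \<bar>v x\<bar> * \<bar>v y\<bar> * \<delta>"
          by (metis abs_le_D1 abs_mult)
      qed
      also have "\<dots> = \<delta> * (\<Sum>x\<in>I. \<bar>v x\<bar>)\<^sup>2"
        by (simp add: power2_eq_square sum_product sum_distrib_left sum_distrib_right mult_ac)
      also have "(\<Sum>x\<in>I. \<bar>v x\<bar>)\<^sup>2 \<le> real (card I) * (\<Sum>x\<in>I. (v x)\<^sup>2)"
        using Cauchy_Schwarz_ineq_sum[of "\<lambda>_. 1" "\<lambda>x. \<bar>v x\<bar>" I] by simp
      also have "\<delta> * (real (card I) * (\<Sum>x\<in>I. (v x)\<^sup>2)) \<le> c / 2 * (\<Sum>x\<in>I. (v x)\<^sup>2)"
      proof -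
        have "\<delta> * real (card I) \<le> c / 2" using \<open>c > 0\<close> by (simp add: \<delta>_def field_simps)
        then show ?thesis by (subst mult.assoc[symmetric]) (intro mult_right_mono sum_nonneg, auto)
      qed
      finally have *: "(\<Sum>x\<in>I. \<Sum>y\<in>I. v x * v y * N n x y) - (\<Sum>x\<in>I. \<Sum>y\<in>I. v x * v y * M n x y)
          \<le> c / 2 * (\<Sum>x\<in>I. (v x)\<^sup>2)" using d by (simp add: mult_left_mono)
      show "c / 2 * (\<Sum>x\<in>I. (v x)\<^sup>2) \<le> (\<Sum>x\<in>I. \<Sum>y\<in>I. v x * v y * M n x y)"
        using * elim(1)[rule_format, of v] by (simp add: field_simps)
    qed
  qed
qed

text \<open>A statement about a single path. The sample covariance matrix is bounded and uniformly
  definite but is not asked to converge, because the conditional covariances may vary in time;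
  limits are taken along subsequences later. Zero values at nonpositive times cut every lagged sum
  off at the beginning of the sample.\<close>

locale white_noise =
  fixes p :: nat and e :: "nat \<Rightarrow> int \<Rightarrow> real"
  assumes noise_nonpos: "\<And>a t. t \<le> 0 \<Longrightarrow> e a t = 0"
    and noise_lagged: "\<And>a b i. a < p \<Longrightarrow> b < p \<Longrightarrow> i \<ge> 1 \<Longrightarrow>
      (\<lambda>T. mean T (\<lambda>t. e a t * e b (t - int i))) \<longlonglongrightarrow> 0"
    and noise_bounded: "\<exists>R. \<forall>\<^sub>F T in sequentially. \<forall>a<p. mean T (\<lambda>t. (e a t)\<^sup>2) \<le> R"
    and noise_sublinear: "\<And>a. a < p \<Longrightarrow> sublinear (\<lambda>t. (e a t)\<^sup>2)"
    and noise_pd: "\<exists>c>0. \<forall>\<^sub>F T in sequentially. \<forall>u. c * (\<Sum>a<p. (u a)\<^sup>2) \<le> mean T (\<lambda>t. (\<Sum>a<p. u a * e a t)\<^sup>2)"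
begin

lemma noise_gram_same:
  assumes "a < p" "b < p"
  shows "(\<lambda>T. mean T (\<lambda>t. e a (t - i) * e b (t - i)) - mean T (\<lambda>t. e a t * e b t)) \<longlonglongrightarrow> 0"
  by (rule mean_shift_tendsto[where w = "\<lambda>t. e a t * e b t"]) (intro sublinear_mult noise_sublinear assms)

text \<open>Up to boundary terms, a common shift reduces the two lags to the single lag
  \<open>j - i\<close>.\<close>

lemma noise_gram_distinct:
  assumes "a < p" "b < p" "i \<noteq> j"
  shows "(\<lambda>T. mean T (\<lambda>t. e a (t - i) * e b (t - j))) \<longlonglongrightarrow> 0"
proof -
  have *: "(\<lambda>T. mean T (\<lambda>t. e a (t - i) * e b (t - j))) \<longlonglongrightarrow> 0"
    if ab: "a < p" "b < p" and ij: "i < j" for a b i j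
  proof -
    define w where "w = (\<lambda>t. e a t * e b (t - (j - i)))"
    have "sublinear (\<lambda>t. (e b (t - (j - i)))\<^sup>2)"
      by (rule sublinear_shift[where w = "\<lambda>t. (e b t)\<^sup>2"]) (rule noise_sublinear[OF ab(2)])
    then have "sublinear w" unfolding w_def using noise_sublinear[OF ab(1)] by (intro sublinear_mult)
    then have "(\<lambda>T. mean T (\<lambda>t. w (t - i)) - mean T w) \<longlonglongrightarrow> 0" by (rule mean_shift_tendsto)
    moreover have "(\<lambda>T. mean T w) \<longlonglongrightarrow> 0"
      using noise_lagged[OF ab, of "nat (j - i)"] ij by (simp add: w_def)
    ultimately have "(\<lambda>T. mean T (\<lambda>t. w (t - i)) - mean T w + mean T w) \<longlonglongrightarrow> 0 + 0"
      by (rule tendsto_add)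
    then show ?thesis by (simp add: w_def algebra_simps)
  qed
  show ?thesis
  proof (cases "i < j")
    case False
    then have "j < i" using assms by simp
    from *[OF assms(2,1) this] show ?thesis by (simp add: mult.commute)
  qed (use * assms in auto)
qed

text \<open>The Gram matrix of \<open>m + 1\<close> stacked lags is asymptotically block diagonal
  with the sample covariance of the noise in every block, so it keeps half of the lower bound.
  Uniformity in \<open>C\<close> matters since the coefficients inserted later are fitted ones. The
  first \<open>N\<close> terms are dropped to stay where residuals have a moving average
  representation.\<close>

lemma noise_filter_pd:
  "\<exists>c>0. \<forall>\<^sub>F T in sequentially. \<forall>C. c * (\<Sum>i\<le>m. \<Sum>a<p. (C i a)\<^sup>2)
     \<le> (\<Sum>t = Suc N..T. (\<Sum>i\<le>m. \<Sum>a<p. C i a * e a (int t - int i))\<^sup>2) / real T"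
proof -
  define I where "I = {..m} \<times> {..<p}"
  have I: "finite I" by (simp add: I_def)
  obtain c where c: "c > 0" and ev: "\<forall>\<^sub>F T in sequentially. \<forall>u. c * (\<Sum>a<p. (u a)\<^sup>2) \<le> mean T (\<lambda>t. (\<Sum>a<p. u a * e a t)\<^sup>2)"
    using noise_pd by blast
  define W where "W = (\<lambda>(i, a) t. e a (t - int i))"
  define M where "M = (\<lambda>T x y. (\<Sum>t = Suc N..T. W x (int t) * W y (int t)) / real T)"
  \<comment> \<open>The idealised Gram matrix: the same block for each lag and zeros
    elsewhere.\<close>
  define G where "G = (\<lambda>T (i::nat, a) (j::nat, b). if i = j then mean T (\<lambda>t. e a t * e b t) else 0)"
  have lim: "(\<lambda>T. M T x y - G T x y) \<longlonglongrightarrow> 0" if "x \<in> I" "y \<in> I" for x y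
  proof -
    obtain i a j b where xy: "x = (i, a)" "y = (j, b)" "a < p" "b < p" using \<open>x \<in> I\<close> \<open>y \<in> I\<close> by (auto simp: I_def)
    define S where "S = (\<Sum>t = 1..N. W x (int t) * W y (int t))"
    have "(\<lambda>T. mean T (\<lambda>t. W x t * W y t) - G T x y) \<longlonglongrightarrow> 0"
      using noise_gram_same[OF xy(3,4), of "int i"] noise_gram_distinct[OF xy(3,4), of "int i" "int j"]
      by (cases "i = j") (auto simp: xy W_def G_def)
    then have "(\<lambda>T. mean T (\<lambda>t. W x t * W y t) - G T x y - S / real T) \<longlonglongrightarrow> 0 - 0"
      by (intro tendsto_diff lim_const_over_n)
    then have "(\<lambda>T. mean T (\<lambda>t. W x t * W y t) - G T x y - S / real T) \<longlonglongrightarrow> 0" by simp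
    moreover have "\<forall>\<^sub>F T in sequentially. mean T (\<lambda>t. W x t * W y t) - G T x y - S / real T = M T x y - G T x y"
      using eventually_ge_at_top[of N]
    proof eventually_elim
      case (elim T)
      have "{1..T} = {1..N} \<union> {Suc N..T}" using elim by auto
      then have "(\<Sum>t = 1..T. W x (int t) * W y (int t)) = S + (\<Sum>t = Suc N..T. W x (int t) * W y (int t))"
        unfolding S_def by (subst sum.union_disjoint[symmetric]) auto
      then show ?case by (simp add: mean_def M_def add_divide_distrib)
    qed
    ultimately show ?thesis by (rule Lim_transform_eventually)
  qed
  have Gq: "(\<Sum>x\<in>I. \<Sum>y\<in>I. v x * v y * G T x y) = (\<Sum>i\<le>m. mean T (\<lambda>t. (\<Sum>a<p. v (i, a) * e a t)\<^sup>2))" for v T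
  proof -
    have "(\<Sum>x\<in>I. \<Sum>y\<in>I. v x * v y * G T x y)
      = (\<Sum>i\<le>m. \<Sum>a<p. \<Sum>j\<le>m. if i = j then \<Sum>b<p. v (i, a) * v (j, b) * mean T (\<lambda>t. e a t * e b t) else 0)"
      unfolding I_def sum_Times
      by (intro sum.cong refl) (auto simp: G_def)
    also have "\<dots> = (\<Sum>i\<le>m. \<Sum>a<p. \<Sum>b<p. v (i, a) * v (i, b) * mean T (\<lambda>t. e a t * e b t))"
      by simp
    finally show ?thesis by (simp add: mean_square_sum)
  qed
  have "\<forall>\<^sub>F T in sequentially. \<forall>v. c * (\<Sum>x\<in>I. (v x)\<^sup>2) \<le> (\<Sum>x\<in>I. \<Sum>y\<in>I. v x * v y * G T x y)"
    using ev
  proof eventually_elim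
    case (elim T)
    show ?case
    proof
      fix v :: "nat \<times> nat \<Rightarrow> real"
      have "c * (\<Sum>x\<in>I. (v x)\<^sup>2) = (\<Sum>i\<le>m. c * (\<Sum>a<p. (v (i, a))\<^sup>2))"
        unfolding I_def sum_Times by (simp add: sum_distrib_left)
      also have "\<dots> \<le> (\<Sum>i\<le>m. mean T (\<lambda>t. (\<Sum>a<p. v (i, a) * e a t)\<^sup>2))"
        by (intro sum_mono elim[rule_format])
      finally show "c * (\<Sum>x\<in>I. (v x)\<^sup>2) \<le> (\<Sum>x\<in>I. \<Sum>y\<in>I. v x * v y * G T x y)" by (simp add: Gq)
    qed
  qed
  from eventually_quadratic_form_ge[where N = G and M = M, OF I c _ this, OF lim]
  have "\<forall>\<^sub>F T in sequentially. \<forall>v. c / 2 * (\<Sum>x\<in>I. (v x)\<^sup>2) \<le> (\<Sum>x\<in>I. \<Sum>y\<in>I. v x * v y * M T x y)"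
    by blast
  then have "\<forall>\<^sub>F T in sequentially. \<forall>C. c / 2 * (\<Sum>i\<le>m. \<Sum>a<p. (C i a)\<^sup>2)
     \<le> (\<Sum>t = Suc N..T. (\<Sum>i\<le>m. \<Sum>a<p. C i a * e a (int t - int i))\<^sup>2) / real T"
  proof eventually_elim
    case (elim T)
    show ?case
    proof
      fix C :: "nat \<Rightarrow> nat \<Rightarrow> real"
      define v where "v = (\<lambda>(i, a). C i a)"
      have "(\<Sum>t = Suc N..T. (\<Sum>i\<le>m. \<Sum>a<p. C i a * e a (int t - int i))\<^sup>2)
        = (\<Sum>t = Suc N..T. (\<Sum>x\<in>I. v x * W x (int t))\<^sup>2)"
        unfolding I_def sum_Times by (simp add: v_def W_def)
      also have "\<dots> = (\<Sum>x\<in>I. \<Sum>y\<in>I. v x * v y * (\<Sum>t = Suc N..T. W x (int t) * W y (int t)))"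
      proof -
        have "(\<Sum>t = Suc N..T. (\<Sum>x\<in>I. v x * W x (int t))\<^sup>2)
          = (\<Sum>t = Suc N..T. \<Sum>x\<in>I. \<Sum>y\<in>I. v x * v y * (W x (int t) * W y (int t)))"
          by (simp add: power2_eq_square sum_product mult_ac)
        also have "\<dots> = (\<Sum>x\<in>I. \<Sum>t = Suc N..T. \<Sum>y\<in>I. v x * v y * (W x (int t) * W y (int t)))"
          by (rule sum.swap)
        also have "\<dots> = (\<Sum>x\<in>I. \<Sum>y\<in>I. \<Sum>t = Suc N..T. v x * v y * (W x (int t) * W y (int t)))"
          by (intro sum.cong refl sum.swap)
        finally show ?thesis by (simp add: sum_distrib_left)
      qed
      finally have "(\<Sum>t = Suc N..T. (\<Sum>i\<le>m. \<Sum>a<p. C i a * e a (int t - int i))\<^sup>2) / real T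
        = (\<Sum>x\<in>I. \<Sum>y\<in>I. v x * v y * M T x y)"
        by (simp add: M_def sum_divide_distrib sum_distrib_left)
      moreover have "(\<Sum>x\<in>I. (v x)\<^sup>2) = (\<Sum>i\<le>m. \<Sum>a<p. (C i a)\<^sup>2)"
        unfolding I_def sum_Times by (simp add: v_def)
      ultimately show "c / 2 * (\<Sum>i\<le>m. \<Sum>a<p. (C i a)\<^sup>2)
        \<le> (\<Sum>t = Suc N..T. (\<Sum>i\<le>m. \<Sum>a<p. C i a * e a (int t - int i))\<^sup>2) / real T"
        using elim[rule_format, of v] by simp
    qed
  qed
  then show ?thesis using c by (intro exI[of _ "c / 2"]) auto
qed

text \<open>The residuals change with \<open>n\<close>, so a shift argument for one fixed sequence
  does not reach them. A single squared residual is at most \<open>R\<close> times the sample size,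
  and a squared innovation is of smaller order than the sample size, so each boundary product
  divided by the sample size vanishes.\<close>

lemma mean_residual_noise_shift:
  assumes \<sigma>: "filterlim \<sigma> at_top sequentially"
    and R: "\<forall>\<^sub>F n in sequentially. mean (\<sigma> n) (\<lambda>t. (r n t)\<^sup>2) \<le> R" and a: "a < p" and j: "j \<le> N"
  shows "(\<lambda>n. (\<Sum>t = Suc N..\<sigma> n. r n (int t - int j) * e a (int t - int j - i)) / real (\<sigma> n)
      - mean (\<sigma> n) (\<lambda>t. r n t * e a (t - i))) \<longlonglongrightarrow> 0"
  using j
proof (induction j)
  have inv: "(\<lambda>n. c / real (\<sigma> n)) \<longlonglongrightarrow> 0" for c
    using filterlim_compose[OF lim_const_over_n \<sigma>] .
  have bd: "\<forall>\<^sub>F n in sequentially. \<forall>s. 1 \<le> s \<longrightarrow> s \<le> int (\<sigma> n) \<longrightarrow>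
      (r n s * e a (s - i) / real (\<sigma> n))\<^sup>2 \<le> R * ((e a (s - i))\<^sup>2 / real (\<sigma> n))"
    using R
  proof eventually_elim
    case (elim n)
    show ?case
    proof (intro allI impI)
      fix s assume s: "1 \<le> s" "s \<le> int (\<sigma> n)"
      then have T: "real (\<sigma> n) > 0" by auto
      have "(r n (int (nat s)))\<^sup>2 \<le> (\<Sum>t = 1..\<sigma> n. (r n (int t))\<^sup>2)"
        using s by (intro member_le_sum[where f = "\<lambda>t. (r n (int t))\<^sup>2"]) auto
      also have "\<dots> \<le> R * real (\<sigma> n)" using elim T by (simp add: mean_def field_simps)
      finally have "(r n s)\<^sup>2 * (e a (s - i))\<^sup>2 \<le> R * real (\<sigma> n) * (e a (s - i))\<^sup>2"
        using s by (intro mult_right_mono) auto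
      then show "(r n s * e a (s - i) / real (\<sigma> n))\<^sup>2 \<le> R * ((e a (s - i))\<^sup>2 / real (\<sigma> n))"
        using T by (simp add: power_divide power_mult_distrib power2_eq_square field_simps)
    qed
  qed
  have fixed: "(\<lambda>n. r n (int s) * e a (int s - i) / real (\<sigma> n)) \<longlonglongrightarrow> 0" if "s \<ge> 1" for s
  proof -
    have "\<forall>\<^sub>F n in sequentially. s \<le> \<sigma> n" using \<sigma> by (simp add: filterlim_at_top)
    with bd have "\<forall>\<^sub>F n in sequentially. norm ((r n (int s) * e a (int s - i) / real (\<sigma> n))\<^sup>2)
        \<le> R * ((e a (int s - i))\<^sup>2 / real (\<sigma> n))"
      by eventually_elim (use that in auto)
    moreover have "(\<lambda>n. R * ((e a (int s - i))\<^sup>2 / real (\<sigma> n))) \<longlonglongrightarrow> 0"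
      using tendsto_mult_right_zero[OF inv] .
    ultimately have "(\<lambda>n. (r n (int s) * e a (int s - i) / real (\<sigma> n))\<^sup>2) \<longlonglongrightarrow> 0"
      by (rule Lim_null_comparison)
    then show ?thesis by simp
  qed
  have last: "(\<lambda>n. r n (int (\<sigma> n) - int l) * e a (int (\<sigma> n) - int l - i) / real (\<sigma> n)) \<longlonglongrightarrow> 0" for l
  proof -
    have "\<forall>\<^sub>F n in sequentially. l + 1 \<le> \<sigma> n" using \<sigma> by (simp add: filterlim_at_top)
    with bd have "\<forall>\<^sub>F n in sequentially. norm ((r n (int (\<sigma> n) - int l) * e a (int (\<sigma> n) - int l - i) / real (\<sigma> n))\<^sup>2)
        \<le> R * ((e a (int (\<sigma> n) - int l - i))\<^sup>2 / real (\<sigma> n))"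
      by eventually_elim auto
    moreover have "(\<lambda>n. R * ((e a (int (\<sigma> n) - int l - i))\<^sup>2 / real (\<sigma> n))) \<longlonglongrightarrow> 0"
    proof (rule tendsto_mult_right_zero)
      have "sublinear (\<lambda>t. (e a (t - (int l + i)))\<^sup>2)"
        by (rule sublinear_shift[where w = "\<lambda>t. (e a t)\<^sup>2"]) (rule noise_sublinear[OF a])
      then have "(\<lambda>n. (e a (int n - (int l + i)))\<^sup>2 / real n) \<longlonglongrightarrow> 0" by (simp add: sublinear_def)
      from filterlim_compose[OF this \<sigma>]
      show "(\<lambda>n. (e a (int (\<sigma> n) - int l - i))\<^sup>2 / real (\<sigma> n)) \<longlonglongrightarrow> 0" by (simp add: algebra_simps)
    qed
    ultimately have "(\<lambda>n. (r n (int (\<sigma> n) - int l) * e a (int (\<sigma> n) - int l - i) / real (\<sigma> n))\<^sup>2) \<longlonglongrightarrow> 0"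
      by (rule Lim_null_comparison)
    then show ?thesis by simp
  qed
  {
    case 0
    have "(\<lambda>n. - (\<Sum>s = 1..N. r n (int s) * e a (int s - i) / real (\<sigma> n))) \<longlonglongrightarrow> - (\<Sum>s = 1..N. 0)"
      by (intro tendsto_minus tendsto_sum fixed) auto
    then have "(\<lambda>n. - (\<Sum>s = 1..N. r n (int s) * e a (int s - i) / real (\<sigma> n))) \<longlonglongrightarrow> 0" by simp
    moreover have "\<forall>\<^sub>F n in sequentially. N \<le> \<sigma> n" using \<sigma> by (simp add: filterlim_at_top)
    then have "\<forall>\<^sub>F n in sequentially. - (\<Sum>s = 1..N. r n (int s) * e a (int s - i) / real (\<sigma> n))
      = (\<Sum>t = Suc N..\<sigma> n. r n (int t - int 0) * e a (int t - int 0 - i)) / real (\<sigma> n)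
      - mean (\<sigma> n) (\<lambda>t. r n t * e a (t - i))"
    proof eventually_elim
      case (elim n)
      have "{1..\<sigma> n} = {1..N} \<union> {Suc N..\<sigma> n}" using elim by auto
      then have "(\<Sum>t = 1..\<sigma> n. r n (int t) * e a (int t - i))
        = (\<Sum>t = 1..N. r n (int t) * e a (int t - i)) + (\<Sum>t = Suc N..\<sigma> n. r n (int t) * e a (int t - i))"
        by (subst sum.union_disjoint[symmetric]) auto
      then show ?case by (simp add: mean_def add_divide_distrib sum_divide_distrib)
    qed
    ultimately show ?case by (rule Lim_transform_eventually)
  next
    case (Suc j)
    define f where "f n t = r n t * e a (t - i)" for n t
    \<comment> \<open>One more lag exchanges the last term of the window for one before its first.
      \<open>Suc j \<le> N\<close> keeps the latter at a time of at least 1, where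
      \<open>fixed\<close> applies.\<close>
    have tel: "(\<Sum>t = Suc N..T. f n (int t - int j)) - (\<Sum>t = Suc N..T. f n (int t - int (Suc j)))
        = f n (int T - int j) - f n (int N - int j)" if "N \<le> T" for n T
      using that
    proof (induction T rule: dec_induct)
      case (step T)
      have "f n (int (Suc T) - int (Suc j)) = f n (int T - int j)" by simp
      then show ?case using step by (simp add: sum.cl_ivl_Suc)
    qed simp
    have "(\<lambda>n. ((\<Sum>t = Suc N..\<sigma> n. f n (int t - int j)) / real (\<sigma> n) - mean (\<sigma> n) (f n))
       - (f n (int (\<sigma> n) - int j) / real (\<sigma> n) - f n (int (N - j)) / real (\<sigma> n))) \<longlonglongrightarrow> 0 - (0 - 0)"
      unfolding f_def using Suc by (intro tendsto_diff last fixed) auto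
    then have "(\<lambda>n. ((\<Sum>t = Suc N..\<sigma> n. f n (int t - int j)) / real (\<sigma> n) - mean (\<sigma> n) (f n))
       - (f n (int (\<sigma> n) - int j) / real (\<sigma> n) - f n (int (N - j)) / real (\<sigma> n))) \<longlonglongrightarrow> 0" by simp
    moreover have "\<forall>\<^sub>F n in sequentially. N \<le> \<sigma> n" using \<sigma> by (simp add: filterlim_at_top)
    then have "\<forall>\<^sub>F n in sequentially. ((\<Sum>t = Suc N..\<sigma> n. f n (int t - int j)) / real (\<sigma> n) - mean (\<sigma> n) (f n))
       - (f n (int (\<sigma> n) - int j) / real (\<sigma> n) - f n (int (N - j)) / real (\<sigma> n))
       = (\<Sum>t = Suc N..\<sigma> n. f n (int t - int (Suc j))) / real (\<sigma> n) - mean (\<sigma> n) (f n)"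
    proof eventually_elim
      case (elim n)
      have "int (N - j) = int N - int j" using Suc by simp
      then show ?case using tel[OF elim, of n] by (simp add: algebra_simps flip: add_divide_distrib)
    qed
    ultimately show ?case unfolding f_def by (rule Lim_transform_eventually)
  }
qed

text \<open>Bessel's inequality for a system that is orthogonal only in the limit: subtract from
  \<open>r\<close> a multiple of the combination of lagged innovations with coefficients
  \<open>\<gamma>\<close> and use that a mean square is nonnegative. As the bound is the same for
  every finite \<open>J\<close>, the correlations are square summable.\<close>

lemma noise_Bessel:
  assumes \<sigma>: "filterlim \<sigma> at_top sequentially"
    and R: "\<forall>\<^sub>F n in sequentially. mean (\<sigma> n) (\<lambda>t. (r n t)\<^sup>2) \<le> R"
    and \<gamma>: "\<And>a i. a < p \<Longrightarrow> (\<lambda>n. mean (\<sigma> n) (\<lambda>t. r n t * e a (t - i))) \<longlonglongrightarrow> \<gamma> a i"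
  shows "\<exists>B. \<forall>J. finite J \<longrightarrow> (\<Sum>i\<in>J. \<Sum>a<p. (\<gamma> a i)\<^sup>2) \<le> B"
proof -
  obtain R' where R': "\<forall>\<^sub>F T in sequentially. \<forall>a<p. mean T (\<lambda>t. (e a t)\<^sup>2) \<le> R'" using noise_bounded by blast
  define K where "K = real p * \<bar>R'\<bar> + 1"
  have K: "K > 0" by (simp add: K_def add_nonneg_pos)
  have "(\<Sum>i\<in>J. \<Sum>a<p. (\<gamma> a i)\<^sup>2) \<le> R * K" if J: "finite J" for J
  proof -
    define I where "I = J \<times> {..<p}"
    have I: "finite I" using J by (simp add: I_def)
    define W where "W = (\<lambda>(i, a) t. e a (t - i))"
    define v where "v = (\<lambda>(i, a). \<gamma> a i)"
    define V where "V = (\<Sum>x\<in>I. (v x)\<^sup>2)"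
    define G where "G = (\<lambda>T (i::int, a) (j::int, b). if i = j then mean T (\<lambda>t. e a t * e b t) else 0)"
    define Q where "Q T = (\<Sum>x\<in>I. \<Sum>y\<in>I. v x * v y * (mean T (\<lambda>t. W x t * W y t) - G T x y))" for T
    have V_eq: "V = (\<Sum>i\<in>J. \<Sum>a<p. (\<gamma> a i)\<^sup>2)"
      unfolding V_def I_def sum_Times by (simp add: v_def)
    have "(\<lambda>T. mean T (\<lambda>t. W x t * W y t) - G T x y) \<longlonglongrightarrow> 0" if "x \<in> I" "y \<in> I" for x y
    proof -
      obtain i a j b where xy: "x = (i, a)" "y = (j, b)" "a < p" "b < p" using \<open>x \<in> I\<close> \<open>y \<in> I\<close> by (auto simp: I_def)
      show ?thesis
        using noise_gram_same[OF xy(3,4), of i] noise_gram_distinct[OF xy(3,4), of i j]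
        by (cases "i = j") (auto simp: xy W_def G_def)
    qed
    then have "Q \<longlonglongrightarrow> (\<Sum>x\<in>I. \<Sum>y\<in>I. v x * v y * 0)"
      unfolding Q_def by (intro tendsto_sum tendsto_mult tendsto_const)
    then have Q: "(\<lambda>n. Q (\<sigma> n)) \<longlonglongrightarrow> 0" using filterlim_compose[OF _ \<sigma>, of Q] by simp
    have Gq: "(\<Sum>x\<in>I. \<Sum>y\<in>I. v x * v y * G T x y) = (\<Sum>i\<in>J. mean T (\<lambda>t. (\<Sum>a<p. v (i, a) * e a t)\<^sup>2))" for T
    proof -
      have "(\<Sum>x\<in>I. \<Sum>y\<in>I. v x * v y * G T x y)
        = (\<Sum>i\<in>J. \<Sum>a<p. \<Sum>j\<in>J. if i = j then \<Sum>b<p. v (i, a) * v (j, b) * mean T (\<lambda>t. e a t * e b t) else 0)"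
        unfolding I_def sum_Times
        by (intro sum.cong refl) (auto simp: G_def)
      also have "\<dots> = (\<Sum>i\<in>J. \<Sum>a<p. \<Sum>b<p. v (i, a) * v (i, b) * mean T (\<lambda>t. e a t * e b t))"
        using J by simp
      finally show ?thesis by (simp add: mean_square_sum)
    qed
    have Gle: "\<forall>\<^sub>F n in sequentially. (\<Sum>x\<in>I. \<Sum>y\<in>I. v x * v y * G (\<sigma> n) x y) \<le> K * V"
      using eventually_compose_filterlim[OF R' \<sigma>]
    proof eventually_elim
      case (elim n)
      have "(\<Sum>x\<in>I. \<Sum>y\<in>I. v x * v y * G (\<sigma> n) x y) \<le> (\<Sum>i\<in>J. (\<Sum>a<p. (v (i, a))\<^sup>2) * K)"
        unfolding Gq
      proof (rule sum_mono)
        fix i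
        have "(\<Sum>a<p. mean (\<sigma> n) (\<lambda>t. (e a t)\<^sup>2)) \<le> (\<Sum>a<p. \<bar>R'\<bar>)"
          using elim by (intro sum_mono) fastforce
        also have "\<dots> \<le> K" by (simp add: K_def)
        finally show "mean (\<sigma> n) (\<lambda>t. (\<Sum>a<p. v (i, a) * e a t)\<^sup>2) \<le> (\<Sum>a<p. (v (i, a))\<^sup>2) * K"
          by (intro order.trans[OF mean_square_le] mult_left_mono sum_nonneg) auto
      qed
      also have "\<dots> = K * V"
        unfolding V_def I_def sum_Times by (simp add: sum_distrib_left mult.commute)
      finally show ?case .
    qed
    \<comment> \<open>The maximiser of \<open>2 * s * V - s\<^sup>2 * (K * V)\<close>, with maximal
      value \<open>V / K\<close>.\<close>
    define s where "s = 1 / K"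
    have "\<forall>\<^sub>F n in sequentially. 2 * s * (\<Sum>x\<in>I. v x * mean (\<sigma> n) (\<lambda>t. r n t * W x t)) - s\<^sup>2 * (K * V) - s\<^sup>2 * Q (\<sigma> n) \<le> R"
      using R Gle
    proof eventually_elim
      case (elim n)
      have "0 \<le> mean (\<sigma> n) (\<lambda>t. (r n t - s * (\<Sum>x\<in>I. v x * W x t))\<^sup>2)"
        by (intro mean_nonneg) auto
      also have "\<dots> = mean (\<sigma> n) (\<lambda>t. ((r n t)\<^sup>2 - 2 * s * (\<Sum>x\<in>I. v x * (r n t * W x t))) + s\<^sup>2 * (\<Sum>x\<in>I. v x * W x t)\<^sup>2)"
        by (intro mean_cong) (simp add: power2_diff power_mult_distrib mult_ac sum_distrib_left[of "r n _"])
      also have "\<dots> = mean (\<sigma> n) (\<lambda>t. (r n t)\<^sup>2) - 2 * s * (\<Sum>x\<in>I. v x * mean (\<sigma> n) (\<lambda>t. r n t * W x t))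
          + s\<^sup>2 * mean (\<sigma> n) (\<lambda>t. (\<Sum>x\<in>I. v x * W x t)\<^sup>2)"
        by (simp add: mean_add mean_diff mean_cmult mean_sum)
      also have "mean (\<sigma> n) (\<lambda>t. (\<Sum>x\<in>I. v x * W x t)\<^sup>2) = Q (\<sigma> n) + (\<Sum>x\<in>I. \<Sum>y\<in>I. v x * v y * G (\<sigma> n) x y)"
        by (simp add: mean_square_sum Q_def right_diff_distrib sum_subtractf)
      also have "s\<^sup>2 * (Q (\<sigma> n) + (\<Sum>x\<in>I. \<Sum>y\<in>I. v x * v y * G (\<sigma> n) x y)) \<le> s\<^sup>2 * (Q (\<sigma> n) + K * V)"
        using elim by (intro mult_left_mono add_left_mono) auto
      finally show ?case using elim by (simp add: algebra_simps)
    qed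
    moreover have "(\<lambda>n. 2 * s * (\<Sum>x\<in>I. v x * mean (\<sigma> n) (\<lambda>t. r n t * W x t)) - s\<^sup>2 * (K * V) - s\<^sup>2 * Q (\<sigma> n))
      \<longlonglongrightarrow> 2 * s * (\<Sum>x\<in>I. v x * v x) - s\<^sup>2 * (K * V) - s\<^sup>2 * 0"
    proof (intro tendsto_diff tendsto_mult tendsto_const tendsto_sum Q)
      fix x assume "x \<in> I"
      then obtain i a where "x = (i, a)" "a < p" by (auto simp: I_def)
      then show "(\<lambda>n. mean (\<sigma> n) (\<lambda>t. r n t * W x t)) \<longlonglongrightarrow> v x"
        using \<gamma>[of a i] by (simp add: W_def v_def)
    qed
    ultimately have "2 * s * (\<Sum>x\<in>I. v x * v x) - s\<^sup>2 * (K * V) - s\<^sup>2 * 0 \<le> R"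
      by (intro tendsto_upperbound[where F = sequentially]) auto
    moreover have "s\<^sup>2 * (K * V) = s * V" using K by (simp add: s_def power2_eq_square)
    moreover have V2: "(\<Sum>x\<in>I. v x * v x) = V" by (simp add: V_def power2_eq_square)
    ultimately have "s * V \<le> R" unfolding V2 by linarith
    then show ?thesis using K by (simp add: V_eq s_def field_simps)
  qed
  then show ?thesis by blast
qed

text \<open>Square summability along an injective enumeration forces the terms to zero. Both ends of
  the integers are required by the uniqueness argument for the limit equation.\<close>

lemma noise_correlation_tendsto_0:
  assumes \<sigma>: "filterlim \<sigma> at_top sequentially"
    and R: "\<forall>\<^sub>F n in sequentially. mean (\<sigma> n) (\<lambda>t. (r n t)\<^sup>2) \<le> R"
    and \<gamma>: "\<And>a i. a < p \<Longrightarrow> (\<lambda>n. mean (\<sigma> n) (\<lambda>t. r n t * e a (t - i))) \<longlonglongrightarrow> \<gamma> a i"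
    and a: "a < p"
  shows "(\<lambda>n. \<gamma> a (int n)) \<longlonglongrightarrow> 0" and "(\<lambda>n. \<gamma> a (- int n)) \<longlonglongrightarrow> 0"
proof -
  obtain B where B: "\<And>J. finite J \<Longrightarrow> (\<Sum>i\<in>J. \<Sum>a<p. (\<gamma> a i)\<^sup>2) \<le> B"
    using noise_Bessel[OF \<sigma> R \<gamma>] by blast
  have "(\<lambda>n. \<gamma> a (f n)) \<longlonglongrightarrow> 0" if f: "inj f" for f :: "nat \<Rightarrow> int"
  proof -
    have "(\<Sum>n<m. (\<gamma> a (f n))\<^sup>2) \<le> B" for m
    proof -
      have "(\<Sum>n<m. (\<gamma> a (f n))\<^sup>2) = (\<Sum>i\<in>f ` {..<m}. (\<gamma> a i)\<^sup>2)"
        using f by (subst sum.reindex) (auto intro: inj_on_subset)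
      also have "\<dots> \<le> (\<Sum>i\<in>f ` {..<m}. \<Sum>a<p. (\<gamma> a i)\<^sup>2)"
        using a by (intro sum_mono member_le_sum) auto
      also have "\<dots> \<le> B" by (rule B) auto
      finally show ?thesis .
    qed
    then have "summable (\<lambda>n. (\<gamma> a (f n))\<^sup>2)"
      by (intro bounded_imp_summable[where B = B]) (auto simp only: lessThan_Suc_atMost[symmetric] zero_le_power2)
    then have "(\<lambda>n. (\<gamma> a (f n))\<^sup>2) \<longlonglongrightarrow> 0" by (rule summable_LIMSEQ_zero)
    then show ?thesis by simp
  qed
  from this[of int] this[of "\<lambda>n. - int n"]
  show "(\<lambda>n. \<gamma> a (int n)) \<longlonglongrightarrow> 0" and "(\<lambda>n. \<gamma> a (- int n)) \<longlonglongrightarrow> 0"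
    by (auto simp: inj_def)
qed

end

section \<open>Vector autoregressions\<close>

text \<open>Cramer's rule over the polynomial ring. At zero the matrix is the identity, so the
  determinant has constant term 1 and can be cancelled from one-sided sequences.\<close>

lemma adjugate_poly_matrix:
  fixes A :: "nat \<Rightarrow> nat \<Rightarrow> real poly"
  assumes "\<And>a b. a < p \<Longrightarrow> b < p \<Longrightarrow> coeff (A a b) 0 = (if a = b then 1 else 0)"
  obtains R \<alpha> where "\<And>a b. a < p \<Longrightarrow> b < p \<Longrightarrow> (\<Sum>c<p. R a c * A c b) = (if a = b then \<alpha> else 0)"
    and "coeff \<alpha> 0 = 1"
proof -
  define M where "M = mat p p (\<lambda>(a, b). A a b)"
  have M: "M \<in> carrier_mat p p" by (simp add: M_def)
  define R where "R a b = adj_mat M $$ (a, b)" for a b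
  have adj: "adj_mat M \<in> carrier_mat p p" using M by (rule adj_mat)
  have "(\<Sum>c<p. R a c * A c b) = (if a = b then Determinant.det M else 0)" if "a < p" "b < p" for a b
  proof -
    have "(adj_mat M * M) $$ (a, b) = (\<Sum>c<p. R a c * A c b)"
      using that adj M by (auto simp: scalar_prod_def R_def M_def atLeast0LessThan intro!: sum.cong)
    moreover have "(adj_mat M * M) $$ (a, b) = (if a = b then Determinant.det M else 0)"
      using that by (simp add: adj_mat(3)[OF M])
    ultimately show ?thesis by simp
  qed
  moreover have "coeff (Determinant.det M) 0 = 1"
  proof -
    have h: "comm_ring_hom (\<lambda>q :: real poly. poly q 0)" by unfold_locales auto
    have "poly (Determinant.det M) 0 = Determinant.det (map_mat (\<lambda>q. poly q 0) M)"
      by (rule comm_ring_hom.hom_det[OF h, symmetric])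
    also have "map_mat (\<lambda>q. poly q 0) M = 1\<^sub>m p"
      using assms by (intro eq_matI) (auto simp: M_def poly_0_coeff_0)
    finally show ?thesis by (simp add: poly_0_coeff_0)
  qed
  ultimately show ?thesis using that by blast
qed

text \<open>The path is extended by zero before the initial values, and the deterministic term to all
  integer times. Both extensions are only made to have two-sided convolutions at hand.\<close>

locale var_path = white_noise p e for p :: nat and e :: "nat \<Rightarrow> int \<Rightarrow> real" +
  fixes k d K :: nat and x :: "nat \<Rightarrow> int \<Rightarrow> real" and A :: "nat \<Rightarrow> nat \<Rightarrow> nat \<Rightarrow> real"
    and mu :: "nat \<Rightarrow> nat \<Rightarrow> real" and Dx :: "nat \<Rightarrow> int \<Rightarrow> real" and S :: "nat \<Rightarrow> nat \<Rightarrow> nat \<Rightarrow> real"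
    and PD :: "real poly"
  assumes k_pos: "k \<ge> 1"
    and x_init: "\<And>b t. t \<le> - int K \<Longrightarrow> x b t = 0"
    and x_eq: "\<And>a t. a < p \<Longrightarrow> t \<ge> 1 \<Longrightarrow>
      x a t = (\<Sum>l = 1..k. \<Sum>b<p. A l a b * x b (t - int l)) + (\<Sum>c<d. mu a c * Dx c t) + e a t"
    and D_annihilated: "\<And>c t. c < d \<Longrightarrow> lag_op PD (Dx c) t = 0"
    and PD_0: "coeff PD 0 = 1"
    and D_shift: "\<And>c t i. c < d \<Longrightarrow> Dx c (t - int i) = (\<Sum>c'<d. S i c c' * Dx c' t)"
    and D_growth: "\<exists>C m. \<forall>c<d. \<forall>n. \<bar>Dx c (- int n)\<bar> \<le> C * (1 + real n) ^ m"
begin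

definition Apoly :: "nat \<Rightarrow> nat \<Rightarrow> real poly" where
  "Apoly a b = (if a = b then 1 else 0) - (\<Sum>l = 1..k. monom (A l a b) l)"

lemma coeff_Apoly:
  "coeff (Apoly a b) i = (if i = 0 then (if a = b then 1 else 0) else if i \<le> k then - A i a b else 0)"
proof -
  have "(\<Sum>l = 1..k. coeff (monom (A l a b) l) i) = (if i \<in> {1..k} then A i a b else 0)"
    by (simp add: coeff_monom sum.delta)
  then show ?thesis by (auto simp: Apoly_def coeff_sum)
qed

lemma degree_Apoly: "degree (Apoly a b) \<le> k"
  by (rule degree_le) (auto simp: coeff_Apoly)

lemma lag_op_Apoly:
  "lag_op (Apoly a b) y t = (if a = b then y t else 0) - (\<Sum>l = 1..k. A l a b * y (t - int l))"
proof -
  have "{..k} = insert 0 {1..k}" by auto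
  then have "lag_op (Apoly a b) y t
    = coeff (Apoly a b) 0 * y t + (\<Sum>l = 1..k. coeff (Apoly a b) l * y (t - int l))"
    by (simp add: lag_op_eq_sum[OF degree_Apoly])
  moreover have "(\<Sum>l = 1..k. coeff (Apoly a b) l * y (t - int l)) = (\<Sum>l = 1..k. - A l a b * y (t - int l))"
    by (intro sum.cong refl) (auto simp: coeff_Apoly)
  ultimately show ?thesis by (simp add: coeff_Apoly sum_negf)
qed

text \<open>A(L)X at every integer time. From time 1 on it is drift plus innovation; at the times
  from \<open>1 - K\<close> to 0 it is whatever the initial values produce, and before that it
  vanishes.\<close>

definition \<eta> :: "nat \<Rightarrow> int \<Rightarrow> real" where
  "\<eta> a t = (\<Sum>b<p. lag_op (Apoly a b) (x b) t)"

lemma \<eta>_eq: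
  assumes "a < p" "t \<ge> 1"
  shows "\<eta> a t = (\<Sum>c<d. mu a c * Dx c t) + e a t"
proof -
  have "\<eta> a t = x a t - (\<Sum>b<p. \<Sum>l = 1..k. A l a b * x b (t - int l))"
    using assms by (simp add: \<eta>_def lag_op_Apoly sum_subtractf)
  also have "(\<Sum>b<p. \<Sum>l = 1..k. A l a b * x b (t - int l)) = (\<Sum>l = 1..k. \<Sum>b<p. A l a b * x b (t - int l))"
    by (rule sum.swap)
  finally show ?thesis using x_eq[OF assms] by simp
qed

lemma \<eta>_init: "t \<le> - int K \<Longrightarrow> \<eta> a t = 0"
  by (simp add: \<eta>_def lag_op_def x_init)

text \<open>Adjugate and determinant are chosen jointly so that both become constants of the locale,
  tied together by the two properties inside the choice.\<close>

definition adj_pair :: "(nat \<Rightarrow> nat \<Rightarrow> real poly) \<times> real poly" where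
  "adj_pair = (SOME (R, \<alpha>). (\<forall>a<p. \<forall>b<p. (\<Sum>c<p. R a c * Apoly c b) = (if a = b then \<alpha> else 0)) \<and> coeff \<alpha> 0 = 1)"

definition Adj :: "nat \<Rightarrow> nat \<Rightarrow> real poly" where "Adj = fst adj_pair"

definition \<alpha> :: "real poly" where "\<alpha> = snd adj_pair"

lemma Adj_mult: "a < p \<Longrightarrow> b < p \<Longrightarrow> (\<Sum>c<p. Adj a c * Apoly c b) = (if a = b then \<alpha> else 0)"
  and \<alpha>_0: "coeff \<alpha> 0 = 1"
proof -
  obtain R0 \<alpha>0 where "\<And>a b. a < p \<Longrightarrow> b < p \<Longrightarrow> (\<Sum>c<p. R0 a c * Apoly c b) = (if a = b then \<alpha>0 else 0)"
    "coeff \<alpha>0 0 = 1"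
    by (rule adjugate_poly_matrix[of p Apoly]) (auto simp: coeff_Apoly)
  then have "case (R0, \<alpha>0) of (R, q) \<Rightarrow>
      (\<forall>a<p. \<forall>b<p. (\<Sum>c<p. R a c * Apoly c b) = (if a = b then q else 0)) \<and> coeff q 0 = 1"
    by simp
  then have "case adj_pair of (R, q) \<Rightarrow>
      (\<forall>a<p. \<forall>b<p. (\<Sum>c<p. R a c * Apoly c b) = (if a = b then q else 0)) \<and> coeff q 0 = 1"
    unfolding adj_pair_def by (rule someI)
  then show "a < p \<Longrightarrow> b < p \<Longrightarrow> (\<Sum>c<p. Adj a c * Apoly c b) = (if a = b then \<alpha> else 0)" "coeff \<alpha> 0 = 1"
    by (auto simp: Adj_def \<alpha>_def split: prod.splits)
qed

lemma Adj_0: "a < p \<Longrightarrow> b < p \<Longrightarrow> coeff (Adj a b) 0 = (if a = b then 1 else 0)"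
proof -
  assume ab: "a < p" "b < p"
  have "coeff (\<Sum>c<p. Adj a c * Apoly c b) 0 = (\<Sum>c<p. if c = b then coeff (Adj a c) 0 else 0)"
    by (simp add: coeff_sum coeff_mult_0 coeff_Apoly if_distrib[of "\<lambda>u. _ * u"] cong: if_cong)
  also have "\<dots> = coeff (Adj a b) 0" using ab by simp
  finally show ?thesis using Adj_mult[OF ab] \<alpha>_0 by (auto split: if_splits)
qed

definition \<chi> :: "real poly" where "\<chi> = PD * \<alpha>"

lemma \<chi>_0: "coeff \<chi> 0 = 1"
  by (simp add: \<chi>_def coeff_mult_0 PD_0 \<alpha>_0)

lemma \<chi>_nonzero: "\<chi> \<noteq> 0"
  using \<chi>_0 by auto

definition resid :: "(nat \<Rightarrow> real poly) \<Rightarrow> (nat \<Rightarrow> real) \<Rightarrow> int \<Rightarrow> real" where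
  "resid B \<nu> t = (\<Sum>b<p. lag_op (B b) (x b) t) - (\<Sum>c<d. \<nu> c * Dx c t)"

text \<open>For large times, \<open>\<chi>(L)\<close> turns the residual \<open>resid B \<nu>\<close> into the moving average of the
  innovations with coefficients \<open>filt B\<close>; the drift \<open>\<nu>\<close> drops out because \<open>PD\<close> divides \<open>\<chi>\<close>.\<close>

definition filt :: "(nat \<Rightarrow> real poly) \<Rightarrow> nat \<Rightarrow> real poly" where
  "filt B c = (\<Sum>b<p. PD * B b * Adj b c)"

text \<open>A crude degree bound shared by the filters of all polynomials of degree at most
  \<open>k\<close>, so that one time threshold serves every fit.\<close>

definition m_deg :: nat where
  "m_deg = degree PD + k + (\<Sum>b<p. \<Sum>c<p. degree (Adj b c))"

lemma degree_filt:
  assumes "\<And>b. b < p \<Longrightarrow> degree (B b) \<le> k" "c < p"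
  shows "degree (filt B c) \<le> m_deg"
  unfolding filt_def
proof (rule degree_sum_le)
  fix b assume b: "b \<in> {..<p}"
  have "degree (PD * B b * Adj b c) \<le> degree PD + degree (B b) + degree (Adj b c)"
    by (meson add_le_mono degree_mult_le le_refl order_trans)
  moreover have "degree (Adj b c) \<le> (\<Sum>c<p. degree (Adj b c))" using assms by (intro member_le_sum) auto
  moreover have "(\<Sum>c<p. degree (Adj b c)) \<le> (\<Sum>b<p. \<Sum>c<p. degree (Adj b c))"
    using b by (intro member_le_sum[where f = "\<lambda>b. \<Sum>c<p. degree (Adj b c)"]) auto
  ultimately show "degree (PD * B b * Adj b c) \<le> m_deg"
    using assms(1)[of b] b by (simp add: m_deg_def)
qed simp

text \<open>\<open>PD\<close> has constant term 1 and \<open>Adj\<close> has constant term the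
  identity, so lag zero passes through unchanged. This carries the lower bound for filtered
  coefficients over to residual covariance matrices.\<close>

lemma filt_0: "c < p \<Longrightarrow> coeff (filt B c) 0 = coeff (B c) 0"
proof -
  assume c: "c < p"
  have "coeff (filt B c) 0 = (\<Sum>b<p. if b = c then coeff (B b) 0 else 0)"
    using c unfolding filt_def coeff_sum by (intro sum.cong refl) (simp add: coeff_mult_0 PD_0 Adj_0)
  then show ?thesis using c by simp
qed

text \<open>Multiplying by A turns the adjugate into the determinant. In the limit this identity
  leads from the filtered coefficients back to the fitted ones.\<close>

lemma filt_Apoly:
  assumes "b < p"
  shows "(\<Sum>c<p. filt B c * Apoly c b) = \<chi> * B b"
proof -
  have "(\<Sum>c<p. filt B c * Apoly c b) = (\<Sum>c<p. \<Sum>b'<p. PD * B b' * (Adj b' c * Apoly c b))"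
    by (simp add: filt_def sum_distrib_right mult.assoc)
  also have "\<dots> = (\<Sum>b'<p. PD * B b' * (\<Sum>c<p. Adj b' c * Apoly c b))"
    by (subst sum.swap) (simp add: sum_distrib_left)
  also have "\<dots> = (\<Sum>b'<p. if b' = b then PD * B b' * \<alpha> else 0)"
    using assms by (intro sum.cong refl) (simp add: Adj_mult)
  also have "\<dots> = \<chi> * B b" using assms by (simp add: \<chi>_def mult_ac)
  finally show ?thesis .
qed

text \<open>Multiplying \<open>\<eta>\<close> by the adjugate gives \<open>\<alpha>(L) x\<close>,
  and \<open>PD\<close> removes the drift contained in \<open>\<eta>\<close>. The threshold on
  \<open>t\<close> keeps all times touched by the filter at least 1, where \<open>\<eta>\<close> is
  drift plus innovation.\<close>

lemma lag_op_resid: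
  assumes B: "\<And>b. b < p \<Longrightarrow> degree (B b) \<le> k" and t: "t > int m_deg"
  shows "lag_op \<chi> (resid B \<nu>) t = (\<Sum>c<p. lag_op (filt B c) (e c) t)"
proof -
  have x: "lag_op \<alpha> (x b) t = (\<Sum>c<p. lag_op (Adj b c) (\<eta> c) t)" if "b < p" for b t
  proof -
    have "(\<Sum>c<p. lag_op (Adj b c) (\<eta> c) t) = (\<Sum>c<p. \<Sum>b'<p. lag_op (Adj b c * Apoly c b') (x b') t)"
      by (simp add: \<eta>_def[abs_def] lag_op_fun_sum lag_op_mult)
    also have "\<dots> = (\<Sum>b'<p. lag_op (\<Sum>c<p. Adj b c * Apoly c b') (x b') t)"
      by (subst sum.swap) (simp add: lag_op_sum)
    also have "\<dots> = (\<Sum>b'<p. if b = b' then lag_op \<alpha> (x b') t else 0)"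
      using that by (intro sum.cong refl) (simp add: Adj_mult)
    finally show ?thesis using that by simp
  qed
  have 1: "lag_op \<chi> (\<lambda>t. \<Sum>c<d. \<nu> c * Dx c t) t = 0"
    by (simp add: lag_op_fun_sum lag_op_fun_cmult \<chi>_def lag_op_mult D_annihilated
        lag_op_commute[of PD \<alpha>] lag_op_def[of \<alpha> "lag_op PD _"])
  have 2: "lag_op \<chi> (\<lambda>t. \<Sum>b<p. lag_op (B b) (x b) t) t = (\<Sum>c<p. lag_op (filt B c) (\<eta> c) t)"
  proof -
    have "lag_op \<chi> (\<lambda>t. \<Sum>b<p. lag_op (B b) (x b) t) t = (\<Sum>b<p. lag_op (PD * B b) (lag_op \<alpha> (x b)) t)"
      unfolding lag_op_fun_sum
      by (intro sum.cong refl) (simp add: \<chi>_def flip: lag_op_mult, simp add: mult_ac)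
    also have "\<dots> = (\<Sum>b<p. \<Sum>c<p. lag_op (PD * B b * Adj b c) (\<eta> c) t)"
    proof (intro sum.cong refl)
      fix b assume "b \<in> {..<p}"
      then have "lag_op \<alpha> (x b) = (\<lambda>t. \<Sum>c<p. lag_op (Adj b c) (\<eta> c) t)" using x by auto
      then show "lag_op (PD * B b) (lag_op \<alpha> (x b)) t = (\<Sum>c<p. lag_op (PD * B b * Adj b c) (\<eta> c) t)"
        by (simp add: lag_op_fun_sum lag_op_mult)
    qed
    also have "\<dots> = (\<Sum>c<p. lag_op (filt B c) (\<eta> c) t)"
      by (subst sum.swap) (simp add: filt_def lag_op_sum)
    finally show ?thesis .
  qed
  have 3: "lag_op (filt B c) (\<eta> c) t = lag_op (filt B c) (e c) t" if c: "c < p" for c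
  proof -
    have "lag_op (filt B c) (\<eta> c) t = lag_op (filt B c) (\<lambda>t. (\<Sum>c'<d. mu c c' * Dx c' t) + e c t) t"
      using degree_filt[of B, OF B c] t by (intro lag_op_cong_le \<eta>_eq[OF c]) auto
    also have "\<dots> = lag_op (filt B c) (e c) t + (\<Sum>c'<d. mu c c' * lag_op (filt B c) (Dx c') t)"
      by (simp add: lag_op_fun_add lag_op_fun_sum lag_op_fun_cmult)
    also have "(\<Sum>c'<d. mu c c' * lag_op (filt B c) (Dx c') t) = 0"
    proof (intro sum.neutral ballI)
      fix c' assume c': "c' \<in> {..<d}"
      have "filt B c = (\<Sum>b<p. B b * Adj b c) * PD"
        by (simp add: filt_def sum_distrib_right sum_distrib_left mult_ac)
      then have "lag_op (filt B c) (Dx c') t = lag_op (\<Sum>b<p. B b * Adj b c) (lag_op PD (Dx c')) t"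
        by (simp add: lag_op_mult)
      also have "\<dots> = 0" using c' by (simp add: lag_op_def[of "sum _ _"] D_annihilated)
      finally show "mu c c' * lag_op (filt B c) (Dx c') t = 0" by simp
    qed
    finally show ?thesis by simp
  qed
  show ?thesis unfolding resid_def[abs_def] lag_op_fun_diff 1 2 using 3 by simp
qed

lemma resid_lincomb:
  "resid (\<lambda>b. \<Sum>a<p. Polynomial.smult (u a) (B a b)) (\<lambda>c. \<Sum>a<p. u a * \<nu> a c) t = (\<Sum>a<p. u a * resid (B a) (\<nu> a) t)"
proof -
  have "(\<Sum>b<p. lag_op (\<Sum>a<p. Polynomial.smult (u a) (B a b)) (x b) t) = (\<Sum>a<p. u a * (\<Sum>b<p. lag_op (B a b) (x b) t))"
    unfolding lag_op_sum lag_op_smult by (subst sum.swap) (simp add: sum_distrib_left)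
  moreover have "(\<Sum>c<d. (\<Sum>a<p. u a * \<nu> a c) * Dx c t) = (\<Sum>a<p. u a * (\<Sum>c<d. \<nu> a c * Dx c t))"
    unfolding sum_distrib_right by (subst sum.swap) (simp add: sum_distrib_left mult_ac)
  ultimately show ?thesis by (simp add: resid_def right_diff_distrib sum_subtractf)
qed

text \<open>The fixed finite filter \<open>\<chi>\<close> inflates a sum of squares at most by the
  factor \<open>Q\<close>, and the filtered residual is a moving average of innovations, whose mean
  square is bounded below. The constant is uniform in \<open>B\<close> and \<open>\<nu>\<close> and
  independent of how fast the observations grow.\<close>

lemma resid_pd:
  "\<exists>c>0. \<forall>\<^sub>F T in sequentially. \<forall>B \<nu>. (\<forall>b<p. degree (B b) \<le> k) \<longrightarrow>
     c * (\<Sum>i\<le>m_deg. \<Sum>a<p. (coeff (filt B a) i)\<^sup>2) \<le> mean T (\<lambda>t. (resid B \<nu> t)\<^sup>2)"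
proof -
  \<comment> \<open>Past \<open>N\<close> the moving average representation holds and all residuals
    entering \<open>lag_op \<chi>\<close> have times of at least 1.\<close>
  define N where "N = m_deg + degree \<chi>"
  obtain c where c: "c > 0" and ev: "\<forall>\<^sub>F T in sequentially. \<forall>C. c * (\<Sum>i\<le>m_deg. \<Sum>a<p. (C i a)\<^sup>2)
     \<le> (\<Sum>t = Suc N..T. (\<Sum>i\<le>m_deg. \<Sum>a<p. C i a * e a (int t - int i))\<^sup>2) / real T"
    using noise_filter_pd by blast
  \<comment> \<open>The first factor comes from Cauchy-Schwarz; the second counts in how many lagged
    sums a squared residual can occur.\<close>
  define Q where "Q = (\<Sum>i\<le>degree \<chi>. (coeff \<chi> i)\<^sup>2) * (real (degree \<chi>) + 1)"
  have "(coeff \<chi> 0)\<^sup>2 \<le> (\<Sum>i\<le>degree \<chi>. (coeff \<chi> i)\<^sup>2)"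
    by (rule member_le_sum[where f = "\<lambda>i. (coeff \<chi> i)\<^sup>2"]) auto
  then have "(\<Sum>i\<le>degree \<chi>. (coeff \<chi> i)\<^sup>2) > 0" by (simp add: \<chi>_0)
  then have Q: "Q > 0" unfolding Q_def by (intro mult_pos_pos) auto
  have "\<forall>\<^sub>F T in sequentially. \<forall>B \<nu>. (\<forall>b<p. degree (B b) \<le> k) \<longrightarrow>
     c / Q * (\<Sum>i\<le>m_deg. \<Sum>a<p. (coeff (filt B a) i)\<^sup>2) \<le> mean T (\<lambda>t. (resid B \<nu> t)\<^sup>2)"
    using ev
  proof eventually_elim
    case (elim T)
    show ?case
    proof (intro allI impI)
      fix B :: "nat \<Rightarrow> real poly" and \<nu> assume B: "\<forall>b<p. degree (B b) \<le> k"
      define r where "r = resid B \<nu>"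
      have "(\<Sum>i\<le>m_deg. \<Sum>a<p. coeff (filt B a) i * e a (int t - int i)) = lag_op \<chi> r (int t)" if "t \<ge> Suc N" for t
      proof -
        have "lag_op \<chi> r (int t) = (\<Sum>a<p. \<Sum>i\<le>m_deg. coeff (filt B a) i * e a (int t - int i))"
          unfolding r_def using B that
          by (subst lag_op_resid) (auto simp: N_def lag_op_eq_sum[OF degree_filt])
        then show ?thesis by (subst sum.swap) simp
      qed
      then have "c * (\<Sum>i\<le>m_deg. \<Sum>a<p. (coeff (filt B a) i)\<^sup>2) \<le> (\<Sum>t = Suc N..T. (lag_op \<chi> r (int t))\<^sup>2) / real T"
        using elim[rule_format, of "\<lambda>i a. coeff (filt B a) i"] by simp
      also have "(\<Sum>t = Suc N..T. (lag_op \<chi> r (int t))\<^sup>2) \<le> Q * (\<Sum>t = 1..T. (r (int t))\<^sup>2)"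
      proof -
        have "(\<Sum>t = Suc N..T. (lag_op \<chi> r (int t))\<^sup>2)
          \<le> (\<Sum>t = Suc N..T. (\<Sum>i\<le>degree \<chi>. (coeff \<chi> i)\<^sup>2) * (\<Sum>i\<le>degree \<chi>. (r (int t - int i))\<^sup>2))"
          unfolding lag_op_def by (intro sum_mono Cauchy_Schwarz_ineq_sum)
        also have "\<dots> = (\<Sum>i\<le>degree \<chi>. (coeff \<chi> i)\<^sup>2) * (\<Sum>i\<le>degree \<chi>. \<Sum>t = Suc N..T. (r (int t - int i))\<^sup>2)"
          unfolding sum_distrib_left[symmetric] by (subst sum.swap) simp
        also have "\<dots> \<le> (\<Sum>i\<le>degree \<chi>. (coeff \<chi> i)\<^sup>2) * (\<Sum>i\<le>degree \<chi>. \<Sum>t = 1..T. (r (int t))\<^sup>2)"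
        proof (intro mult_left_mono sum_mono sum_nonneg)
          fix i assume i: "i \<in> {..degree \<chi>}"
          have "(\<Sum>t = Suc N..T. (r (int t - int i))\<^sup>2) = (\<Sum>t\<in>(\<lambda>t. t - i) ` {Suc N..T}. (r (int t))\<^sup>2)"
            using i by (subst sum.reindex) (auto simp: N_def inj_on_def of_nat_diff intro!: sum.cong)
          also have "\<dots> \<le> (\<Sum>t = 1..T. (r (int t))\<^sup>2)"
            using i by (intro sum_mono2) (auto simp: N_def)
          finally show "(\<Sum>t = Suc N..T. (r (int t - int i))\<^sup>2) \<le> (\<Sum>t = 1..T. (r (int t))\<^sup>2)" .
        qed auto
        finally show ?thesis by (simp add: Q_def mult_ac add.commute)
      qed
      finally have "c * (\<Sum>i\<le>m_deg. \<Sum>a<p. (coeff (filt B a) i)\<^sup>2) \<le> Q * mean T (\<lambda>t. (r t)\<^sup>2)"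
        by (simp add: mean_def divide_right_mono)
      then show "c / Q * (\<Sum>i\<le>m_deg. \<Sum>a<p. (coeff (filt B a) i)\<^sup>2) \<le> mean T (\<lambda>t. (resid B \<nu> t)\<^sup>2)"
        using Q by (simp add: r_def field_simps)
    qed
  qed
  then show ?thesis using c Q by (intro exI[of _ "c / Q"]) auto
qed

end

section \<open>From the normal equations to the causal part of the correlations\<close>

lemma lag_op_monom: "lag_op (monom a n) x t = a * x (t - int n)"
proof -
  have "lag_op (monom a n) x t = (\<Sum>i\<le>n. (if n = i then a else 0) * x (t - int i))"
    by (subst lag_op_eq_sum[OF degree_monom_le]) (simp add: coeff_monom)
  also have "\<dots> = (\<Sum>i\<le>n. if n = i then a * x (t - int i) else 0)"
    by (intro sum.cong refl) simp
  finally show ?thesis by simp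
qed

lemma abs_mean_mult_le: "\<bar>mean T (\<lambda>t. u t * v t)\<bar> \<le> mean T (\<lambda>t. (u t)\<^sup>2) + mean T (\<lambda>t. (v t)\<^sup>2)"
proof -
  have bd: "\<bar>u t * v t\<bar> \<le> (u t)\<^sup>2 + (v t)\<^sup>2" for t
  proof -
    have "2 * \<bar>u t\<bar> * \<bar>v t\<bar> \<le> \<bar>u t\<bar>\<^sup>2 + \<bar>v t\<bar>\<^sup>2" by (rule sum_squares_bound)
    moreover have "0 \<le> \<bar>u t\<bar> * \<bar>v t\<bar>" by simp
    ultimately show ?thesis unfolding abs_mult power2_abs by linarith
  qed
  have "\<bar>mean T (\<lambda>t. u t * v t)\<bar> \<le> mean T (\<lambda>t. \<bar>u t * v t\<bar>)"
    unfolding mean_def by (simp add: divide_right_mono sum_abs)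
  also have "\<dots> \<le> mean T (\<lambda>t. (u t)\<^sup>2 + (v t)\<^sup>2)" by (intro mean_mono bd)
  finally show ?thesis by (simp add: mean_add)
qed

lemma sum_power_le_geometric:
  fixes \<rho> :: real
  assumes "0 < \<rho>" "\<rho> < 1"
  shows "(\<Sum>i = m..n. \<rho> ^ i) \<le> \<rho> ^ m / (1 - \<rho>)"
proof (cases "m \<le> n")
  case True
  have "(\<Sum>i = m..n. \<rho> ^ i) = (\<rho> ^ m - \<rho> ^ Suc n) / (1 - \<rho>)"
    using True assms by (subst sum_gp) auto
  also have "\<dots> \<le> \<rho> ^ m / (1 - \<rho>)" using assms by (intro divide_right_mono) auto
  finally show ?thesis .
qed (use assms in simp)

lemma summable_geometric_times_power:
  fixes \<rho> :: real
  assumes "0 < \<rho>" "\<rho> < 1"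
  shows "summable (\<lambda>j. \<rho> ^ j * (1 + real j) ^ m)"
proof -
  have "(\<lambda>j. 1 + 1 / (1 + real j)) \<longlonglongrightarrow> 1 + 0"
    by (intro tendsto_add tendsto_const) (use LIMSEQ_inverse_real_of_nat in \<open>simp add: inverse_eq_divide add.commute\<close>)
  then have "(\<lambda>j. \<rho> * (1 + 1 / (1 + real j)) ^ m) \<longlonglongrightarrow> \<rho> * 1 ^ m"
    by (intro tendsto_mult tendsto_const tendsto_power) simp
  then have "\<forall>\<^sub>F j in sequentially. \<rho> * (1 + 1 / (1 + real j)) ^ m < (1 + \<rho>) / 2"
    by (rule order_tendstoD) (use assms in simp)
  then obtain N where N: "\<And>j. j \<ge> N \<Longrightarrow> \<rho> * (1 + 1 / (1 + real j)) ^ m < (1 + \<rho>) / 2"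
    by (auto simp: eventually_sequentially)
  show ?thesis
  proof (rule summable_ratio_test[where c = "(1 + \<rho>) / 2" and N = N])
    fix j assume j: "j \<ge> N"
    have "1 + real (Suc j) = (1 + 1 / (1 + real j)) * (1 + real j)" by (simp add: field_simps)
    then have "\<rho> ^ Suc j * (1 + real (Suc j)) ^ m
        = (\<rho> * (1 + 1 / (1 + real j)) ^ m) * (\<rho> ^ j * (1 + real j) ^ m)"
      by (simp only: power_mult_distrib power_Suc mult_ac)
    also have "\<dots> \<le> (1 + \<rho>) / 2 * (\<rho> ^ j * (1 + real j) ^ m)"
      using N[OF j] assms by (intro mult_right_mono) auto
    finally show "norm (\<rho> ^ Suc j * (1 + real (Suc j)) ^ m) \<le> (1 + \<rho>) / 2 * norm (\<rho> ^ j * (1 + real j) ^ m)"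
      using assms by (simp add: abs_mult)
  qed (use assms in simp)
qed

context var_path
begin

text \<open>With \<open>g\<close> cut off below index 1 its product with A vanishes at lag 0, and by
  \<open>rec\<close> also beyond lag \<open>k\<close>; what remains is a combination of the
  regressors. Truncation at \<open>L\<close> disturbs only coefficients beyond \<open>L\<close>, and
  these meet the zero extension of the path.\<close>

lemma causal_convolution:
  assumes rec: "\<And>b i. b < p \<Longrightarrow> i > int k \<Longrightarrow> (\<Sum>c<p. lag_op (Apoly c b) (g c) i) = 0"
  obtains \<delta> where "\<And>t L. t \<ge> 1 \<Longrightarrow> L \<ge> nat t + K + k \<Longrightarrow>
    (\<Sum>c<p. \<Sum>i = 1..L. g c (int i) * \<eta> c (t - int i)) = (\<Sum>b<p. \<Sum>n = 1..k. \<delta> b n * x b (t - int n))"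
proof -
  define gp where "gp c i = (if i \<ge> 1 then g c i else 0)" for c i
  define \<delta> where "\<delta> b n = (\<Sum>c<p. lag_op (Apoly c b) (gp c) (int n))" for b n
  have d0: "\<delta> b 0 = 0" for b
    by (simp add: \<delta>_def lag_op_def gp_def)
  \<comment> \<open>A filter of degree at most \<open>k\<close> evaluated beyond \<open>k\<close>
    reads only indices of at least 1, where the cut changes nothing.\<close>
  have dk: "\<delta> b n = 0" if "b < p" "n > k" for b n
  proof -
    have "lag_op (Apoly c b) (gp c) (int n) = lag_op (Apoly c b) (g c) (int n)" for c
      using degree_Apoly[of c b] that by (intro lag_op_cong_le) (auto simp: gp_def)
    then show ?thesis using rec[of b "int n"] that by (simp add: \<delta>_def)
  qed
  have "(\<Sum>c<p. \<Sum>i = 1..L. g c (int i) * \<eta> c (t - int i)) = (\<Sum>b<p. \<Sum>n = 1..k. \<delta> b n * x b (t - int n))"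
    if t: "t \<ge> 1" and L: "L \<ge> nat t + K + k" for t L
  proof -
    define pg where "pg c = (\<Sum>i = 1..L. monom (g c (int i)) i)" for c
    have pg_coeff: "coeff (pg c) i = (if 1 \<le> i \<and> i \<le> L then g c (int i) else 0)" for c i
    proof -
      have "coeff (pg c) i = (\<Sum>j = 1..L. if j = i then g c (int j) else 0)"
        by (simp add: pg_def coeff_sum coeff_monom)
      then show ?thesis by simp
    qed
    define P where "P b = (\<Sum>c<p. pg c * Apoly c b)" for b
    have degP: "degree (P b) \<le> L + k" for b
      unfolding P_def
    proof (rule degree_sum_le)
      fix c
      have "degree (pg c) \<le> L" by (rule degree_le) (auto simp: pg_coeff)
      then show "degree (pg c * Apoly c b) \<le> L + k"
        using degree_mult_le[of "pg c" "Apoly c b"] degree_Apoly[of c b] by linarith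
    qed simp
    have coeffP: "coeff (P b) n = \<delta> b n" if "n \<le> L" for b n
    proof -
      have "coeff (P b) n = (\<Sum>c<p. coeff_seq (Apoly c b * pg c) (int n))"
        by (simp add: P_def coeff_sum coeff_seq_def mult.commute)
      also have "\<dots> = \<delta> b n"
        unfolding \<delta>_def lag_op_coeff_seq[symmetric]
        using that by (intro sum.cong refl lag_op_cong_le) (auto simp: coeff_seq_def pg_coeff gp_def)
      finally show ?thesis .
    qed
    have "(\<Sum>c<p. \<Sum>i = 1..L. g c (int i) * \<eta> c (t - int i)) = (\<Sum>c<p. lag_op (pg c) (\<eta> c) t)"
      by (simp add: pg_def lag_op_sum lag_op_monom)
    also have "\<dots> = (\<Sum>c<p. \<Sum>b<p. lag_op (pg c * Apoly c b) (x b) t)"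
      by (simp add: \<eta>_def[abs_def] lag_op_fun_sum lag_op_mult)
    also have "\<dots> = (\<Sum>b<p. lag_op (P b) (x b) t)"
      by (subst sum.swap) (simp add: P_def lag_op_sum)
    also have "\<dots> = (\<Sum>b<p. \<Sum>n = 1..k. \<delta> b n * x b (t - int n))"
    proof (intro sum.cong refl)
      fix b assume b: "b \<in> {..<p}"
      have "lag_op (P b) (x b) t = (\<Sum>n\<le>L + k. coeff (P b) n * x b (t - int n))"
        by (rule lag_op_eq_sum[OF degP])
      also have "\<dots> = (\<Sum>n = 1..k. coeff (P b) n * x b (t - int n))"
      proof (rule sum.mono_neutral_right)
        show "\<forall>n\<in>{..L + k} - {1..k}. coeff (P b) n * x b (t - int n) = 0"
        proof
          fix n assume n: "n \<in> {..L + k} - {1..k}"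
          show "coeff (P b) n * x b (t - int n) = 0"
          proof (cases "n \<le> L")
            case True
            then have "n = 0 \<or> n > k" using n by auto
            then show ?thesis using True d0 dk b by (auto simp: coeffP)
          next
            case False
            then show ?thesis using t L by (auto intro!: x_init)
          qed
        qed
      qed auto
      also have "\<dots> = (\<Sum>n = 1..k. \<delta> b n * x b (t - int n))"
        using L by (intro sum.cong refl) (simp add: coeffP)
      finally show "lag_op (P b) (x b) t = (\<Sum>n = 1..k. \<delta> b n * x b (t - int n))" .
    qed
    finally show ?thesis .
  qed
  then show ?thesis using that by blast
qed

text \<open>The causal convolution of \<open>g\<close> with the noise is, up to a summable error, a
  combination of regressors, to which \<open>r\<close> is orthogonal. Its correlation with
  \<open>r\<close> also tends to the sum over \<open>i \<ge> 1\<close> of the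
  \<open>\<Sigma>\<close>-forms of \<open>g\<close> at \<open>i\<close>. This sum is therefore zero,
  and each term is nonnegative.\<close>

lemma causal_part_vanishes:
  assumes \<sigma>: "filterlim \<sigma> at_top sequentially"
    and R: "\<forall>\<^sub>F n in sequentially. mean (\<sigma> n) (\<lambda>t. (r n t)\<^sup>2) \<le> R"
    and \<gamma>: "\<And>b i. b < p \<Longrightarrow> (\<lambda>n. mean (\<sigma> n) (\<lambda>t. r n t * e b (t - i))) \<longlonglongrightarrow> (\<Sum>c<p. g c i * \<Sigma> c b)"
    and c0: "c0 > 0" and pd: "\<And>u. c0 * (\<Sum>a<p. (u a)\<^sup>2) \<le> (\<Sum>a<p. \<Sum>b<p. u a * u b * \<Sigma> a b)"
    and \<rho>: "0 < \<rho>" "\<rho> < 1" and decay: "\<And>c n. c < p \<Longrightarrow> \<bar>g c (int n)\<bar> \<le> C * \<rho> ^ n"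
    and rec: "\<And>b i. b < p \<Longrightarrow> i > int k \<Longrightarrow> (\<Sum>c<p. lag_op (Apoly c b) (g c) i) = 0"
    and orth_x: "\<And>n b i. b < p \<Longrightarrow> 1 \<le> i \<Longrightarrow> i \<le> k \<Longrightarrow> mean (\<sigma> n) (\<lambda>t. r n t * x b (t - int i)) = 0"
    and orth_D: "\<And>n c. c < d \<Longrightarrow> mean (\<sigma> n) (\<lambda>t. r n t * Dx c t) = 0"
    and c: "c < p" and i: "i \<ge> 1"
  shows "g c i = 0"
proof -
  obtain \<delta> where \<delta>: "\<And>t L. t \<ge> 1 \<Longrightarrow> L \<ge> nat t + K + k \<Longrightarrow>
      (\<Sum>c<p. \<Sum>i = 1..L. g c (int i) * \<eta> c (t - int i)) = (\<Sum>b<p. \<Sum>n = 1..k. \<delta> b n * x b (t - int n))"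
    using causal_convolution[OF rec] by blast
  define q where "q t = (\<Sum>b<p. \<Sum>n = 1..k. \<delta> b n * x b (t - int n))" for t
  define D where "D c t = (\<Sum>c'<d. mu c c' * Dx c' t)" for c t
  define F where "F i t = (\<Sum>c<p. g c (int i) * D c (t - int i))" for i t
  \<comment> \<open>The drift is convolved over all lags from 1 on, including those reaching back
    before the sample. Every summand is then a linear image of \<open>Dx\<close> at time
    \<open>t\<close> itself, hence orthogonal to \<open>r\<close>.\<close>
  define z where "z t = (\<Sum>i. F (Suc i) t)" for t
  define conv where "conv L t = (\<Sum>c<p. \<Sum>i = 1..L. g c (int i) * e c (t - int i))" for L t
  have "\<bar>g c (int 0)\<bar> \<le> C * \<rho> ^ 0" by (rule decay[OF c])
  then have C: "C \<ge> 0" by simp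
  obtain C0 m where C0: "\<And>c n. c < d \<Longrightarrow> \<bar>Dx c (- int n)\<bar> \<le> C0 * (1 + real n) ^ m"
    using D_growth by blast
  define C1 where "C1 = (\<Sum>c<p. \<Sum>c'<d. \<bar>mu c c'\<bar> * \<bar>C0\<bar>)"
  have C1: "C1 \<ge> 0" unfolding C1_def by (intro sum_nonneg) auto
  have D_bd: "\<bar>D c (- int n)\<bar> \<le> C1 * (1 + real n) ^ m" if "c < p" for c n
  proof -
    have "\<bar>D c (- int n)\<bar> \<le> (\<Sum>c'<d. \<bar>mu c c'\<bar> * (\<bar>C0\<bar> * (1 + real n) ^ m))"
      unfolding D_def
    proof (rule order.trans[OF sum_abs], rule sum_mono)
      fix c' assume "c' \<in> {..<d}"
      then have "\<bar>Dx c' (- int n)\<bar> \<le> C0 * (1 + real n) ^ m" by (intro C0) simp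
      also have "\<dots> \<le> \<bar>C0\<bar> * (1 + real n) ^ m" by (intro mult_right_mono) auto
      finally show "\<bar>mu c c' * Dx c' (- int n)\<bar> \<le> \<bar>mu c c'\<bar> * (\<bar>C0\<bar> * (1 + real n) ^ m)"
        by (simp add: abs_mult mult_left_mono)
    qed
    also have "\<dots> = (\<Sum>c'<d. \<bar>mu c c'\<bar> * \<bar>C0\<bar>) * (1 + real n) ^ m"
      by (simp add: sum_distrib_right mult.assoc)
    also have "\<dots> \<le> C1 * (1 + real n) ^ m"
      unfolding C1_def using that
      by (intro mult_right_mono member_le_sum[where f = "\<lambda>c. \<Sum>c'<d. \<bar>mu c c'\<bar> * \<bar>C0\<bar>"] sum_nonneg) auto
    finally show ?thesis .
  qed
  define G where "G j = \<rho> ^ j * (1 + real j) ^ m" for j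
  have G: "summable G" unfolding G_def by (rule summable_geometric_times_power[OF \<rho>])
  have G0: "G j \<ge> 0" for j using \<rho> by (simp add: G_def)
  define W where "W = real p * C * C1"
  \<comment> \<open>Lag \<open>j + t\<close> reads the drift at time \<open>- j\<close>: the
    exponential rate beats the polynomial growth in \<open>j\<close> and still leaves the factor
    \<open>\<rho> ^ t\<close>.\<close>
  have F_bd: "\<bar>F (j + t) (int t)\<bar> \<le> W * \<rho> ^ t * G j" for j t
  proof -
    have "\<bar>F (j + t) (int t)\<bar> \<le> (\<Sum>c<p. C * \<rho> ^ (j + t) * (C1 * (1 + real j) ^ m))"
      unfolding F_def
    proof (rule order.trans[OF sum_abs], rule sum_mono)
      fix c assume "c \<in> {..<p}"
      then have c: "c < p" by simp
      have "\<bar>D c (int t - int (j + t))\<bar> \<le> C1 * (1 + real j) ^ m" using D_bd[OF c, of j] by simp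
      then show "\<bar>g c (int (j + t)) * D c (int t - int (j + t))\<bar> \<le> C * \<rho> ^ (j + t) * (C1 * (1 + real j) ^ m)"
        unfolding abs_mult using C \<rho> by (intro mult_mono decay[OF c]) auto
    qed
    then show ?thesis by (simp add: W_def G_def power_add mult_ac)
  qed
  have sumF: "summable (\<lambda>j. F (j + t) (int t))" for t
  proof (rule summable_comparison_test')
    show "summable (\<lambda>j. W * \<rho> ^ t * G j)" by (rule summable_mult[OF G])
  qed (use F_bd in simp)
  have sumF1: "summable (\<lambda>i. F (Suc i) (int t))" if "t \<ge> 1" for t
  proof -
    have "summable (\<lambda>i. F (Suc (i + (t - 1))) (int t))" using sumF[of t] that by simp
    then show ?thesis by (subst summable_iff_shift[symmetric, of _ "t - 1"])
  qed
  have z_eq: "z (int t) = (\<Sum>i = 1..<t. F i (int t)) + (\<Sum>j. F (j + t) (int t))" if "t \<ge> 1" for t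
  proof -
    have "z (int t) = (\<Sum>i. F (Suc (i + (t - 1))) (int t)) + (\<Sum>i<t - 1. F (Suc i) (int t))"
      unfolding z_def by (rule suminf_split_initial_segment[OF sumF1[OF that]])
    moreover have "(\<Sum>i<t - 1. F (Suc i) (int t)) = (\<Sum>i = 1..<t. F i (int t))"
      using that sum.shift_bounds_Suc_ivl[of "\<lambda>i. F i (int t)" 0 "t - 1"] by (simp add: atLeast0LessThan)
    ultimately show ?thesis using that by simp
  qed
  define H where "H = (\<Sum>c<p. \<Sum>s\<le>K. \<bar>\<eta> c (- int s)\<bar>)"
  \<comment> \<open>The discrepancy has two sources, the values of \<open>\<eta>\<close> at times
    from \<open>- K\<close> to 0 and the extended drift at nonpositive times. Both are met only at
    lags of at least \<open>t\<close>, whence the exponential bound below.\<close>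
  define small where "small t = q t - z t - conv (nat t) t" for t
  define W2 where "W2 = real p * (real K + 1) * C * H + W * suminf G"
  have small_bd: "\<bar>small (int t)\<bar> \<le> W2 * \<rho> ^ t" if t: "t \<ge> 1" for t
  proof -
    define L where "L = t + K + k"
    have "q (int t) = (\<Sum>c<p. \<Sum>i = 1..L. g c (int i) * \<eta> c (int t - int i))"
      unfolding q_def by (rule \<delta>[symmetric]) (use t in \<open>auto simp: L_def\<close>)
    also have "\<dots> = (\<Sum>c<p. (\<Sum>i = 1..<t. g c (int i) * (D c (int t - int i) + e c (int t - int i)))
        + (\<Sum>i = t..t + K. g c (int i) * \<eta> c (int t - int i)))"
    proof (intro sum.cong refl)
      fix c assume "c \<in> {..<p}"
      then have c: "c < p" by simp
      have "(\<Sum>i = 1..L. g c (int i) * \<eta> c (int t - int i)) = (\<Sum>i = 1..t + K. g c (int i) * \<eta> c (int t - int i))"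
        by (rule sum.mono_neutral_right) (auto simp: L_def intro!: \<eta>_init)
      also have "{1..t + K} = {1..<t} \<union> {t..t + K}" using t by auto
      also have "(\<Sum>i\<in>{1..<t} \<union> {t..t + K}. g c (int i) * \<eta> c (int t - int i))
        = (\<Sum>i = 1..<t. g c (int i) * \<eta> c (int t - int i)) + (\<Sum>i = t..t + K. g c (int i) * \<eta> c (int t - int i))"
        by (rule sum.union_disjoint) auto
      also have "(\<Sum>i = 1..<t. g c (int i) * \<eta> c (int t - int i))
        = (\<Sum>i = 1..<t. g c (int i) * (D c (int t - int i) + e c (int t - int i)))"
        by (intro sum.cong refl) (simp add: \<eta>_eq[OF c] D_def)
      finally show "(\<Sum>i = 1..L. g c (int i) * \<eta> c (int t - int i))
        = (\<Sum>i = 1..<t. g c (int i) * (D c (int t - int i) + e c (int t - int i)))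
        + (\<Sum>i = t..t + K. g c (int i) * \<eta> c (int t - int i))" .
    qed
    also have "\<dots> = (\<Sum>i = 1..<t. F i (int t)) + (\<Sum>c<p. \<Sum>i = 1..<t. g c (int i) * e c (int t - int i))
        + (\<Sum>c<p. \<Sum>i = t..t + K. g c (int i) * \<eta> c (int t - int i))"
      unfolding F_def by (subst sum.swap[of _ "{..<p}" "{1..<t}"])
        (simp add: sum.distrib distrib_left)
    also have "(\<Sum>c<p. \<Sum>i = 1..<t. g c (int i) * e c (int t - int i)) = conv t (int t)"
      unfolding conv_def
      by (intro sum.cong refl sum.mono_neutral_left) (auto intro!: noise_nonpos)
    finally have "small (int t) = (\<Sum>c<p. \<Sum>i = t..t + K. g c (int i) * \<eta> c (int t - int i)) - (\<Sum>j. F (j + t) (int t))"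
      unfolding small_def z_eq[OF t] by simp
    moreover have "\<bar>\<Sum>c<p. \<Sum>i = t..t + K. g c (int i) * \<eta> c (int t - int i)\<bar> \<le> (\<Sum>c<p. \<Sum>i = t..t + K. C * \<rho> ^ t * H)"
    proof (rule order.trans[OF sum_abs], rule sum_mono, rule order.trans[OF sum_abs], rule sum_mono)
      fix c i assume ci: "c \<in> {..<p}" "i \<in> {t..t + K}"
      have "\<bar>g c (int i)\<bar> \<le> C * \<rho> ^ i" using ci by (intro decay) simp
      also have "\<dots> \<le> C * \<rho> ^ t" using ci C \<rho> by (intro mult_left_mono power_decreasing) auto
      finally have 1: "\<bar>g c (int i)\<bar> \<le> C * \<rho> ^ t" .
      have "\<bar>\<eta> c (- int (i - t))\<bar> \<le> (\<Sum>s\<le>K. \<bar>\<eta> c (- int s)\<bar>)"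
        using ci by (intro member_le_sum[where f = "\<lambda>s. \<bar>\<eta> c (- int s)\<bar>"]) auto
      also have "\<dots> \<le> H" unfolding H_def
        using ci by (intro member_le_sum[where f = "\<lambda>c. \<Sum>s\<le>K. \<bar>\<eta> c (- int s)\<bar>"] sum_nonneg) auto
      finally have 2: "\<bar>\<eta> c (int t - int i)\<bar> \<le> H" using ci by (simp add: of_nat_diff)
      show "\<bar>g c (int i) * \<eta> c (int t - int i)\<bar> \<le> C * \<rho> ^ t * H"
        unfolding abs_mult using 1 2 C \<rho> by (intro mult_mono) auto
    qed
    moreover have "\<bar>\<Sum>j. F (j + t) (int t)\<bar> \<le> (\<Sum>j. W * \<rho> ^ t * G j)"
    proof -
      have s: "summable (\<lambda>j. norm (F (j + t) (int t)))"
        by (rule summable_comparison_test'[OF summable_mult[OF G, of "W * \<rho> ^ t"]]) (use F_bd in simp)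
      have "norm (\<Sum>j. F (j + t) (int t)) \<le> (\<Sum>j. norm (F (j + t) (int t)))" by (rule summable_norm[OF s])
      also have "\<dots> \<le> (\<Sum>j. W * \<rho> ^ t * G j)"
        by (rule suminf_le[OF _ s summable_mult[OF G]]) (use F_bd in simp)
      finally show ?thesis by simp
    qed
    moreover have "(\<Sum>j. W * \<rho> ^ t * G j) = W * \<rho> ^ t * suminf G" by (rule suminf_mult[OF G])
    moreover have "(\<Sum>c<p. \<Sum>i = t..t + K. C * \<rho> ^ t * H) + W * \<rho> ^ t * suminf G = W2 * \<rho> ^ t"
      by (simp add: W2_def algebra_simps)
    ultimately show ?thesis by linarith
  qed
  \<comment> \<open>Since the noise is zero at nonpositive times, the common truncation point
    \<open>\<sigma> n\<close> can replace the varying one for all times in the sample.\<close>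
  have conv_eq: "conv L (int t) = conv t (int t)" if "t \<le> L" for L t
    unfolding conv_def using that
    by (intro sum.cong refl sum.mono_neutral_right) (auto intro!: noise_nonpos)
  have rq: "mean (\<sigma> n) (\<lambda>t. r n t * q t) = 0" for n
  proof -
    have "mean (\<sigma> n) (\<lambda>t. r n t * q t)
      = mean (\<sigma> n) (\<lambda>t. \<Sum>b<p. \<Sum>i = 1..k. \<delta> b i * (r n t * x b (t - int i)))"
      by (simp add: q_def sum_distrib_left mult_ac)
    also have "\<dots> = 0" by (simp add: mean_sum mean_cmult orth_x)
    finally show ?thesis .
  qed
  have rF: "mean (\<sigma> n) (\<lambda>t. r n t * F i t) = 0" for n i
  proof -
    have "mean (\<sigma> n) (\<lambda>t. r n t * F i t)
      = mean (\<sigma> n) (\<lambda>t. \<Sum>c<p. \<Sum>c'<d. \<Sum>c''<d. (g c (int i) * mu c c' * S i c' c'') * (r n t * Dx c'' t))"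
      unfolding F_def D_def
      by (intro mean_cong) (simp add: D_shift sum_distrib_left mult_ac)
    also have "\<dots> = 0" by (simp add: mean_sum mean_cmult orth_D)
    finally show ?thesis .
  qed
  have rz: "mean (\<sigma> n) (\<lambda>t. r n t * z t) = 0" for n
  proof -
    have 0: "(\<Sum>t = 1..\<sigma> n. r n (int t) * F i (int t)) = 0" for i
      using rF[of n i] by (cases "\<sigma> n = 0") (auto simp: mean_def)
    have "(\<Sum>t = 1..\<sigma> n. r n (int t) * z (int t)) = (\<Sum>t = 1..\<sigma> n. \<Sum>i. r n (int t) * F (Suc i) (int t))"
      unfolding z_def by (intro sum.cong refl suminf_mult[symmetric] sumF1) auto
    also have "\<dots> = (\<Sum>i. \<Sum>t = 1..\<sigma> n. r n (int t) * F (Suc i) (int t))"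
      by (intro suminf_sum[symmetric] summable_mult sumF1) auto
    also have "\<dots> = 0" unfolding 0 by simp
    finally show ?thesis by (simp add: mean_def)
  qed
  have rconv: "mean (\<sigma> n) (\<lambda>t. r n t * conv (\<sigma> n) t) = - mean (\<sigma> n) (\<lambda>t. r n t * small t)" for n
  proof -
    have "mean (\<sigma> n) (\<lambda>t. r n t * conv (\<sigma> n) t) = mean (\<sigma> n) (\<lambda>t. r n t * q t - r n t * z t - r n t * small t)"
    proof (rule mean_cong)
      fix t :: int assume t: "1 \<le> t" "t \<le> int (\<sigma> n)"
      have "conv (\<sigma> n) (int (nat t)) = conv (nat t) (int (nat t))"
        using t by (intro conv_eq) auto
      then show "r n t * conv (\<sigma> n) t = r n t * q t - r n t * z t - r n t * small t"
        using t by (simp add: small_def algebra_simps)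
    qed
    then show ?thesis by (simp add: mean_diff rq rz)
  qed
  have small_mean: "mean T (\<lambda>t. (small t)\<^sup>2) \<le> (W2\<^sup>2 / (1 - \<rho>)) / real T" for T
  proof -
    have "(\<Sum>t = 1..T. (small (int t))\<^sup>2) \<le> (\<Sum>t = 1..T. W2\<^sup>2 * \<rho> ^ t)"
    proof (rule sum_mono)
      fix t assume "t \<in> {1..T}"
      then have "\<bar>small (int t)\<bar>\<^sup>2 \<le> (W2 * \<rho> ^ t)\<^sup>2" by (intro power_mono small_bd) auto
      also have "\<dots> \<le> W2\<^sup>2 * \<rho> ^ t"
      proof -
        have "(\<rho> ^ t)\<^sup>2 \<le> \<rho> ^ t"
          using \<rho> power_le_one[of \<rho> t] by (simp add: power2_eq_square mult_left_le)
        then show ?thesis by (simp add: power_mult_distrib mult_left_mono)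
      qed
      finally show "(small (int t))\<^sup>2 \<le> W2\<^sup>2 * \<rho> ^ t" by simp
    qed
    also have "\<dots> \<le> W2\<^sup>2 * (\<rho> ^ 1 / (1 - \<rho>))"
      unfolding sum_distrib_left[symmetric] by (intro mult_left_mono sum_power_le_geometric \<rho>) auto
    also have "\<dots> \<le> W2\<^sup>2 / (1 - \<rho>)" using \<rho> by (simp add: divide_right_mono mult_left_le)
    finally show ?thesis unfolding mean_def by (intro divide_right_mono) auto
  qed
  obtain R' where R': "\<forall>\<^sub>F T in sequentially. \<forall>a<p. mean T (\<lambda>t. (e a t)\<^sup>2) \<le> R'" using noise_bounded by blast
  \<comment> \<open>Lags up to the sample size occur below, so a bound uniform in the lag is
    required; it holds because the shifted sum only loses terms.\<close>
  have e_shift: "mean T (\<lambda>t. (e c (t - int i))\<^sup>2) \<le> mean T (\<lambda>t. (e c t)\<^sup>2)" for T c i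
  proof -
    have "(\<Sum>t = 1..T. (e c (int t - int i))\<^sup>2) \<le> (\<Sum>t = 1..T. (e c (int t))\<^sup>2)"
    proof (cases "i \<le> T")
      case True
      have "(\<Sum>t = 1..T. (e c (int t - int i))\<^sup>2) = (\<Sum>t = Suc i..T. (e c (int t - int i))\<^sup>2)"
        by (rule sum.mono_neutral_right) (auto simp: noise_nonpos)
      also have "\<dots> = (\<Sum>t\<in>(\<lambda>t. t - i) ` {Suc i..T}. (e c (int t))\<^sup>2)"
        by (subst sum.reindex) (auto simp: inj_on_def of_nat_diff intro!: sum.cong)
      also have "\<dots> \<le> (\<Sum>t = 1..T. (e c (int t))\<^sup>2)"
        by (intro sum_mono2) auto
      finally show ?thesis .
    next
      case False
      then have "(\<Sum>t = 1..T. (e c (int t - int i))\<^sup>2) = 0"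
        by (intro sum.neutral) (auto simp: noise_nonpos)
      then show ?thesis by (simp add: sum_nonneg)
    qed
    then show ?thesis by (simp add: mean_def divide_right_mono)
  qed
  define W3 where "W3 = \<bar>R\<bar> + \<bar>R'\<bar>"
  define W4 where "W4 = real p * C * W3 / (1 - \<rho>)"
  define P where "P L = (\<Sum>i = 1..L. \<Sum>c<p. g c (int i) * (\<Sum>c'<p. g c' (int i) * \<Sigma> c' c))" for L
  \<comment> \<open>For fixed \<open>L\<close> the partial sum differs from the nearly vanishing
    full sum by a tail that is of order \<open>\<rho> ^ L\<close> uniformly in the sample size. So
    \<open>n\<close> goes to infinity first and \<open>L\<close> afterwards.\<close>
  have P_le: "P L \<le> W4 * \<rho> ^ L" for L
  proof (rule tendsto_le[OF sequentially_bot])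
    show "(\<lambda>n. \<Sum>i = 1..L. \<Sum>c<p. g c (int i) * mean (\<sigma> n) (\<lambda>t. r n t * e c (t - int i))) \<longlonglongrightarrow> P L"
      unfolding P_def by (intro tendsto_sum tendsto_mult tendsto_const \<gamma>) auto
    have inv: "(\<lambda>n. X / real (\<sigma> n)) \<longlonglongrightarrow> 0" for X
      using filterlim_compose[OF lim_const_over_n \<sigma>] .
    have "(\<lambda>n. mean (\<sigma> n) (\<lambda>t. r n t * small t)) \<longlonglongrightarrow> 0"
    proof -
      have "\<forall>\<^sub>F n in sequentially. norm ((mean (\<sigma> n) (\<lambda>t. r n t * small t))\<^sup>2) \<le> (R * (W2\<^sup>2 / (1 - \<rho>))) / real (\<sigma> n)"
        using R
      proof eventually_elim
        case (elim n)
        have "0 \<le> mean (\<sigma> n) (\<lambda>t. (r n t)\<^sup>2)" "0 \<le> mean (\<sigma> n) (\<lambda>t. (small t)\<^sup>2)" by (auto intro!: mean_nonneg)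
        then have "mean (\<sigma> n) (\<lambda>t. (r n t)\<^sup>2) * mean (\<sigma> n) (\<lambda>t. (small t)\<^sup>2)
          \<le> R * ((W2\<^sup>2 / (1 - \<rho>)) / real (\<sigma> n))"
          using elim small_mean by (intro mult_mono) auto
        then show ?case
          using mean_Cauchy_Schwarz[of "\<sigma> n" "r n" small] by simp
      qed
      then have "(\<lambda>n. (mean (\<sigma> n) (\<lambda>t. r n t * small t))\<^sup>2) \<longlonglongrightarrow> 0"
        by (rule Lim_null_comparison[OF _ inv])
      then show ?thesis by simp
    qed
    then have "(\<lambda>n. - mean (\<sigma> n) (\<lambda>t. r n t * small t) + W4 * \<rho> ^ L) \<longlonglongrightarrow> - 0 + W4 * \<rho> ^ L"
      by (intro tendsto_add tendsto_minus tendsto_const)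
    then show "(\<lambda>n. - mean (\<sigma> n) (\<lambda>t. r n t * small t) + W4 * \<rho> ^ L) \<longlonglongrightarrow> W4 * \<rho> ^ L" by simp
    have "\<forall>\<^sub>F n in sequentially. L \<le> \<sigma> n" using \<sigma> by (simp add: filterlim_at_top)
    then show "\<forall>\<^sub>F n in sequentially. (\<Sum>i = 1..L. \<Sum>c<p. g c (int i) * mean (\<sigma> n) (\<lambda>t. r n t * e c (t - int i)))
        \<le> - mean (\<sigma> n) (\<lambda>t. r n t * small t) + W4 * \<rho> ^ L"
      using R eventually_compose_filterlim[OF R' \<sigma>]
    proof eventually_elim
      case (elim n)
      define M where "M c i = mean (\<sigma> n) (\<lambda>t. r n t * e c (t - int i))" for c i
      have M: "\<bar>M c i\<bar> \<le> W3" if "c < p" for c i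
      proof -
        have "\<bar>M c i\<bar> \<le> mean (\<sigma> n) (\<lambda>t. (r n t)\<^sup>2) + mean (\<sigma> n) (\<lambda>t. (e c (t - int i))\<^sup>2)"
          unfolding M_def by (rule abs_mean_mult_le)
        also have "\<dots> \<le> R + R'" using elim that e_shift[where T = "\<sigma> n" and c = c and i = i] by fastforce
        also have "\<dots> \<le> W3" by (simp add: W3_def)
        finally show ?thesis .
      qed
      have W3: "W3 \<ge> 0" by (simp add: W3_def)
      have "mean (\<sigma> n) (\<lambda>t. r n t * conv (\<sigma> n) t) = mean (\<sigma> n) (\<lambda>t. \<Sum>c<p. \<Sum>i = 1..\<sigma> n. g c (int i) * (r n t * e c (t - int i)))"
        by (simp add: conv_def sum_distrib_left mult_ac)
      also have "\<dots> = (\<Sum>c<p. \<Sum>i = 1..\<sigma> n. g c (int i) * M c i)"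
        by (simp add: mean_sum mean_cmult M_def)
      also have "\<dots> = (\<Sum>i = 1..\<sigma> n. \<Sum>c<p. g c (int i) * M c i)" by (rule sum.swap)
      also have "{1..\<sigma> n} = {1..L} \<union> {Suc L..\<sigma> n}" using elim by auto
      also have "(\<Sum>i\<in>{1..L} \<union> {Suc L..\<sigma> n}. \<Sum>c<p. g c (int i) * M c i)
        = (\<Sum>i = 1..L. \<Sum>c<p. g c (int i) * M c i) + (\<Sum>i = Suc L..\<sigma> n. \<Sum>c<p. g c (int i) * M c i)"
        by (rule sum.union_disjoint) auto
      finally have 1: "(\<Sum>i = 1..L. \<Sum>c<p. g c (int i) * M c i)
        = - mean (\<sigma> n) (\<lambda>t. r n t * small t) - (\<Sum>i = Suc L..\<sigma> n. \<Sum>c<p. g c (int i) * M c i)"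
        using rconv[of n] by simp
      have "\<bar>\<Sum>i = Suc L..\<sigma> n. \<Sum>c<p. g c (int i) * M c i\<bar> \<le> (\<Sum>i = Suc L..\<sigma> n. \<Sum>c<p. C * \<rho> ^ i * W3)"
      proof (rule order.trans[OF sum_abs], rule sum_mono, rule order.trans[OF sum_abs], rule sum_mono)
        fix i c assume "c \<in> {..<p}"
        then show "\<bar>g c (int i) * M c i\<bar> \<le> C * \<rho> ^ i * W3"
          unfolding abs_mult using C \<rho> by (intro mult_mono decay M) auto
      qed
      also have "\<dots> = real p * C * W3 * (\<Sum>i = Suc L..\<sigma> n. \<rho> ^ i)"
        by (simp add: sum_distrib_left mult_ac)
      also have "\<dots> \<le> real p * C * W3 * (\<rho> ^ Suc L / (1 - \<rho>))"
        using C W3 by (intro mult_left_mono sum_power_le_geometric \<rho>) auto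
      also have "\<dots> \<le> real p * C * W3 * (\<rho> ^ L / (1 - \<rho>))"
        using C W3 \<rho> by (intro mult_left_mono divide_right_mono) (auto simp: mult_left_le_one_le)
      also have "\<dots> = W4 * \<rho> ^ L" by (simp add: W4_def)
      finally show ?case using 1 by (simp add: M_def)
    qed
  qed
  have P_eq: "P L = (\<Sum>i = 1..L. \<Sum>a<p. \<Sum>b<p. g a (int i) * g b (int i) * \<Sigma> a b)" for L
  proof -
    have "(\<Sum>c<p. g c (int i) * (\<Sum>c'<p. g c' (int i) * \<Sigma> c' c)) = (\<Sum>a<p. \<Sum>b<p. g a (int i) * g b (int i) * \<Sigma> a b)" for i
      by (subst sum.swap) (simp add: sum_distrib_left mult_ac)
    then show ?thesis by (simp add: P_def)
  qed
  \<comment> \<open>All terms of \<open>P L\<close> are nonnegative, so a single one is dominated by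
    a bound that vanishes as \<open>L\<close> grows.\<close>
  have key: "c0 * (g c i)\<^sup>2 \<le> W4 * \<rho> ^ L" if L: "L \<ge> nat i" for L
  proof -
    have nonneg: "0 \<le> (\<Sum>a<p. \<Sum>b<p. g a (int i) * g b (int i) * \<Sigma> a b)" for i
    proof -
      have "0 \<le> c0 * (\<Sum>a<p. (g a (int i))\<^sup>2)" using c0 by (intro mult_nonneg_nonneg sum_nonneg) auto
      then show ?thesis using pd[of "\<lambda>a. g a (int i)"] by linarith
    qed
    have "c0 * (g c i)\<^sup>2 \<le> c0 * (\<Sum>a<p. (g a (int (nat i)))\<^sup>2)"
      using c0 c i member_le_sum[of c "{..<p}" "\<lambda>a. (g a i)\<^sup>2"] by (intro mult_left_mono) auto
    also have "\<dots> \<le> (\<Sum>a<p. \<Sum>b<p. g a (int (nat i)) * g b (int (nat i)) * \<Sigma> a b)" by (rule pd)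
    also have "\<dots> \<le> P L" unfolding P_eq
      using L i by (intro member_le_sum[where f = "\<lambda>i. \<Sum>a<p. \<Sum>b<p. g a (int i) * g b (int i) * \<Sigma> a b"] nonneg) auto
    also have "\<dots> \<le> W4 * \<rho> ^ L" by (rule P_le)
    finally show ?thesis .
  qed
  have "(\<lambda>L. W4 * \<rho> ^ L) \<longlonglongrightarrow> W4 * 0" using \<rho> by (intro tendsto_mult tendsto_const LIMSEQ_realpow_zero) auto
  then have "c0 * (g c i)\<^sup>2 \<le> W4 * 0"
    by (rule LIMSEQ_le_const) (use key in blast)
  then show ?thesis using c0 by (simp add: mult_le_0_iff)
qed

end

section \<open>Compactness and the limit equation\<close>

lemma diagonal_convergent_subsequence:
  fixes f :: "'i :: countable \<Rightarrow> nat \<Rightarrow> real"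
  assumes "\<And>i. Bseq (f i)"
  shows "\<exists>s. strict_mono s \<and> (\<forall>i. convergent (\<lambda>n. f i (s n)))"
proof -
  interpret subseqs "\<lambda>n s. convergent (\<lambda>m. f (from_nat n) (s m))"
  proof
    fix n and s :: "nat \<Rightarrow> nat" assume s: "strict_mono s"
    obtain r where r: "strict_mono r" "monoseq (\<lambda>m. f (from_nat n) (s (r m)))"
      using seq_monosub[of "\<lambda>m. f (from_nat n) (s m)"] by blast
    have "Bseq (\<lambda>m. f (from_nat n) ((s \<circ> r) m))"
      by (rule Bseq_subseq[OF assms])
    then have "convergent (\<lambda>m. f (from_nat n) (s (r m)))"
      using r(2) by (intro Bseq_monoseq_convergent) auto
    then show "\<exists>r. strict_mono r \<and> convergent (\<lambda>m. f (from_nat n) ((s \<circ> r) m))"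
      using r(1) by auto
  qed
  have "convergent (\<lambda>m. f (from_nat n) (diagseq m))" for n
  proof -
    have "convergent (\<lambda>m. f (from_nat n) ((diagseq \<circ> (+) (Suc n)) m))"
    proof (rule diagseq_holds)
      fix r s :: "nat \<Rightarrow> nat" and n
      assume "strict_mono r" "convergent (\<lambda>m. f (from_nat n) (s m))"
      then show "convergent (\<lambda>m. f (from_nat n) ((s \<circ> r) m))"
        using convergent_subseq_convergent[of "\<lambda>m. f (from_nat n) (s m)" r] by (simp add: o_def)
    qed
    then have "convergent (\<lambda>m. f (from_nat n) (diagseq (m + Suc n)))" by (simp add: add.commute)
    then show ?thesis by (subst (asm) convergent_ignore_initial_segment)
  qed
  then have "convergent (\<lambda>m. f (from_nat (to_nat i)) (diagseq m))" for i :: 'i by blast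
  then have "convergent (\<lambda>m. f i (diagseq m))" for i by simp
  then show ?thesis using subseq_diagseq by auto
qed

lemma pd_matrix_inverse:
  fixes G :: "nat \<Rightarrow> nat \<Rightarrow> real"
  assumes c: "c > 0" and pd: "\<And>u. c * (\<Sum>a<p. (u a)\<^sup>2) \<le> (\<Sum>a<p. \<Sum>b<p. u a * u b * G a b)"
  obtains H where "\<And>a b. a < p \<Longrightarrow> b < p \<Longrightarrow> (\<Sum>c<p. G a c * H c b) = (if a = b then 1 else 0)"
    and "\<And>a b. a < p \<Longrightarrow> b < p \<Longrightarrow> (\<Sum>c<p. H a c * G c b) = (if a = b then 1 else 0)"
proof -
  define M where "M = mat p p (\<lambda>(a, b). G a b)"
  have M: "M \<in> carrier_mat p p" by (simp add: M_def)
  have det: "Determinant.det M \<noteq> 0"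
  proof
    assume "Determinant.det M = 0"
    then obtain v where v: "v \<in> carrier_vec p" "v \<noteq> 0\<^sub>v p" "M *\<^sub>v v = 0\<^sub>v p"
      using det_0_iff_vec_prod_zero[OF M] by blast
    have z: "(\<Sum>b<p. G a b * v $ b) = 0" if "a < p" for a
    proof -
      have "(M *\<^sub>v v) $ a = (\<Sum>b<p. G a b * v $ b)"
        using that v(1) by (auto simp: M_def scalar_prod_def atLeast0LessThan intro!: sum.cong)
      then show ?thesis using v(3) that by simp
    qed
    have "(\<Sum>a<p. \<Sum>b<p. v $ a * v $ b * G a b) = (\<Sum>a<p. v $ a * (\<Sum>b<p. G a b * v $ b))"
      by (simp add: sum_distrib_left mult_ac)
    also have "\<dots> = 0" by (simp add: z)
    finally have "(\<Sum>a<p. (v $ a)\<^sup>2) \<le> 0" using pd[of "\<lambda>a. v $ a"] c by (simp add: mult_le_0_iff)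
    then have "(\<Sum>a<p. (v $ a)\<^sup>2) = 0" by (meson antisym sum_nonneg zero_le_power2)
    then have "\<forall>a<p. v $ a = 0" by (subst (asm) sum_nonneg_eq_0_iff) auto
    then have "v = 0\<^sub>v p" using v(1) by (intro eq_vecI) auto
    then show False using v(2) by simp
  qed
  define H where "H a b = adj_mat M $$ (a, b) / Determinant.det M" for a b
  note adj = adj_mat[OF M]
  have "(\<Sum>c<p. G a c * H c b) = (if a = b then 1 else 0)" if "a < p" "b < p" for a b
  proof -
    have "(M * adj_mat M) $$ (a, b) = (\<Sum>c<p. G a c * adj_mat M $$ (c, b))" (is "_ = ?S")
      using that adj(1) by (auto simp: M_def scalar_prod_def atLeast0LessThan intro!: sum.cong)
    moreover have "(M * adj_mat M) $$ (a, b) = (if a = b then Determinant.det M else 0)"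
      using that by (simp add: adj(2))
    ultimately have "?S = (if a = b then Determinant.det M else 0)" by (rule trans[OF sym])
    then show ?thesis using det by (simp add: H_def flip: sum_divide_distrib)
  qed
  moreover have "(\<Sum>c<p. H a c * G c b) = (if a = b then 1 else 0)" if "a < p" "b < p" for a b
  proof -
    have "(adj_mat M * M) $$ (a, b) = (\<Sum>c<p. adj_mat M $$ (a, c) * G c b)" (is "_ = ?S")
      using that adj(1) by (auto simp: M_def scalar_prod_def atLeast0LessThan intro!: sum.cong)
    moreover have "(adj_mat M * M) $$ (a, b) = (if a = b then Determinant.det M else 0)"
      using that by (simp add: adj(3))
    ultimately have "?S = (if a = b then Determinant.det M else 0)" by (rule trans[OF sym])
    then show ?thesis using det by (simp add: H_def flip: sum_divide_distrib)
  qed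
  ultimately show ?thesis using that by blast
qed

lemma mean_mult_tendsto_0:
  assumes "(\<lambda>n. mean (\<sigma> n) (\<lambda>t. (u n t)\<^sup>2)) \<longlonglongrightarrow> 0"
    and "\<forall>\<^sub>F n in sequentially. mean (\<sigma> n) (\<lambda>t. (v n t)\<^sup>2) \<le> R"
  shows "(\<lambda>n. mean (\<sigma> n) (\<lambda>t. u n t * v n t)) \<longlonglongrightarrow> 0"
proof -
  have "\<forall>\<^sub>F n in sequentially. norm ((mean (\<sigma> n) (\<lambda>t. u n t * v n t))\<^sup>2) \<le> mean (\<sigma> n) (\<lambda>t. (u n t)\<^sup>2) * R"
    using assms(2)
  proof eventually_elim
    case (elim n)
    have "mean (\<sigma> n) (\<lambda>t. (u n t)\<^sup>2) * mean (\<sigma> n) (\<lambda>t. (v n t)\<^sup>2) \<le> mean (\<sigma> n) (\<lambda>t. (u n t)\<^sup>2) * R"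
      using elim by (intro mult_left_mono mean_nonneg) auto
    then show ?case using mean_Cauchy_Schwarz[of "\<sigma> n" "u n" "v n"] by simp
  qed
  moreover have "(\<lambda>n. mean (\<sigma> n) (\<lambda>t. (u n t)\<^sup>2) * R) \<longlonglongrightarrow> 0"
    using tendsto_mult_left_zero[OF assms(1)] .
  ultimately have "(\<lambda>n. (mean (\<sigma> n) (\<lambda>t. u n t * v n t))\<^sup>2) \<longlonglongrightarrow> 0"
    by (rule Lim_null_comparison)
  then show ?thesis by simp
qed

lemma mean_tail_tendsto:
  "(\<lambda>T. (\<Sum>t = Suc N..T. w (int t)) / real T - mean T w) \<longlonglongrightarrow> 0"
proof -
  define S where "S = (\<Sum>t = 1..N. w (int t))"
  have "(\<lambda>T. - (S / real T)) \<longlonglongrightarrow> - 0" by (intro tendsto_minus lim_const_over_n)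
  then have "(\<lambda>T. - (S / real T)) \<longlonglongrightarrow> 0" by simp
  moreover have "\<forall>\<^sub>F T in sequentially. - (S / real T) = (\<Sum>t = Suc N..T. w (int t)) / real T - mean T w"
    using eventually_ge_at_top[of N]
  proof eventually_elim
    case (elim T)
    have "{1..T} = {1..N} \<union> {Suc N..T}" using elim by auto
    then have "(\<Sum>t = 1..T. w (int t)) = S + (\<Sum>t = Suc N..T. w (int t))"
      unfolding S_def by (subst sum.union_disjoint[symmetric]) auto
    then show ?case by (simp add: mean_def add_divide_distrib)
  qed
  ultimately show ?thesis by (rule Lim_transform_eventually)
qed

context white_noise
begin

lemma noise_shift_bounded:
  assumes "b < p"
  shows "\<exists>R. \<forall>\<^sub>F T in sequentially. mean T (\<lambda>t. (e b (t - i))\<^sup>2) \<le> R"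
proof -
  obtain R where R: "\<forall>\<^sub>F T in sequentially. \<forall>a<p. mean T (\<lambda>t. (e a t)\<^sup>2) \<le> R" using noise_bounded by blast
  have "(\<lambda>T. mean T (\<lambda>t. (e b (t - i))\<^sup>2) - mean T (\<lambda>t. (e b t)\<^sup>2)) \<longlonglongrightarrow> 0"
    using noise_gram_same[OF assms assms, of i] by (simp add: power2_eq_square)
  then have "\<forall>\<^sub>F T in sequentially. mean T (\<lambda>t. (e b (t - i))\<^sup>2) - mean T (\<lambda>t. (e b t)\<^sup>2) < 1"
    by (rule order_tendstoD) simp
  with R have "\<forall>\<^sub>F T in sequentially. mean T (\<lambda>t. (e b (t - i))\<^sup>2) \<le> R + 1"
    by eventually_elim (use assms in force)
  then show ?thesis ..
qed

end

context var_path
begin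

lemma common_exponential_bound:
  fixes g :: "nat \<Rightarrow> nat \<Rightarrow> real"
  assumes "\<And>c. c < p \<Longrightarrow> \<exists>C \<rho>. 0 < \<rho> \<and> \<rho> < 1 \<and> (\<forall>n. \<bar>g c n\<bar> \<le> C * \<rho> ^ n)"
  shows "\<exists>C \<rho>. 0 < \<rho> \<and> \<rho> < 1 \<and> (\<forall>c<p. \<forall>n. \<bar>g c n\<bar> \<le> C * \<rho> ^ n)"
proof -
  obtain C \<rho> where C: "\<And>c. c < p \<Longrightarrow> 0 < \<rho> c \<and> \<rho> c < 1 \<and> (\<forall>n. \<bar>g c n\<bar> \<le> C c * \<rho> c ^ n)"
    using assms by metis
  \<comment> \<open>The inserted 1/2 keeps the set nonempty and the common rate positive, also for
    \<open>p = 0\<close>.\<close>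
  define \<rho>' where "\<rho>' = Max (insert (1 / 2) (\<rho> ` {..<p}))"
  define C' where "C' = (\<Sum>c<p. \<bar>C c\<bar>)"
  have "\<rho>' < 1" unfolding \<rho>'_def using C by auto
  moreover have "1 / 2 \<le> \<rho>'" unfolding \<rho>'_def by (rule Max_ge) auto
  ultimately have r: "\<rho>' < 1" "\<rho>' \<ge> 1 / 2" by auto
  have "\<bar>g c n\<bar> \<le> C' * \<rho>' ^ n" if "c < p" for c n
  proof -
    have "\<bar>g c n\<bar> \<le> C c * \<rho> c ^ n" using C that by blast
    also have "\<dots> \<le> C' * \<rho>' ^ n"
    proof (rule mult_mono)
      have "\<bar>C c\<bar> \<le> C'" unfolding C'_def using that by (intro member_le_sum) auto
      then show "C c \<le> C'" by linarith
      have "\<rho> c \<le> \<rho>'" unfolding \<rho>'_def using that by (intro Max_ge) auto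
      then show "\<rho> c ^ n \<le> \<rho>' ^ n" using C[OF that] by (intro power_mono) auto
      show "0 \<le> C'" unfolding C'_def by (intro sum_nonneg) auto
      show "0 \<le> \<rho> c ^ n" using C[OF that] by simp
    qed
    finally show ?thesis .
  qed
  then show ?thesis using r by (intro exI[of _ C'] exI[of _ \<rho>']) auto
qed

text \<open>Here \<open>r\<close> are the residuals of a lower order and \<open>s\<close> those of order \<open>k\<close>. The limits \<open>\<gamma>\<close>, \<open>\<Omega>\<close>, \<open>\<Sigma>\<close>
  exist after passing to a subsequence.\<close>

lemma lag_k_vanishes_aux:
  fixes B :: "nat \<Rightarrow> nat \<Rightarrow> nat \<Rightarrow> real poly" and \<nu> :: "nat \<Rightarrow> nat \<Rightarrow> nat \<Rightarrow> real"
  assumes r_def: "\<And>n a. r n a = resid (B n a) (\<nu> n a)"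
    and \<sigma>: "filterlim \<sigma> at_top sequentially"
    and B0: "\<And>n a b. a < p \<Longrightarrow> b < p \<Longrightarrow> coeff (B n a b) 0 = (if a = b then 1 else 0)"
    and Bk: "\<And>n a b i. a < p \<Longrightarrow> b < p \<Longrightarrow> i \<ge> k \<Longrightarrow> coeff (B n a b) i = 0"
    and R: "\<And>a. a < p \<Longrightarrow> \<forall>\<^sub>F n in sequentially. mean (\<sigma> n) (\<lambda>t. (r n a t)\<^sup>2) \<le> R"
    and orth_x: "\<And>n a b i. a < p \<Longrightarrow> b < p \<Longrightarrow> 1 \<le> i \<Longrightarrow> i \<le> k \<Longrightarrow> mean (\<sigma> n) (\<lambda>t. s n a t * x b (t - int i)) = 0"
    and orth_D: "\<And>n a c. a < p \<Longrightarrow> c < d \<Longrightarrow> mean (\<sigma> n) (\<lambda>t. s n a t * Dx c t) = 0"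
    and close: "\<And>a. a < p \<Longrightarrow> (\<lambda>n. mean (\<sigma> n) (\<lambda>t. (r n a t - s n a t)\<^sup>2)) \<longlonglongrightarrow> 0"
    and \<gamma>: "\<And>a b i. a < p \<Longrightarrow> b < p \<Longrightarrow> (\<lambda>n. mean (\<sigma> n) (\<lambda>t. r n a t * e b (t - i))) \<longlonglongrightarrow> \<gamma> a b i"
    and \<Omega>: "\<And>a b. a < p \<Longrightarrow> b < p \<Longrightarrow> (\<lambda>n. mean (\<sigma> n) (\<lambda>t. r n a t * r n b t)) \<longlonglongrightarrow> \<Omega> a b"
    and \<Sigma>: "\<And>a b. a < p \<Longrightarrow> b < p \<Longrightarrow> (\<lambda>n. mean (\<sigma> n) (\<lambda>t. e a t * e b t)) \<longlonglongrightarrow> \<Sigma> a b"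
    and ab: "a < p" "b < p"
  shows "A k a b = 0"
proof -
  have degB: "degree (B n a b) \<le> k" if "a < p" "b < p" for n a b
    by (rule degree_le) (use Bk[OF that] in auto)
  obtain c0 where c0: "c0 > 0" and pd0: "\<forall>\<^sub>F T in sequentially. \<forall>u. c0 * (\<Sum>a<p. (u a)\<^sup>2) \<le> mean T (\<lambda>t. (\<Sum>a<p. u a * e a t)\<^sup>2)"
    using noise_pd by blast
  have pd\<Sigma>: "c0 * (\<Sum>a<p. (u a)\<^sup>2) \<le> (\<Sum>a<p. \<Sum>b<p. u a * u b * \<Sigma> a b)" for u
  proof (rule tendsto_lowerbound[OF _ _ sequentially_bot])
    show "(\<lambda>n. \<Sum>a<p. \<Sum>b<p. u a * u b * mean (\<sigma> n) (\<lambda>t. e a t * e b t)) \<longlonglongrightarrow> (\<Sum>a<p. \<Sum>b<p. u a * u b * \<Sigma> a b)"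
      by (intro tendsto_sum tendsto_mult tendsto_const \<Sigma>) auto
    show "\<forall>\<^sub>F n in sequentially. c0 * (\<Sum>a<p. (u a)\<^sup>2) \<le> (\<Sum>a<p. \<Sum>b<p. u a * u b * mean (\<sigma> n) (\<lambda>t. e a t * e b t))"
      using eventually_compose_filterlim[OF pd0 \<sigma>] by eventually_elim (simp flip: mean_square_sum)
  qed
  obtain H where H: "\<And>a b. a < p \<Longrightarrow> b < p \<Longrightarrow> (\<Sum>c<p. \<Sigma> a c * H c b) = (if a = b then 1 else 0)"
    "\<And>a b. a < p \<Longrightarrow> b < p \<Longrightarrow> (\<Sum>c<p. H a c * \<Sigma> c b) = (if a = b then 1 else 0)"
    using pd_matrix_inverse[OF c0 pd\<Sigma>] by blast
  obtain c1 where c1: "c1 > 0" and pd1: "\<forall>\<^sub>F T in sequentially. \<forall>B \<nu>. (\<forall>b<p. degree (B b) \<le> k) \<longrightarrow>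
     c1 * (\<Sum>i\<le>m_deg. \<Sum>a<p. (coeff (filt B a) i)\<^sup>2) \<le> mean T (\<lambda>t. (resid B \<nu> t)\<^sup>2)"
    using resid_pd by blast
  \<comment> \<open>A combination \<open>u\<close> of residual components is again a
    \<open>resid\<close>, and the lag-zero coefficients of its filter are the entries of
    \<open>u\<close>; the uniform lower bound then applies before the limit is taken.\<close>
  have pd\<Omega>: "c1 * (\<Sum>a<p. (u a)\<^sup>2) \<le> (\<Sum>a<p. \<Sum>b<p. u a * u b * \<Omega> a b)" for u
  proof (rule tendsto_lowerbound[OF _ _ sequentially_bot])
    show "(\<lambda>n. \<Sum>a<p. \<Sum>b<p. u a * u b * mean (\<sigma> n) (\<lambda>t. r n a t * r n b t)) \<longlonglongrightarrow> (\<Sum>a<p. \<Sum>b<p. u a * u b * \<Omega> a b)"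
      by (intro tendsto_sum tendsto_mult tendsto_const \<Omega>) auto
    show "\<forall>\<^sub>F n in sequentially. c1 * (\<Sum>a<p. (u a)\<^sup>2) \<le> (\<Sum>a<p. \<Sum>b<p. u a * u b * mean (\<sigma> n) (\<lambda>t. r n a t * r n b t))"
      using eventually_compose_filterlim[OF pd1 \<sigma>]
    proof eventually_elim
      case (elim n)
      define B' where "B' b = (\<Sum>a<p. Polynomial.smult (u a) (B n a b))" for b
      define \<nu>' where "\<nu>' c = (\<Sum>a<p. u a * \<nu> n a c)" for c
      have deg: "degree (B' b) \<le> k" if "b < p" for b
        unfolding B'_def using degB that
        by (intro degree_sum_le) (auto intro: order.trans[OF degree_smult_le])
      have co: "coeff (filt B' a) 0 = u a" if "a < p" for a
      proof -
        have "coeff (filt B' a) 0 = (\<Sum>a'<p. if a' = a then u a' else 0)"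
          using that by (simp add: filt_0 B'_def coeff_sum B0 if_distrib[of "\<lambda>z. _ * z"] cong: if_cong)
        then show ?thesis using that by simp
      qed
      have "(\<Sum>a<p. (u a)\<^sup>2) = (\<Sum>a<p. (coeff (filt B' a) 0)\<^sup>2)" using co by simp
      also have "\<dots> \<le> (\<Sum>i\<le>m_deg. \<Sum>a<p. (coeff (filt B' a) i)\<^sup>2)"
        by (rule member_le_sum[where f = "\<lambda>i. \<Sum>a<p. (coeff (filt B' a) i)\<^sup>2"]) (auto intro: sum_nonneg)
      finally have "c1 * (\<Sum>a<p. (u a)\<^sup>2) \<le> mean (\<sigma> n) (\<lambda>t. (resid B' \<nu>' t)\<^sup>2)"
        using elim[rule_format, of B' \<nu>'] deg c1 by (meson mult_left_mono less_imp_le order.trans)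
      also have "resid B' \<nu>' = (\<lambda>t. \<Sum>a<p. u a * r n a t)"
        unfolding B'_def \<nu>'_def r_def by (rule ext) (rule resid_lincomb)
      finally show ?case by (simp add: mean_square_sum)
    qed
  qed
  have s_R: "\<forall>\<^sub>F n in sequentially. mean (\<sigma> n) (\<lambda>t. (s n a t)\<^sup>2) \<le> 2 * R + 2" if a: "a < p" for a
  proof -
    have "\<forall>\<^sub>F n in sequentially. mean (\<sigma> n) (\<lambda>t. (r n a t - s n a t)\<^sup>2) < 1"
      using close[OF a] by (rule order_tendstoD) simp
    with R[OF a] show ?thesis
    proof eventually_elim
      case (elim n)
      have "mean (\<sigma> n) (\<lambda>t. (s n a t)\<^sup>2) \<le> mean (\<sigma> n) (\<lambda>t. 2 * (r n a t)\<^sup>2 + 2 * (r n a t - s n a t)\<^sup>2)"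
      proof (rule mean_mono)
        fix t
        \<comment> \<open>This square is exactly the difference of the two sides.\<close>
        have "0 \<le> (2 * r n a t - s n a t)\<^sup>2" by simp
        then show "(s n a t)\<^sup>2 \<le> 2 * (r n a t)\<^sup>2 + 2 * (r n a t - s n a t)\<^sup>2"
          by (simp add: power2_eq_square algebra_simps)
      qed
      then show ?case using elim by (simp add: mean_add mean_cmult)
    qed
  qed
  have s_\<gamma>: "(\<lambda>n. mean (\<sigma> n) (\<lambda>t. s n a t * e b (t - i))) \<longlonglongrightarrow> \<gamma> a b i" if ab: "a < p" "b < p" for a b i
  proof -
    obtain R1 where R1: "\<forall>\<^sub>F T in sequentially. mean T (\<lambda>t. (e b (t - i))\<^sup>2) \<le> R1"
      using noise_shift_bounded[OF ab(2), of i] ..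
    have "(\<lambda>n. mean (\<sigma> n) (\<lambda>t. (r n a t - s n a t) * e b (t - i))) \<longlonglongrightarrow> 0"
      by (rule mean_mult_tendsto_0[OF close[OF ab(1)]]) (rule eventually_compose_filterlim[OF R1 \<sigma>])
    from tendsto_diff[OF \<gamma>[OF ab, of i] this] show ?thesis
      by (simp add: left_diff_distrib mean_diff)
  qed
  \<comment> \<open>\<open>r\<close> and the innovation both have lag-zero coefficient the identity,
    so they differ by a combination of the order-\<open>k\<close> regressors, to which
    \<open>s\<close> is orthogonal. Exchanging \<open>s\<close> for \<open>r\<close> in the limit
    identifies \<open>\<gamma>\<close> at lag zero with the residual covariance, which is the source
    of its invertibility.\<close>
  have \<Omega>_\<gamma>: "\<Omega> a b = \<gamma> a b 0" if ab: "a < p" "b < p" for a b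
  proof -
    have eq: "mean (\<sigma> n) (\<lambda>t. s n a t * r n b t) = mean (\<sigma> n) (\<lambda>t. s n a t * e b t)" for n
    proof -
      have re: "r n b t - e b t = (\<Sum>i = 1..k. \<Sum>c<p. (coeff (B n b c) i + A i b c) * x c (t - int i))
          + (\<Sum>c<d. (mu b c - \<nu> n b c) * Dx c t)" if t: "t \<ge> 1" for t
      proof -
        have "lag_op (B n b c) (x c) t = (if b = c then x c t else 0) + (\<Sum>i = 1..k. coeff (B n b c) i * x c (t - int i))"
          if "c < p" for c
        proof -
          have "{..k} = insert 0 {1..k}" by auto
          then show ?thesis using that ab B0[OF ab(2) that] by (simp add: lag_op_eq_sum[OF degB])
        qed
        then have "(\<Sum>c<p. lag_op (B n b c) (x c) t)
          = (\<Sum>c<p. (if b = c then x c t else 0) + (\<Sum>i = 1..k. coeff (B n b c) i * x c (t - int i)))"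
          by (intro sum.cong) auto
        also have "\<dots> = x b t + (\<Sum>i = 1..k. \<Sum>c<p. coeff (B n b c) i * x c (t - int i))"
          using ab by (simp add: sum.distrib) (rule sum.swap)
        finally have "r n b t = x b t + (\<Sum>i = 1..k. \<Sum>c<p. coeff (B n b c) i * x c (t - int i)) - (\<Sum>c<d. \<nu> n b c * Dx c t)"
          by (simp add: r_def resid_def)
        then show ?thesis using x_eq[OF ab(2) t]
          by (simp add: algebra_simps sum.distrib sum_subtractf)
      qed
      have "mean (\<sigma> n) (\<lambda>t. s n a t * r n b t) - mean (\<sigma> n) (\<lambda>t. s n a t * e b t)
        = mean (\<sigma> n) (\<lambda>t. s n a t * (r n b t - e b t))"
        by (simp add: right_diff_distrib mean_diff)
      also have "\<dots> = mean (\<sigma> n) (\<lambda>t. (\<Sum>i = 1..k. \<Sum>c<p. (coeff (B n b c) i + A i b c) * (s n a t * x c (t - int i)))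
          + (\<Sum>c<d. (mu b c - \<nu> n b c) * (s n a t * Dx c t)))"
        by (intro mean_cong) (simp add: re distrib_left sum_distrib_left mult_ac)
      also have "\<dots> = 0" using ab by (simp add: mean_add mean_sum mean_cmult orth_x orth_D)
      finally show ?thesis by simp
    qed
    have "(\<lambda>n. mean (\<sigma> n) (\<lambda>t. (r n a t - s n a t) * r n b t)) \<longlonglongrightarrow> 0"
      by (rule mean_mult_tendsto_0[OF close[OF ab(1)] R[OF ab(2)]])
    from tendsto_diff[OF \<Omega>[OF ab] this]
    have "(\<lambda>n. mean (\<sigma> n) (\<lambda>t. s n a t * e b t)) \<longlonglongrightarrow> \<Omega> a b"
      by (simp add: left_diff_distrib mean_diff eq)
    moreover have "(\<lambda>n. mean (\<sigma> n) (\<lambda>t. s n a t * e b t)) \<longlonglongrightarrow> \<gamma> a b 0"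
      using s_\<gamma>[OF ab, of 0] by simp
    ultimately show ?thesis by (rule LIMSEQ_unique)
  qed
  define g where "g a c i = (\<Sum>b<p. \<gamma> a b i * H b c)" for a c i
  have g\<Sigma>: "(\<Sum>c<p. g a c i * \<Sigma> c b) = \<gamma> a b i" if "b < p" for a b i
  proof -
    have "(\<Sum>c<p. g a c i * \<Sigma> c b) = (\<Sum>b'<p. \<gamma> a b' i * (\<Sum>c<p. H b' c * \<Sigma> c b))"
      unfolding g_def sum_distrib_right by (subst sum.swap) (simp add: sum_distrib_left mult.assoc)
    also have "\<dots> = (\<Sum>b'<p. if b' = b then \<gamma> a b' i else 0)"
      using that by (intro sum.cong refl) (simp add: H)
    finally show ?thesis using that by simp
  qed
  \<comment> \<open>The covariance of \<open>\<chi>(L) r\<close> with the innovation lagged by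
    \<open>i\<close> is computed twice: directly it tends to \<open>\<chi>\<close> applied to
    \<open>\<gamma>\<close>, and by the moving average it is coefficient \<open>i\<close> of the
    filter times \<open>\<Sigma>\<close>, up to a vanishing error. Multiplying by \<open>H\<close>
    isolates the coefficient.\<close>
  have Clim: "(\<lambda>n. coeff_seq (filt (B n a) c) i) \<longlonglongrightarrow> lag_op \<chi> (g a c) i" if a: "a < p" and c: "c < p" for a c i
  proof -
    define N where "N = m_deg + degree \<chi>"
    \<comment> \<open>The uniform lower bound converts bounded mean squares into bounded filter
      coefficients, which may then multiply the vanishing Gram errors. The form of the constant
      comes from \<open>\<bar>y\<bar> \<le> 1 + y\<^sup>2\<close>.\<close>
    have bdd: "\<forall>\<^sub>F n in sequentially. \<forall>c<p. \<forall>i\<le>m_deg. \<bar>coeff (filt (B n a) c) i\<bar> \<le> 1 + R / c1"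
      using eventually_compose_filterlim[OF pd1 \<sigma>] R[OF a]
    proof eventually_elim
      case (elim n)
      show ?case
      proof (intro allI impI)
        fix c i assume ci: "c < p" "i \<le> m_deg"
        have "(coeff (filt (B n a) c) i)\<^sup>2 \<le> (\<Sum>c<p. (coeff (filt (B n a) c) i)\<^sup>2)"
          using ci by (intro member_le_sum[where f = "\<lambda>c. (coeff (filt (B n a) c) i)\<^sup>2"]) auto
        also have "\<dots> \<le> (\<Sum>i\<le>m_deg. \<Sum>c<p. (coeff (filt (B n a) c) i)\<^sup>2)"
          using ci by (intro member_le_sum[where f = "\<lambda>i. \<Sum>c<p. (coeff (filt (B n a) c) i)\<^sup>2"] sum_nonneg) auto
        finally have "c1 * (coeff (filt (B n a) c) i)\<^sup>2 \<le> c1 * (\<Sum>i\<le>m_deg. \<Sum>c<p. (coeff (filt (B n a) c) i)\<^sup>2)"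
          using c1 by (intro mult_left_mono) auto
        also have "\<dots> \<le> mean (\<sigma> n) (\<lambda>t. (r n a t)\<^sup>2)"
          unfolding r_def using elim(1) degB[OF a] by blast
        also have "\<dots> \<le> R" by (rule elim)
        finally have "(coeff (filt (B n a) c) i)\<^sup>2 \<le> R / c1" using c1 by (simp add: field_simps)
        moreover have "\<bar>y\<bar> \<le> 1 + y\<^sup>2" for y :: real
        proof -
          have "0 \<le> (\<bar>y\<bar> - 1)\<^sup>2" by simp
          then have "2 * \<bar>y\<bar> \<le> 1 + y\<^sup>2" by (simp add: power2_diff)
          then show ?thesis by linarith
        qed
        ultimately show "\<bar>coeff (filt (B n a) c) i\<bar> \<le> 1 + R / c1"
          by (meson add_left_mono order.trans)
      qed
    qed
    have key: "(\<lambda>n. \<Sum>c<p. coeff_seq (filt (B n a) c) i * \<Sigma> c b) \<longlonglongrightarrow> lag_op \<chi> (\<gamma> a b) i" if b: "b < p" for b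
    proof -
      define L where "L n = (\<Sum>t = Suc N..\<sigma> n. lag_op \<chi> (r n a) (int t) * e b (int t - i)) / real (\<sigma> n)" for n
      have L1: "L \<longlonglongrightarrow> lag_op \<chi> (\<gamma> a b) i"
      proof -
        have "(\<lambda>n. (\<Sum>t = Suc N..\<sigma> n. r n a (int t - int j) * e b (int t - i)) / real (\<sigma> n)) \<longlonglongrightarrow> \<gamma> a b (i - int j)"
          if "j \<le> degree \<chi>" for j
        proof -
          have "j \<le> N" using that by (simp add: N_def)
          from mean_residual_noise_shift[where r = "\<lambda>n. r n a" and i = "i - int j", OF \<sigma> R[OF a] b this]
          have "(\<lambda>n. (\<Sum>t = Suc N..\<sigma> n. r n a (int t - int j) * e b (int t - i)) / real (\<sigma> n)
            - mean (\<sigma> n) (\<lambda>t. r n a t * e b (t - (i - int j)))) \<longlonglongrightarrow> 0" by simp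
          from tendsto_add[OF this \<gamma>[OF a b, of "i - int j"]] show ?thesis by simp
        qed
        then have "(\<lambda>n. \<Sum>j\<le>degree \<chi>. coeff \<chi> j * ((\<Sum>t = Suc N..\<sigma> n. r n a (int t - int j) * e b (int t - i)) / real (\<sigma> n)))
          \<longlonglongrightarrow> (\<Sum>j\<le>degree \<chi>. coeff \<chi> j * \<gamma> a b (i - int j))"
          by (intro tendsto_sum tendsto_mult tendsto_const) auto
        moreover have "L n = (\<Sum>j\<le>degree \<chi>. coeff \<chi> j * ((\<Sum>t = Suc N..\<sigma> n. r n a (int t - int j) * e b (int t - i)) / real (\<sigma> n)))" for n
          unfolding L_def lag_op_def sum_distrib_right
          by (subst sum.swap) (simp add: sum_distrib_left sum_divide_distrib mult_ac)
        ultimately show ?thesis unfolding lag_op_def by presburger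
      qed
      define G where "G n l c = (\<Sum>t = Suc N..\<sigma> n. e c (int t - int l) * e b (int t - i)) / real (\<sigma> n)" for n l c
      have G: "(\<lambda>n. (if int l = i then \<Sigma> c b else 0) - G n l c) \<longlonglongrightarrow> 0" if c: "c < p" for l c
      proof -
        have lim: "(\<lambda>n. mean (\<sigma> n) (\<lambda>t. e c (t - int l) * e b (t - i))) \<longlonglongrightarrow> (if int l = i then \<Sigma> c b else 0)"
        proof (cases "int l = i")
          case True
          have "(\<lambda>n. mean (\<sigma> n) (\<lambda>t. e c (t - i) * e b (t - i)) - mean (\<sigma> n) (\<lambda>t. e c t * e b t)) \<longlonglongrightarrow> 0"
            using filterlim_compose[OF noise_gram_same[OF c b, of i] \<sigma>] .
          from tendsto_add[OF this \<Sigma>[OF c b]] show ?thesis using True by simp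
        next
          case False
          then show ?thesis using filterlim_compose[OF noise_gram_distinct[OF c b False] \<sigma>] by simp
        qed
        have "(\<lambda>n. G n l c - mean (\<sigma> n) (\<lambda>t. e c (t - int l) * e b (t - i))) \<longlonglongrightarrow> 0"
          unfolding G_def
          using filterlim_compose[OF mean_tail_tendsto[where N = N and w = "\<lambda>t. e c (t - int l) * e b (t - i)"] \<sigma>] .
        from tendsto_add[OF this lim]
        have "(\<lambda>n. G n l c) \<longlonglongrightarrow> (if int l = i then \<Sigma> c b else 0)" by simp
        from tendsto_diff[OF tendsto_const[of "if int l = i then \<Sigma> c b else 0"] this] show ?thesis by simp
      qed
      have L2: "L n = (\<Sum>l\<le>m_deg. \<Sum>c<p. coeff (filt (B n a) c) l * G n l c)" for n
      proof -
        have "L n = (\<Sum>t = Suc N..\<sigma> n. (\<Sum>c<p. \<Sum>l\<le>m_deg. coeff (filt (B n a) c) l * e c (int t - int l)) * e b (int t - i)) / real (\<sigma> n)"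
          unfolding L_def
        proof (intro arg_cong2[where f = "(/)"] sum.cong refl)
          fix t assume "t \<in> {Suc N..\<sigma> n}"
          then have "lag_op \<chi> (r n a) (int t) = (\<Sum>c<p. lag_op (filt (B n a) c) (e c) (int t))"
            unfolding r_def by (intro lag_op_resid degB[OF a]) (auto simp: N_def)
          also have "\<dots> = (\<Sum>c<p. \<Sum>l\<le>m_deg. coeff (filt (B n a) c) l * e c (int t - int l))"
            by (intro sum.cong refl lag_op_eq_sum degree_filt degB[OF a]) auto
          finally show "lag_op \<chi> (r n a) (int t) * e b (int t - i)
            = (\<Sum>c<p. \<Sum>l\<le>m_deg. coeff (filt (B n a) c) l * e c (int t - int l)) * e b (int t - i)" by simp
        qed
        also have "\<dots> = (\<Sum>t = Suc N..\<sigma> n. \<Sum>l\<le>m_deg. \<Sum>c<p. coeff (filt (B n a) c) l * (e c (int t - int l) * e b (int t - i)) / real (\<sigma> n))"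
          by (subst sum.swap[of _ "{..m_deg}"]) (simp add: sum_distrib_right sum_divide_distrib mult.assoc)
        also have "\<dots> = (\<Sum>l\<le>m_deg. \<Sum>t = Suc N..\<sigma> n. \<Sum>c<p. coeff (filt (B n a) c) l * (e c (int t - int l) * e b (int t - i)) / real (\<sigma> n))"
          by (rule sum.swap)
        also have "\<dots> = (\<Sum>l\<le>m_deg. \<Sum>c<p. \<Sum>t = Suc N..\<sigma> n. coeff (filt (B n a) c) l * (e c (int t - int l) * e b (int t - i)) / real (\<sigma> n))"
          by (intro sum.cong refl sum.swap)
        finally show ?thesis by (simp add: G_def sum_distrib_left sum_divide_distrib)
      qed
      have "(\<lambda>n. \<Sum>l\<le>m_deg. \<Sum>c<p. coeff (filt (B n a) c) l * ((if int l = i then \<Sigma> c b else 0) - G n l c)) \<longlonglongrightarrow> (\<Sum>l\<le>m_deg. \<Sum>c<p. 0)"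
      proof (rule tendsto_sum, rule tendsto_sum)
        fix l c assume lc: "l \<in> {..m_deg}" "c \<in> {..<p}"
        have "\<forall>\<^sub>F n in sequentially. norm (coeff (filt (B n a) c) l * ((if int l = i then \<Sigma> c b else 0) - G n l c))
            \<le> (1 + R / c1) * \<bar>(if int l = i then \<Sigma> c b else 0) - G n l c\<bar>"
          using bdd
        proof eventually_elim
          case (elim n)
          then have "\<bar>coeff (filt (B n a) c) l\<bar> \<le> 1 + R / c1" using lc by auto
          then show ?case unfolding real_norm_def abs_mult by (rule mult_right_mono) simp
        qed
        moreover have "(\<lambda>n. (1 + R / c1) * \<bar>(if int l = i then \<Sigma> c b else 0) - G n l c\<bar>) \<longlonglongrightarrow> 0"
          using lc by (intro tendsto_mult_right_zero tendsto_rabs_zero G) auto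
        ultimately show "(\<lambda>n. coeff (filt (B n a) c) l * ((if int l = i then \<Sigma> c b else 0) - G n l c)) \<longlonglongrightarrow> 0"
          by (rule Lim_null_comparison)
      qed
      moreover have "(\<Sum>l\<le>m_deg. \<Sum>c<p. coeff (filt (B n a) c) l * ((if int l = i then \<Sigma> c b else 0) - G n l c))
          = (\<Sum>c<p. coeff_seq (filt (B n a) c) i * \<Sigma> c b) - L n" for n
      proof -
        have "(\<Sum>l\<le>m_deg. \<Sum>c<p. coeff (filt (B n a) c) l * (if int l = i then \<Sigma> c b else 0))
          = (\<Sum>c<p. \<Sum>l\<le>m_deg. if int l = i then coeff (filt (B n a) c) l * \<Sigma> c b else 0)"
          by (subst sum.swap) (intro sum.cong refl, simp)
        also have "\<dots> = (\<Sum>c<p. coeff_seq (filt (B n a) c) i * \<Sigma> c b)"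
        proof (intro sum.cong refl)
          fix c assume c: "c \<in> {..<p}"
          have "(\<Sum>l\<le>m_deg. if int l = i then coeff (filt (B n a) c) l * \<Sigma> c b else 0)
            = (\<Sum>l\<le>m_deg. if l = nat i then (if i \<ge> 0 then coeff (filt (B n a) c) l * \<Sigma> c b else 0) else 0)"
            by (intro sum.cong refl) auto
          also have "\<dots> = coeff_seq (filt (B n a) c) i * \<Sigma> c b"
            using degree_filt[of "B n a" c] degB[OF a] c by (auto simp: coeff_seq_def coeff_eq_0)
          finally show "(\<Sum>l\<le>m_deg. if int l = i then coeff (filt (B n a) c) l * \<Sigma> c b else 0) = coeff_seq (filt (B n a) c) i * \<Sigma> c b" .
        qed
        finally show ?thesis by (simp add: right_diff_distrib sum_subtractf L2)
      qed
      ultimately have "(\<lambda>n. (\<Sum>c<p. coeff_seq (filt (B n a) c) i * \<Sigma> c b) - L n) \<longlonglongrightarrow> 0" by simp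
      from tendsto_add[OF this L1] show ?thesis by simp
    qed
    have "(\<lambda>n. \<Sum>b<p. (\<Sum>c'<p. coeff_seq (filt (B n a) c') i * \<Sigma> c' b) * H b c) \<longlonglongrightarrow> (\<Sum>b<p. lag_op \<chi> (\<gamma> a b) i * H b c)"
      by (intro tendsto_sum tendsto_mult tendsto_const key) auto
    moreover have "(\<Sum>b<p. (\<Sum>c'<p. coeff_seq (filt (B n a) c') i * \<Sigma> c' b) * H b c) = coeff_seq (filt (B n a) c) i" for n
    proof -
      have "(\<Sum>b<p. (\<Sum>c'<p. coeff_seq (filt (B n a) c') i * \<Sigma> c' b) * H b c)
        = (\<Sum>c'<p. coeff_seq (filt (B n a) c') i * (\<Sum>b<p. \<Sigma> c' b * H b c))"
        unfolding sum_distrib_right by (subst sum.swap) (simp add: sum_distrib_left mult.assoc)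
      also have "\<dots> = (\<Sum>c'<p. if c' = c then coeff_seq (filt (B n a) c') i else 0)"
        using c by (intro sum.cong refl) (simp add: H)
      finally show ?thesis using c by simp
    qed
    moreover have "(\<Sum>b<p. lag_op \<chi> (\<gamma> a b) i * H b c) = lag_op \<chi> (g a c) i"
      unfolding g_def lag_op_fun_sum
      using lag_op_fun_cmult[of \<chi> "H _ c" "\<gamma> a _"] by (simp add: mult.commute)
    ultimately show ?thesis by simp
  qed
  have \<gamma>0: "(\<lambda>n. \<gamma> a b (int n)) \<longlonglongrightarrow> 0" "(\<lambda>n. \<gamma> a b (- int n)) \<longlonglongrightarrow> 0" if "a < p" "b < p" for a b
    using noise_correlation_tendsto_0[where r = "\<lambda>n. r n a" and \<gamma> = "\<gamma> a", OF \<sigma> R[OF that(1)] \<gamma>[OF that(1)] that(2)] by auto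
  have g0: "(\<lambda>n. g a c (int n)) \<longlonglongrightarrow> 0" "(\<lambda>n. g a c (- int n)) \<longlonglongrightarrow> 0" if "a < p" for a c
    unfolding g_def
    by (rule tendsto_null_sum, rule tendsto_mult_left_zero, rule \<gamma>0, use that in auto)+
  \<comment> \<open>Cancelling \<open>\<chi>\<close> shows that the fitted coefficients converge to
    some \<open>\<beta>\<close>, and \<open>\<chi>\<close> annihilates
    \<open>\<beta> - \<delta>\<close>. This difference tends to zero at both ends, so it is zero;
    and \<open>\<beta>\<close> vanishes from lag \<open>k\<close> on because every \<open>B\<close>
    does.\<close>
  have gA: "(\<Sum>c<p. lag_op (Apoly c b) (g a c) i) = 0" if ab: "a < p" "b < p" and i: "i \<ge> int k" for a b i
  proof -
    define \<delta> where "\<delta> i = (\<Sum>c<p. lag_op (Apoly c b) (g a c) i)" for i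
    have lim: "(\<lambda>n. lag_op \<chi> (coeff_seq (B n a b)) i) \<longlonglongrightarrow> lag_op \<chi> \<delta> i" for i
    proof -
      have "(\<lambda>n. \<Sum>c<p. lag_op (Apoly c b) (coeff_seq (filt (B n a) c)) i)
        \<longlonglongrightarrow> (\<Sum>c<p. lag_op (Apoly c b) (lag_op \<chi> (g a c)) i)"
        by (intro tendsto_sum lag_op_tendsto Clim) (use ab in auto)
      moreover have "(\<Sum>c<p. lag_op (Apoly c b) (coeff_seq (filt (B n a) c)) i) = lag_op \<chi> (coeff_seq (B n a b)) i" for n
      proof -
        have "(\<Sum>c<p. lag_op (Apoly c b) (coeff_seq (filt (B n a) c)) i) = coeff_seq (\<Sum>c<p. filt (B n a) c * Apoly c b) i"
          by (simp add: lag_op_coeff_seq coeff_seq_def coeff_sum mult.commute)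
        then show ?thesis by (simp add: filt_Apoly[OF ab(2)] lag_op_coeff_seq)
      qed
      moreover have "(\<Sum>c<p. lag_op (Apoly c b) (lag_op \<chi> (g a c)) i) = lag_op \<chi> \<delta> i"
        by (simp add: \<delta>_def[abs_def] lag_op_fun_sum lag_op_commute[of \<chi>])
      ultimately show ?thesis by simp
    qed
    have "convergent (\<lambda>n. coeff_seq (B n a b) i)" for i
    proof (rule lag_op_tendsto_cancel[OF \<chi>_0])
      show "convergent (\<lambda>n. lag_op \<chi> (coeff_seq (B n a b)) i)" for i
        using lim[of i] unfolding convergent_def by blast
    qed (simp add: coeff_seq_def)
    then obtain \<beta> where \<beta>: "\<And>i. (\<lambda>n. coeff_seq (B n a b) i) \<longlonglongrightarrow> \<beta> i"
      unfolding convergent_def by metis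
    have \<beta>0: "\<beta> i = 0" if "i < 0 \<or> i \<ge> int k" for i
    proof -
      have "coeff_seq (B n a b) i = 0" for n using that Bk[OF ab] by (auto simp: coeff_seq_def)
      then show ?thesis using \<beta>[of i] by (simp add: LIMSEQ_const_iff)
    qed
    have "\<beta> i - \<delta> i = 0"
    proof (rule lag_op_eq_0_imp_0_real[OF \<chi>_nonzero, where x = "\<lambda>i. \<beta> i - \<delta> i"])
      have "(\<lambda>n. \<beta> (int n)) \<longlonglongrightarrow> 0"
        by (rule tendsto_eventually) (use \<beta>0 in \<open>auto intro!: eventually_sequentiallyI[of k]\<close>)
      moreover have "(\<lambda>n. \<delta> (int n)) \<longlonglongrightarrow> 0"
        unfolding \<delta>_def by (rule tendsto_null_sum, rule lag_op_tendsto_0_at_top, rule g0, rule ab)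
      ultimately show "(\<lambda>n. \<beta> (int n) - \<delta> (int n)) \<longlonglongrightarrow> 0" using tendsto_diff by fastforce
      have "(\<lambda>n. \<beta> (- int n)) \<longlonglongrightarrow> 0"
        by (rule tendsto_eventually) (use \<beta>0 in \<open>auto intro!: eventually_sequentiallyI[of 1]\<close>)
      moreover have "(\<lambda>n. \<delta> (- int n)) \<longlonglongrightarrow> 0"
        unfolding \<delta>_def by (rule tendsto_null_sum, rule lag_op_tendsto_0_at_bot, rule g0, rule ab)
      ultimately show "(\<lambda>n. \<beta> (- int n) - \<delta> (- int n)) \<longlonglongrightarrow> 0" using tendsto_diff by fastforce
      fix i
      have "lag_op \<chi> \<beta> i = lag_op \<chi> \<delta> i"
        by (rule LIMSEQ_unique[OF lag_op_tendsto[OF \<beta>] lim])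
      then show "lag_op \<chi> (\<lambda>i. \<beta> i - \<delta> i) i = 0" by (simp add: lag_op_fun_diff)
    qed
    then show ?thesis using \<beta>0[of i] i by (simp add: \<delta>_def)
  qed
  \<comment> \<open>The filter coefficients end at \<open>m_deg\<close>, hence so does
    \<open>\<chi>\<close> applied to \<open>g\<close>, and \<open>g\<close> decays exponentially.
    The causal argument is run with \<open>s\<close> in place of \<open>r\<close>: it has the same
    limits \<open>\<gamma>\<close> and is orthogonal to all \<open>k\<close> lags at every
    \<open>n\<close>.\<close>
  have g_pos: "g a c i = 0" if a: "a < p" and c: "c < p" and i: "i \<ge> 1" for a c i
  proof -
    have "\<exists>C \<rho>. 0 < \<rho> \<and> \<rho> < 1 \<and> (\<forall>n. \<bar>g a c (int n)\<bar> \<le> C * \<rho> ^ n)" if c: "c < p" for c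
    proof -
      have "lag_op \<chi> (g a c) t = 0" if t: "t \<ge> int m_deg + 1" for t
      proof -
        have "coeff_seq (filt (B n a) c) t = 0" for n
          using degree_filt[of "B n a" c] degB[OF a] c t by (auto simp: coeff_seq_def coeff_eq_0)
        then show ?thesis using Clim[OF a c, of t] by (simp add: LIMSEQ_const_iff)
      qed
      from lag_op_exp_decay_real[OF \<chi>_nonzero g0(1)[OF a] this]
      show ?thesis by blast
    qed
    then have "\<exists>C \<rho>. 0 < \<rho> \<and> \<rho> < 1 \<and> (\<forall>c<p. \<forall>n. \<bar>g a c (int n)\<bar> \<le> C * \<rho> ^ n)"
      by (rule common_exponential_bound)
    then obtain C \<rho> where \<rho>: "0 < \<rho>" "\<rho> < 1" "\<And>c n. c < p \<Longrightarrow> \<bar>g a c (int n)\<bar> \<le> C * \<rho> ^ n"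
      by auto
    show ?thesis
    proof (rule causal_part_vanishes[where r = "\<lambda>n. s n a" and \<Sigma> = \<Sigma> and g = "g a", OF \<sigma> s_R[OF a] _ c0 pd\<Sigma> \<rho> _ _ _ c i])
      show "(\<lambda>n. mean (\<sigma> n) (\<lambda>t. s n a t * e b (t - i))) \<longlonglongrightarrow> (\<Sum>c<p. g a c i * \<Sigma> c b)" if "b < p" for b i
        using s_\<gamma>[OF a that] g\<Sigma>[OF that] by simp
    qed (use gA[OF a] orth_x[OF a] orth_D[OF a] in auto)
  qed
  \<comment> \<open>At lag \<open>k\<close> the only summand of g * A that survives pairs
    \<open>g\<close> at index 0 with the last coefficient matrix.\<close>
  have gA0: "(\<Sum>c<p. g a c 0 * A k c b) = 0" if ab: "a < p" "b < p" for a b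
  proof -
    have "lag_op (Apoly c b) (g a c) (int k) = - (g a c 0 * A k c b)" if c: "c < p" for c
    proof -
      have "g a c (int k) = 0" using g_pos[OF ab(1) c, of "int k"] k_pos by simp
      moreover have "(\<Sum>l = 1..k. A l c b * g a c (int k - int l)) = (\<Sum>l = 1..k. if l = k then g a c 0 * A k c b else 0)"
        using g_pos[OF ab(1) c] by (intro sum.cong refl) auto
      ultimately show ?thesis using k_pos by (auto simp: lag_op_Apoly)
    qed
    then have "(\<Sum>c<p. lag_op (Apoly c b) (g a c) (int k)) = - (\<Sum>c<p. g a c 0 * A k c b)"
      by (simp add: sum_negf)
    then show ?thesis using gA[OF ab, of "int k"] by simp
  qed
  \<comment> \<open>A column of the inverse of \<open>\<Sigma>\<close> times \<open>A k\<close>.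
    Then \<open>\<Omega>\<close> times \<open>y\<close> is the column shown to vanish in
    \<open>gA0\<close>, so definiteness of \<open>\<Omega>\<close> gives \<open>y = 0\<close>, and
    \<open>A k\<close> is \<open>\<Sigma>\<close> times \<open>y\<close>.\<close>
  define y where "y c = (\<Sum>c'<p. H c c' * A k c' b)" for c
  have "(\<Sum>c<p. \<Omega> a c * y c) = 0" if a: "a < p" for a
  proof -
    have "(\<Sum>c<p. \<Omega> a c * y c) = (\<Sum>c<p. \<Sum>c'<p. \<gamma> a c 0 * H c c' * A k c' b)"
      using a by (intro sum.cong refl) (simp add: \<Omega>_\<gamma> y_def sum_distrib_left mult.assoc)
    also have "\<dots> = (\<Sum>c'<p. g a c' 0 * A k c' b)"
      by (subst sum.swap) (simp add: g_def sum_distrib_right)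
    finally show ?thesis using gA0[OF a ab(2)] by simp
  qed
  then have "(\<Sum>a<p. \<Sum>c<p. y a * y c * \<Omega> a c) = (\<Sum>a<p. y a * 0)"
    by (intro sum.cong refl) (simp add: mult.assoc mult.commute[of "y _" "\<Omega> _ _"] flip: sum_distrib_left)
  then have "c1 * (\<Sum>a<p. (y a)\<^sup>2) \<le> 0" using pd\<Omega>[of y] by simp
  then have "(\<Sum>a<p. (y a)\<^sup>2) \<le> 0" using c1 by (simp add: mult_le_0_iff)
  then have "(\<Sum>a<p. (y a)\<^sup>2) = 0" by (meson antisym sum_nonneg zero_le_power2)
  then have y0: "y c = 0" if "c < p" for c using that by (subst (asm) sum_nonneg_eq_0_iff) auto
  have "A k a b = (\<Sum>c'<p. if a = c' then A k c' b else 0)" using ab by simp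
  also have "\<dots> = (\<Sum>c'<p. (\<Sum>c<p. \<Sigma> a c * H c c') * A k c' b)"
    using ab by (intro sum.cong refl) (simp add: H)
  also have "\<dots> = (\<Sum>c<p. \<Sigma> a c * y c)"
    unfolding sum_distrib_right by (subst sum.swap) (simp add: y_def sum_distrib_left mult.assoc)
  also have "\<dots> = 0" using y0 by simp
  finally show ?thesis .
qed

text \<open>All sample covariances in question are bounded and there are countably many of them, so
  a diagonal subsequence supplies the limits required by the auxiliary version.\<close>

lemma lag_k_vanishes:
  fixes B :: "nat \<Rightarrow> nat \<Rightarrow> nat \<Rightarrow> real poly" and \<nu> :: "nat \<Rightarrow> nat \<Rightarrow> nat \<Rightarrow> real"
  assumes r_def: "\<And>n a. r n a = resid (B n a) (\<nu> n a)"
    and \<sigma>: "filterlim \<sigma> at_top sequentially"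
    and B0: "\<And>n a b. a < p \<Longrightarrow> b < p \<Longrightarrow> coeff (B n a b) 0 = (if a = b then 1 else 0)"
    and Bk: "\<And>n a b i. a < p \<Longrightarrow> b < p \<Longrightarrow> i \<ge> k \<Longrightarrow> coeff (B n a b) i = 0"
    and R: "\<And>a. a < p \<Longrightarrow> \<forall>\<^sub>F n in sequentially. mean (\<sigma> n) (\<lambda>t. (r n a t)\<^sup>2) \<le> R"
    and orth_x: "\<And>n a b i. a < p \<Longrightarrow> b < p \<Longrightarrow> 1 \<le> i \<Longrightarrow> i \<le> k \<Longrightarrow> mean (\<sigma> n) (\<lambda>t. s n a t * x b (t - int i)) = 0"
    and orth_D: "\<And>n a c. a < p \<Longrightarrow> c < d \<Longrightarrow> mean (\<sigma> n) (\<lambda>t. s n a t * Dx c t) = 0"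
    and close: "\<And>a. a < p \<Longrightarrow> (\<lambda>n. mean (\<sigma> n) (\<lambda>t. (r n a t - s n a t)\<^sup>2)) \<longlonglongrightarrow> 0"
    and ab: "a < p" "b < p"
  shows "A k a b = 0"
proof -
  \<comment> \<open>One countable index type for three families: the tag \<open>m\<close> selects
    residual against lagged noise, residual against residual, or noise against noise. The default 0
    keeps the sequences bounded outside the dimension.\<close>
  define w where "w = (\<lambda>(m::nat, a, b, i::int) n. if a < p \<and> b < p then
      (if m = 0 then mean (\<sigma> n) (\<lambda>t. r n a t * e b (t - i))
       else if m = 1 then mean (\<sigma> n) (\<lambda>t. r n a t * r n b t)
       else mean (\<sigma> n) (\<lambda>t. e a t * e b t)) else 0)"
  have bdd: "Bseq (\<lambda>n. mean (\<sigma> n) (\<lambda>t. u n t * v n t))"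
    if "\<forall>\<^sub>F n in sequentially. mean (\<sigma> n) (\<lambda>t. (u n t)\<^sup>2) \<le> R1" "\<forall>\<^sub>F n in sequentially. mean (\<sigma> n) (\<lambda>t. (v n t)\<^sup>2) \<le> R2"
    for u v R1 R2
  proof (rule BfunI[where K = "R1 + R2"])
    show "\<forall>\<^sub>F n in sequentially. norm (mean (\<sigma> n) (\<lambda>t. u n t * v n t)) \<le> R1 + R2"
      using that
    proof eventually_elim
      case (elim n)
      then show ?case using abs_mean_mult_le[of "\<sigma> n" "u n" "v n"] by simp
    qed
  qed
  have e_bd: "\<exists>R. \<forall>\<^sub>F n in sequentially. mean (\<sigma> n) (\<lambda>t. (e b (t - i))\<^sup>2) \<le> R" if b: "b < p" for b i
  proof -
    obtain R1 where "\<forall>\<^sub>F T in sequentially. mean T (\<lambda>t. (e b (t - i))\<^sup>2) \<le> R1"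
      using noise_shift_bounded[OF b, of i] ..
    from eventually_compose_filterlim[OF this \<sigma>] show ?thesis ..
  qed
  have Bw: "Bseq (w (m, a, b, i))" for m a b i
  proof (cases "a < p \<and> b < p")
    case False
    then have "w (m, a, b, i) = (\<lambda>n. 0)" unfolding w_def by (simp only: prod.case if_False)
    then show ?thesis by (simp only: Bfun_const)
  next
    case True
    then have a: "a < p" and b: "b < p" by auto
    obtain R1 where R1: "\<forall>\<^sub>F n in sequentially. mean (\<sigma> n) (\<lambda>t. (e b (t - i))\<^sup>2) \<le> R1"
      using e_bd[OF b, of i] ..
    obtain R2 where R2: "\<forall>\<^sub>F n in sequentially. mean (\<sigma> n) (\<lambda>t. (e b (t - 0))\<^sup>2) \<le> R2"
      using e_bd[OF b, of 0] ..
    obtain R3 where R3: "\<forall>\<^sub>F n in sequentially. mean (\<sigma> n) (\<lambda>t. (e a (t - 0))\<^sup>2) \<le> R3"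
      using e_bd[OF a, of 0] ..
    have "Bseq (\<lambda>n. mean (\<sigma> n) (\<lambda>t. r n a t * e b (t - i)))"
      by (rule bdd[where u = "\<lambda>n. r n a" and v = "\<lambda>n t. e b (t - i)", OF R[OF a] R1])
    moreover have "Bseq (\<lambda>n. mean (\<sigma> n) (\<lambda>t. r n a t * r n b t))"
      by (rule bdd[where u = "\<lambda>n. r n a" and v = "\<lambda>n. r n b", OF R[OF a] R[OF b]])
    moreover have "Bseq (\<lambda>n. mean (\<sigma> n) (\<lambda>t. e a (t - 0) * e b (t - 0)))"
      by (rule bdd[where u = "\<lambda>n t. e a (t - 0)" and v = "\<lambda>n t. e b (t - 0)", OF R3 R2])
    moreover have "w (m, a, b, i) = (if m = 0 then (\<lambda>n. mean (\<sigma> n) (\<lambda>t. r n a t * e b (t - i)))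
       else if m = 1 then (\<lambda>n. mean (\<sigma> n) (\<lambda>t. r n a t * r n b t))
       else (\<lambda>n. mean (\<sigma> n) (\<lambda>t. e a (t - 0) * e b (t - 0))))"
      using a b by (auto simp: w_def fun_eq_iff)
    ultimately show ?thesis by presburger
  qed
  have "Bseq (w j)" for j
    by (rule prod_cases4[of j]) (simp only: Bw)
  then have "\<exists>f. strict_mono f \<and> (\<forall>j. convergent (\<lambda>n. w j (f n)))"
    by (rule diagonal_convergent_subsequence)
  then obtain f where f: "strict_mono f" "\<And>j. convergent (\<lambda>n. w j (f n))"
    by auto
  define W where "W j = lim (\<lambda>n. w j (f n))" for j
  have W: "(\<lambda>n. w j (f n)) \<longlonglongrightarrow> W j" for j
    using f(2)[of j] unfolding W_def convergent_LIMSEQ_iff .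
  have ff: "filterlim f at_top sequentially" using f(1) by (rule filterlim_subseq)
  show ?thesis
  proof (rule lag_k_vanishes_aux[where \<sigma> = "\<lambda>n. \<sigma> (f n)" and B = "\<lambda>n. B (f n)" and \<nu> = "\<lambda>n. \<nu> (f n)"
        and s = "\<lambda>n. s (f n)" and R = R and \<gamma> = "\<lambda>a b i. W (0, a, b, i)" and \<Omega> = "\<lambda>a b. W (1, a, b, 0)"
        and \<Sigma> = "\<lambda>a b. W (2, a, b, 0)" and r = "\<lambda>n. r (f n)"])
    show "filterlim (\<lambda>n. \<sigma> (f n)) at_top sequentially" by (rule filterlim_compose[OF \<sigma> ff])
    show "\<forall>\<^sub>F n in sequentially. mean (\<sigma> (f n)) (\<lambda>t. (r (f n) a t)\<^sup>2) \<le> R" if "a < p" for a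
      by (rule eventually_compose_filterlim[OF R[OF that] ff])
    show "(\<lambda>n. mean (\<sigma> (f n)) (\<lambda>t. (r (f n) a t - s (f n) a t)\<^sup>2)) \<longlonglongrightarrow> 0" if "a < p" for a
      by (rule filterlim_compose[OF close[OF that] ff])
    show "(\<lambda>n. mean (\<sigma> (f n)) (\<lambda>t. r (f n) a t * e b (t - i))) \<longlonglongrightarrow> W (0, a, b, i)" if "a < p" "b < p" for a b i
      using W[of "(0, a, b, i)"] that by (simp add: w_def)
    show "(\<lambda>n. mean (\<sigma> (f n)) (\<lambda>t. r (f n) a t * r (f n) b t)) \<longlonglongrightarrow> W (1, a, b, 0)" if "a < p" "b < p" for a b
      using W[of "(1, a, b, 0)"] that by (simp add: w_def)
    show "(\<lambda>n. mean (\<sigma> (f n)) (\<lambda>t. e a t * e b t)) \<longlonglongrightarrow> W (2, a, b, 0)" if "a < p" "b < p" for a b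
      using W[of "(2, a, b, 0)"] that by (simp add: w_def)
    show "r (f n) a = resid (B (f n) a) (\<nu> (f n) a)" for n a by (rule r_def)
    show "coeff (B (f n) a b) 0 = (if a = b then 1 else 0)" if "a < p" "b < p" for n a b
      using that by (rule B0)
    show "coeff (B (f n) a b) i = 0" if "a < p" "b < p" "i \<ge> k" for n a b i
      using that by (rule Bk)
    show "mean (\<sigma> (f n)) (\<lambda>t. s (f n) a t * x b (t - int i)) = 0"
      if "a < p" "b < p" "1 \<le> i" "i \<le> k" for n a b i
      using that by (rule orth_x)
    show "mean (\<sigma> (f n)) (\<lambda>t. s (f n) a t * Dx c t) = 0" if "a < p" "c < d" for n a c
      using that by (rule orth_D)
  qed (fact ab)+
qed

end

section \<open>Determinants of Gram matrices\<close>

definition det_fun :: "nat \<Rightarrow> (nat \<Rightarrow> nat \<Rightarrow> real) \<Rightarrow> real" where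
  "det_fun p G = Determinant.det (mat p p (\<lambda>(a, b). G a b))"

lemma det_fun_cong: "(\<And>a b. a < p \<Longrightarrow> b < p \<Longrightarrow> G a b = H a b) \<Longrightarrow> det_fun p G = det_fun p H"
  unfolding det_fun_def by (intro arg_cong[where f = Determinant.det] eq_matI) auto

text \<open>Sylvester's identity. The bordered matrix \<open>M\<close> is multiplied by the unit
  triangular \<open>L\<close> from either side: one product leaves a scalar block, the other the
  \<open>n\<close> by \<open>n\<close> block, and both have determinant
  \<open>det M\<close>.\<close>

lemma det_one_plus_outer:
  fixes u v :: "real vec"
  assumes u: "u \<in> carrier_vec n" and v: "v \<in> carrier_vec n"
  shows "Determinant.det (1\<^sub>m n + mat n n (\<lambda>(i, j). u $ i * v $ j)) = 1 + v \<bullet> u"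
proof -
  define U where "U = mat n 1 (\<lambda>(i, j). u $ i)"
  define V where "V = mat 1 n (\<lambda>(i, j). v $ j)"
  have UV[simp]: "U \<in> carrier_mat n 1" "V \<in> carrier_mat 1 n" by (auto simp: U_def V_def)
  then have [simp]: "U \<in> carrier_mat n (Suc 0)" "V \<in> carrier_mat (Suc 0) n" by auto
  define W where "W = U * V"
  have W: "W \<in> carrier_mat n n" unfolding W_def by (rule mult_carrier_mat[OF UV])
  have W_eq: "mat n n (\<lambda>(i, j). u $ i * v $ j) = W"
    by (intro eq_matI) (auto simp: W_def U_def V_def scalar_prod_def)
  have VU: "V * U = mat 1 1 (\<lambda>_. v \<bullet> u)"
    using u v by (intro eq_matI) (auto simp: U_def V_def scalar_prod_def)
  define M where "M = four_block_mat (1\<^sub>m n) U (- V) (1\<^sub>m 1)"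
  define L where "L = four_block_mat (1\<^sub>m n) (0\<^sub>m n 1) V (1\<^sub>m 1)"
  have M: "M \<in> carrier_mat (n + 1) (n + 1)" and L: "L \<in> carrier_mat (n + 1) (n + 1)"
    unfolding M_def L_def by (auto intro!: four_block_carrier_mat)
  have detL: "Determinant.det L = 1"
    unfolding L_def by (subst det_four_block_mat_upper_right_zero[of _ n _ 1]) auto
  have "L * M = four_block_mat (1\<^sub>m n * 1\<^sub>m n + 0\<^sub>m n 1 * (- V)) (1\<^sub>m n * U + 0\<^sub>m n 1 * 1\<^sub>m 1)
      (V * 1\<^sub>m n + 1\<^sub>m 1 * (- V)) (V * U + 1\<^sub>m 1 * 1\<^sub>m 1)"
    unfolding L_def M_def by (rule mult_four_block_mat) auto
  also have "\<dots> = four_block_mat (1\<^sub>m n) U (0\<^sub>m 1 n) (V * U + 1\<^sub>m 1)"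
  proof -
    have "V * 1\<^sub>m n + 1\<^sub>m 1 * (- V) = 0\<^sub>m 1 n" by (simp add: V_def) (intro eq_matI, auto)
    moreover have "1\<^sub>m n * 1\<^sub>m n + 0\<^sub>m n 1 * (- V) = 1\<^sub>m n"
      by (intro eq_matI) (auto simp: V_def scalar_prod_def)
    moreover have "1\<^sub>m n * U + 0\<^sub>m n 1 * 1\<^sub>m 1 = U" by (simp add: U_def)
    ultimately show ?thesis by simp
  qed
  finally have "Determinant.det (L * M) = Determinant.det (1\<^sub>m n) * Determinant.det (V * U + 1\<^sub>m 1)"
    by (simp add: det_four_block_mat_lower_left_zero[of _ n _ "Suc 0"])
  moreover have "Determinant.det (V * U + 1\<^sub>m 1) = 1 + v \<bullet> u"
    unfolding VU by (subst det_single) auto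
  ultimately have detM: "Determinant.det M = 1 + v \<bullet> u"
    using det_mult[OF L M] detL by simp
  have "M * L = four_block_mat (1\<^sub>m n * 1\<^sub>m n + U * V) (1\<^sub>m n * 0\<^sub>m n 1 + U * 1\<^sub>m 1)
      ((- V) * 1\<^sub>m n + 1\<^sub>m 1 * V) ((- V) * 0\<^sub>m n 1 + 1\<^sub>m 1 * 1\<^sub>m 1)"
    unfolding L_def M_def by (rule mult_four_block_mat) auto
  also have "\<dots> = four_block_mat (1\<^sub>m n + W) U (0\<^sub>m 1 n) (1\<^sub>m 1)"
  proof -
    have "(- V) * 1\<^sub>m n + 1\<^sub>m 1 * V = 0\<^sub>m 1 n" by (simp add: V_def)
    moreover have "1\<^sub>m n * 0\<^sub>m n 1 + U * 1\<^sub>m 1 = U" by (simp add: U_def)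
    moreover have "(- V) * 0\<^sub>m n 1 + 1\<^sub>m 1 * 1\<^sub>m 1 = 1\<^sub>m 1" by (simp add: V_def)
    ultimately show ?thesis by (simp add: W_def)
  qed
  finally have "Determinant.det (M * L) = Determinant.det (1\<^sub>m n + W)"
    using W by (simp add: det_four_block_mat_lower_left_zero[of _ n _ "Suc 0"])
  then show ?thesis using det_mult[OF M L] detL detM by (simp add: W_eq)
qed

text \<open>Factor out \<open>G\<close>: what remains is the identity plus the outer product of
  \<open>H v\<close> with \<open>v\<close>.\<close>

lemma det_fun_rank_one_update:
  assumes inv: "\<And>a b. a < p \<Longrightarrow> b < p \<Longrightarrow> (\<Sum>c<p. G a c * H c b) = (if a = b then 1 else 0)"
  shows "det_fun p (\<lambda>a b. G a b + v a * v b) = det_fun p G * (1 + (\<Sum>a<p. \<Sum>b<p. v a * H a b * v b))"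
proof -
  define M where "M = mat p p (\<lambda>(a, b). G a b)"
  define u where "u = vec p (\<lambda>a. \<Sum>b<p. H a b * v b)"
  define w where "w = vec p v"
  define W where "W = mat p p (\<lambda>(i, j). u $ i * w $ j)"
  have M: "M \<in> carrier_mat p p" by (simp add: M_def)
  have uw: "u \<in> carrier_vec p" "w \<in> carrier_vec p" by (simp_all add: u_def w_def)
  have "mat p p (\<lambda>(a, b). G a b + v a * v b) = M * (1\<^sub>m p + W)"
  proof (rule eq_matI)
    fix a b assume "a < dim_row (M * (1\<^sub>m p + W))" "b < dim_col (M * (1\<^sub>m p + W))"
    then have ab: "a < p" "b < p" by (auto simp: M_def W_def)
    have "(M * (1\<^sub>m p + W)) $$ (a, b) = (\<Sum>c<p. G a c * ((if c = b then 1 else 0) + u $ c * v b))"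
      using ab by (auto simp: M_def W_def w_def scalar_prod_def atLeast0LessThan intro!: sum.cong)
    also have "\<dots> = (\<Sum>c<p. if c = b then G a c else 0) + (\<Sum>c<p. G a c * u $ c) * v b"
      by (simp add: distrib_left sum.distrib sum_distrib_right mult.assoc if_distrib[of "\<lambda>z. _ * z"] cong: if_cong)
    also have "(\<Sum>c<p. G a c * u $ c) = (\<Sum>c<p. \<Sum>b<p. G a c * H c b * v b)"
      by (intro sum.cong refl) (simp add: u_def sum_distrib_left mult.assoc)
    also have "\<dots> = (\<Sum>b<p. (\<Sum>c<p. G a c * H c b) * v b)"
      by (subst sum.swap) (simp add: sum_distrib_right)
    also have "\<dots> = (\<Sum>b<p. if a = b then v b else 0)"
      using ab by (intro sum.cong refl) (simp add: inv)
    finally show "mat p p (\<lambda>(a, b). G a b + v a * v b) $$ (a, b) = (M * (1\<^sub>m p + W)) $$ (a, b)"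
      using ab by simp
  qed (auto simp: M_def W_def)
  then have "det_fun p (\<lambda>a b. G a b + v a * v b) = Determinant.det M * Determinant.det (1\<^sub>m p + W)"
    unfolding det_fun_def by (subst det_mult[symmetric, OF M]) (auto simp: W_def)
  also have "Determinant.det (1\<^sub>m p + W) = 1 + w \<bullet> u"
    unfolding W_def by (rule det_one_plus_outer[OF uw])
  also have "w \<bullet> u = (\<Sum>a<p. \<Sum>b<p. v a * H a b * v b)"
    by (auto simp: scalar_prod_def w_def u_def atLeast0LessThan sum_distrib_left mult.assoc intro!: sum.cong)
  finally show ?thesis by (simp add: det_fun_def M_def)
qed

text \<open>Semidefiniteness tested on vectors supported on two coordinates gives one inequality per
  pair, and summing over pairs gives the claim. The trace thus serves as an upper bound for the
  largest eigenvalue.\<close>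

lemma quadratic_form_le_trace:
  fixes G :: "nat \<Rightarrow> nat \<Rightarrow> real"
  assumes sym: "\<And>a b. G a b = G b a" and psd: "\<And>u. 0 \<le> (\<Sum>a<p. \<Sum>b<p. u a * u b * G a b)"
  shows "(\<Sum>a<p. \<Sum>b<p. v a * v b * G a b) \<le> (\<Sum>a<p. G a a) * (\<Sum>a<p. (v a)\<^sup>2)"
proof -
  have pair: "2 * (v a * v b * G a b) \<le> G a a * (v b)\<^sup>2 + G b b * (v a)\<^sup>2" if ab: "a < p" "b < p" for a b
  proof -
    \<comment> \<open>Entries \<open>v b\<close> at \<open>a\<close> and \<open>- v a\<close> at
      \<open>b\<close> produce the cross term \<open>- 2 * (v a * v b * G a b)\<close>. For
      \<open>a = b\<close> the two contributions cancel and \<open>u\<close> is zero.\<close>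
    define u where "u c = (if c = a then v b else 0) - (if c = b then v a else 0)" for c
    have S: "(\<Sum>c<p. u c * h c) = v b * h a - v a * h b" for h :: "nat \<Rightarrow> real"
    proof -
      have "(\<Sum>c<p. u c * h c) = (\<Sum>c<p. (if c = a then v b * h c else 0) - (if c = b then v a * h c else 0))"
        by (intro sum.cong refl) (auto simp: u_def algebra_simps)
      then show ?thesis using ab by (simp add: sum_subtractf)
    qed
    have "(\<Sum>c<p. \<Sum>c'<p. u c * u c' * G c c') = (\<Sum>c<p. u c * (\<Sum>c'<p. u c' * G c c'))"
      by (simp add: sum_distrib_left mult.assoc)
    also have "\<dots> = v b * (v b * G a a - v a * G a b) - v a * (v b * G b a - v a * G b b)"
      by (simp add: S)
    finally show ?thesis using psd[of u] sym[of b a] by (simp add: power2_eq_square algebra_simps)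
  qed
  have "2 * (\<Sum>a<p. \<Sum>b<p. v a * v b * G a b) \<le> (\<Sum>a<p. \<Sum>b<p. G a a * (v b)\<^sup>2 + G b b * (v a)\<^sup>2)"
    unfolding sum_distrib_left by (intro sum_mono pair) auto
  also have "\<dots> = (\<Sum>a<p. G a a) * (\<Sum>a<p. (v a)\<^sup>2) + (\<Sum>a<p. \<Sum>b<p. G b b * (v a)\<^sup>2)"
    by (simp add: sum.distrib sum_product)
  also have "(\<Sum>a<p. \<Sum>b<p. G b b * (v a)\<^sup>2) = (\<Sum>a<p. G a a) * (\<Sum>a<p. (v a)\<^sup>2)"
    by (subst sum.swap) (simp add: sum_product)
  finally show ?thesis by simp
qed

text \<open>The explicit constant survives positive semidefinite updates, so it can be carried
  through an induction over observations.\<close>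

definition pd_form :: "nat \<Rightarrow> real \<Rightarrow> (nat \<Rightarrow> nat \<Rightarrow> real) \<Rightarrow> bool" where
  "pd_form p c G \<longleftrightarrow> (\<forall>a b. G a b = G b a) \<and>
     (\<forall>u. c * (\<Sum>a<p. (u a)\<^sup>2) \<le> (\<Sum>a<p. \<Sum>b<p. u a * u b * G a b))"

lemma pd_form_rank_one_update:
  assumes "pd_form p c G"
  shows "pd_form p c (\<lambda>a b. G a b + v a * v b)"
proof -
  have "(\<Sum>a<p. \<Sum>b<p. u a * u b * (G a b + v a * v b)) = (\<Sum>a<p. \<Sum>b<p. u a * u b * G a b) + (\<Sum>a<p. u a * v a)\<^sup>2" for u
    by (simp add: distrib_left sum.distrib power2_eq_square sum_product mult_ac)
  then show ?thesis using assms unfolding pd_form_def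
    by (auto simp: mult.commute intro: order.trans)
qed

text \<open>The determinant grows by the factor 1 + v' G^{-1} v. Since \<open>G\<close> is at most
  its trace times the identity, this is at least 1 + |v|^2 / trace, which is the growth factor of
  the trace.\<close>

lemma det_fun_rank_one_update_ge:
  assumes pd: "pd_form p c G" and c: "c > 0" and p: "p \<ge> 1" and det: "det_fun p G > 0"
  shows "det_fun p G * ((\<Sum>a<p. G a a) + (\<Sum>a<p. (v a)\<^sup>2)) \<le> det_fun p (\<lambda>a b. G a b + v a * v b) * (\<Sum>a<p. G a a)"
    and "det_fun p (\<lambda>a b. G a b + v a * v b) > 0"
    and "(\<Sum>a<p. G a a) > 0"
proof -
  have pd': "\<And>u. c * (\<Sum>a<p. (u a)\<^sup>2) \<le> (\<Sum>a<p. \<Sum>b<p. u a * u b * G a b)" and sym: "\<And>a b. G a b = G b a"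
    using pd by (auto simp: pd_form_def)
  have psd: "0 \<le> (\<Sum>a<p. \<Sum>b<p. u a * u b * G a b)" for u
    by (rule order.trans[OF _ pd'[of u]]) (use c in \<open>auto intro!: mult_nonneg_nonneg sum_nonneg\<close>)
  define tr where "tr = (\<Sum>a<p. G a a)"
  have diag: "G a a \<ge> c" if "a < p" for a
  proof -
    define u where "u = (\<lambda>b. if b = a then 1 else 0 :: real)"
    have "(\<Sum>a<p. \<Sum>b<p. u a * u b * G a b) = (\<Sum>a'<p. if a' = a then G a a else 0)"
    proof (rule sum.cong[OF refl])
      fix a' assume "a' \<in> {..<p}"
      have "(\<Sum>b<p. u a' * u b * G a' b) = (\<Sum>b<p. if b = a then u a' * G a' b else 0)"
        by (intro sum.cong refl) (simp add: u_def)
      then show "(\<Sum>b<p. u a' * u b * G a' b) = (if a' = a then G a a else 0)"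
        using that by (simp add: u_def)
    qed
    moreover have "(\<Sum>b<p. (u b)\<^sup>2) = (\<Sum>b<p. if b = a then 1 else 0)"
      by (intro sum.cong refl) (simp add: u_def)
    ultimately show ?thesis using pd'[of u] that by simp
  qed
  have "0 < (\<Sum>a<p. c)" using c p by simp
  also have "\<dots> \<le> tr" unfolding tr_def by (intro sum_mono diag) auto
  finally have tr: "tr > 0" .
  then show "(\<Sum>a<p. G a a) > 0" by (simp add: tr_def)
  obtain H where H: "\<And>a b. a < p \<Longrightarrow> b < p \<Longrightarrow> (\<Sum>c<p. G a c * H c b) = (if a = b then 1 else 0)"
    by (rule pd_matrix_inverse[OF c pd']) blast
  define y where "y a = (\<Sum>b<p. H a b * v b)" for a
  define q where "q = (\<Sum>a<p. \<Sum>b<p. v a * H a b * v b)"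
  define V where "V = (\<Sum>a<p. (v a)\<^sup>2)"
  have Gy: "(\<Sum>b<p. G a b * y b) = v a" if "a < p" for a
  proof -
    have "(\<Sum>b<p. G a b * y b) = (\<Sum>b'<p. (\<Sum>b<p. G a b * H b b') * v b')"
      unfolding y_def sum_distrib_left sum_distrib_right by (subst sum.swap) (simp add: mult.assoc)
    also have "\<dots> = (\<Sum>b'<p. if a = b' then v b' else 0)"
      using that by (intro sum.cong refl) (simp add: H)
    finally show ?thesis using that by simp
  qed
  have q_eq: "q = (\<Sum>a<p. v a * y a)"
    by (simp add: q_def y_def sum_distrib_left mult.assoc)
  \<comment> \<open>Minimises the upper bound \<open>q - 2 * s * V + s\<^sup>2 * (tr * V)\<close>
    for the form at \<open>y - s v\<close>, and so yields the best inequality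
    \<open>q \<ge> V / tr\<close>.\<close>
  define s where "s = 1 / tr"
  have "0 \<le> (\<Sum>a<p. \<Sum>b<p. (y a - s * v a) * (y b - s * v b) * G a b)" by (rule psd)
  also have "\<dots> = (\<Sum>a<p. y a * (\<Sum>b<p. G a b * y b)) - s * (\<Sum>a<p. v a * (\<Sum>b<p. G a b * y b))
      - s * (\<Sum>a<p. \<Sum>b<p. y a * v b * G a b) + s\<^sup>2 * (\<Sum>a<p. \<Sum>b<p. v a * v b * G a b)"
    by (simp add: sum_distrib_left sum.distrib sum_subtractf algebra_simps power2_eq_square)
  also have "(\<Sum>a<p. \<Sum>b<p. y a * v b * G a b) = (\<Sum>b<p. v b * (\<Sum>a<p. G b a * y a))"
    by (subst sum.swap) (simp add: sum_distrib_left sym mult_ac)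
  also have "(\<Sum>a<p. y a * (\<Sum>b<p. G a b * y b)) = q"
    unfolding q_eq by (intro sum.cong refl) (simp add: Gy)
  also have "(\<Sum>a<p. v a * (\<Sum>b<p. G a b * y b)) = V"
    unfolding V_def by (intro sum.cong refl) (simp add: Gy power2_eq_square)
  also have "s\<^sup>2 * (\<Sum>a<p. \<Sum>b<p. v a * v b * G a b) \<le> s\<^sup>2 * (tr * V)"
    unfolding tr_def V_def by (intro mult_left_mono quadratic_form_le_trace sym psd) auto
  also have "s\<^sup>2 * (tr * V) = s * V" using tr by (simp add: s_def power2_eq_square)
  finally have "s * V \<le> q" by (simp add: mult.commute)
  then have q: "V \<le> q * tr" using tr by (simp add: s_def field_simps)
  have eq: "det_fun p (\<lambda>a b. G a b + v a * v b) = det_fun p G * (1 + q)"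
    unfolding q_def by (rule det_fun_rank_one_update[OF H])
  have "det_fun p G * (tr + V) \<le> det_fun p G * (tr + q * tr)"
    using det q by (intro mult_left_mono) auto
  then show "det_fun p G * ((\<Sum>a<p. G a a) + (\<Sum>a<p. (v a)\<^sup>2)) \<le> det_fun p (\<lambda>a b. G a b + v a * v b) * (\<Sum>a<p. G a a)"
    unfolding eq by (simp add: tr_def V_def algebra_simps)
  have "V \<ge> 0" unfolding V_def by (intro sum_nonneg) auto
  then have "q \<ge> 0" using q tr by (meson order.trans zero_le_mult_iff not_less)
  then show "det_fun p (\<lambda>a b. G a b + v a * v b) > 0" unfolding eq using det by simp
qed

text \<open>Observations are added one at a time, and both the determinant ratio and the trace ratio
  telescope. In the application a small gain in determinant forces a small gain in trace, that is,
  in mean square.\<close>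

lemma det_fun_gram_update_ge:
  fixes w :: "nat \<Rightarrow> nat \<Rightarrow> real"
  assumes pd: "pd_form p c G" and c: "c > 0" and p: "p \<ge> 1" and det: "det_fun p G > 0"
  shows "pd_form p c (\<lambda>a b. G a b + (\<Sum>t = 1..T. w t a * w t b)) \<and>
    det_fun p (\<lambda>a b. G a b + (\<Sum>t = 1..T. w t a * w t b)) > 0 \<and>
    det_fun p G * (\<Sum>a<p. G a a + (\<Sum>t = 1..T. w t a * w t a))
      \<le> det_fun p (\<lambda>a b. G a b + (\<Sum>t = 1..T. w t a * w t b)) * (\<Sum>a<p. G a a)"
proof (induction T)
  case 0
  then show ?case using assms by simp
next
  case (Suc T)
  define G' where "G' a b = G a b + (\<Sum>t = 1..T. w t a * w t b)" for a b
  have G': "pd_form p c G'" "det_fun p G' > 0"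
    and le: "det_fun p G * (\<Sum>a<p. G' a a) \<le> det_fun p G' * (\<Sum>a<p. G a a)"
    using Suc unfolding G'_def[abs_def] by auto
  have eq: "(\<lambda>a b. G a b + (\<Sum>t = 1..Suc T. w t a * w t b)) = (\<lambda>a b. G' a b + w (Suc T) a * w (Suc T) b)"
    by (simp add: G'_def fun_eq_iff)
  note u = det_fun_rank_one_update_ge(1)[OF G'(1) c p G'(2), of "w (Suc T)"]
    det_fun_rank_one_update_ge(2)[OF G'(1) c p G'(2), of "w (Suc T)"]
    det_fun_rank_one_update_ge(3)[OF G'(1) c p G'(2)]
  have tr: "(\<Sum>a<p. G a a) > 0" by (rule det_fun_rank_one_update_ge(3)[OF pd c p det])
  have tr_eq: "(\<Sum>a<p. G a a + (\<Sum>t = 1..Suc T. w t a * w t a)) = (\<Sum>a<p. G' a a) + (\<Sum>a<p. (w (Suc T) a)\<^sup>2)" (is "_ = ?t2")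
    by (simp add: G'_def sum.distrib power2_eq_square)
  define D where "D = det_fun p (\<lambda>a b. G' a b + w (Suc T) a * w (Suc T) b)"
  \<comment> \<open>Multiplication by the positive trace of \<open>G'\<close> lets the two
    inequalities be chained; it is cancelled at the end.\<close>
  have "(det_fun p G * ?t2) * (\<Sum>a<p. G' a a) = (det_fun p G * (\<Sum>a<p. G' a a)) * ?t2"
    by (simp only: mult_ac)
  also have "\<dots> \<le> (det_fun p G' * (\<Sum>a<p. G a a)) * ?t2"
    using le u(3) by (intro mult_right_mono add_nonneg_nonneg sum_nonneg[of _ "\<lambda>a. (w (Suc T) a)\<^sup>2"]) auto
  also have "\<dots> = (det_fun p G' * ?t2) * (\<Sum>a<p. G a a)" by (simp only: mult_ac)
  also have "\<dots> \<le> (D * (\<Sum>a<p. G' a a)) * (\<Sum>a<p. G a a)"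
    using u(1) tr unfolding D_def by (intro mult_right_mono) auto
  also have "\<dots> = (D * (\<Sum>a<p. G a a)) * (\<Sum>a<p. G' a a)" by (simp only: mult_ac)
  finally have "det_fun p G * ?t2 \<le> D * (\<Sum>a<p. G a a)"
    using u(3) by (rule mult_right_le_imp_le)
  then show ?case
    unfolding eq tr_eq D_def using u(2) pd_form_rank_one_update[OF G'(1)] by blast
qed

lemma tendsto_det_fun:
  assumes "\<And>a b. a < p \<Longrightarrow> b < p \<Longrightarrow> ((\<lambda>n. G n a b) \<longlongrightarrow> H a b) F"
  shows "((\<lambda>n. det_fun p (G n)) \<longlongrightarrow> det_fun p H) F"
proof -
  have eq: "det_fun p G = (\<Sum>\<pi>\<in>{\<pi>. \<pi> permutes {0..<p}}. signof \<pi> * (\<Prod>i = 0..<p. G i (\<pi> i)))" for G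
    unfolding det_fun_def Determinant.det_def
    by (auto intro!: sum.cong prod.cong simp: permutes_in_image)
  show ?thesis unfolding eq
    by (intro tendsto_sum tendsto_mult tendsto_const tendsto_prod assms) (auto simp: permutes_in_image)
qed

lemma det_fun_scaled_identity: "det_fun p (\<lambda>a b. if a = b then c else 0) = c ^ p"
proof -
  have "mat p p (\<lambda>(a, b). if a = b then c else 0) = c \<cdot>\<^sub>m 1\<^sub>m p"
    by (intro eq_matI) auto
  then show ?thesis by (simp add: det_fun_def)
qed

text \<open>Updating a small multiple of the identity gives a positive determinant, so the limit is
  nonnegative, and invertibility excludes zero.\<close>

lemma det_fun_gram_pos:
  fixes w :: "nat \<Rightarrow> nat \<Rightarrow> real"
  assumes pd: "pd_form p c (\<lambda>a b. \<Sum>t = 1..T. w t a * w t b)" and c: "c > 0" and p: "p \<ge> 1"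
  shows "det_fun p (\<lambda>a b. \<Sum>t = 1..T. w t a * w t b) > 0"
proof -
  define G where "G a b = (\<Sum>t = 1..T. w t a * w t b)" for a b
  have pos: "det_fun p (\<lambda>a b. (if a = b then \<epsilon> else 0) + G a b) > 0" if e: "\<epsilon> > 0" for \<epsilon>
  proof -
    have "(\<Sum>a<p. \<Sum>b<p. u a * u b * (if a = b then \<epsilon> else 0)) = \<epsilon> * (\<Sum>a<p. (u a)\<^sup>2)" for u
    proof -
      have "(\<Sum>a<p. \<Sum>b<p. u a * u b * (if a = b then \<epsilon> else 0)) = (\<Sum>a<p. \<Sum>b<p. if a = b then \<epsilon> * (u a)\<^sup>2 else 0)"
        by (intro sum.cong refl) (simp add: power2_eq_square)
      then show ?thesis by (simp add: sum_distrib_left)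
    qed
    then have "pd_form p \<epsilon> (\<lambda>a b. if a = b then \<epsilon> else 0)" by (auto simp: pd_form_def)
    from det_fun_gram_update_ge[OF this e p, of w T] show ?thesis
      using e by (simp add: G_def det_fun_scaled_identity)
  qed
  have "(\<lambda>n. det_fun p (\<lambda>a b. (if a = b then inverse (real (Suc n)) else 0) + G a b)) \<longlonglongrightarrow> det_fun p (\<lambda>a b. (if a = b then 0 else 0) + G a b)"
  proof (rule tendsto_det_fun)
    fix a b
    show "(\<lambda>n. (if a = b then inverse (real (Suc n)) else 0) + G a b) \<longlonglongrightarrow> (if a = b then 0 else 0) + G a b"
      using tendsto_add[OF LIMSEQ_inverse_real_of_nat tendsto_const[of "G a b"]] by (cases "a = b") auto
  qed
  then have "0 \<le> det_fun p (\<lambda>a b. (if a = b then 0 else 0) + G a b)"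
    by (rule tendsto_lowerbound) (auto intro!: always_eventually less_imp_le pos)
  then have ge: "det_fun p G \<ge> 0" by simp
  have pd': "\<And>u. c * (\<Sum>a<p. (u a)\<^sup>2) \<le> (\<Sum>a<p. \<Sum>b<p. u a * u b * G a b)"
    using pd by (auto simp: pd_form_def G_def)
  obtain H where H: "\<And>a b. a < p \<Longrightarrow> b < p \<Longrightarrow> (\<Sum>c<p. G a c * H c b) = (if a = b then 1 else 0)"
    by (rule pd_matrix_inverse[OF c pd']) blast
  have "mat p p (\<lambda>(a, b). G a b) * mat p p (\<lambda>(a, b). H a b) = 1\<^sub>m p"
    using H by (intro eq_matI) (auto simp: scalar_prod_def atLeast0LessThan)
  then have "det_fun p G * det_fun p H = 1"
    unfolding det_fun_def by (subst det_mult[symmetric]) auto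
  then have "det_fun p G \<noteq> 0" by auto
  then show ?thesis using ge by (simp add: G_def[abs_def] order.strict_iff_order)
qed

text \<open>Gram-Schmidt in coefficient form, valid for collinear \<open>s\<close> as well: the new
  regressor is first freed from the earlier ones, then its coefficient is chosen. \<open>y\<close>
  is arbitrary in the induction because the hypothesis is used for the response and for the new
  regressor.\<close>

lemma projection_exists:
  fixes s :: "nat \<Rightarrow> 'a \<Rightarrow> real"
  assumes "finite I"
  shows "\<exists>w. \<forall>j<m. (\<Sum>t\<in>I. (y t - (\<Sum>i<m. w i * s i t)) * s j t) = 0"
proof (induction m arbitrary: y)
  case 0
  then show ?case by simp
next
  case (Suc m)
  obtain w where w: "\<And>j. j < m \<Longrightarrow> (\<Sum>t\<in>I. (y t - (\<Sum>i<m. w i * s i t)) * s j t) = 0"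
    using Suc[of y] by blast
  obtain v where v: "\<And>j. j < m \<Longrightarrow> (\<Sum>t\<in>I. (s m t - (\<Sum>i<m. v i * s i t)) * s j t) = 0"
    using Suc[of "s m"] by blast
  define r where "r t = y t - (\<Sum>i<m. w i * s i t)" for t
  define q where "q t = s m t - (\<Sum>i<m. v i * s i t)" for t
  \<comment> \<open>If the new regressor is in the span of the earlier ones, then \<open>q\<close>
    vanishes on \<open>I\<close> and division by zero gives \<open>c = 0\<close>, an admissible
    choice.\<close>
  define c where "c = (\<Sum>t\<in>I. r t * q t) / (\<Sum>t\<in>I. (q t)\<^sup>2)"
  define w' where "w' i = (if i < m then w i - c * v i else c)" for i
  have rs: "(\<Sum>t\<in>I. r t * s j t) = 0" "(\<Sum>t\<in>I. q t * s j t) = 0" if "j < m" for j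
    using w v that by (auto simp: r_def q_def)
  have res: "y t - (\<Sum>i<Suc m. w' i * s i t) = r t - c * q t" for t
    by (simp add: w'_def r_def q_def algebra_simps sum_subtractf sum_distrib_left)
  have "(\<Sum>t\<in>I. (r t - c * q t) * s j t) = 0" if j: "j < Suc m" for j
  proof (cases "j < m")
    case True
    have "(\<Sum>t\<in>I. (r t - c * q t) * s j t) = (\<Sum>t\<in>I. r t * s j t) - c * (\<Sum>t\<in>I. q t * s j t)"
      by (simp add: algebra_simps sum_subtractf sum_distrib_left)
    then show ?thesis using rs[OF True] by simp
  next
    case False
    then have [simp]: "j = m" using j by simp
    have orth: "(\<Sum>t\<in>I. (r t - c * q t) * (\<Sum>i<m. v i * s i t)) = 0"
    proof -
      have "(\<Sum>t\<in>I. (r t - c * q t) * (\<Sum>i<m. v i * s i t)) = (\<Sum>i<m. \<Sum>t\<in>I. v i * (r t * s i t) - c * v i * (q t * s i t))"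
        by (subst sum.swap) (simp add: sum_distrib_left algebra_simps)
      also have "\<dots> = (\<Sum>i<m. v i * (\<Sum>t\<in>I. r t * s i t) - c * v i * (\<Sum>t\<in>I. q t * s i t))"
        by (simp add: sum_subtractf sum_distrib_left)
      finally show ?thesis using rs by simp
    qed
    have "(\<Sum>t\<in>I. (r t - c * q t) * q t) = 0"
    proof (cases "(\<Sum>t\<in>I. (q t)\<^sup>2) = 0")
      case True
      then have "\<forall>t\<in>I. q t = 0" using assms by (simp add: sum_nonneg_eq_0_iff)
      then show ?thesis by simp
    next
      case False
      have "(\<Sum>t\<in>I. (r t - c * q t) * q t) = (\<Sum>t\<in>I. r t * q t) - c * (\<Sum>t\<in>I. (q t)\<^sup>2)"
        by (simp add: algebra_simps sum_subtractf sum_distrib_left power2_eq_square)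
      then show ?thesis using False by (simp add: c_def)
    qed
    moreover have "(\<Sum>t\<in>I. (r t - c * q t) * s j t) = (\<Sum>t\<in>I. (r t - c * q t) * q t) + (\<Sum>t\<in>I. (r t - c * q t) * (\<Sum>i<m. v i * s i t))"
      by (simp add: q_def sum.distrib[symmetric] flip: distrib_left)
    ultimately show ?thesis using orth by simp
  qed
  then show ?case by (intro exI[of _ w']) (simp only: res, blast)
qed

section \<open>A strong law for martingale differences\<close>

text \<open>By monotone convergence the series of the \<open>f n\<close> has finite expectation,
  hence converges almost surely.\<close>

lemma (in prob_space) AE_tendsto_0_of_summable_integral:
  fixes f :: "nat \<Rightarrow> 'a \<Rightarrow> real"
  assumes f: "\<And>n. integrable M (f n)" "\<And>n \<omega>. \<omega> \<in> space M \<Longrightarrow> 0 \<le> f n \<omega>"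
    and b: "\<And>n. (\<integral>\<omega>. f n \<omega> \<partial>M) \<le> b n" "summable b"
  shows "AE \<omega> in M. (\<lambda>n. f n \<omega>) \<longlonglongrightarrow> 0"
proof -
  have [measurable]: "f n \<in> borel_measurable M" for n using f(1) by auto
  have int0: "0 \<le> (\<integral>\<omega>. f n \<omega> \<partial>M)" for n by (rule integral_nonneg_AE) (use f(2) in auto)
  have b0: "0 \<le> b n" for n by (rule order.trans[OF int0 b(1)])
  have "(\<integral>\<^sup>+\<omega>. (\<Sum>n. ennreal (f n \<omega>)) \<partial>M) = (\<Sum>n. \<integral>\<^sup>+\<omega>. ennreal (f n \<omega>) \<partial>M)"
    by (rule nn_integral_suminf) simp
  also have "\<dots> \<le> (\<Sum>n. ennreal (b n))"
  proof (rule suminf_le)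
    fix n
    have "(\<integral>\<^sup>+\<omega>. ennreal (f n \<omega>) \<partial>M) = ennreal (\<integral>\<omega>. f n \<omega> \<partial>M)"
      by (rule nn_integral_eq_integral[OF f(1)]) (use f(2) in auto)
    then show "(\<integral>\<^sup>+\<omega>. ennreal (f n \<omega>) \<partial>M) \<le> ennreal (b n)" using b(1)[of n] by (simp add: ennreal_leI)
  qed auto
  also have "\<dots> = ennreal (suminf b)" using b0 b(2) by (rule suminf_ennreal2)
  also have "\<dots> < \<infinity>" by simp
  finally have "(\<integral>\<^sup>+\<omega>. (\<Sum>n. ennreal (f n \<omega>)) \<partial>M) \<noteq> \<infinity>" by simp
  then have "AE \<omega> in M. (\<Sum>n. ennreal (f n \<omega>)) \<noteq> \<infinity>"
    by (intro nn_integral_PInf_AE) auto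
  then show ?thesis
    using AE_space
  proof eventually_elim
    case (elim \<omega>)
    have "summable (\<lambda>n. f n \<omega>)"
      using f(2)[OF elim(2)] elim(1) by (intro summable_suminf_not_top) auto
    then show ?case by (rule summable_LIMSEQ_zero)
  qed
qed

lemma (in prob_space) integrable_mult_of_squares:
  fixes u v :: "'a \<Rightarrow> real"
  assumes [measurable]: "u \<in> borel_measurable M" "v \<in> borel_measurable M"
    and "integrable M (\<lambda>\<omega>. (u \<omega>)\<^sup>2)" "integrable M (\<lambda>\<omega>. (v \<omega>)\<^sup>2)"
  shows "integrable M (\<lambda>\<omega>. u \<omega> * v \<omega>)"
proof (rule Bochner_Integration.integrable_bound)
  show "integrable M (\<lambda>\<omega>. (u \<omega>)\<^sup>2 + (v \<omega>)\<^sup>2)" using assms(3,4) by (rule Bochner_Integration.integrable_add)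
  show "AE \<omega> in M. norm (u \<omega> * v \<omega>) \<le> norm ((u \<omega>)\<^sup>2 + (v \<omega>)\<^sup>2)"
  proof (rule AE_I2)
    fix \<omega>
    have "2 * \<bar>u \<omega>\<bar> * \<bar>v \<omega>\<bar> \<le> \<bar>u \<omega>\<bar>\<^sup>2 + \<bar>v \<omega>\<bar>\<^sup>2" by (rule sum_squares_bound)
    moreover have "0 \<le> \<bar>u \<omega>\<bar> * \<bar>v \<omega>\<bar>" by simp
    ultimately have "\<bar>u \<omega>\<bar> * \<bar>v \<omega>\<bar> \<le> (u \<omega>)\<^sup>2 + (v \<omega>)\<^sup>2" unfolding power2_abs by linarith
    then show "norm (u \<omega> * v \<omega>) \<le> norm ((u \<omega>)\<^sup>2 + (v \<omega>)\<^sup>2)" by (simp add: abs_mult)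
  qed
qed simp

lemma (in prob_space) integral_square_sum_orthogonal:
  fixes \<xi> :: "nat \<Rightarrow> 'a \<Rightarrow> real"
  assumes [measurable]: "\<And>t. \<xi> t \<in> borel_measurable M"
    and sq: "\<And>t. t \<in> I \<Longrightarrow> integrable M (\<lambda>\<omega>. (\<xi> t \<omega>)\<^sup>2)"
    and orth: "\<And>s t. s \<in> I \<Longrightarrow> t \<in> I \<Longrightarrow> s < t \<Longrightarrow> (\<integral>\<omega>. \<xi> s \<omega> * \<xi> t \<omega> \<partial>M) = 0"
    and I: "finite I"
  shows "integrable M (\<lambda>\<omega>. (\<Sum>t\<in>I. \<xi> t \<omega>)\<^sup>2)"
    and "(\<integral>\<omega>. (\<Sum>t\<in>I. \<xi> t \<omega>)\<^sup>2 \<partial>M) = (\<Sum>t\<in>I. \<integral>\<omega>. (\<xi> t \<omega>)\<^sup>2 \<partial>M)"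
proof -
  have int: "integrable M (\<lambda>\<omega>. \<xi> s \<omega> * \<xi> t \<omega>)" if "s \<in> I" "t \<in> I" for s t
    by (rule integrable_mult_of_squares) (use sq that in auto)
  have eq: "(\<lambda>\<omega>. (\<Sum>t\<in>I. \<xi> t \<omega>)\<^sup>2) = (\<lambda>\<omega>. \<Sum>s\<in>I. \<Sum>t\<in>I. \<xi> s \<omega> * \<xi> t \<omega>)"
    by (simp add: power2_eq_square sum_product)
  show "integrable M (\<lambda>\<omega>. (\<Sum>t\<in>I. \<xi> t \<omega>)\<^sup>2)"
    unfolding eq by (intro Bochner_Integration.integrable_sum int)
  have "(\<integral>\<omega>. (\<Sum>t\<in>I. \<xi> t \<omega>)\<^sup>2 \<partial>M) = (\<Sum>s\<in>I. \<integral>\<omega>. (\<Sum>t\<in>I. \<xi> s \<omega> * \<xi> t \<omega>) \<partial>M)"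
    unfolding eq by (rule Bochner_Integration.integral_sum) (intro Bochner_Integration.integrable_sum int)
  also have "\<dots> = (\<Sum>s\<in>I. \<Sum>t\<in>I. \<integral>\<omega>. \<xi> s \<omega> * \<xi> t \<omega> \<partial>M)"
    by (intro sum.cong refl Bochner_Integration.integral_sum int)
  also have "\<dots> = (\<Sum>s\<in>I. \<Sum>t\<in>I. if s = t then \<integral>\<omega>. (\<xi> s \<omega>)\<^sup>2 \<partial>M else 0)"
  proof (intro sum.cong refl)
    fix s t assume st: "s \<in> I" "t \<in> I"
    show "(\<integral>\<omega>. \<xi> s \<omega> * \<xi> t \<omega> \<partial>M) = (if s = t then \<integral>\<omega>. (\<xi> s \<omega>)\<^sup>2 \<partial>M else 0)"
    proof (cases s t rule: linorder_cases)
      case less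
      then show ?thesis using orth[OF st] by simp
    next
      case equal
      then show ?thesis by (simp add: power2_eq_square)
    next
      case greater
      then show ?thesis using orth[OF st(2,1)] by (simp add: mult.commute)
    qed
  qed
  finally show "(\<integral>\<omega>. (\<Sum>t\<in>I. \<xi> t \<omega>)\<^sup>2 \<partial>M) = (\<Sum>t\<in>I. \<integral>\<omega>. (\<xi> t \<omega>)\<^sup>2 \<partial>M)"
    using I by simp
qed

lemma filterlim_floor_sqrt: "filterlim floor_sqrt at_top sequentially"
  unfolding filterlim_at_top
proof
  fix Z
  show "\<forall>\<^sub>F x in sequentially. Z \<le> floor_sqrt x"
    using eventually_ge_at_top[of "Z\<^sup>2"] by eventually_elim (rule le_floor_sqrtI)
qed

text \<open>Averages up to \<open>k\<^sup>2\<close> have second moments of at most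
  \<open>B / k\<^sup>2\<close>, which are summable. The gap to the next square has only
  \<open>2 * k + 1\<close> terms, so Cauchy-Schwarz bounds the fluctuation inside it by a second
  quantity with summable expectations.\<close>

lemma (in prob_space) orthogonal_strong_law:
  fixes \<xi> :: "nat \<Rightarrow> 'a \<Rightarrow> real"
  assumes meas[measurable]: "\<And>t. \<xi> t \<in> borel_measurable M"
    and sq: "\<And>t. t \<ge> 1 \<Longrightarrow> integrable M (\<lambda>\<omega>. (\<xi> t \<omega>)\<^sup>2)"
    and B: "\<And>t. t \<ge> 1 \<Longrightarrow> (\<integral>\<omega>. (\<xi> t \<omega>)\<^sup>2 \<partial>M) \<le> B"
    and orth: "\<And>s t. 1 \<le> s \<Longrightarrow> s < t \<Longrightarrow> (\<integral>\<omega>. \<xi> s \<omega> * \<xi> t \<omega> \<partial>M) = 0"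
  shows "AE \<omega> in M. (\<lambda>T. (\<Sum>t = 1..T. \<xi> t \<omega>) / real T) \<longlonglongrightarrow> 0"
proof -
  have B0: "0 \<le> B"
    by (rule order.trans[OF _ B[of 1]]) (auto intro!: integral_nonneg_AE)
  define Z where "Z k \<omega> = ((\<Sum>t = 1..k\<^sup>2. \<xi> t \<omega>) / real (k\<^sup>2))\<^sup>2" for k \<omega>
  \<comment> \<open>Square of the bound for the relative fluctuation before the next square. Its
    expectation is at most \<open>(2 * k + 1)\<^sup>2 * B / k ^ 4\<close>; the constant 9 comes from
    \<open>2 * k + 1 \<le> 3 * k\<close>, and \<open>k = 0\<close> is covered by division by
    zero.\<close>
  define D where "D k \<omega> = (2 * real k + 1) * (\<Sum>t = Suc (k\<^sup>2)..(Suc k)\<^sup>2. (\<xi> t \<omega>)\<^sup>2) / (real (k\<^sup>2))\<^sup>2" for k \<omega>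
  have sum2: "summable (\<lambda>k. 9 * B * (1 / (real k)\<^sup>2))"
    by (intro summable_mult) (use inverse_power_summable[of 2, where 'a = real] in \<open>simp add: inverse_eq_divide\<close>)
  have Z: "AE \<omega> in M. (\<lambda>k. Z k \<omega>) \<longlonglongrightarrow> 0"
  proof (rule AE_tendsto_0_of_summable_integral[where b = "\<lambda>k. 9 * B * (1 / (real k)\<^sup>2)"])
    fix k
    have i: "integrable M (\<lambda>\<omega>. (\<Sum>t = 1..k\<^sup>2. \<xi> t \<omega>)\<^sup>2)"
      and e: "(\<integral>\<omega>. (\<Sum>t = 1..k\<^sup>2. \<xi> t \<omega>)\<^sup>2 \<partial>M) = (\<Sum>t = 1..k\<^sup>2. \<integral>\<omega>. (\<xi> t \<omega>)\<^sup>2 \<partial>M)"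
      by (rule integral_square_sum_orthogonal; use sq orth in auto)+
    show "integrable M (Z k)" unfolding Z_def power_divide by (rule integrable_divide_zero) (use i in auto)
    have "(\<integral>\<omega>. Z k \<omega> \<partial>M) = (\<Sum>t = 1..k\<^sup>2. \<integral>\<omega>. (\<xi> t \<omega>)\<^sup>2 \<partial>M) / (real (k\<^sup>2))\<^sup>2"
      unfolding Z_def power_divide integral_divide_zero e ..
    also have "\<dots> \<le> (\<Sum>t = 1..k\<^sup>2. B) / (real (k\<^sup>2))\<^sup>2"
      by (intro divide_right_mono sum_mono B) auto
    also have "\<dots> = B * (1 / (real k)\<^sup>2)" by (simp add: power2_eq_square)
    also have "\<dots> \<le> 9 * B * (1 / (real k)\<^sup>2)" using B0 by (intro mult_right_mono) auto
    finally show "(\<integral>\<omega>. Z k \<omega> \<partial>M) \<le> 9 * B * (1 / (real k)\<^sup>2)" .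
  qed (use sum2 in \<open>auto simp: Z_def\<close>)
  have D: "AE \<omega> in M. (\<lambda>k. D k \<omega>) \<longlonglongrightarrow> 0"
  proof (rule AE_tendsto_0_of_summable_integral[where b = "\<lambda>k. 9 * B * (1 / (real k)\<^sup>2)"])
    fix k
    have i: "integrable M (\<lambda>\<omega>. \<Sum>t = Suc (k\<^sup>2)..(Suc k)\<^sup>2. (\<xi> t \<omega>)\<^sup>2)"
      by (intro Bochner_Integration.integrable_sum sq) auto
    show "integrable M (D k)" unfolding D_def
      by (intro integrable_divide_zero impI integrable_mult_right i)
    have "(\<integral>\<omega>. D k \<omega> \<partial>M) = (2 * real k + 1) * (\<Sum>t = Suc (k\<^sup>2)..(Suc k)\<^sup>2. \<integral>\<omega>. (\<xi> t \<omega>)\<^sup>2 \<partial>M) / (real (k\<^sup>2))\<^sup>2"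
      unfolding D_def
      by (simp only: integral_divide_zero integral_mult_right_zero)
        (subst Bochner_Integration.integral_sum; use sq in auto)
    also have "\<dots> \<le> (2 * real k + 1) * (\<Sum>t = Suc (k\<^sup>2)..(Suc k)\<^sup>2. B) / (real (k\<^sup>2))\<^sup>2"
      by (intro divide_right_mono mult_left_mono sum_mono B) auto
    also have "(\<Sum>t = Suc (k\<^sup>2)..(Suc k)\<^sup>2. B) = (2 * real k + 1) * B"
      by (simp add: power2_eq_square algebra_simps)
    also have "(2 * real k + 1) * ((2 * real k + 1) * B) / (real (k\<^sup>2))\<^sup>2 \<le> 9 * B * (1 / (real k)\<^sup>2)"
    proof (cases "k = 0")
      case False
      then have k: "real k \<ge> 1" by simp
      have "(2 * real k + 1)\<^sup>2 \<le> (3 * real k)\<^sup>2" using k by (intro power_mono) auto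
      then have "(2 * real k + 1)\<^sup>2 * B \<le> 9 * (real k)\<^sup>2 * B" using B0 by (intro mult_right_mono) (auto simp: power_mult_distrib)
      then have "(2 * real k + 1)\<^sup>2 * B / (real (k\<^sup>2))\<^sup>2 \<le> 9 * (real k)\<^sup>2 * B / (real (k\<^sup>2))\<^sup>2"
        by (intro divide_right_mono) auto
      also have "\<dots> = 9 * B * (1 / (real k)\<^sup>2)" using k by (simp add: power2_eq_square)
      finally show ?thesis by (simp add: power2_eq_square mult.assoc)
    qed simp
    finally show "(\<integral>\<omega>. D k \<omega> \<partial>M) \<le> 9 * B * (1 / (real k)\<^sup>2)" .
  qed (use sum2 in \<open>auto simp: D_def intro!: divide_nonneg_nonneg mult_nonneg_nonneg sum_nonneg\<close>)
  from Z D show ?thesis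
  proof eventually_elim
    case (elim \<omega>)
    have "(\<lambda>k. sqrt (Z k \<omega>) + sqrt (D k \<omega>)) \<longlonglongrightarrow> sqrt 0 + sqrt 0"
      by (intro tendsto_add tendsto_real_sqrt elim)
    then have lim: "(\<lambda>T. sqrt (Z (floor_sqrt T) \<omega>) + sqrt (D (floor_sqrt T) \<omega>)) \<longlonglongrightarrow> 0"
      using filterlim_compose[OF _ filterlim_floor_sqrt] by force
    have "\<forall>\<^sub>F T in sequentially. norm ((\<Sum>t = 1..T. \<xi> t \<omega>) / real T) \<le> sqrt (Z (floor_sqrt T) \<omega>) + sqrt (D (floor_sqrt T) \<omega>)"
      using eventually_ge_at_top[of 1]
    proof eventually_elim
      case (elim T)
      define k where "k = floor_sqrt T"
      have k: "k \<ge> 1" "k\<^sup>2 \<le> T" "T < (Suc k)\<^sup>2"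
        using elim floor_sqrt_greater_zero_iff[of T] Suc_floor_sqrt_power2_gt[of T] by (auto simp: k_def Suc_le_eq)
      have k0: "real (k\<^sup>2) > 0" using k by simp
      have sqZ: "sqrt (Z k \<omega>) = \<bar>\<Sum>t = 1..k\<^sup>2. \<xi> t \<omega>\<bar> / real (k\<^sup>2)"
        unfolding Z_def real_sqrt_abs by simp
      have "\<bar>\<Sum>t = Suc (k\<^sup>2)..T. \<xi> t \<omega>\<bar> \<le> (\<Sum>t = Suc (k\<^sup>2)..(Suc k)\<^sup>2. 1 * \<bar>\<xi> t \<omega>\<bar>)"
      proof -
        have "\<bar>\<Sum>t = Suc (k\<^sup>2)..T. \<xi> t \<omega>\<bar> \<le> (\<Sum>t = Suc (k\<^sup>2)..T. \<bar>\<xi> t \<omega>\<bar>)" by (rule sum_abs)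
        also have "\<dots> \<le> (\<Sum>t = Suc (k\<^sup>2)..(Suc k)\<^sup>2. \<bar>\<xi> t \<omega>\<bar>)" using k by (intro sum_mono2) auto
        finally show ?thesis by simp
      qed
      also have "\<dots> \<le> sqrt ((2 * real k + 1) * (\<Sum>t = Suc (k\<^sup>2)..(Suc k)\<^sup>2. (\<xi> t \<omega>)\<^sup>2))"
      proof (rule real_le_rsqrt)
        have "(\<Sum>t = Suc (k\<^sup>2)..(Suc k)\<^sup>2. 1 * \<bar>\<xi> t \<omega>\<bar>)\<^sup>2
          \<le> (\<Sum>t = Suc (k\<^sup>2)..(Suc k)\<^sup>2. 1\<^sup>2) * (\<Sum>t = Suc (k\<^sup>2)..(Suc k)\<^sup>2. \<bar>\<xi> t \<omega>\<bar>\<^sup>2)"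
          by (rule Cauchy_Schwarz_ineq_sum)
        also have "(\<Sum>t = Suc (k\<^sup>2)..(Suc k)\<^sup>2. 1\<^sup>2 :: real) = 2 * real k + 1"
          by (simp add: power2_eq_square algebra_simps)
        finally show "(\<Sum>t = Suc (k\<^sup>2)..(Suc k)\<^sup>2. 1 * \<bar>\<xi> t \<omega>\<bar>)\<^sup>2
          \<le> (2 * real k + 1) * (\<Sum>t = Suc (k\<^sup>2)..(Suc k)\<^sup>2. (\<xi> t \<omega>)\<^sup>2)" by simp
      qed
      also have "\<dots> = sqrt (D k \<omega>) * real (k\<^sup>2)"
      proof -
        have q: "sqrt ((real (k\<^sup>2))\<^sup>2) = real (k\<^sup>2)" by (simp only: real_sqrt_abs abs_of_nat)
        have "real (k\<^sup>2) \<noteq> 0" using k0 by linarith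
        then show ?thesis unfolding D_def real_sqrt_divide q by (metis nonzero_divide_eq_eq)
      qed
      finally have tail: "\<bar>\<Sum>t = Suc (k\<^sup>2)..T. \<xi> t \<omega>\<bar> \<le> sqrt (D k \<omega>) * real (k\<^sup>2)" .
      have "{1..T} = {1..k\<^sup>2} \<union> {Suc (k\<^sup>2)..T}" using k by auto
      then have "(\<Sum>t = 1..T. \<xi> t \<omega>) = (\<Sum>t = 1..k\<^sup>2. \<xi> t \<omega>) + (\<Sum>t = Suc (k\<^sup>2)..T. \<xi> t \<omega>)"
        by (subst sum.union_disjoint[symmetric]) auto
      then have "\<bar>\<Sum>t = 1..T. \<xi> t \<omega>\<bar> \<le> \<bar>\<Sum>t = 1..k\<^sup>2. \<xi> t \<omega>\<bar> + sqrt (D k \<omega>) * real (k\<^sup>2)"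
        using tail by linarith
      also have "\<dots> = (sqrt (Z k \<omega>) + sqrt (D k \<omega>)) * real (k\<^sup>2)"
        unfolding sqZ using k0 by (simp add: distrib_right)
      also have "\<dots> \<le> (sqrt (Z k \<omega>) + sqrt (D k \<omega>)) * real T"
        using k by (intro mult_left_mono) (auto simp: Z_def D_def intro!: add_nonneg_nonneg divide_nonneg_nonneg mult_nonneg_nonneg sum_nonneg)
      finally show ?case using elim by (simp add: k_def field_simps)
    qed
    then show ?case using lim by (rule Lim_null_comparison)
  qed
qed

section \<open>Conditional moments, localisation and truncation of the noise\<close>

lemma (in finite_measure_subalgebra) integrable_real_cond_exp_bounded:
  assumes [measurable]: "Y \<in> borel_measurable M" and K: "\<And>\<omega>. \<bar>Y \<omega>\<bar> \<le> K"
  defines "E \<equiv> real_cond_exp M F Y"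
  shows "integrable M Y" "integrable M (\<lambda>\<omega>. (Y \<omega> - E \<omega>)\<^sup>2)"
    "(\<integral>\<omega>. (Y \<omega> - E \<omega>)\<^sup>2 \<partial>M) \<le> (\<integral>\<omega>. (Y \<omega>)\<^sup>2 \<partial>M)"
proof -
  show Y: "integrable M Y" by (rule integrable_const_bound[where B = K]) (use K in auto)
  have E: "integrable M E" unfolding E_def using Y by (rule real_cond_exp_int)
  have [measurable]: "E \<in> borel_measurable F" "E \<in> borel_measurable M" by (auto simp: E_def)
  have EY: "integrable M (\<lambda>\<omega>. E \<omega> * Y \<omega>)"
  proof (rule Bochner_Integration.integrable_bound)
    show "integrable M (\<lambda>\<omega>. K * E \<omega>)" using E by simp
    show "AE \<omega> in M. norm (E \<omega> * Y \<omega>) \<le> norm (K * E \<omega>)"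
    proof (rule AE_I2)
      fix \<omega>
      have "\<bar>Y \<omega>\<bar> \<le> \<bar>K\<bar>" using K[of \<omega>] by linarith
      then have "\<bar>E \<omega>\<bar> * \<bar>Y \<omega>\<bar> \<le> \<bar>E \<omega>\<bar> * \<bar>K\<bar>" by (intro mult_left_mono) auto
      then show "norm (E \<omega> * Y \<omega>) \<le> norm (K * E \<omega>)" by (simp add: abs_mult mult.commute)
    qed
  qed simp
  have EE: "integrable M (\<lambda>\<omega>. E \<omega> * E \<omega>)" and eq: "(\<integral>\<omega>. E \<omega> * E \<omega> \<partial>M) = (\<integral>\<omega>. E \<omega> * Y \<omega> \<partial>M)"
    using real_cond_exp_intg[OF EY] by (auto simp: E_def)
  have YY: "integrable M (\<lambda>\<omega>. (Y \<omega>)\<^sup>2)"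
  proof (rule integrable_const_bound[where B = "K\<^sup>2"])
    show "AE \<omega> in M. norm ((Y \<omega>)\<^sup>2) \<le> K\<^sup>2"
    proof (rule AE_I2)
      fix \<omega>
      have "\<bar>Y \<omega>\<bar>\<^sup>2 \<le> K\<^sup>2" by (intro power_mono K) auto
      then show "norm ((Y \<omega>)\<^sup>2) \<le> K\<^sup>2" by simp
    qed
  qed simp
  have expand: "(\<lambda>\<omega>. (Y \<omega> - E \<omega>)\<^sup>2) = (\<lambda>\<omega>. (Y \<omega>)\<^sup>2 - 2 * (E \<omega> * Y \<omega>) + E \<omega> * E \<omega>)"
    by (rule ext) (simp add: power2_eq_square algebra_simps)
  show "integrable M (\<lambda>\<omega>. (Y \<omega> - E \<omega>)\<^sup>2)"
    unfolding expand by (intro Bochner_Integration.integrable_add Bochner_Integration.integrable_diff integrable_mult_right YY EY EE)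
  have "(\<integral>\<omega>. (Y \<omega> - E \<omega>)\<^sup>2 \<partial>M) = (\<integral>\<omega>. (Y \<omega>)\<^sup>2 \<partial>M) - (\<integral>\<omega>. E \<omega> * E \<omega> \<partial>M)"
    unfolding expand using YY EY EE eq by simp
  moreover have "0 \<le> (\<integral>\<omega>. E \<omega> * E \<omega> \<partial>M)" by (rule integral_nonneg_AE) auto
  ultimately show "(\<integral>\<omega>. (Y \<omega> - E \<omega>)\<^sup>2 \<partial>M) \<le> (\<integral>\<omega>. (Y \<omega>)\<^sup>2 \<partial>M)" by linarith
qed

lemma (in finite_measure_subalgebra) integral_mult_centered_eq_0:
  assumes [measurable]: "U \<in> borel_measurable F" "Y \<in> borel_measurable M"
    and U: "integrable M U" and K: "\<And>\<omega>. \<bar>Y \<omega>\<bar> \<le> K"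
  shows "(\<integral>\<omega>. U \<omega> * (Y \<omega> - real_cond_exp M F Y \<omega>) \<partial>M) = 0"
proof -
  have [measurable]: "U \<in> borel_measurable M" by (rule measurable_from_subalg[OF subalg]) simp
  have UY: "integrable M (\<lambda>\<omega>. U \<omega> * Y \<omega>)"
  proof (rule Bochner_Integration.integrable_bound)
    show "integrable M (\<lambda>\<omega>. K * U \<omega>)" using U by simp
    show "AE \<omega> in M. norm (U \<omega> * Y \<omega>) \<le> norm (K * U \<omega>)"
    proof (rule AE_I2)
      fix \<omega>
      have "\<bar>Y \<omega>\<bar> \<le> \<bar>K\<bar>" using K[of \<omega>] by linarith
      then have "\<bar>U \<omega>\<bar> * \<bar>Y \<omega>\<bar> \<le> \<bar>U \<omega>\<bar> * \<bar>K\<bar>" by (intro mult_left_mono) auto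
      then show "norm (U \<omega> * Y \<omega>) \<le> norm (K * U \<omega>)" by (simp add: abs_mult mult.commute)
    qed
  qed simp
  then show ?thesis using real_cond_exp_intg[OF UY] by (simp add: right_diff_distrib)
qed

lemma integrable_of_nn_integral_le:
  fixes f :: "'a \<Rightarrow> real"
  assumes f: "f \<in> borel_measurable M" "\<And>\<omega>. 0 \<le> f \<omega>" and le: "(\<integral>\<^sup>+\<omega>. ennreal (f \<omega>) \<partial>M) \<le> ennreal B" and B: "0 \<le> B"
  shows "integrable M f" "(\<integral>\<omega>. f \<omega> \<partial>M) \<le> B"
proof -
  show int: "integrable M f"
  proof (rule integrableI_bounded[OF f(1)])
    have "(\<integral>\<^sup>+\<omega>. ennreal (norm (f \<omega>)) \<partial>M) \<le> ennreal B" using le f(2) by simp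
    also have "\<dots> < \<infinity>" by simp
    finally show "(\<integral>\<^sup>+\<omega>. ennreal (norm (f \<omega>)) \<partial>M) < \<infinity>" .
  qed
  have "(\<integral>\<^sup>+\<omega>. ennreal (f \<omega>) \<partial>M) = ennreal (\<integral>\<omega>. f \<omega> \<partial>M)"
    by (rule nn_integral_eq_integral[OF int]) (simp add: f(2))
  then show "(\<integral>\<omega>. f \<omega> \<partial>M) \<le> B" using le B by simp
qed

text \<open>Componentwise form of the innovations. \<open>s\<close> is half of the moment order,
  because moments are taken of the squared norm. The noise need not be square integrable: only its
  conditional moments will be bounded, and only by a random constant.\<close>

locale martingale_noise = prob_space M for M :: "'w measure" +
  fixes F :: "nat \<Rightarrow> 'w measure" and p :: nat and \<epsilon> :: "nat \<Rightarrow> nat \<Rightarrow> 'w \<Rightarrow> real" and s :: real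
  assumes subalg: "\<And>t. subalgebra M (F t)"
    and F_mono: "\<And>i j. i \<le> j \<Longrightarrow> sets (F i) \<subseteq> sets (F j)"
    and \<epsilon>_meas: "\<And>t a. t \<ge> 1 \<Longrightarrow> a < p \<Longrightarrow> \<epsilon> t a \<in> borel_measurable (F t)"
    and \<epsilon>_mds: "\<And>t a. t \<ge> 1 \<Longrightarrow> a < p \<Longrightarrow> AE \<omega> in M. real_cond_exp M (F (t - 1)) (\<epsilon> t a) \<omega> = 0"
    and s_gt_1: "s > 1"
begin

definition sqn :: "nat \<Rightarrow> 'w \<Rightarrow> real" where "sqn t \<omega> = (\<Sum>a<p. (\<epsilon> t a \<omega>)\<^sup>2)"

definition cmom :: "nat \<Rightarrow> 'w \<Rightarrow> ennreal" where
  "cmom t = nn_cond_exp M (F (t - 1)) (\<lambda>\<omega>. ennreal (sqn t \<omega> powr s))"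

text \<open>Localisation: the indicator is predictable, \<open>loc C\<close> therefore is a martingale difference with
  bounded conditional moments, and on the event \<open>sup cmom \<le> C\<close> it coincides with the noise.\<close>

definition ind :: "real \<Rightarrow> nat \<Rightarrow> 'w \<Rightarrow> real" where
  "ind C t \<omega> = (if cmom t \<omega> \<le> ennreal C then 1 else 0)"

definition loc :: "real \<Rightarrow> nat \<Rightarrow> nat \<Rightarrow> 'w \<Rightarrow> real" where
  "loc C t a \<omega> = (if 1 \<le> t \<and> a < p then ind C t \<omega> * \<epsilon> t a \<omega> else 0)"

definition lsqn :: "real \<Rightarrow> nat \<Rightarrow> 'w \<Rightarrow> real" where "lsqn C t \<omega> = (\<Sum>a<p. (loc C t a \<omega>)\<^sup>2)"

lemma subalg_finite: "finite_measure_subalgebra M (F t)"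
  using subalg by unfold_locales

lemma meas_up:
  assumes "f \<in> borel_measurable (F i)" "i \<le> j"
  shows "f \<in> borel_measurable (F j)"
  by (rule measurable_from_subalg[OF _ assms(1)])
    (use F_mono[OF assms(2)] subalg[of i] subalg[of j] in \<open>auto simp: subalgebra_def\<close>)

lemma meas_M: "f \<in> borel_measurable (F i) \<Longrightarrow> f \<in> borel_measurable M"
  by (rule measurable_from_subalg[OF subalg])

lemma cmom_meas: "cmom t \<in> borel_measurable (F (t - 1))"
  unfolding cmom_def by simp

lemma ind_meas: "ind C t \<in> borel_measurable (F (t - 1))"
proof -
  note [measurable] = cmom_meas
  show ?thesis unfolding ind_def[abs_def] by measurable
qed

lemma ind_meas_M [measurable]: "ind C t \<in> borel_measurable M"
  by (rule meas_M[OF ind_meas])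

lemma \<epsilon>_meas_M: "t \<ge> 1 \<Longrightarrow> a < p \<Longrightarrow> \<epsilon> t a \<in> borel_measurable M"
  by (rule meas_M[OF \<epsilon>_meas])

lemma loc_meas: "loc C t a \<in> borel_measurable (F t)"
proof (cases "1 \<le> t \<and> a < p")
  case True
  note [measurable] = \<epsilon>_meas[of t a] meas_up[OF ind_meas[of C t], of t]
  have "loc C t a = (\<lambda>\<omega>. ind C t \<omega> * \<epsilon> t a \<omega>)" using True by (simp add: loc_def fun_eq_iff)
  then show ?thesis using True by simp
next
  case False
  then have "loc C t a = (\<lambda>\<omega>. 0)" by (auto simp: loc_def fun_eq_iff)
  then show ?thesis by simp
qed

lemma loc_meas_M [measurable]: "loc C t a \<in> borel_measurable M"
  by (rule meas_M[OF loc_meas])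

lemma lsqn_meas: "lsqn C t \<in> borel_measurable (F t)"
proof -
  note [measurable] = loc_meas
  show ?thesis unfolding lsqn_def[abs_def] by measurable
qed

lemma lsqn_meas_M [measurable]: "lsqn C t \<in> borel_measurable M"
  by (rule meas_M[OF lsqn_meas])

lemma lsqn_nonneg: "0 \<le> lsqn C t \<omega>"
  unfolding lsqn_def by (intro sum_nonneg) auto

lemma lsqn_eq: "t \<ge> 1 \<Longrightarrow> lsqn C t \<omega> = ind C t \<omega> * sqn t \<omega>"
  by (simp add: lsqn_def sqn_def loc_def ind_def)

lemma sqn_meas_M: "t \<ge> 1 \<Longrightarrow> sqn t \<in> borel_measurable M"
  unfolding sqn_def[abs_def] using \<epsilon>_meas_M by (intro borel_measurable_sum borel_measurable_power) auto

lemma loc_sq_le: "(loc C t a \<omega>)\<^sup>2 \<le> lsqn C t \<omega>"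
proof (cases "a < p")
  case True
  then show ?thesis unfolding lsqn_def by (intro member_le_sum[where f = "\<lambda>a. (loc C t a \<omega>)\<^sup>2"]) auto
qed (use lsqn_nonneg in \<open>simp add: loc_def\<close>)

lemma abs_loc_mult_le: "\<bar>loc C t a \<omega> * loc C t b \<omega>\<bar> \<le> lsqn C t \<omega>"
proof -
  have "2 * \<bar>loc C t a \<omega>\<bar> * \<bar>loc C t b \<omega>\<bar> \<le> \<bar>loc C t a \<omega>\<bar>\<^sup>2 + \<bar>loc C t b \<omega>\<bar>\<^sup>2" by (rule sum_squares_bound)
  then show ?thesis
    unfolding abs_mult using loc_sq_le[of C t a \<omega>] loc_sq_le[of C t b \<omega>] by simp
qed

lemma le_one_plus_powr: "0 \<le> x \<Longrightarrow> 1 \<le> r \<Longrightarrow> x \<le> 1 + x powr r" for x r :: real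
proof (cases "x \<le> 1")
  case False
  assume "1 \<le> r"
  then have "x powr 1 \<le> x powr r" using False by (intro powr_mono) auto
  then show ?thesis using False by simp
qed (simp add: add_increasing2)

context
  fixes C :: real assumes C: "C \<ge> 0"
begin

text \<open>Weight and indicator are both known at time \<open>t - 1\<close>, so the conditional
  moment may be inserted under the integral, and where the indicator is 1 it is at most
  \<open>C\<close>. The weight 1 gives unconditional moments; a lagged square as weight controls
  products of innovations without fourth moments.\<close>

lemma nn_integral_lsqn_powr_le:
  assumes h: "h \<in> borel_measurable (F (t - 1))" and t: "t \<ge> 1"
  shows "(\<integral>\<^sup>+\<omega>. h \<omega> * ennreal (lsqn C t \<omega> powr s) \<partial>M) \<le> (\<integral>\<^sup>+\<omega>. h \<omega> \<partial>M) * ennreal C"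
proof -
  interpret finite_measure_subalgebra M "F (t - 1)" by (rule subalg_finite)
  note [measurable] = h meas_M[OF h] ind_meas[of C t] sqn_meas_M[OF t] cmom_meas[of t] meas_M[OF cmom_meas[of t]]
  have "(\<integral>\<^sup>+\<omega>. h \<omega> * ennreal (lsqn C t \<omega> powr s) \<partial>M)
    = (\<integral>\<^sup>+\<omega>. (h \<omega> * ennreal (ind C t \<omega>)) * ennreal (sqn t \<omega> powr s) \<partial>M)"
    by (intro nn_integral_cong) (auto simp: lsqn_eq[OF t] ind_def)
  also have "\<dots> = (\<integral>\<^sup>+\<omega>. (h \<omega> * ennreal (ind C t \<omega>)) * cmom t \<omega> \<partial>M)"
    unfolding cmom_def by (rule nn_cond_exp_intg[symmetric]) measurable
  also have "\<dots> \<le> (\<integral>\<^sup>+\<omega>. h \<omega> * ennreal C \<partial>M)"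
    by (intro nn_integral_mono) (auto simp: ind_def intro!: mult_left_mono)
  also have "\<dots> = (\<integral>\<^sup>+\<omega>. h \<omega> \<partial>M) * ennreal C" by (rule nn_integral_multc) measurable
  finally show ?thesis .
qed

lemma nn_integral_lsqn_le:
  assumes h: "h \<in> borel_measurable (F (t - 1))" and t: "t \<ge> 1"
  shows "(\<integral>\<^sup>+\<omega>. h \<omega> * ennreal (lsqn C t \<omega>) \<partial>M) \<le> (\<integral>\<^sup>+\<omega>. h \<omega> \<partial>M) * ennreal (1 + C)"
proof -
  note [measurable] = meas_M[OF h]
  have "(\<integral>\<^sup>+\<omega>. h \<omega> * ennreal (lsqn C t \<omega>) \<partial>M) \<le> (\<integral>\<^sup>+\<omega>. h \<omega> + h \<omega> * ennreal (lsqn C t \<omega> powr s) \<partial>M)"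
  proof (intro nn_integral_mono)
    fix \<omega>
    have "ennreal (lsqn C t \<omega>) \<le> ennreal (1 + lsqn C t \<omega> powr s)"
      using s_gt_1 lsqn_nonneg by (intro ennreal_leI le_one_plus_powr) auto
    also have "\<dots> = 1 + ennreal (lsqn C t \<omega> powr s)" by (simp add: ennreal_plus)
    finally have "h \<omega> * ennreal (lsqn C t \<omega>) \<le> h \<omega> * (1 + ennreal (lsqn C t \<omega> powr s))" by (rule mult_left_mono) simp
    then show "h \<omega> * ennreal (lsqn C t \<omega>) \<le> h \<omega> + h \<omega> * ennreal (lsqn C t \<omega> powr s)" by (simp add: distrib_left)
  qed
  also have "\<dots> = (\<integral>\<^sup>+\<omega>. h \<omega> \<partial>M) + (\<integral>\<^sup>+\<omega>. h \<omega> * ennreal (lsqn C t \<omega> powr s) \<partial>M)"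
    by (rule nn_integral_add) measurable
  also have "\<dots> \<le> (\<integral>\<^sup>+\<omega>. h \<omega> \<partial>M) + (\<integral>\<^sup>+\<omega>. h \<omega> \<partial>M) * ennreal C"
    by (intro add_left_mono nn_integral_lsqn_powr_le assms)
  also have "\<dots> = (\<integral>\<^sup>+\<omega>. h \<omega> \<partial>M) * ennreal (1 + C)" using C by (simp add: ennreal_plus distrib_left)
  finally show ?thesis .
qed

lemma integrable_lsqn_powr:
  assumes "t \<ge> 1"
  shows "integrable M (\<lambda>\<omega>. lsqn C t \<omega> powr s)" "(\<integral>\<omega>. lsqn C t \<omega> powr s \<partial>M) \<le> C"
proof -
  have le: "(\<integral>\<^sup>+\<omega>. ennreal (lsqn C t \<omega> powr s) \<partial>M) \<le> ennreal C"
    using nn_integral_lsqn_powr_le[of "\<lambda>_. 1" t] assms by (simp add: emeasure_space_1)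
  show "integrable M (\<lambda>\<omega>. lsqn C t \<omega> powr s)" "(\<integral>\<omega>. lsqn C t \<omega> powr s \<partial>M) \<le> C"
    by (rule integrable_of_nn_integral_le[OF _ _ le C]; simp)+
qed

lemma integrable_lsqn:
  assumes "t \<ge> 1"
  shows "integrable M (lsqn C t)" "(\<integral>\<omega>. lsqn C t \<omega> \<partial>M) \<le> 1 + C"
proof -
  have le: "(\<integral>\<^sup>+\<omega>. ennreal (lsqn C t \<omega>) \<partial>M) \<le> ennreal (1 + C)"
    using nn_integral_lsqn_le[of "\<lambda>_. 1" t] assms by (simp add: emeasure_space_1)
  have C1: "0 \<le> 1 + C" using C by simp
  show "integrable M (lsqn C t)" "(\<integral>\<omega>. lsqn C t \<omega> \<partial>M) \<le> 1 + C"
    by (rule integrable_of_nn_integral_le[OF _ _ le C1]; simp add: lsqn_nonneg)+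
qed

text \<open>The \<open>s\<close>-th powers of the quotients have expectations of at most
  \<open>C * t powr (- s)\<close>, summable as \<open>s > 1\<close>. Moments strictly above order
  two enter here.\<close>

lemma AE_lsqn_over_t: "AE \<omega> in M. (\<lambda>t. lsqn C t \<omega> / real t) \<longlonglongrightarrow> 0"
proof -
  define f where "f t \<omega> = (if t \<ge> 1 then lsqn C t \<omega> powr s * real t powr (- s) else 0)" for t \<omega>
  have "AE \<omega> in M. (\<lambda>t. f t \<omega>) \<longlonglongrightarrow> 0"
  proof (rule AE_tendsto_0_of_summable_integral[where b = "\<lambda>t. C * real t powr (- s)"])
    fix t
    show "integrable M (f t)"
    proof (cases "t \<ge> 1")
      case True
      then have "f t = (\<lambda>\<omega>. lsqn C t \<omega> powr s * real t powr (- s))" by (simp add: f_def fun_eq_iff)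
      then show ?thesis using integrable_lsqn_powr(1)[OF True] by simp
    next
      case False
      then have "f t = (\<lambda>\<omega>. 0)" by (simp add: f_def fun_eq_iff)
      then show ?thesis by simp
    qed
    show "(\<integral>\<omega>. f t \<omega> \<partial>M) \<le> C * real t powr (- s)"
    proof (cases "t \<ge> 1")
      case True
      then have "(\<integral>\<omega>. f t \<omega> \<partial>M) = (\<integral>\<omega>. lsqn C t \<omega> powr s \<partial>M) * real t powr (- s)" by (simp add: f_def)
      also have "\<dots> \<le> C * real t powr (- s)" by (intro mult_right_mono integrable_lsqn_powr True) auto
      finally show ?thesis .
    qed (use C in \<open>simp add: f_def\<close>)
    show "summable (\<lambda>t. C * real t powr (- s))"
      using s_gt_1 by (intro summable_mult) (simp add: summable_real_powr_iff)
  qed (simp add: f_def)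
  then show ?thesis
  proof eventually_elim
    case (elim \<omega>)
    have "(\<lambda>t. f t \<omega> powr (1 / s)) \<longlonglongrightarrow> 0 powr (1 / s)"
      by (rule tendsto_powr'[OF elim tendsto_const]) (use s_gt_1 in \<open>auto simp: f_def\<close>)
    then have "(\<lambda>t. f t \<omega> powr (1 / s)) \<longlonglongrightarrow> 0" by simp
    moreover have "\<forall>\<^sub>F t in sequentially. f t \<omega> powr (1 / s) = lsqn C t \<omega> / real t"
      using eventually_ge_at_top[of 1]
    proof eventually_elim
      case (elim t)
      have "f t \<omega> powr (1 / s) = lsqn C t \<omega> powr (s * (1 / s)) * real t powr (- s * (1 / s))"
        using elim by (simp add: f_def powr_mult powr_powr)
      also have "\<dots> = lsqn C t \<omega> / real t"
        using s_gt_1 elim lsqn_nonneg[of C t \<omega>] by (simp add: powr_minus divide_inverse)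
      finally show ?case .
    qed
    ultimately show ?case by (rule Lim_transform_eventually)
  qed
qed

text \<open>Given the past, the lagged factor is a constant, so the products have bounded second
  moments; and in a product of two of them everything except the newest innovation is predictable,
  so they are orthogonal. For \<open>t \<le> i\<close> natural subtraction gives index 0, where
  \<open>loc\<close> is zero.\<close>

lemma AE_lagged_products:
  assumes i: "i \<ge> 1" and a: "a < p" and b: "b < p"
  shows "AE \<omega> in M. (\<lambda>T. (\<Sum>t = 1..T. loc C t a \<omega> * loc C (t - i) b \<omega>) / real T) \<longlonglongrightarrow> 0"
proof -
  define \<xi> where "\<xi> t \<omega> = loc C t a \<omega> * loc C (t - i) b \<omega>" for t \<omega>
  have \<xi>_meas: "\<xi> t \<in> borel_measurable (F t)" for t
    unfolding \<xi>_def[abs_def] by (intro borel_measurable_times loc_meas meas_up[OF loc_meas]) auto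
  have sq_bound: "(\<integral>\<^sup>+\<omega>. ennreal ((\<xi> t \<omega>)\<^sup>2) \<partial>M) \<le> ennreal ((1 + C) * (1 + C))" if t: "t \<ge> 1" for t
  proof -
    define h where "h \<omega> = ennreal ((loc C (t - i) b \<omega>)\<^sup>2)" for \<omega>
    have h: "h \<in> borel_measurable (F (t - 1))"
      unfolding h_def[abs_def] using i
      by (intro measurable_compose[OF _ measurable_ennreal] borel_measurable_power meas_up[OF loc_meas]) auto
    have "(\<integral>\<^sup>+\<omega>. ennreal ((\<xi> t \<omega>)\<^sup>2) \<partial>M) \<le> (\<integral>\<^sup>+\<omega>. h \<omega> * ennreal (lsqn C t \<omega>) \<partial>M)"
    proof (intro nn_integral_mono)
      fix \<omega>
      have "(\<xi> t \<omega>)\<^sup>2 \<le> (loc C (t - i) b \<omega>)\<^sup>2 * lsqn C t \<omega>"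
        unfolding \<xi>_def power_mult_distrib by (subst mult.commute) (intro mult_left_mono loc_sq_le, auto)
      then show "ennreal ((\<xi> t \<omega>)\<^sup>2) \<le> h \<omega> * ennreal (lsqn C t \<omega>)"
        using lsqn_nonneg by (simp add: h_def ennreal_leI flip: ennreal_mult)
    qed
    also have "\<dots> \<le> (\<integral>\<^sup>+\<omega>. h \<omega> \<partial>M) * ennreal (1 + C)" by (rule nn_integral_lsqn_le[OF h t])
    also have "(\<integral>\<^sup>+\<omega>. h \<omega> \<partial>M) * ennreal (1 + C) \<le> ennreal (1 + C) * ennreal (1 + C)"
    proof (rule mult_right_mono, cases "t - i \<ge> 1")
      case True
      have "(\<integral>\<^sup>+\<omega>. h \<omega> \<partial>M) \<le> (\<integral>\<^sup>+\<omega>. 1 * ennreal (lsqn C (t - i) \<omega>) \<partial>M)"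
        unfolding h_def by (intro nn_integral_mono) (simp add: ennreal_leI loc_sq_le)
      also have "\<dots> \<le> (\<integral>\<^sup>+\<omega>. 1 \<partial>M) * ennreal (1 + C)" by (rule nn_integral_lsqn_le[OF _ True]) simp
      finally show "(\<integral>\<^sup>+\<omega>. h \<omega> \<partial>M) \<le> ennreal (1 + C)" by (simp add: emeasure_space_1)
    next
      case False
      then have "h = (\<lambda>_. 0)" by (auto simp: h_def loc_def fun_eq_iff)
      then show "(\<integral>\<^sup>+\<omega>. h \<omega> \<partial>M) \<le> ennreal (1 + C)" by simp
    qed simp
    finally show ?thesis using C by (simp only: ennreal_mult)
  qed
  have [measurable]: "\<xi> t \<in> borel_measurable M" for t by (rule meas_M[OF \<xi>_meas])
  have CC: "0 \<le> (1 + C) * (1 + C)" using C by simp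
  have sq: "integrable M (\<lambda>\<omega>. (\<xi> t \<omega>)\<^sup>2)" "(\<integral>\<omega>. (\<xi> t \<omega>)\<^sup>2 \<partial>M) \<le> (1 + C) * (1 + C)" if "t \<ge> 1" for t
    by (rule integrable_of_nn_integral_le[OF _ _ sq_bound[OF that] CC]; simp)+
  show ?thesis
    unfolding \<xi>_def[symmetric]
  proof (rule orthogonal_strong_law[where B = "(1 + C) * (1 + C)"])
    show "\<xi> t \<in> borel_measurable M" for t by (rule meas_M[OF \<xi>_meas])
    show "integrable M (\<lambda>\<omega>. (\<xi> t \<omega>)\<^sup>2)" if "t \<ge> 1" for t by (rule sq(1)[OF that])
    show "(\<integral>\<omega>. (\<xi> t \<omega>)\<^sup>2 \<partial>M) \<le> (1 + C) * (1 + C)" if "t \<ge> 1" for t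
      by (rule sq(2)[OF that])
    fix s t :: nat assume st: "1 \<le> s" "s < t"
    interpret finite_measure_subalgebra M "F (t - 1)" by (rule subalg_finite)
    define h where "h \<omega> = \<xi> s \<omega> * loc C (t - i) b \<omega> * ind C t \<omega>" for \<omega>
    have h: "h \<in> borel_measurable (F (t - 1))"
      unfolding h_def[abs_def] using st i
      by (intro borel_measurable_times meas_up[OF \<xi>_meas] meas_up[OF loc_meas] ind_meas) auto
    have eq: "(\<lambda>\<omega>. \<xi> s \<omega> * \<xi> t \<omega>) = (\<lambda>\<omega>. h \<omega> * \<epsilon> t a \<omega>)"
      using st a by (auto simp: h_def \<xi>_def loc_def fun_eq_iff)
    have int: "integrable M (\<lambda>\<omega>. h \<omega> * \<epsilon> t a \<omega>)"
      unfolding eq[symmetric] using st by (intro integrable_mult_of_squares meas_M[OF \<xi>_meas] sq(1)) auto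
    have e: "\<epsilon> t a \<in> borel_measurable M" using st a by (intro \<epsilon>_meas_M) auto
    have "(\<integral>\<omega>. h \<omega> * \<epsilon> t a \<omega> \<partial>M) = (\<integral>\<omega>. h \<omega> * real_cond_exp M (F (t - 1)) (\<epsilon> t a) \<omega> \<partial>M)"
      by (rule real_cond_exp_intg(2)[symmetric, OF int h e])
    also have "\<dots> = (\<integral>\<omega>. 0 \<partial>M)"
    proof (rule integral_cong_AE)
      show "AE \<omega> in M. h \<omega> * real_cond_exp M (F (t - 1)) (\<epsilon> t a) \<omega> = 0"
        using \<epsilon>_mds[of t a] st a by (auto elim: eventually_mono)
    qed (use meas_M[OF h] in auto)
    finally show "(\<integral>\<omega>. \<xi> s \<omega> * \<xi> t \<omega> \<partial>M) = 0" by (simp add: eq)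
  qed
qed

lemma AE_cond_exp_lsqn_powr_le:
  assumes t: "t \<ge> 1"
  shows "AE \<omega> in M. real_cond_exp M (F (t - 1)) (\<lambda>\<omega>. lsqn C t \<omega> powr s) \<omega> \<le> C"
proof -
  interpret finite_measure_subalgebra M "F (t - 1)" by (rule subalg_finite)
  note [measurable] = sqn_meas_M[OF t]
  have eq: "(\<lambda>\<omega>. lsqn C t \<omega> powr s) = (\<lambda>\<omega>. ind C t \<omega> * (sqn t \<omega> powr s))"
    by (auto simp: lsqn_eq[OF t] ind_def fun_eq_iff)
  have "AE \<omega> in M. real_cond_exp M (F (t - 1)) (\<lambda>\<omega>. lsqn C t \<omega> powr s) \<omega>
      = ind C t \<omega> * real_cond_exp M (F (t - 1)) (\<lambda>\<omega>. sqn t \<omega> powr s) \<omega>"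
    unfolding eq
    by (rule real_cond_exp_mult) (use ind_meas integrable_lsqn_powr(1)[OF t] in \<open>auto simp: eq\<close>)
  then show ?thesis
  proof eventually_elim
    case (elim \<omega>)
    have "ind C t \<omega> * real_cond_exp M (F (t - 1)) (\<lambda>\<omega>. sqn t \<omega> powr s) \<omega> \<le> C"
    proof (cases "cmom t \<omega> \<le> ennreal C")
      case True
      have "real_cond_exp M (F (t - 1)) (\<lambda>\<omega>. sqn t \<omega> powr s) \<omega> \<le> enn2real (cmom t \<omega>)"
        unfolding real_cond_exp_def cmom_def by simp
      also have "\<dots> \<le> C" using True C by (simp add: enn2real_leI)
      finally show ?thesis using True by (simp add: ind_def)
    qed (use C in \<open>simp add: ind_def\<close>)
    then show ?case using elim by simp
  qed
qed

lemma AE_cond_exp_lsqn_le: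
  assumes t: "t \<ge> 1"
  shows "AE \<omega> in M. real_cond_exp M (F (t - 1)) (lsqn C t) \<omega> \<le> 1 + C"
proof -
  interpret finite_measure_subalgebra M "F (t - 1)" by (rule subalg_finite)
  have one: "AE \<omega> in M. real_cond_exp M (F (t - 1)) (\<lambda>_. 1) \<omega> = 1"
    by (rule real_cond_exp_F_meas) auto
  have add: "AE \<omega> in M. real_cond_exp M (F (t - 1)) (\<lambda>\<omega>. 1 + lsqn C t \<omega> powr s) \<omega>
      = real_cond_exp M (F (t - 1)) (\<lambda>_. 1) \<omega> + real_cond_exp M (F (t - 1)) (\<lambda>\<omega>. lsqn C t \<omega> powr s) \<omega>"
    by (rule real_cond_exp_add) (use integrable_lsqn_powr[OF t] in auto)
  have mono: "AE \<omega> in M. real_cond_exp M (F (t - 1)) (lsqn C t) \<omega>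
      \<le> real_cond_exp M (F (t - 1)) (\<lambda>\<omega>. 1 + lsqn C t \<omega> powr s) \<omega>"
    using integrable_lsqn[OF t] integrable_lsqn_powr[OF t] s_gt_1 lsqn_nonneg
    by (intro real_cond_exp_mono) (auto intro!: le_one_plus_powr)
  from one add mono AE_cond_exp_lsqn_powr_le[OF t] show ?thesis
    by eventually_elim auto
qed

text \<open>Subtracting the conditional mean creates martingale differences, and the centering does
  not increase second moments. Truncated products reach the strong law in this form.\<close>

lemma centered_orthogonal:
  fixes Y :: "nat \<Rightarrow> 'w \<Rightarrow> real"
  assumes Y: "\<And>t. Y t \<in> borel_measurable (F t)" and K: "\<And>t \<omega>. \<bar>Y t \<omega>\<bar> \<le> K t"
  defines "U \<equiv> \<lambda>t \<omega>. Y t \<omega> - real_cond_exp M (F (t - 1)) (Y t) \<omega>"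
  shows "U t \<in> borel_measurable M" "integrable M (\<lambda>\<omega>. (U t \<omega>)\<^sup>2)" "(\<integral>\<omega>. (U t \<omega>)\<^sup>2 \<partial>M) \<le> (\<integral>\<omega>. (Y t \<omega>)\<^sup>2 \<partial>M)"
    and "1 \<le> r \<Longrightarrow> r < t \<Longrightarrow> (\<integral>\<omega>. U r \<omega> * U t \<omega> \<partial>M) = 0"
proof -
  have YM: "Y t \<in> borel_measurable M" for t by (rule meas_M[OF Y])
  have UF: "U t \<in> borel_measurable (F t)" for t
    unfolding U_def by (intro borel_measurable_diff Y meas_up[of _ "t - 1" t]) auto
  show UM: "U t \<in> borel_measurable M" for t by (rule meas_M[OF UF])
  have *: "integrable M (Y t) \<and> integrable M (\<lambda>\<omega>. (U t \<omega>)\<^sup>2) \<and> (\<integral>\<omega>. (U t \<omega>)\<^sup>2 \<partial>M) \<le> (\<integral>\<omega>. (Y t \<omega>)\<^sup>2 \<partial>M)" for t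
  proof -
    interpret finite_measure_subalgebra M "F (t - 1)" by (rule subalg_finite)
    show ?thesis unfolding U_def using integrable_real_cond_exp_bounded[OF YM K] by blast
  qed
  show "integrable M (\<lambda>\<omega>. (U t \<omega>)\<^sup>2)" "(\<integral>\<omega>. (U t \<omega>)\<^sup>2 \<partial>M) \<le> (\<integral>\<omega>. (Y t \<omega>)\<^sup>2 \<partial>M)" using * by auto
  assume r: "1 \<le> r" "r < t"
  interpret finite_measure_subalgebra M "F (t - 1)" by (rule subalg_finite)
  have "integrable M (U r)"
    using integrable_mult_of_squares[OF UM[of r], of "\<lambda>_. 1"] * by simp
  moreover have "U r \<in> borel_measurable (F (t - 1))" by (rule meas_up[OF UF]) (use r in simp)
  ultimately have "(\<integral>\<omega>. U r \<omega> * (Y t \<omega> - real_cond_exp M (F (t - 1)) (Y t) \<omega>) \<partial>M) = 0"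
    by (intro integral_mult_centered_eq_0[OF _ YM _ K])
  then show "(\<integral>\<omega>. U r \<omega> * U t \<omega> \<partial>M) = 0" by (simp only: U_def)
qed

lemma powr_le_one_plus_powr: "0 \<le> x \<Longrightarrow> 0 \<le> r \<Longrightarrow> r \<le> q \<Longrightarrow> x powr r \<le> 1 + x powr q" for x r q :: real
proof (cases "x \<le> 1")
  case True
  assume "0 \<le> x" "0 \<le> r"
  then have "x powr r \<le> 1 powr r" using True by (intro powr_mono2) auto
  then show ?thesis by (simp add: add_increasing2)
next
  case False
  assume "r \<le> q"
  then have "x powr r \<le> x powr q" using False by (intro powr_mono) auto
  then show ?thesis by simp
qed

text \<open>Squared norms have moments only of some order above one, so they are truncated at the
  growing level \<open>t\<close>. The conditional means stay below \<open>1 + C\<close>, and the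
  centered averages at powers of two have summable second moments. Since the summands are
  nonnegative, dyadic times control all others up to a factor 2.\<close>

lemma AE_bounded_average: "AE \<omega> in M. \<exists>R. \<forall>\<^sub>F T in sequentially. (\<Sum>t = 1..T. lsqn C t \<omega>) / real T \<le> R"
proof -
  define W where "W t \<omega> = min (lsqn C t \<omega>) (real t)" for t \<omega>
  define E where "E t = real_cond_exp M (F (t - 1)) (W t)" for t
  define U where "U t \<omega> = W t \<omega> - E t \<omega>" for t \<omega>
  \<comment> \<open>Capped at 2 so that \<open>2 - r\<close> and \<open>r\<close> are both
    nonnegative exponents for interpolating the square; \<open>r > 1\<close> makes the ratio
    \<open>2 powr (1 - r)\<close> less than 1.\<close>
  define r where "r = min s 2"
  have r: "1 < r" "r \<le> 2" "r \<le> s" using s_gt_1 by (auto simp: r_def)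
  have W_meas: "W t \<in> borel_measurable (F t)" for t
    unfolding W_def[abs_def] by (intro borel_measurable_min lsqn_meas) auto
  have W0: "0 \<le> W t \<omega>" "W t \<omega> \<le> real t" "W t \<omega> \<le> lsqn C t \<omega>" for t \<omega>
    using lsqn_nonneg by (auto simp: W_def)
  then have Wb: "\<bar>W t \<omega>\<bar> \<le> real t" for t \<omega> by simp
  note U = centered_orthogonal[of W real, OF W_meas Wb, folded E_def U_def]
  have U4: "(\<integral>\<omega>. U r' \<omega> * U t \<omega> \<partial>M) = 0" if "1 \<le> r'" "r' < t" for r' t
    using U(4)[OF that] .
  have Wsq: "(\<integral>\<omega>. (W t \<omega>)\<^sup>2 \<partial>M) \<le> real t powr (2 - r) * (1 + C)" if t: "t \<ge> 1" for t
  proof -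
    have int: "integrable M (\<lambda>\<omega>. real t powr (2 - r) * (1 + lsqn C t \<omega> powr s))"
      using integrable_lsqn_powr(1)[OF t] by simp
    have bd: "(W t \<omega>)\<^sup>2 \<le> real t powr (2 - r) * (1 + lsqn C t \<omega> powr s)" for \<omega>
    proof (cases "W t \<omega> = 0")
      case False
      then have pos: "W t \<omega> > 0" using W0(1)[of t \<omega>] by simp
      have "(W t \<omega>)\<^sup>2 = W t \<omega> powr ((2 - r) + r)" using pos by (simp flip: powr_numeral)
      also have "\<dots> = W t \<omega> powr (2 - r) * W t \<omega> powr r" by (rule powr_add)
      also have "\<dots> \<le> real t powr (2 - r) * lsqn C t \<omega> powr r"
        using W0[of t \<omega>] r by (intro mult_mono powr_mono2) auto
      also have "\<dots> \<le> real t powr (2 - r) * (1 + lsqn C t \<omega> powr s)"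
        using r lsqn_nonneg by (intro mult_left_mono powr_le_one_plus_powr) auto
      finally show ?thesis .
    qed (auto intro!: mult_nonneg_nonneg add_nonneg_nonneg)
    have "(\<integral>\<omega>. (W t \<omega>)\<^sup>2 \<partial>M) \<le> (\<integral>\<omega>. real t powr (2 - r) * (1 + lsqn C t \<omega> powr s) \<partial>M)"
      by (rule integral_mono'[OF int bd]) (auto intro!: mult_nonneg_nonneg add_nonneg_nonneg)
    also have "\<dots> = real t powr (2 - r) * (1 + (\<integral>\<omega>. lsqn C t \<omega> powr s \<partial>M))"
      using integrable_lsqn_powr(1)[OF t] by (simp add: prob_space)
    also have "\<dots> \<le> real t powr (2 - r) * (1 + C)"
      by (intro mult_left_mono add_left_mono integrable_lsqn_powr(2)[OF t]) auto
    finally show ?thesis .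
  qed
  have lim: "AE \<omega> in M. (\<lambda>n. ((\<Sum>t = 1..2 ^ n. U t \<omega>) / 2 ^ n)\<^sup>2) \<longlonglongrightarrow> 0"
  proof (rule AE_tendsto_0_of_summable_integral[where b = "\<lambda>n. (1 + C) * (2 powr (1 - r)) ^ n"])
    fix n :: nat
    have i: "integrable M (\<lambda>\<omega>. (\<Sum>t\<in>{1..2 ^ n}. U t \<omega>)\<^sup>2)"
      and e: "(\<integral>\<omega>. (\<Sum>t\<in>{1..2 ^ n}. U t \<omega>)\<^sup>2 \<partial>M) = (\<Sum>t\<in>{1..2 ^ n}. \<integral>\<omega>. (U t \<omega>)\<^sup>2 \<partial>M)"
      by (rule integral_square_sum_orthogonal; use U(1,2) U4 in auto)+
    show "integrable M (\<lambda>\<omega>. ((\<Sum>t = 1..2 ^ n. U t \<omega>) / 2 ^ n)\<^sup>2)"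
      unfolding power_divide by (intro integrable_divide_zero impI i)
    define N where "N = real (2 ^ n)"
    have N: "N > 0" by (simp add: N_def)
    have "(\<integral>\<omega>. ((\<Sum>t = 1..2 ^ n. U t \<omega>) / 2 ^ n)\<^sup>2 \<partial>M) = (\<Sum>t = 1..2 ^ n. \<integral>\<omega>. (U t \<omega>)\<^sup>2 \<partial>M) / N\<^sup>2"
      unfolding power_divide integral_divide_zero e N_def by simp
    also have "\<dots> \<le> (\<Sum>t\<in>{1..(2::nat) ^ n}. N powr (2 - r) * (1 + C)) / N\<^sup>2"
    proof (intro divide_right_mono sum_mono)
      fix t assume t: "t \<in> {1..(2::nat) ^ n}"
      have "real t \<le> N" using t by (simp add: N_def)
      have "(\<integral>\<omega>. (U t \<omega>)\<^sup>2 \<partial>M) \<le> (\<integral>\<omega>. (W t \<omega>)\<^sup>2 \<partial>M)" by (rule U(3))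
      also have "\<dots> \<le> real t powr (2 - r) * (1 + C)" using t by (intro Wsq) auto
      also have "\<dots> \<le> N powr (2 - r) * (1 + C)"
        using \<open>real t \<le> N\<close> r C by (intro mult_right_mono powr_mono2) auto
      finally show "(\<integral>\<omega>. (U t \<omega>)\<^sup>2 \<partial>M) \<le> N powr (2 - r) * (1 + C)" .
    qed auto
    also have "\<dots> = (1 + C) * (N powr (2 - r) * N / N\<^sup>2)" by (simp add: N_def)
    also have "N powr (2 - r) = N powr (1 - r) * N"
      using powr_add[of N "1 - r" 1] N by simp
    also have "N powr (1 - r) * N * N / N\<^sup>2 = N powr (1 - r)" using N by (simp add: power2_eq_square)
    also have "N powr (1 - r) = (2 powr (1 - r)) ^ n"
    proof -
      have "N = 2 powr real n" by (simp add: N_def powr_realpow)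
      then have "N powr (1 - r) = 2 powr (real n * (1 - r))" by (simp add: powr_powr)
      also have "\<dots> = (2 powr (1 - r)) ^ n" by (subst powr_power) auto
      finally show ?thesis .
    qed
    finally show "(\<integral>\<omega>. ((\<Sum>t = 1..2 ^ n. U t \<omega>) / 2 ^ n)\<^sup>2 \<partial>M) \<le> (1 + C) * (2 powr (1 - r)) ^ n" .
    have "2 powr (1 - r) < 2 powr 0" using r by (intro powr_less_mono) auto
    then show "summable (\<lambda>n. (1 + C) * (2 powr (1 - r)) ^ n)"
      by (intro summable_mult summable_geometric) simp
  qed simp
  have AE_E: "AE \<omega> in M. \<forall>t\<ge>1. E t \<omega> \<le> 1 + C"
  proof -
    have "AE \<omega> in M. E t \<omega> \<le> 1 + C" if t: "t \<ge> 1" for t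
    proof -
      interpret finite_measure_subalgebra M "F (t - 1)" by (rule subalg_finite)
      have "AE \<omega> in M. E t \<omega> \<le> real_cond_exp M (F (t - 1)) (lsqn C t) \<omega>"
        unfolding E_def
      proof (rule real_cond_exp_mono)
        show "integrable M (W t)" by (rule integrable_real_cond_exp_bounded(1)[OF meas_M[OF W_meas] Wb])
      qed (use W0 integrable_lsqn[OF t] in auto)
      with AE_cond_exp_lsqn_le[OF t] show ?thesis by eventually_elim linarith
    qed
    then have "AE \<omega> in M. t \<ge> 1 \<longrightarrow> E t \<omega> \<le> 1 + C" for t by (cases "t \<ge> 1") auto
    then show ?thesis by (simp add: AE_all_countable)
  qed
  from lim AE_E AE_lsqn_over_t show ?thesis
  proof eventually_elim
    case (elim \<omega>)
    have "(\<lambda>n. (\<Sum>t = 1..2 ^ n. U t \<omega>) / 2 ^ n) \<longlonglongrightarrow> 0" using elim(1) by simp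
    then have "Bseq (\<lambda>n. (\<Sum>t = 1..2 ^ n. U t \<omega>) / 2 ^ n)" by (intro convergent_imp_Bseq convergentI)
    then obtain K where K: "\<And>n. \<bar>(\<Sum>t = 1..2 ^ n. U t \<omega>) / 2 ^ n\<bar> \<le> K" "K > 0"
      by (auto simp: Bseq_def simp del: abs_divide)
    have Wsum: "(\<Sum>t = 1..2 ^ n. W t \<omega>) \<le> (1 + C + K) * 2 ^ n" for n :: nat
    proof -
      have "(\<Sum>t = 1..2 ^ n. U t \<omega>) / 2 ^ n \<le> K" using K(1)[of n] by linarith
      then have 1: "(\<Sum>t = 1..2 ^ n. U t \<omega>) \<le> K * 2 ^ n" by (simp add: field_simps)
      have "(\<Sum>t\<in>{1..2 ^ n}. E t \<omega>) \<le> (\<Sum>t\<in>{1..(2::nat) ^ n}. 1 + C)" using elim(2) by (intro sum_mono) auto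
      then have 2: "(\<Sum>t = 1..2 ^ n. E t \<omega>) \<le> (1 + C) * 2 ^ n" by (simp add: mult.commute)
      have "(\<Sum>t = 1..2 ^ n. W t \<omega>) = (\<Sum>t = 1..2 ^ n. U t \<omega>) + (\<Sum>t = 1..2 ^ n. E t \<omega>)"
        by (simp add: U_def flip: sum.distrib)
      also have "\<dots> \<le> K * 2 ^ n + (1 + C) * 2 ^ n" using 1 2 by (rule add_mono)
      finally show ?thesis by (simp add: algebra_simps)
    qed
    have "\<forall>\<^sub>F t in sequentially. lsqn C t \<omega> / real t < 1" using elim(3) by (rule order_tendstoD) simp
    then obtain t0 where t0: "\<And>t. t \<ge> t0 \<Longrightarrow> lsqn C t \<omega> / real t < 1" by (auto simp: eventually_sequentially)
    have small: "lsqn C t \<omega> \<le> W t \<omega> + (if t < t0 then lsqn C t \<omega> else 0)" if "t \<ge> 1" for t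
      using t0[of t] that W0(1)[of t \<omega>] by (cases "t < t0") (auto simp: W_def min_def field_simps)
    \<comment> \<open>Collects the times before \<open>t0\<close>; from \<open>t0\<close> on the
      squared norm is below \<open>t\<close>, so the truncation is inactive.\<close>
    define K0 where "K0 = (\<Sum>t<t0. lsqn C t \<omega>)"
    have K0: "K0 \<ge> 0" unfolding K0_def by (intro sum_nonneg lsqn_nonneg)
    have "(\<Sum>t = 1..T. lsqn C t \<omega>) / real T \<le> 2 * (1 + C + K) + K0" if T: "T \<ge> 1" for T
    proof -
      obtain n where n: "2 ^ n \<le> T" "T < 2 ^ (n + 1)" using ex_power_ivl1[of 2 T] T by auto
      have "(\<Sum>t = 1..T. lsqn C t \<omega>) \<le> (\<Sum>t = 1..T. W t \<omega>) + (\<Sum>t = 1..T. if t < t0 then lsqn C t \<omega> else 0)"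
        unfolding sum.distrib[symmetric] by (intro sum_mono small) auto
      also have "(\<Sum>t = 1..T. if t < t0 then lsqn C t \<omega> else 0) = (\<Sum>t\<in>{1..T} \<inter> {..<t0}. lsqn C t \<omega>)"
        by (subst sum.inter_restrict) (auto intro!: sum.cong)
      also have "\<dots> \<le> K0" unfolding K0_def by (intro sum_mono2 lsqn_nonneg) auto
      also have "(\<Sum>t = 1..T. W t \<omega>) \<le> (\<Sum>t = 1..2 ^ (n + 1). W t \<omega>)"
        using n W0 by (intro sum_mono2) auto
      also have "\<dots> \<le> (1 + C + K) * 2 ^ (n + 1)" by (rule Wsum)
      also have "\<dots> = 2 * (1 + C + K) * real (2 ^ n)" by simp
      also have "\<dots> \<le> 2 * (1 + C + K) * real T"
        using n(1) C K(2) by (intro mult_left_mono of_nat_mono) auto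
      also have "2 * (1 + C + K) * real T + K0 \<le> (2 * (1 + C + K) + K0) * real T"
        using K0 T by (simp add: distrib_right mult_le_cancel_left1)
      finally show ?thesis using T by (simp add: field_simps)
    qed
    then show ?case
      by (intro exI[of _ "2 * (1 + C + K) + K0"]) (auto simp: eventually_sequentially intro!: exI[of _ 1])
  qed
qed

text \<open>The products of the noise need not be square integrable, since only a moment of some order
  above two is available; the strong law is applied to these truncations, and the conditional
  moments control the truncation error uniformly in time.\<close>

definition trunc :: "nat \<Rightarrow> nat \<Rightarrow> nat \<Rightarrow> nat \<Rightarrow> 'w \<Rightarrow> real" where
  "trunc B a b t \<omega> = (if lsqn C t \<omega> \<le> real B then loc C t a \<omega> * loc C t b \<omega> else 0)"

lemma trunc_meas: "trunc B a b t \<in> borel_measurable (F t)"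
proof -
  note [measurable] = loc_meas lsqn_meas
  show ?thesis unfolding trunc_def[abs_def] by measurable
qed

lemma trunc_bounded: "\<bar>trunc B a b t \<omega>\<bar> \<le> real B"
  using abs_loc_mult_le[of C t a \<omega> b] by (auto simp: trunc_def)

lemma AE_trunc_average:
  "AE \<omega> in M. (\<lambda>T. (\<Sum>t = 1..T. trunc B a b t \<omega> - real_cond_exp M (F (t - 1)) (trunc B a b t) \<omega>) / real T) \<longlonglongrightarrow> 0"
proof (rule orthogonal_strong_law[where B = "(real B)\<^sup>2"])
  note U = centered_orthogonal[of "trunc B a b" "\<lambda>_. real B", OF trunc_meas trunc_bounded]
  fix t
  show "(\<lambda>\<omega>. trunc B a b t \<omega> - real_cond_exp M (F (t - 1)) (trunc B a b t) \<omega>) \<in> borel_measurable M" by (rule U(1))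
  show "integrable M (\<lambda>\<omega>. (trunc B a b t \<omega> - real_cond_exp M (F (t - 1)) (trunc B a b t) \<omega>)\<^sup>2)" by (rule U(2))
  have "(\<integral>\<omega>. (trunc B a b t \<omega> - real_cond_exp M (F (t - 1)) (trunc B a b t) \<omega>)\<^sup>2 \<partial>M) \<le> (\<integral>\<omega>. (trunc B a b t \<omega>)\<^sup>2 \<partial>M)"
    by (rule U(3))
  also have "\<dots> \<le> (\<integral>\<omega>. (real B)\<^sup>2 \<partial>M)"
  proof (rule integral_mono')
    fix \<omega>
    have "\<bar>trunc B a b t \<omega>\<bar>\<^sup>2 \<le> (real B)\<^sup>2" by (intro power_mono trunc_bounded) auto
    then show "(trunc B a b t \<omega>)\<^sup>2 \<le> (real B)\<^sup>2" by simp
  qed auto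
  finally show "(\<integral>\<omega>. (trunc B a b t \<omega> - real_cond_exp M (F (t - 1)) (trunc B a b t) \<omega>)\<^sup>2 \<partial>M) \<le> (real B)\<^sup>2"
    by (simp add: prob_space)
  fix r assume "1 \<le> r" "r < t"
  then show "(\<integral>\<omega>. (trunc B a b r \<omega> - real_cond_exp M (F (r - 1)) (trunc B a b r) \<omega>)
      * (trunc B a b t \<omega> - real_cond_exp M (F (t - 1)) (trunc B a b t) \<omega>) \<partial>M) = 0"
    by (rule U(4))
qed

text \<open>Where the truncation acts, \<open>lsqn\<close> exceeds \<open>B\<close>, hence is at
  most \<open>B powr (1 - s)\<close> times its own \<open>s\<close>-th power, whose conditional mean
  is at most \<open>C\<close>. The error is uniform in \<open>t\<close> and tends to zero as
  \<open>B\<close> grows.\<close>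

lemma AE_trunc_cond_exp:
  assumes t: "t \<ge> 1" and ab: "a < p" "b < p" and B: "B \<ge> 1"
  shows "AE \<omega> in M. \<bar>real_cond_exp M (F (t - 1)) (trunc B a b t) \<omega>
      - ind C t \<omega> * real_cond_exp M (F (t - 1)) (\<lambda>\<omega>. \<epsilon> t a \<omega> * \<epsilon> t b \<omega>) \<omega>\<bar> \<le> C * real B powr (1 - s)"
proof -
  interpret finite_measure_subalgebra M "F (t - 1)" by (rule subalg_finite)
  define P where "P \<omega> = loc C t a \<omega> * loc C t b \<omega>" for \<omega>
  define Q where "Q \<omega> = real B powr (1 - s) * lsqn C t \<omega> powr s" for \<omega>
  note [measurable] = \<epsilon>_meas_M[OF t ab(1)] \<epsilon>_meas_M[OF t ab(2)] meas_M[OF trunc_meas[of B a b t]]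
  have P: "integrable M P"
    by (rule Bochner_Integration.integrable_bound[OF integrable_lsqn(1)[OF t]])
      (use abs_loc_mult_le lsqn_nonneg in \<open>auto simp: P_def[abs_def]\<close>)
  have Q: "integrable M Q" unfolding Q_def using integrable_lsqn_powr(1)[OF t] by simp
  have Y: "integrable M (trunc B a b t)"
    by (rule integrable_real_cond_exp_bounded(1)[OF meas_M[OF trunc_meas] trunc_bounded])
  have bd: "\<bar>P \<omega> - trunc B a b t \<omega>\<bar> \<le> Q \<omega>" for \<omega>
  proof (cases "lsqn C t \<omega> \<le> real B")
    case False
    have "\<bar>P \<omega>\<bar> \<le> lsqn C t \<omega>" unfolding P_def by (rule abs_loc_mult_le)
    also have "\<dots> = lsqn C t \<omega> powr (1 - s) * lsqn C t \<omega> powr s"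
      using False B by (simp flip: powr_add)
    also have "\<dots> \<le> Q \<omega>" unfolding Q_def
      using False B s_gt_1 by (intro mult_right_mono powr_mono2') auto
    finally show ?thesis using False by (simp add: trunc_def)
  qed (simp add: trunc_def P_def Q_def)
  have eqP: "P = (\<lambda>\<omega>. ind C t \<omega> * (\<epsilon> t a \<omega> * \<epsilon> t b \<omega>))"
    using t ab by (auto simp: P_def loc_def ind_def fun_eq_iff)
  have EP: "AE \<omega> in M. real_cond_exp M (F (t - 1)) P \<omega> = ind C t \<omega> * real_cond_exp M (F (t - 1)) (\<lambda>\<omega>. \<epsilon> t a \<omega> * \<epsilon> t b \<omega>) \<omega>"
    unfolding eqP by (rule real_cond_exp_mult) (use ind_meas P in \<open>auto simp: eqP\<close>)
  have EQ: "AE \<omega> in M. real_cond_exp M (F (t - 1)) Q \<omega> = real B powr (1 - s) * real_cond_exp M (F (t - 1)) (\<lambda>\<omega>. lsqn C t \<omega> powr s) \<omega>"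
    unfolding Q_def by (rule real_cond_exp_cmult) (rule integrable_lsqn_powr(1)[OF t])
  have D1: "AE \<omega> in M. real_cond_exp M (F (t - 1)) (\<lambda>\<omega>. P \<omega> - trunc B a b t \<omega>) \<omega>
      = real_cond_exp M (F (t - 1)) P \<omega> - real_cond_exp M (F (t - 1)) (trunc B a b t) \<omega>"
    by (rule real_cond_exp_diff[OF P Y])
  have D2: "AE \<omega> in M. real_cond_exp M (F (t - 1)) (\<lambda>\<omega>. trunc B a b t \<omega> - P \<omega>) \<omega>
      = real_cond_exp M (F (t - 1)) (trunc B a b t) \<omega> - real_cond_exp M (F (t - 1)) P \<omega>"
    by (rule real_cond_exp_diff[OF Y P])
  have M1: "AE \<omega> in M. real_cond_exp M (F (t - 1)) (\<lambda>\<omega>. P \<omega> - trunc B a b t \<omega>) \<omega> \<le> real_cond_exp M (F (t - 1)) Q \<omega>"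
    by (rule real_cond_exp_mono[OF _ Bochner_Integration.integrable_diff[OF P Y] Q]) (use bd in \<open>auto intro!: AE_I2 simp: abs_le_iff\<close>)
  have M2: "AE \<omega> in M. real_cond_exp M (F (t - 1)) (\<lambda>\<omega>. trunc B a b t \<omega> - P \<omega>) \<omega> \<le> real_cond_exp M (F (t - 1)) Q \<omega>"
    by (rule real_cond_exp_mono[OF _ Bochner_Integration.integrable_diff[OF Y P] Q]) (use bd in \<open>auto intro!: AE_I2 simp: abs_le_iff\<close>)
  from EP EQ D1 D2 M1 M2 AE_cond_exp_lsqn_powr_le[OF t] show ?thesis
  proof eventually_elim
    case (elim \<omega>)
    have "real B powr (1 - s) * real_cond_exp M (F (t - 1)) (\<lambda>\<omega>. lsqn C t \<omega> powr s) \<omega> \<le> real B powr (1 - s) * C"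
      using elim(7) by (intro mult_left_mono) auto
    then show ?case using elim by (simp add: abs_le_iff mult.commute)
  qed
qed

end

end

section \<open>Assembling the almost sure statements into white noise\<close>

context martingale_noise
begin

text \<open>The argument is for one fixed \<open>\<omega>\<close>. Definiteness passes from the
  conditional covariances to the truncated ones at a small cost, then by the strong law to averages
  of truncated products; restoring the truncated observations can only increase the quadratic
  form.\<close>

lemma white_noise_path:
  fixes \<omega> :: 'w and C :: nat
  defines "V \<equiv> \<lambda>t a b. real_cond_exp M (F (t - 1)) (\<lambda>\<omega>. \<epsilon> t a \<omega> * \<epsilon> t b \<omega>) \<omega>"
  assumes sup: "\<And>t. t \<ge> 1 \<Longrightarrow> cmom t \<omega> \<le> ennreal (real C)"
    and low: "\<exists>c>0. \<forall>\<^sub>F t in sequentially. \<forall>u::nat \<Rightarrow> real. c * (\<Sum>a<p. (u a)\<^sup>2) \<le> (\<Sum>a<p. \<Sum>b<p. u a * u b * V t a b)"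
    and avg: "\<exists>R. \<forall>\<^sub>F T in sequentially. (\<Sum>t = 1..T. lsqn (real C) t \<omega>) / real T \<le> R"
    and sub: "(\<lambda>t. lsqn (real C) t \<omega> / real t) \<longlonglongrightarrow> 0"
    and lag: "\<And>i a b. i \<ge> 1 \<Longrightarrow> a < p \<Longrightarrow> b < p \<Longrightarrow>
      (\<lambda>T. (\<Sum>t = 1..T. loc (real C) t a \<omega> * loc (real C) (t - i) b \<omega>) / real T) \<longlonglongrightarrow> 0"
    and tr: "\<And>B a b. (\<lambda>T. (\<Sum>t = 1..T. trunc (real C) B a b t \<omega>
      - real_cond_exp M (F (t - 1)) (trunc (real C) B a b t) \<omega>) / real T) \<longlonglongrightarrow> 0"
    and tc: "\<And>B a b t. t \<ge> 1 \<Longrightarrow> a < p \<Longrightarrow> b < p \<Longrightarrow> B \<ge> 1 \<Longrightarrow>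
      \<bar>real_cond_exp M (F (t - 1)) (trunc (real C) B a b t) \<omega> - ind (real C) t \<omega> * V t a b\<bar> \<le> real C * real B powr (1 - s)"
  shows "white_noise p (\<lambda>a t. if t \<le> 0 then 0 else \<epsilon> (nat t) a \<omega>)"
proof -
  define e where "e a t = (if t \<le> 0 then 0 else \<epsilon> (nat t) a \<omega>)" for a and t :: int
  have ind1: "ind (real C) t \<omega> = 1" if "t \<ge> 1" for t using sup[OF that] by (simp add: ind_def)
  have loc_eq: "loc (real C) t a \<omega> = e a (int t)" if "a < p" for t a
    using that ind1[of t] by (auto simp: loc_def e_def)
  have lsqn_eq_e: "lsqn (real C) t \<omega> = (\<Sum>a<p. (e a (int t))\<^sup>2)" for t
    by (simp add: lsqn_def loc_eq)
  show ?thesis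
    unfolding e_def[symmetric]
  proof
    show "e a t = 0" if "t \<le> 0" for a t using that by (simp add: e_def)
  next
    fix a b i assume ab: "a < p" "b < p" and i: "(1::nat) \<le> i"
    have "loc (real C) (t - i) b \<omega> = e b (int t - int i)" for t
    proof (cases "i < t")
      case True
      then show ?thesis using ab by (simp add: loc_eq of_nat_diff)
    qed (simp add: loc_def e_def)
    then show "(\<lambda>T. mean T (\<lambda>t. e a t * e b (t - int i))) \<longlonglongrightarrow> 0"
      using lag[OF i ab] ab by (simp add: mean_def loc_eq)
  next
    obtain R where R: "\<forall>\<^sub>F T in sequentially. (\<Sum>t = 1..T. lsqn (real C) t \<omega>) / real T \<le> R" using avg ..
    have "\<forall>\<^sub>F T in sequentially. \<forall>a<p. mean T (\<lambda>t. (e a t)\<^sup>2) \<le> R"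
      using R
    proof eventually_elim
      case (elim T)
      show ?case
      proof (intro allI impI)
        fix a assume "a < p"
        then have "mean T (\<lambda>t. (e a t)\<^sup>2) \<le> (\<Sum>t = 1..T. lsqn (real C) t \<omega>) / real T"
          unfolding mean_def lsqn_eq_e
          by (intro divide_right_mono sum_mono member_le_sum[where f = "\<lambda>a. (e a _)\<^sup>2"]) auto
        then show "mean T (\<lambda>t. (e a t)\<^sup>2) \<le> R" using elim by linarith
      qed
    qed
    then show "\<exists>R. \<forall>\<^sub>F T in sequentially. \<forall>a<p. mean T (\<lambda>t. (e a t)\<^sup>2) \<le> R" ..
  next
    fix a assume a: "a < p"
    have "norm ((e a (int t))\<^sup>2 / real t) \<le> lsqn (real C) t \<omega> / real t" for t
    proof -
      have "(e a (int t))\<^sup>2 \<le> lsqn (real C) t \<omega>"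
        unfolding lsqn_eq_e using a by (intro member_le_sum[where f = "\<lambda>a. (e a (int t))\<^sup>2"]) auto
      then show ?thesis by (simp add: divide_right_mono)
    qed
    then show "sublinear (\<lambda>t. (e a t)\<^sup>2)"
      unfolding sublinear_def by (rule Lim_null_comparison[OF always_eventually[OF allI] sub])
  next
    obtain c where c: "c > 0" and cev: "\<forall>\<^sub>F t in sequentially. \<forall>u::nat \<Rightarrow> real. c * (\<Sum>a<p. (u a)\<^sup>2) \<le> (\<Sum>a<p. \<Sum>b<p. u a * u b * V t a b)"
      using low by auto
    obtain t0 where t0: "\<And>t u. t \<ge> t0 \<Longrightarrow> c * (\<Sum>a<p. (u a)\<^sup>2) \<le> (\<Sum>a<p. \<Sum>b<p. u a * u b * V t a b)"
      using cev by (auto simp: eventually_sequentially)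
    \<comment> \<open>An entrywise error \<open>\<kappa>\<close> changes the quadratic form by at
      most \<open>\<kappa> * p\<close> times the squared norm; \<open>B\<close> is taken so large
      that this costs less than half of \<open>c\<close>.\<close>
    have "(\<lambda>B. real C * real B powr (1 - s) * real p) \<longlonglongrightarrow> real C * 0 * real p"
      using s_gt_1 by (intro tendsto_mult tendsto_const tendsto_neg_powr filterlim_real_sequentially) auto
    then have "\<forall>\<^sub>F B in sequentially. real C * real B powr (1 - s) * real p < c / 2"
      by (rule order_tendstoD) (use c in simp)
    with eventually_ge_at_top[of 1] have "\<forall>\<^sub>F B in sequentially. B \<ge> 1 \<and> real C * real B powr (1 - s) * real p < c / 2"
      by eventually_elim simp
    then obtain B where B: "B \<ge> 1" "real C * real B powr (1 - s) * real p < c / 2"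
      by (auto simp: eventually_sequentially)
    define \<kappa> where "\<kappa> = real C * real B powr (1 - s)"
    have \<kappa>: "\<kappa> \<ge> 0" by (simp add: \<kappa>_def)
    define Y where "Y a b t = trunc (real C) B a b t \<omega>" for a b t
    define Z where "Z a b t = real_cond_exp M (F (t - 1)) (trunc (real C) B a b t) \<omega>" for a b t
    \<comment> \<open>Before \<open>t0\<close> no lower bound is available, so the matrices are
      replaced there by \<open>c / 2\<close> times the identity; finitely many changes disappear in
      the average.\<close>
    define Z' where "Z' a b t = (if t \<ge> t0 then Z a b t else if a = b then c / 2 else 0)" for a b t
    have Z_pd: "c / 2 * (\<Sum>a<p. (u a)\<^sup>2) \<le> (\<Sum>a<p. \<Sum>b<p. u a * u b * Z' a b t)" if t: "t \<ge> 1" for t u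
    proof (cases "t \<ge> t0")
      case True
      have "(\<Sum>a<p. \<Sum>b<p. u a * u b * V t a b) - (\<Sum>a<p. \<Sum>b<p. u a * u b * Z' a b t)
        = (\<Sum>a<p. \<Sum>b<p. u a * u b * (V t a b - Z a b t))"
        using True by (simp add: Z'_def right_diff_distrib sum_subtractf)
      also have "\<dots> \<le> (\<Sum>a<p. \<Sum>b<p. \<bar>u a\<bar> * \<bar>u b\<bar> * \<kappa>)"
      proof (intro sum_mono)
        fix a b assume "a \<in> {..<p}" "b \<in> {..<p}"
        then have "\<bar>V t a b - Z a b t\<bar> \<le> \<kappa>"
          using tc[OF t, of a b B] B(1) ind1[OF t] by (simp add: Z_def \<kappa>_def abs_minus_commute)
        then have "\<bar>u a * u b\<bar> * \<bar>V t a b - Z a b t\<bar> \<le> \<bar>u a * u b\<bar> * \<kappa>" by (rule mult_left_mono) simp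
        then show "u a * u b * (V t a b - Z a b t) \<le> \<bar>u a\<bar> * \<bar>u b\<bar> * \<kappa>"
          unfolding abs_mult[symmetric] by linarith
      qed
      also have "\<dots> = \<kappa> * (\<Sum>a<p. \<bar>u a\<bar>)\<^sup>2"
        by (simp add: power2_eq_square sum_product sum_distrib_left sum_distrib_right mult_ac)
      also have "\<dots> \<le> \<kappa> * (real p * (\<Sum>a<p. (u a)\<^sup>2))"
        using Cauchy_Schwarz_ineq_sum[of "\<lambda>_. 1" "\<lambda>a. \<bar>u a\<bar>" "{..<p}"] \<kappa> by (intro mult_left_mono) auto
      also have "\<dots> \<le> c / 2 * (\<Sum>a<p. (u a)\<^sup>2)"
        unfolding mult.assoc[symmetric] using B(2) by (intro mult_right_mono sum_nonneg) (auto simp: \<kappa>_def)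
      finally show ?thesis using t0[OF True, of u] by (simp add: field_simps)
    next
      case False
      have "(\<Sum>a<p. \<Sum>b<p. u a * u b * Z' a b t) = (\<Sum>a<p. \<Sum>b<p. if a = b then c / 2 * (u a)\<^sup>2 else 0)"
        using False by (intro sum.cong refl) (auto simp: Z'_def power2_eq_square)
      then show ?thesis by (simp add: sum_distrib_left)
    qed
    define G where "G T a b = (\<Sum>t = 1..T. Y a b t) / real T" for T a b
    define H where "H T a b = (\<Sum>t = 1..T. Z' a b t) / real T" for T a b
    have GH: "(\<lambda>T. G T a b - H T a b) \<longlonglongrightarrow> 0" for a b
    proof -
      define S where "S = (\<Sum>t = 1..t0. Z a b t - Z' a b t)"
      have "(\<lambda>T. (\<Sum>t = 1..T. Y a b t - Z a b t) / real T + S / real T) \<longlonglongrightarrow> 0 + 0"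
        using tr[of B a b] unfolding Y_def Z_def by (intro tendsto_add lim_const_over_n)
      moreover have "\<forall>\<^sub>F T in sequentially. (\<Sum>t = 1..T. Y a b t - Z a b t) / real T + S / real T = G T a b - H T a b"
        using eventually_ge_at_top[of t0]
      proof eventually_elim
        case (elim T)
        have "S = (\<Sum>t = 1..T. Z a b t - Z' a b t)"
          unfolding S_def using elim by (intro sum.mono_neutral_left) (auto simp: Z'_def)
        then have "(\<Sum>t = 1..T. Y a b t - Z a b t) + S = (\<Sum>t = 1..T. Y a b t) - (\<Sum>t = 1..T. Z' a b t)"
          by (simp add: sum_subtractf)
        then show ?case by (simp add: G_def H_def flip: add_divide_distrib diff_divide_distrib)
      qed
      ultimately show ?thesis by (auto intro: Lim_transform_eventually)
    qed
    have H_pd: "\<forall>\<^sub>F T in sequentially. \<forall>u. c / 2 * (\<Sum>a<p. (u a)\<^sup>2) \<le> (\<Sum>a<p. \<Sum>b<p. u a * u b * H T a b)"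
      using eventually_ge_at_top[of 1]
    proof eventually_elim
      case (elim T)
      show ?case
      proof
        fix u :: "nat \<Rightarrow> real"
        have "real T * (c / 2 * (\<Sum>a<p. (u a)\<^sup>2)) = (\<Sum>t = 1..T. c / 2 * (\<Sum>a<p. (u a)\<^sup>2))" by simp
        also have "\<dots> \<le> (\<Sum>t = 1..T. \<Sum>a<p. \<Sum>b<p. u a * u b * Z' a b t)"
          by (intro sum_mono Z_pd) auto
        also have "\<dots> = (\<Sum>a<p. \<Sum>t = 1..T. \<Sum>b<p. u a * u b * Z' a b t)" by (rule sum.swap)
        also have "\<dots> = (\<Sum>a<p. \<Sum>b<p. \<Sum>t = 1..T. u a * u b * Z' a b t)" by (intro sum.cong refl sum.swap)
        also have "\<dots> = real T * (\<Sum>a<p. \<Sum>b<p. u a * u b * H T a b)"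
        proof -
          have "(\<Sum>t = 1..T. Z' a b t) = real T * H T a b" for a b using elim by (simp add: H_def)
          then have "(\<Sum>t = 1..T. u a * u b * Z' a b t) = real T * (u a * u b * H T a b)" for a b
            unfolding sum_distrib_left[symmetric] by simp
          then show ?thesis by (simp only: sum_distrib_left)
        qed
        finally show "c / 2 * (\<Sum>a<p. (u a)\<^sup>2) \<le> (\<Sum>a<p. \<Sum>b<p. u a * u b * H T a b)"
          using elim by simp
      qed
    qed
    have "\<forall>\<^sub>F T in sequentially. \<forall>u. c / 2 / 2 * (\<Sum>a<p. (u a)\<^sup>2) \<le> (\<Sum>a<p. \<Sum>b<p. u a * u b * G T a b)"
      by (rule eventually_quadratic_form_ge[OF finite_lessThan _ GH H_pd]) (use c in simp)
    then have "\<forall>\<^sub>F T in sequentially. \<forall>u. c / 4 * (\<Sum>a<p. (u a)\<^sup>2) \<le> mean T (\<lambda>t. (\<Sum>a<p. u a * e a t)\<^sup>2)"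
    proof eventually_elim
      case (elim T)
      show ?case
      proof
        fix u :: "nat \<Rightarrow> real"
        have "(\<Sum>a<p. \<Sum>b<p. u a * u b * G T a b) = (\<Sum>a<p. \<Sum>b<p. \<Sum>t = 1..T. u a * u b * Y a b t) / real T"
          by (simp add: G_def sum_distrib_left sum_divide_distrib)
        also have "(\<Sum>a<p. \<Sum>b<p. \<Sum>t = 1..T. u a * u b * Y a b t) = (\<Sum>a<p. \<Sum>t = 1..T. \<Sum>b<p. u a * u b * Y a b t)"
          by (intro sum.cong refl sum.swap)
        also have "\<dots> = (\<Sum>t = 1..T. \<Sum>a<p. \<Sum>b<p. u a * u b * Y a b t)" by (rule sum.swap)
        also have "\<dots> / real T \<le> mean T (\<lambda>t. (\<Sum>a<p. u a * e a t)\<^sup>2)"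
          unfolding mean_def
        proof (intro divide_right_mono sum_mono)
          fix t assume "t \<in> {1..T}"
          \<comment> \<open>The truncation event is the same for all pairs of components, so it
            keeps or deletes the whole square.\<close>
          have "(\<Sum>a<p. \<Sum>b<p. u a * u b * Y a b t) = (if lsqn (real C) t \<omega> \<le> real B then (\<Sum>a<p. u a * e a (int t))\<^sup>2 else 0)"
            by (simp add: Y_def trunc_def loc_eq power2_eq_square sum_product mult_ac)
          then show "(\<Sum>a<p. \<Sum>b<p. u a * u b * Y a b t) \<le> (\<Sum>a<p. u a * e a (int t))\<^sup>2" by simp
        qed simp
        finally have "(\<Sum>a<p. \<Sum>b<p. u a * u b * G T a b) \<le> mean T (\<lambda>t. (\<Sum>a<p. u a * e a t)\<^sup>2)" .
        then show "c / 4 * (\<Sum>a<p. (u a)\<^sup>2) \<le> mean T (\<lambda>t. (\<Sum>a<p. u a * e a t)\<^sup>2)"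
          using elim[rule_format, of u] by simp
      qed
    qed
    then show "\<exists>c>0. \<forall>\<^sub>F T in sequentially. \<forall>u. c * (\<Sum>a<p. (u a)\<^sup>2) \<le> mean T (\<lambda>t. (\<Sum>a<p. u a * e a t)\<^sup>2)"
      using c by (intro exI[of _ "c / 4"]) auto
  qed
qed

text \<open>Countably many levels \<open>C\<close> and truncation bounds \<open>B\<close> leave a
  single null set. Outside it the finite supremum lies below some natural number \<open>C\<close>,
  and at that level localised and original noise coincide.\<close>

theorem AE_white_noise:
  assumes sup: "AE \<omega> in M. (SUP t\<in>{1..}. cmom t \<omega>) < \<infinity>"
    and low: "AE \<omega> in M. \<exists>c>0. \<forall>\<^sub>F t in sequentially. \<forall>u::nat \<Rightarrow> real. c * (\<Sum>a<p. (u a)\<^sup>2)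
      \<le> (\<Sum>a<p. \<Sum>b<p. u a * u b * real_cond_exp M (F (t - 1)) (\<lambda>\<omega>. \<epsilon> t a \<omega> * \<epsilon> t b \<omega>) \<omega>)"
  shows "AE \<omega> in M. white_noise p (\<lambda>a t. if t \<le> 0 then 0 else \<epsilon> (nat t) a \<omega>)"
proof -
  have 1: "AE \<omega> in M. \<forall>C::nat. \<exists>R. \<forall>\<^sub>F T in sequentially. (\<Sum>t = 1..T. lsqn (real C) t \<omega>) / real T \<le> R"
    unfolding AE_all_countable by (intro allI AE_bounded_average) simp
  have 2: "AE \<omega> in M. \<forall>C::nat. (\<lambda>t. lsqn (real C) t \<omega> / real t) \<longlonglongrightarrow> 0"
    unfolding AE_all_countable by (intro allI AE_lsqn_over_t) simp
  have 3: "AE \<omega> in M. \<forall>C::nat. \<forall>i::nat. \<forall>a b. i \<ge> 1 \<and> a < p \<and> b < p \<longrightarrow>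
      (\<lambda>T. (\<Sum>t = 1..T. loc (real C) t a \<omega> * loc (real C) (t - i) b \<omega>) / real T) \<longlonglongrightarrow> 0"
    unfolding AE_all_countable
  proof (intro allI)
    fix C i a b :: nat
    show "AE \<omega> in M. i \<ge> 1 \<and> a < p \<and> b < p \<longrightarrow>
      (\<lambda>T. (\<Sum>t = 1..T. loc (real C) t a \<omega> * loc (real C) (t - i) b \<omega>) / real T) \<longlonglongrightarrow> 0"
      using AE_lagged_products[of "real C" i a b] by (cases "i \<ge> 1 \<and> a < p \<and> b < p") auto
  qed
  have 4: "AE \<omega> in M. \<forall>C B a b :: nat. (\<lambda>T. (\<Sum>t = 1..T. trunc (real C) B a b t \<omega>
      - real_cond_exp M (F (t - 1)) (trunc (real C) B a b t) \<omega>) / real T) \<longlonglongrightarrow> 0"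
    unfolding AE_all_countable by (intro allI AE_trunc_average) simp
  have 5: "AE \<omega> in M. \<forall>C B a b t :: nat. t \<ge> 1 \<and> a < p \<and> b < p \<and> B \<ge> 1 \<longrightarrow>
      \<bar>real_cond_exp M (F (t - 1)) (trunc (real C) B a b t) \<omega>
        - ind (real C) t \<omega> * real_cond_exp M (F (t - 1)) (\<lambda>\<omega>. \<epsilon> t a \<omega> * \<epsilon> t b \<omega>) \<omega>\<bar> \<le> real C * real B powr (1 - s)"
    unfolding AE_all_countable
  proof (intro allI)
    fix C B a b t :: nat
    show "AE \<omega> in M. t \<ge> 1 \<and> a < p \<and> b < p \<and> B \<ge> 1 \<longrightarrow>
      \<bar>real_cond_exp M (F (t - 1)) (trunc (real C) B a b t) \<omega>
        - ind (real C) t \<omega> * real_cond_exp M (F (t - 1)) (\<lambda>\<omega>. \<epsilon> t a \<omega> * \<epsilon> t b \<omega>) \<omega>\<bar> \<le> real C * real B powr (1 - s)"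
      using AE_trunc_cond_exp[of "real C" t a b B] by (cases "t \<ge> 1 \<and> a < p \<and> b < p \<and> B \<ge> 1") auto
  qed
  from sup low 1 2 3 4 5 show ?thesis
  proof eventually_elim
    case (elim \<omega>)
    define x where "x = enn2real (SUP t\<in>{1..}. cmom t \<omega>)"
    have x: "(SUP t\<in>{1..}. cmom t \<omega>) = ennreal x"
      unfolding x_def by (rule ennreal_enn2real[symmetric]) (use elim(1) in \<open>simp only: infinity_ennreal_def\<close>)
    define C where "C = nat \<lceil>x\<rceil>"
    have xC: "x \<le> real C" by (simp add: C_def real_nat_ceiling_ge)
    show ?case
    proof (rule white_noise_path[of \<omega> C])
      fix t :: nat assume "t \<ge> 1"
      then have "cmom t \<omega> \<le> (SUP t\<in>{1..}. cmom t \<omega>)" by (intro SUP_upper) simp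
      then show "cmom t \<omega> \<le> ennreal (real C)" using x xC by (simp add: ennreal_leI order_trans)
    qed (use elim in auto)
  qed
qed

end

section \<open>Least squares\<close>

lemma mult_mat_vec_index_sum:
  assumes "M \<in> carrier_mat n m" "v \<in> carrier_vec m" "a < n"
  shows "(M *\<^sub>v v) $ a = (\<Sum>i<m. M $$ (a, i) * v $ i)"
  using assms by (auto simp: scalar_prod_def atLeast0LessThan intro!: sum.cong)

lemma matrix_inverse_exists:
  fixes M :: "'a :: field mat"
  assumes M: "M \<in> carrier_mat n n" and det: "Determinant.det M \<noteq> 0"
  shows "\<exists>N \<in> carrier_mat n n. M * N = 1\<^sub>m n \<and> N * M = 1\<^sub>m n"
proof -
  define N where "N = inverse (Determinant.det M) \<cdot>\<^sub>m adj_mat M"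
  note adj = adj_mat[OF M]
  have N: "N \<in> carrier_mat n n" using adj(1) by (simp add: N_def)
  have "M * N = inverse (Determinant.det M) \<cdot>\<^sub>m (M * adj_mat M)"
    unfolding N_def by (rule mult_smult_distrib[OF M adj(1)])
  then have 1: "M * N = 1\<^sub>m n" using det by (simp add: adj(2)) (auto intro!: eq_matI)
  have "N * M = inverse (Determinant.det M) \<cdot>\<^sub>m (adj_mat M * M)"
    unfolding N_def by (rule mult_smult_assoc_mat[OF adj(1) M])
  then have "N * M = 1\<^sub>m n" using det by (simp add: adj(3)) (auto intro!: eq_matI)
  with 1 N show ?thesis by blast
qed

text \<open>The largest \<open>s\<close> for which the form dominates \<open>s\<close> times the
  squared norm is an eigenvalue. Otherwise the shifted matrix would be semidefinite and invertible,
  and its inverse would leave room for a larger \<open>s\<close>. The minimum of the spectrum is at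
  most this \<open>s\<close>.\<close>

lemma smallest_eigenvalue_le_form:
  assumes p: "p \<ge> 1" and sym: "\<And>a b. G a b = G b a"
  shows "smallest_eigenvalue (mat p p (\<lambda>(a, b). G a b)) * (\<Sum>a<p. (u a)\<^sup>2) \<le> (\<Sum>a<p. \<Sum>b<p. u a * u b * G a b)"
proof -
  define A where "A = mat p p (\<lambda>(a, b). G a b)"
  have A: "A \<in> carrier_mat p p" by (simp add: A_def)
  define Q where "Q u = (\<Sum>a<p. \<Sum>b<p. u a * u b * G a b)" for u
  define nn where "nn u = (\<Sum>a<p. (u a)\<^sup>2)" for u :: "nat \<Rightarrow> real"
  define S where "S = {s. \<forall>u. s * nn u \<le> Q u}"
  have nn0: "0 \<le> nn u" for u by (simp add: nn_def sum_nonneg)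
  have prod_le: "\<bar>v a * v b\<bar> \<le> nn v" if "a < p" "b < p" for v a b
  proof -
    have "(v a)\<^sup>2 \<le> nn v" "(v b)\<^sup>2 \<le> nn v"
      unfolding nn_def using that by (auto intro!: member_le_sum[where f = "\<lambda>a. (v a)\<^sup>2"])
    moreover have "2 * \<bar>v a\<bar> * \<bar>v b\<bar> \<le> \<bar>v a\<bar>\<^sup>2 + \<bar>v b\<bar>\<^sup>2" by (rule sum_squares_bound)
    ultimately show ?thesis unfolding abs_mult power2_abs by linarith
  qed
  have bound: "\<bar>\<Sum>a<p. \<Sum>b<p. v a * v b * M a b\<bar> \<le> (\<Sum>a<p. \<Sum>b<p. \<bar>M a b\<bar>) * nn v" for M v
  proof -
    have "\<bar>\<Sum>a<p. \<Sum>b<p. v a * v b * M a b\<bar> \<le> (\<Sum>a<p. \<Sum>b<p. \<bar>v a * v b * M a b\<bar>)"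
      by (intro order.trans[OF sum_abs] sum_mono sum_abs)
    also have "\<dots> \<le> (\<Sum>a<p. \<Sum>b<p. nn v * \<bar>M a b\<bar>)"
      by (intro sum_mono) (auto simp: abs_mult[of "_ * _"] intro!: mult_right_mono prod_le)
    finally show ?thesis by (simp add: sum_distrib_left mult.commute)
  qed
  define e0 where "e0 a = (if a = 0 then 1 else 0 :: real)" for a :: nat
  have nne: "nn e0 = 1"
  proof -
    have "nn e0 = (\<Sum>a<p. if a = 0 then 1 else 0)" unfolding nn_def by (intro sum.cong refl) (simp add: e0_def)
    then show ?thesis using p by simp
  qed
  have bdd: "bdd_above S" unfolding bdd_above_def
    by (rule exI[of _ "Q e0"]) (auto simp: S_def nne dest: spec[of _ e0])
  have "- (\<Sum>a<p. \<Sum>b<p. \<bar>G a b\<bar>) \<in> S"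
    unfolding S_def
  proof (intro CollectI allI)
    fix u :: "nat \<Rightarrow> real"
    have "\<bar>Q u\<bar> \<le> (\<Sum>a<p. \<Sum>b<p. \<bar>G a b\<bar>) * nn u" using bound[where M = G and v = u] by (simp only: Q_def)
    then show "- (\<Sum>a<p. \<Sum>b<p. \<bar>G a b\<bar>) * nn u \<le> Q u" unfolding minus_mult_left[symmetric] by linarith
  qed
  then have ne: "S \<noteq> {}" by blast
  define s where "s = Sup S"
  have s: "s * nn u \<le> Q u" for u
  proof (cases "nn u = 0")
    case True
    then have "\<bar>Q u\<bar> \<le> 0" using bound[where M = G and v = u] by (simp add: Q_def)
    then show ?thesis using True by simp
  next
    case False
    then have pos: "nn u > 0" using nn0[of u] by simp
    have "s \<le> Q u / nn u" unfolding s_def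
      by (rule cSup_least[OF ne]) (use pos in \<open>auto simp: S_def field_simps\<close>)
    then show ?thesis using pos by (simp add: field_simps)
  qed
  define B where "B a b = G a b - (if a = b then s else 0)" for a b
  define QB where "QB u = (\<Sum>a<p. \<Sum>b<p. u a * u b * B a b)" for u
  have QB: "QB u = Q u - s * nn u" for u
  proof -
    have "QB u = Q u - (\<Sum>a<p. \<Sum>b<p. if a = b then s * (u a)\<^sup>2 else 0)"
      unfolding QB_def Q_def B_def sum_subtractf[symmetric]
      by (intro sum.cong refl) (auto simp: power2_eq_square algebra_simps)
    then show ?thesis by (simp add: nn_def sum_distrib_left)
  qed
  have det0: "Determinant.det (mat p p (\<lambda>(a, b). B a b)) = 0"
  proof (rule ccontr)
    assume d: "Determinant.det (mat p p (\<lambda>(a, b). B a b)) \<noteq> 0"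
    obtain N where N: "N \<in> carrier_mat p p" "mat p p (\<lambda>(a, b). B a b) * N = 1\<^sub>m p"
      using matrix_inverse_exists[of "mat p p (\<lambda>(a, b). B a b)" p, OF _ d] by auto
    define H where "H a b = N $$ (a, b)" for a b
    have H: "(\<Sum>c<p. B a c * H c b) = (if a = b then 1 else 0)" if "a < p" "b < p" for a b
    proof -
      have "(mat p p (\<lambda>(a, b). B a b) * N) $$ (a, b) = (\<Sum>c<p. B a c * H c b)"
        using that N(1) by (auto simp: H_def scalar_prod_def atLeast0LessThan intro!: sum.cong)
      then show ?thesis using that by (simp add: N(2))
    qed
    \<comment> \<open>Bounds the quadratic form of the inverse. Testing semidefiniteness at
      \<open>y - \<tau> x\<close> with \<open>\<tau> = K + 1\<close> and \<open>y = H x\<close>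
      gives the gain \<open>1 / (K + 1)\<close>.\<close>
    define K where "K = (\<Sum>a<p. \<Sum>b<p. \<bar>H a b\<bar>)"
    have K: "K \<ge> 0" unfolding K_def by (intro sum_nonneg) auto
    have "s + 1 / (K + 1) \<in> S"
      unfolding S_def
    proof (intro CollectI allI)
      fix x :: "nat \<Rightarrow> real"
      define y where "y a = (\<Sum>b<p. H a b * x b)" for a
      have By: "(\<Sum>b<p. B a b * y b) = x a" if "a < p" for a
      proof -
        have "(\<Sum>b<p. B a b * y b) = (\<Sum>b<p. \<Sum>b'<p. B a b * H b b' * x b')"
          by (simp add: y_def sum_distrib_left mult.assoc)
        also have "\<dots> = (\<Sum>b'<p. (\<Sum>b<p. B a b * H b b') * x b')"
          unfolding sum_distrib_right by (rule sum.swap)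
        also have "\<dots> = (\<Sum>b'<p. if a = b' then x b' else 0)"
          using that by (intro sum.cong refl) (simp add: H)
        finally show ?thesis using that by simp
      qed
      have symB: "B a b = B b a" for a b using sym[of a b] by (simp add: B_def)
      define \<tau> where "\<tau> = K + 1"
      have "0 \<le> QB (\<lambda>a. y a - \<tau> * x a)" using s unfolding QB by simp
      also have "\<dots> = (\<Sum>a<p. y a * (\<Sum>b<p. B a b * y b)) - \<tau> * (\<Sum>a<p. x a * (\<Sum>b<p. B a b * y b))
          - \<tau> * (\<Sum>a<p. \<Sum>b<p. y a * x b * B a b) + \<tau>\<^sup>2 * QB x"
        by (simp add: QB_def sum_distrib_left sum.distrib sum_subtractf algebra_simps power2_eq_square)
      also have "(\<Sum>a<p. \<Sum>b<p. y a * x b * B a b) = (\<Sum>b<p. x b * (\<Sum>a<p. B b a * y a))"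
        by (subst sum.swap) (simp add: sum_distrib_left symB mult_ac)
      also have "(\<Sum>b<p. x b * (\<Sum>a<p. B b a * y a)) = nn x"
        unfolding nn_def by (intro sum.cong refl) (simp add: By power2_eq_square)
      also have "(\<Sum>a<p. y a * (\<Sum>b<p. B a b * y b)) = (\<Sum>a<p. \<Sum>b<p. x a * x b * H a b)"
      proof (intro sum.cong refl)
        fix a assume "a \<in> {..<p}"
        then have "y a * (\<Sum>b<p. B a b * y b) = x a * y a" using By[of a] by simp
        then show "y a * (\<Sum>b<p. B a b * y b) = (\<Sum>b<p. x a * x b * H a b)"
          by (simp add: y_def sum_distrib_left mult_ac)
      qed
      also have "\<dots> \<le> K * nn x" using bound[where M = H and v = x] by (simp add: K_def abs_le_iff)
      finally have "0 \<le> K * nn x - 2 * \<tau> * nn x + \<tau>\<^sup>2 * QB x" by simp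
      then have "\<tau> * nn x \<le> \<tau>\<^sup>2 * QB x" using nn0[of x] by (simp add: \<tau>_def algebra_simps)
      then have "\<tau> * nn x \<le> \<tau> * (\<tau> * QB x)" by (simp add: power2_eq_square mult.assoc)
      then have "nn x \<le> \<tau> * QB x" by (rule mult_left_le_imp_le) (use K in \<open>simp add: \<tau>_def\<close>)
      then have "nn x / \<tau> \<le> QB x" using K by (simp add: \<tau>_def field_simps)
      then show "(s + 1 / (K + 1)) * nn x \<le> Q x" by (simp add: QB \<tau>_def distrib_right)
    qed
    then have "s + 1 / (K + 1) \<le> s" unfolding s_def by (rule cSup_upper[OF _ bdd])
    then show False using K by simp
  qed
  have "char_matrix A s = mat p p (\<lambda>(a, b). B a b)"
    unfolding char_matrix_def by (intro eq_matI) (auto simp: A_def B_def)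
  then have "eigenvalue A s" using eigenvalue_det[OF A] det0 by simp
  then have "s \<in> spectrum A" by (simp add: spectrum_def)
  then have "Min (spectrum A) \<le> s" using card_finite_spectrum(1)[OF A] by (intro Min_le) auto
  then have "Min (spectrum A) * nn u \<le> s * nn u" using nn0 by (intro mult_right_mono) auto
  then show ?thesis using s[of u] by (simp add: smallest_eigenvalue_def A_def nn_def Q_def)
qed

section \<open>Regressor vectors and normal equations\<close>

lemma lag_vec_carrier:
  "(\<And>l. 1 \<le> l \<Longrightarrow> l \<le> j \<Longrightarrow> x (t - int l) \<in> carrier_vec p) \<Longrightarrow> lag_vec x t j \<in> carrier_vec (p * j)"
proof (induction j)
  case (Suc j)
  have "lag_vec x t j \<in> carrier_vec (p * j)" by (rule Suc.IH) (rule Suc.prems, auto)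
  moreover have "x (t - int (Suc j)) \<in> carrier_vec p" by (rule Suc.prems) auto
  ultimately have "lag_vec x t (Suc j) \<in> carrier_vec (p * j + p)" unfolding lag_vec.simps by (rule append_carrier_vec)
  then show ?case by (simp add: add.commute)
qed simp

text \<open>Blocks are numbered from 0 and lags from 1, hence \<open>Suc l\<close>.\<close>

lemma lag_vec_index:
  assumes "\<And>l. 1 \<le> l \<Longrightarrow> l \<le> j \<Longrightarrow> x (t - int l) \<in> carrier_vec p" and "l < j" "b < p"
  shows "lag_vec x t j $ (p * l + b) = x (t - int (Suc l)) $ b"
  using assms
proof (induction j)
  case (Suc j)
  have "lag_vec x t j \<in> carrier_vec (p * j)" by (rule lag_vec_carrier) (rule Suc.prems, auto)
  moreover have "x (t - int (Suc j)) \<in> carrier_vec p" by (rule Suc.prems) auto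
  ultimately have c: "dim_vec (lag_vec x t j) = p * j" "dim_vec (x (t - int (Suc j))) = p" by auto
  show ?case
  proof (cases "l < j")
    case True
    have "p * l + b < p * Suc l" using \<open>b < p\<close> by simp
    also have "\<dots> \<le> p * j" using True by (intro mult_le_mono2) simp
    finally have lt: "p * l + b < p * j" .
    then have "lag_vec x t (Suc j) $ (p * l + b) = lag_vec x t j $ (p * l + b)"
      unfolding lag_vec.simps using c by (subst index_append_vec(1)) auto
    also have "\<dots> = x (t - int (Suc l)) $ b"
      by (rule Suc.IH) (use True \<open>b < p\<close> in \<open>auto intro!: Suc.prems(1)\<close>)
    finally show ?thesis .
  next
    case False
    then have [simp]: "l = j" using Suc.prems by simp
    show ?thesis unfolding lag_vec.simps using c \<open>b < p\<close> by (subst index_append_vec(1)) auto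
  qed
qed simp

lemma sum_block_index:
  fixes f :: "nat \<Rightarrow> real"
  shows "(\<Sum>i<p * j + d. f i) = (\<Sum>l<j. \<Sum>b<p. f (p * l + b)) + (\<Sum>c<d. f (p * j + c))"
proof -
  have split: "(\<Sum>i<m + n. f i) = (\<Sum>i<m. f i) + (\<Sum>i<n. f (m + i))" for m n
    by (induction n) simp_all
  have "(\<Sum>i<p * j. f i) = (\<Sum>l<j. \<Sum>b<p. f (p * l + b))" for j
  proof (induction j)
    case (Suc j)
    have "(\<Sum>i<p * Suc j. f i) = (\<Sum>i<p * j + p. f i)" by (simp add: add.commute)
    then show ?case by (simp add: split Suc)
  qed simp
  then show ?thesis by (simp add: split)
qed

lemma sum_of_squares_eq:
  assumes "B \<in> carrier_mat p n" and "\<And>t. 1 \<le> t \<Longrightarrow> t \<le> T \<Longrightarrow> x (int t) \<in> carrier_vec p"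
    and "\<And>t. 1 \<le> t \<Longrightarrow> t \<le> T \<Longrightarrow> regressor x D j t \<in> carrier_vec n"
  shows "sum_of_squares x D j T B
    = (\<Sum>a<p. \<Sum>t = 1..T. (x (int t) $ a - (\<Sum>i<n. B $$ (a, i) * regressor x D j t $ i))\<^sup>2)"
proof -
  have "sum_of_squares x D j T B
    = (\<Sum>t = 1..T. \<Sum>a<p. (x (int t) $ a - (\<Sum>i<n. B $$ (a, i) * regressor x D j t $ i))\<^sup>2)"
    unfolding sum_of_squares_def Let_def
  proof (intro sum.cong refl)
    fix t assume "t \<in> {1..T}"
    then have c: "x (int t) \<in> carrier_vec p" "regressor x D j t \<in> carrier_vec n" using assms by auto
    show "(x (int t) - B *\<^sub>v regressor x D j t) \<bullet> (x (int t) - B *\<^sub>v regressor x D j t)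
      = (\<Sum>a<p. (x (int t) $ a - (\<Sum>i<n. B $$ (a, i) * regressor x D j t $ i))\<^sup>2)"
    proof -
      have d: "dim_vec (x (int t)) = p" "dim_vec (B *\<^sub>v regressor x D j t) = p" using c(1) assms(1) by auto
      show ?thesis unfolding scalar_prod_def index_minus_vec(2) d(2) atLeast0LessThan
      proof (rule sum.cong[OF refl])
        fix a assume "a \<in> {..<p}"
        then have "(x (int t) - B *\<^sub>v regressor x D j t) $ a = x (int t) $ a - (\<Sum>i<n. B $$ (a, i) * regressor x D j t $ i)"
          using d mult_mat_vec_index_sum[OF assms(1) c(2), of a] by (simp del: index_mult_mat_vec)
        then show "(x (int t) - B *\<^sub>v regressor x D j t) $ a * (x (int t) - B *\<^sub>v regressor x D j t) $ a
          = (x (int t) $ a - (\<Sum>i<n. B $$ (a, i) * regressor x D j t $ i))\<^sup>2"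
          by (simp only: power2_eq_square)
      qed
    qed
  qed
  then show ?thesis by (simp only: sum.swap[of _ "{..<p}" "{1..T}"])
qed

text \<open>A projection solves the normal equations and therefore minimises, so the choice made by
  \<open>arg_min\<close> is a genuine minimiser. Varying one entry of that choice then gives the
  normal equations for it, whichever minimiser it is.\<close>

lemma ls_coeff_normal_equations:
  assumes x: "\<And>t. 1 \<le> t \<Longrightarrow> t \<le> T \<Longrightarrow> x (int t) \<in> carrier_vec p"
    and reg: "\<And>t. 1 \<le> t \<Longrightarrow> t \<le> T \<Longrightarrow> regressor x D j t \<in> carrier_vec (p * j + d)"
  shows "ls_coeff p d x D j T \<in> carrier_mat p (p * j + d)"
    and "a < p \<Longrightarrow> i < p * j + d \<Longrightarrow>
      (\<Sum>t = 1..T. (x (int t) $ a - (\<Sum>i<p * j + d. ls_coeff p d x D j T $$ (a, i) * regressor x D j t $ i))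
        * regressor x D j t $ i) = 0"
proof -
  define n where "n = p * j + d"
  define s where "s i t = regressor x D j t $ i" for i t
  define L where "L = ls_coeff p d x D j T"
  define f where "f = sum_of_squares x D j T"
  define res where "res B a t = x (int t) $ a - (\<Sum>i<n. B $$ (a, i) * s i t)" for B :: "real mat" and a t
  have f_eq: "f B = (\<Sum>a<p. \<Sum>t = 1..T. (res B a t)\<^sup>2)" if "B \<in> carrier_mat p n" for B
    unfolding f_def res_def s_def by (rule sum_of_squares_eq[OF that]) (use x reg in \<open>auto simp: n_def\<close>)
  have "\<forall>a. \<exists>w. \<forall>i<n. (\<Sum>t\<in>{1..T}. (x (int t) $ a - (\<Sum>i<n. w i * s i t)) * s i t) = 0"
    by (intro allI projection_exists) simp
  from choice[OF this]
  obtain w where w: "\<And>a i. i < n \<Longrightarrow> (\<Sum>t\<in>{1..T}. (x (int t) $ a - (\<Sum>i<n. w a i * s i t)) * s i t) = 0"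
    by blast
  define W where "W = mat p n (\<lambda>(a, i). w a i)"
  have W: "W \<in> carrier_mat p n" by (simp add: W_def)
  have W_orth: "(\<Sum>t = 1..T. res W a t * s i t) = 0" if "a < p" "i < n" for a i
    using w[OF that(2), of a] that by (simp add: res_def W_def)
  have W_min: "f W \<le> f B" if B: "B \<in> carrier_mat p n" for B
    unfolding f_eq[OF W] f_eq[OF B]
  proof (rule sum_mono)
    fix a assume a: "a \<in> {..<p}"
    have diff: "res B a t = res W a t + (\<Sum>i<n. (W $$ (a, i) - B $$ (a, i)) * s i t)" for t
      by (simp add: res_def left_diff_distrib sum_subtractf)
    have "(\<Sum>t = 1..T. res W a t * (\<Sum>i<n. (W $$ (a, i) - B $$ (a, i)) * s i t))
      = (\<Sum>i<n. (W $$ (a, i) - B $$ (a, i)) * (\<Sum>t = 1..T. res W a t * s i t))"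
      unfolding sum_distrib_left by (subst sum.swap) (simp add: mult_ac)
    also have "\<dots> = 0" using W_orth a by simp
    finally have z: "(\<Sum>t = 1..T. res W a t * (\<Sum>i<n. (W $$ (a, i) - B $$ (a, i)) * s i t)) = 0" .
    have "(\<Sum>t = 1..T. (res B a t)\<^sup>2) = (\<Sum>t = 1..T. (res W a t)\<^sup>2)
        + 2 * (\<Sum>t = 1..T. res W a t * (\<Sum>i<n. (W $$ (a, i) - B $$ (a, i)) * s i t))
        + (\<Sum>t = 1..T. (\<Sum>i<n. (W $$ (a, i) - B $$ (a, i)) * s i t)\<^sup>2)"
      unfolding sum_distrib_left sum.distrib[symmetric] diff power2_sum by (intro sum.cong refl) (simp only: ac_simps)
    then show "(\<Sum>t = 1..T. (res W a t)\<^sup>2) \<le> (\<Sum>t = 1..T. (res B a t)\<^sup>2)"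
      using z by (simp add: sum_nonneg)
  qed
  have "is_arg_min f (\<lambda>B. B \<in> carrier_mat p n) W"
    unfolding is_arg_min_def using W W_min by (auto simp: not_less)
  then have "is_arg_min f (\<lambda>B. B \<in> carrier_mat p n) L"
    unfolding L_def ls_coeff_def arg_min_def n_def[symmetric] f_def[symmetric] by (rule someI)
  then have L: "L \<in> carrier_mat p n" and L_min: "\<And>B. B \<in> carrier_mat p n \<Longrightarrow> f L \<le> f B"
    by (auto simp: is_arg_min_def not_less)
  then show "ls_coeff p d x D j T \<in> carrier_mat p (p * j + d)" by (simp add: L_def n_def)
  assume a: "a < p" and "i < p * j + d"
  then have i: "i < n" by (simp add: n_def)
  define c where "c = (\<Sum>t = 1..T. res L a t * s i t)"
  define q where "q = (\<Sum>t = 1..T. (s i t)\<^sup>2)"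
  have q: "q \<ge> 0" by (simp add: q_def sum_nonneg)
  \<comment> \<open>Moving the entry at \<open>(a, i)\<close> by \<open>\<delta>\<close> changes the
    sum of squares by exactly this quadratic polynomial.\<close>
  have var: "0 \<le> - 2 * \<delta> * c + \<delta>\<^sup>2 * q" for \<delta>
  proof -
    define B where "B = mat p n (\<lambda>(a', i'). L $$ (a', i') + (if a' = a \<and> i' = i then \<delta> else 0))"
    have B: "B \<in> carrier_mat p n" by (simp add: B_def)
    have resB: "res B a' t = res L a' t - (if a' = a then \<delta> * s i t else 0)" if "a' < p" for a' t
    proof -
      have "(\<Sum>i'<n. B $$ (a', i') * s i' t)
        = (\<Sum>i'<n. L $$ (a', i') * s i' t + (if i' = i then (if a' = a then \<delta> * s i t else 0) else 0))"
      proof (intro sum.cong refl)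
        fix i' assume "i' \<in> {..<n}"
        then show "B $$ (a', i') * s i' t = L $$ (a', i') * s i' t + (if i' = i then (if a' = a then \<delta> * s i t else 0) else 0)"
          using that by (cases "a' = a \<and> i' = i") (auto simp: B_def distrib_right)
      qed
      also have "\<dots> = (\<Sum>i'<n. L $$ (a', i') * s i' t) + (if a' = a then \<delta> * s i t else 0)"
        unfolding sum.distrib using i by (subst sum.delta) auto
      finally show ?thesis unfolding res_def by (simp only: diff_diff_eq)
    qed
    have "f B = (\<Sum>a'<p. (\<Sum>t = 1..T. (res L a' t)\<^sup>2) + (if a' = a then - 2 * \<delta> * c + \<delta>\<^sup>2 * q else 0))"
      unfolding f_eq[OF B]
    proof (intro sum.cong refl)
      have "(\<Sum>t = 1..T. (res L a t - \<delta> * s i t)\<^sup>2)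
        = (\<Sum>t = 1..T. (res L a t)\<^sup>2 + (- 2 * \<delta>) * (res L a t * s i t) + \<delta>\<^sup>2 * (s i t)\<^sup>2)"
        by (intro sum.cong refl) (simp add: power2_diff power_mult_distrib)
      then have "(\<Sum>t = 1..T. (res L a t - \<delta> * s i t)\<^sup>2) = (\<Sum>t = 1..T. (res L a t)\<^sup>2) + (- 2 * \<delta> * c + \<delta>\<^sup>2 * q)"
        unfolding c_def q_def by (simp only: sum.distrib sum_distrib_left[symmetric] add.assoc)
      moreover fix a' assume "a' \<in> {..<p}"
      ultimately show "(\<Sum>t = 1..T. (res B a' t)\<^sup>2) = (\<Sum>t = 1..T. (res L a' t)\<^sup>2) + (if a' = a then - 2 * \<delta> * c + \<delta>\<^sup>2 * q else 0)"
        by (cases "a' = a") (simp_all add: resB)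
    qed
    also have "\<dots> = f L + (- 2 * \<delta> * c + \<delta>\<^sup>2 * q)" using a by (simp add: sum.distrib f_eq[OF L])
    finally show ?thesis using L_min[OF B] by simp
  qed
  have "c = 0"
  proof (rule ccontr)
    assume "c \<noteq> 0"
    \<comment> \<open>Close to the minimiser \<open>c / q\<close> of the parabola;
      \<open>q + 1\<close> also covers a regressor that is zero throughout the sample.\<close>
    define \<delta> where "\<delta> = c / (q + 1)"
    have \<delta>: "\<delta> * (q + 1) = c" using q by (simp add: \<delta>_def)
    have "- 2 * \<delta> * c + \<delta>\<^sup>2 * q = - (\<delta>\<^sup>2 * (q + 2))"
      unfolding \<delta>[symmetric] by (simp add: power2_eq_square algebra_simps)
    moreover have "\<delta>\<^sup>2 * (q + 2) > 0" using q \<open>c \<noteq> 0\<close> by (intro mult_pos_pos) (auto simp: \<delta>_def)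
    ultimately show False using var[of \<delta>] by linarith
  qed
  then show "(\<Sum>t = 1..T. (x (int t) $ a - (\<Sum>i<p * j + d. ls_coeff p d x D j T $$ (a, i) * regressor x D j t $ i))
        * regressor x D j t $ i) = 0"
    by (simp add: c_def res_def L_def s_def n_def)
qed

section \<open>Deterministic terms\<close>

text \<open>An eigenvector of \<open>E\<close> is one of its inverse \<open>N\<close> with the
  reciprocal eigenvalue, and the eigenvalues of \<open>N\<close> lie on the unit circle.\<close>

lemma spectral_radius_inverse_le_1:
  fixes E :: "complex mat"
  assumes E: "E \<in> carrier_mat n n" and N: "N \<in> carrier_mat n n" "N * E = 1\<^sub>m n"
    and eig: "\<And>z. eigenvalue N z \<Longrightarrow> cmod z = 1" and n: "n > 0"
  shows "spectral_radius E \<le> 1"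
proof -
  obtain z where z: "eigenvalue E z" "spectral_radius E = cmod z"
    using spectral_radius_mem_max(1)[OF E n] by (auto simp: spectrum_def)
  then obtain v where v: "v \<in> carrier_vec n" "v \<noteq> 0\<^sub>v n" "E *\<^sub>v v = z \<cdot>\<^sub>v v"
    using E by (auto simp: eigenvalue_def eigenvector_def)
  have "N *\<^sub>v (E *\<^sub>v v) = v" using v(1) N E by (simp flip: assoc_mult_mat_vec)
  then have 1: "z \<cdot>\<^sub>v (N *\<^sub>v v) = v" using v N(1) by (simp add: mult_mat_vec)
  have "z \<noteq> 0"
  proof
    assume "z = 0"
    have "v = 0\<^sub>v n"
    proof (intro eq_vecI)
      fix i assume "i < dim_vec (0\<^sub>v n :: complex vec)"
      then have i: "i < n" "i < dim_vec (N *\<^sub>v v)" using N(1) by auto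
      have "v $ i = (z \<cdot>\<^sub>v (N *\<^sub>v v)) $ i" by (simp only: 1)
      also have "\<dots> = 0" using i(2) unfolding \<open>z = 0\<close> by (simp only: index_smult_vec mult_zero_left)
      finally show "v $ i = 0\<^sub>v n $ i" using i(1) by simp
    qed (use v(1) in auto)
    then show False using v(2) by simp
  qed
  have "N *\<^sub>v v = (inverse z * z) \<cdot>\<^sub>v (N *\<^sub>v v)" using \<open>z \<noteq> 0\<close> by simp
  also have "\<dots> = inverse z \<cdot>\<^sub>v (z \<cdot>\<^sub>v (N *\<^sub>v v))" by (simp only: smult_smult_assoc)
  also have "\<dots> = inverse z \<cdot>\<^sub>v v" by (simp only: 1)
  finally have "eigenvalue N (inverse z)" using v N(1) by (auto simp: eigenvalue_def eigenvector_def)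
  then have "cmod (inverse z) = 1" by (rule eig)
  then show ?thesis by (simp add: z(2) norm_inverse)
qed

text \<open>Eigenvalues of modulus one make the matrix invertible, so the recursion also runs
  backwards. By the rank condition the first \<open>d\<close> vectors form a basis, in which
  \<open>D (Suc d)\<close> has coordinates \<open>u\<close>; the matrix carries this single relation
  to all times, as the scalar recursion \<open>PD\<close>. Backward growth is polynomial because the
  inverse has spectral radius at most 1.\<close>

lemma deterministic_term_extension:
  assumes Dm: "Dmat \<in> carrier_mat d d" and Dc: "\<And>t. t \<ge> 1 \<Longrightarrow> D t \<in> carrier_vec d"
    and rec: "\<And>t. t \<ge> 1 \<Longrightarrow> D (Suc t) = Dmat *\<^sub>v D t"
    and eig: "\<And>z. eigenvalue (map_mat complex_of_real Dmat) z \<Longrightarrow> cmod z = 1"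
    and rank: "vec_space.rank d (mat_of_cols d (map D [1..<Suc d])) = d"
  obtains Dx S PD where "\<And>c t. c < d \<Longrightarrow> t \<ge> 1 \<Longrightarrow> Dx c (int t) = D t $ c" and "coeff PD 0 = 1"
    and "\<And>c t. c < d \<Longrightarrow> lag_op PD (Dx c) t = 0"
    and "\<And>c t i. c < d \<Longrightarrow> Dx c (t - int i) = (\<Sum>c'<d. S i c c' * Dx c' t)"
    and "\<exists>C m. \<forall>c<d. \<forall>n. \<bar>Dx c (- int n)\<bar> \<le> C * (1 + real n) ^ m"
proof -
  define N where "N = map_mat complex_of_real Dmat"
  have N: "N \<in> carrier_mat d d" using Dm by (simp add: N_def)
  have "char_matrix N 0 = N" using N by (auto simp: char_matrix_def intro!: eq_matI)
  then have "Determinant.det N \<noteq> 0" using eig[of 0] eigenvalue_det[OF N, of 0] by (auto simp: N_def)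
  then have "Determinant.det Dmat \<noteq> 0" unfolding N_def of_real_hom.hom_det by simp
  then obtain E where E: "E \<in> carrier_mat d d" "Dmat * E = 1\<^sub>m d" "E * Dmat = 1\<^sub>m d"
    using matrix_inverse_exists[OF Dm] by auto
  \<comment> \<open>\<open>W n\<close> is the term at time \<open>1 - n\<close>; the two branches of
    \<open>V\<close> are glued at time 1.\<close>
  define W where "W n = ((\<lambda>v. E *\<^sub>v v) ^^ n) (D 1)" for n
  define V where "V t = (if t \<ge> 1 then D (nat t) else W (nat (1 - t)))" for t :: int
  have Wc: "W n \<in> carrier_vec d" for n by (induction n) (use Dc[of 1] E(1) in \<open>auto simp: W_def\<close>)
  have Vc: "V t \<in> carrier_vec d" for t using Wc Dc by (auto simp: V_def)
  have V_prev: "V (t - 1) = E *\<^sub>v V t" for t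
  proof (cases "t \<ge> 2")
    case True
    then have "nat t = Suc (nat (t - 1))" by simp
    then have "D (nat t) = Dmat *\<^sub>v D (nat (t - 1))" using rec[of "nat (t - 1)"] True by simp
    then have "E *\<^sub>v D (nat t) = E *\<^sub>v (Dmat *\<^sub>v D (nat (t - 1)))" by simp
    also have "\<dots> = (E * Dmat) *\<^sub>v D (nat (t - 1))"
      using E(1) Dm Dc[of "nat (t - 1)"] True by (intro assoc_mult_mat_vec[symmetric]) auto
    also have "\<dots> = D (nat (t - 1))" using Dc[of "nat (t - 1)"] True by (simp add: E(3))
    finally show ?thesis using True by (simp add: V_def)
  next
    case False
    then have "nat (1 - (t - 1)) = Suc (nat (1 - t))" by simp
    moreover have "V t = W (nat (1 - t))"
    proof (cases "t = 1")
      case False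
      then show ?thesis using \<open>\<not> t \<ge> 2\<close> by (simp add: V_def)
    qed (simp add: V_def W_def)
    ultimately show ?thesis using False by (simp add: V_def W_def)
  qed
  have V_next: "V t = Dmat *\<^sub>v V (t - 1)" for t
  proof -
    have "Dmat *\<^sub>v V (t - 1) = (Dmat * E) *\<^sub>v V t"
      unfolding V_prev by (rule assoc_mult_mat_vec[symmetric, OF Dm E(1) Vc])
    then show ?thesis using Vc by (simp add: E(2))
  qed
  have V_shift: "V (t - int i) = (E ^\<^sub>m i) *\<^sub>v V t" for t i
  proof (induction i arbitrary: t)
    case 0
    then show ?case using Vc[of t] E(1) by simp
  next
    case (Suc i)
    have "V (t - int (Suc i)) = V (t - 1 - int i)" by (rule arg_cong[of _ _ V]) simp
    also have "\<dots> = (E ^\<^sub>m i) *\<^sub>v (E *\<^sub>v V t)" unfolding Suc V_prev[of t] ..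
    also have "\<dots> = (E ^\<^sub>m i * E) *\<^sub>v V t"
      by (rule assoc_mult_mat_vec[symmetric, OF pow_carrier_mat[OF E(1)] E(1) Vc])
    finally show ?case by simp
  qed
  define Dx where "Dx c t = V t $ c" for c t
  define S where "S i c c' = (E ^\<^sub>m i) $$ (c, c')" for i c c'
  have mv: "(M *\<^sub>v v) $ c = (\<Sum>c'<d. M $$ (c, c') * v $ c')"
    if "M \<in> carrier_mat d d" "v \<in> carrier_vec d" "c < d" for M :: "real mat" and v c
    using that by (auto simp: scalar_prod_def atLeast0LessThan intro!: sum.cong)
  have 1: "Dx c (int t) = D t $ c" if "t \<ge> 1" for c t using that by (simp add: Dx_def V_def)
  have 2: "Dx c (t - int i) = (\<Sum>c'<d. S i c c' * Dx c' t)" if "c < d" for c t i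
    unfolding Dx_def S_def V_shift by (rule mv[OF pow_carrier_mat[OF E(1)] Vc that])
  have prev: "Dx c (t - 1) = (\<Sum>c'<d. E $$ (c, c') * Dx c' t)" if "c < d" for c t
    unfolding Dx_def V_prev by (rule mv[OF E(1) Vc that])
  have nxt: "Dx c t = (\<Sum>c'<d. Dmat $$ (c, c') * Dx c' (t - 1))" if "c < d" for c t
    using V_next[of t] mv[OF Dm Vc that] unfolding Dx_def by metis
  define G where "G = mat_of_cols d (map D [1..<Suc d])"
  have G: "G \<in> carrier_mat d d" 
    unfolding G_def using mat_of_cols_carrier(1)[of d "map D [1..<Suc d]"] by (simp del: upt_Suc)
  have "Determinant.det G \<noteq> 0" using rank vec_space.det_rank_iff[OF G] by (simp add: G_def)
  then obtain H where H: "H \<in> carrier_mat d d" "G * H = 1\<^sub>m d"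
    using matrix_inverse_exists[OF G] by auto
  define u where "u = H *\<^sub>v D (Suc d)"
  have u: "u \<in> carrier_vec d" using H(1) Dc[of "Suc d"] by (simp add: u_def)
  have "G *\<^sub>v u = (G * H) *\<^sub>v D (Suc d)"
    unfolding u_def by (rule assoc_mult_mat_vec[symmetric, OF G H(1)]) (simp add: Dc)
  then have Gu: "G *\<^sub>v u = D (Suc d)" using Dc[of "Suc d"] by (simp add: H(2))
  \<comment> \<open>\<open>D (Suc i)\<close> lies \<open>d - i\<close> steps before
    \<open>D (Suc d)\<close>. These lags are at least 1, so the constant term is 1.\<close>
  define PD where "PD = 1 - (\<Sum>i<d. monom (u $ i) (d - i))"
  have PD0: "coeff PD 0 = 1" by (simp add: PD_def coeff_sum coeff_monom)
  have PDh: "lag_op PD y t = y t - (\<Sum>i<d. u $ i * y (t - int (d - i)))" for y t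
  proof -
    have "lag_op PD y t + lag_op (\<Sum>i<d. monom (u $ i) (d - i)) y t = lag_op 1 y t"
      unfolding lag_op_add[symmetric] by (simp add: PD_def)
    then show ?thesis by (simp add: lag_op_sum lag_op_monom)
  qed
  define hh where "hh c t = lag_op PD (Dx c) t" for c t
  have base: "hh c (int (Suc d)) = 0" if "c < d" for c
  proof -
    have "D (Suc d) $ c = (\<Sum>i<d. G $$ (c, i) * u $ i)" using mv[OF G u that] by (simp only: Gu)
    also have "\<dots> = (\<Sum>i<d. u $ i * D (Suc i) $ c)"
      using that by (intro sum.cong refl) (simp add: G_def mat_of_cols_index del: upt_Suc)
    also have "\<dots> = (\<Sum>i<d. u $ i * Dx c (int (Suc d) - int (d - i)))"
    proof (intro sum.cong refl)
      fix i assume "i \<in> {..<d}"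
      then have "int (Suc d) - int (d - i) = int (Suc i)" by auto
      then show "u $ i * D (Suc i) $ c = u $ i * Dx c (int (Suc d) - int (d - i))" by (simp only: 1)
    qed
    finally show ?thesis unfolding hh_def PDh using 1[of "Suc d" c] by simp
  qed
  have 3: "\<forall>c<d. hh c t = 0" for t
  proof (induction t rule: int_induct[where k = "int (Suc d)"])
    case base
    then show ?case using \<open>\<And>c. c < d \<Longrightarrow> hh c (int (Suc d)) = 0\<close> by blast
  next
    case (step1 t)
    show ?case
    proof (intro allI impI)
      fix c assume c: "c < d"
      have "hh c (t + 1) = lag_op PD (\<lambda>s. Dx c (s - (- 1))) t"
        unfolding hh_def lag_op_shift by simp
      also have "(\<lambda>s. Dx c (s - (- 1))) = (\<lambda>s. \<Sum>c'<d. Dmat $$ (c, c') * Dx c' s)"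
        using nxt[OF c] by (auto simp: fun_eq_iff)
      finally show "hh c (t + 1) = 0" using step1(2) by (simp add: lag_op_fun_sum lag_op_fun_cmult hh_def)
    qed
  next
    case (step2 t)
    show ?case
    proof (intro allI impI)
      fix c assume c: "c < d"
      have "hh c (t - 1) = lag_op PD (\<lambda>s. Dx c (s - 1)) t"
        unfolding hh_def lag_op_shift by simp
      also have "(\<lambda>s. Dx c (s - 1)) = (\<lambda>s. \<Sum>c'<d. E $$ (c, c') * Dx c' s)"
        using prev[OF c] by (auto simp: fun_eq_iff)
      finally show "hh c (t - 1) = 0" using step2(2) by (simp add: lag_op_fun_sum lag_op_fun_cmult hh_def)
    qed
  qed
  have 4: "\<exists>C m. \<forall>c<d. \<forall>n. \<bar>Dx c (- int n)\<bar> \<le> C * (1 + real n) ^ m"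
  proof (cases "d = 0")
    case False
    define Ec where "Ec = map_mat complex_of_real E"
    have Ec: "Ec \<in> carrier_mat d d" using E(1) by (simp add: Ec_def)
    have "N * Ec = map_mat complex_of_real (Dmat * E)"
      unfolding N_def Ec_def by (rule of_real_hom.mat_hom_mult[OF Dm E(1), symmetric])
    then have "N * Ec = 1\<^sub>m d" by (simp add: E(2) of_real_hom.mat_hom_one)
    then have "spectral_radius Ec \<le> 1"
      by (rule spectral_radius_inverse_le_1[OF Ec N]) (use eig False in \<open>auto simp: N_def\<close>)
    from spectral_radius_jnf_norm_bound_le_1_upper_triangular[OF Ec this]
    obtain c1 c2 where b: "\<And>k. norm_bound (Ec ^\<^sub>m k) (c1 + c2 * real k ^ (d - 1))" by auto
    have Eb: "\<bar>(E ^\<^sub>m k) $$ (c, c')\<bar> \<le> (\<bar>c1\<bar> + \<bar>c2\<bar>) * (1 + real k) ^ (d - 1)" if "c < d" "c' < d" for k c c'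
    proof -
      note dim = carrier_matD[OF pow_carrier_mat[OF E(1), of k]] and dimc = carrier_matD[OF pow_carrier_mat[OF Ec, of k]]
      have "Ec ^\<^sub>m k = map_mat complex_of_real (E ^\<^sub>m k)" unfolding Ec_def by (rule of_real_hom.mat_hom_pow[OF E(1), symmetric])
      then have "(Ec ^\<^sub>m k) $$ (c, c') = complex_of_real ((E ^\<^sub>m k) $$ (c, c'))"
        using that dim by (simp only: index_map_mat)
      moreover have "norm ((Ec ^\<^sub>m k) $$ (c, c')) \<le> c1 + c2 * real k ^ (d - 1)"
        using b[of k, unfolded norm_bound_def dimc] that by blast
      ultimately have "\<bar>(E ^\<^sub>m k) $$ (c, c')\<bar> \<le> c1 + c2 * real k ^ (d - 1)" by (simp only: norm_of_real)
      also have "\<dots> \<le> \<bar>c1\<bar> * (1 + real k) ^ (d - 1) + \<bar>c2\<bar> * (1 + real k) ^ (d - 1)"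
      proof (rule add_mono)
        have "1 \<le> (1 + real k) ^ (d - 1)" by (rule one_le_power) simp
        then have "\<bar>c1\<bar> * 1 \<le> \<bar>c1\<bar> * (1 + real k) ^ (d - 1)" by (intro mult_left_mono) auto
        then show "c1 \<le> \<bar>c1\<bar> * (1 + real k) ^ (d - 1)" by linarith
        show "c2 * real k ^ (d - 1) \<le> \<bar>c2\<bar> * (1 + real k) ^ (d - 1)"
          by (intro mult_mono power_mono) auto
      qed
      finally show ?thesis by (simp add: distrib_right)
    qed
    define C0 where "C0 = \<bar>c1\<bar> + \<bar>c2\<bar>"
    have C0: "C0 \<ge> 0" by (simp add: C0_def)
    show ?thesis
    proof (intro exI allI impI)
      fix c n assume c: "c < d"
      have "1 - int (Suc n) = - int n" by simp
      with 2[OF c, of 1 "Suc n"] have "Dx c (- int n) = (\<Sum>c'<d. S (Suc n) c c' * Dx c' 1)" by (simp only:)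
      then have "\<bar>Dx c (- int n)\<bar> = \<bar>\<Sum>c'<d. S (Suc n) c c' * Dx c' 1\<bar>" by (rule arg_cong)
      also have "\<dots> \<le> (\<Sum>c'<d. \<bar>S (Suc n) c c'\<bar> * \<bar>Dx c' 1\<bar>)"
        unfolding abs_mult[symmetric] by (rule sum_abs)
      also have "\<dots> \<le> (\<Sum>c'<d. (C0 * (2 * (1 + real n)) ^ (d - 1)) * \<bar>Dx c' 1\<bar>)"
      proof (intro sum_mono mult_right_mono abs_ge_zero)
        fix c' assume "c' \<in> {..<d}"
        then have "\<bar>S (Suc n) c c'\<bar> \<le> C0 * (1 + real (Suc n)) ^ (d - 1)" unfolding S_def C0_def using c by (intro Eb) auto
        also have "\<dots> \<le> C0 * (2 * (1 + real n)) ^ (d - 1)" using C0 by (intro mult_left_mono power_mono) auto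
        finally show "\<bar>S (Suc n) c c'\<bar> \<le> C0 * (2 * (1 + real n)) ^ (d - 1)" .
      qed
      also have "\<dots> = (C0 * 2 ^ (d - 1) * (\<Sum>c'<d. \<bar>Dx c' 1\<bar>)) * (1 + real n) ^ (d - 1)"
        unfolding sum_distrib_left[symmetric] power_mult_distrib by (simp only: mult_ac)
      finally show "\<bar>Dx c (- int n)\<bar> \<le> (C0 * 2 ^ (d - 1) * (\<Sum>c'<d. \<bar>Dx c' 1\<bar>)) * (1 + real n) ^ (d - 1)" .
    qed
  qed simp
  show ?thesis
  proof (rule that)
    show "lag_op PD (Dx c) t = 0" if "c < d" for c t using 3 that by (simp add: hh_def)
  qed (rule 1 PD0 2 4, assumption?)+
qed

section \<open>The information criterion\<close>

lemma block_index_less: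
  fixes b l i p :: nat
  assumes "l < i" "b < p"
  shows "p * l + b < p * i"
proof -
  have "p * l + b < p * Suc l" using assms by simp
  also have "\<dots> \<le> p * i" using assms by (intro mult_le_mono2) simp
  finally show ?thesis .
qed

text \<open>Connects the observed vectors with the scalar path extended by zero. For orders up to
  \<open>K\<close> every lag of a sample time is at least \<open>1 - K\<close>, so the extension
  never enters a regressor.\<close>

locale ls_path = var_path p e k d K x A mu Dx S PD
  for p e k d K x A mu Dx S PD +
  fixes X :: "int \<Rightarrow> real vec" and D :: "nat \<Rightarrow> real vec"
  assumes p_pos: "p \<ge> 1" and k_le: "k \<le> K"
    and X_carrier: "\<And>t. t \<ge> 1 - int K \<Longrightarrow> X t \<in> carrier_vec p"
    and x_X: "\<And>b t. b < p \<Longrightarrow> t \<ge> 1 - int K \<Longrightarrow> x b t = X t $ b"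
    and D_carrier: "\<And>t. t \<ge> 1 \<Longrightarrow> D t \<in> carrier_vec d"
    and Dx_D: "\<And>c t. c < d \<Longrightarrow> t \<ge> 1 \<Longrightarrow> Dx c (int t) = D t $ c"
begin

lemma lag_carrier: "i \<le> K \<Longrightarrow> t \<ge> 1 \<Longrightarrow> 1 \<le> l \<Longrightarrow> l \<le> i \<Longrightarrow> X (int t - int l) \<in> carrier_vec p"
  by (rule X_carrier) linarith

lemma regressor_carrier: "i \<le> K \<Longrightarrow> t \<ge> 1 \<Longrightarrow> regressor X D i t \<in> carrier_vec (p * i + d)"
  unfolding regressor_def by (intro append_carrier_vec lag_vec_carrier D_carrier lag_carrier)

lemma regressor_lag:
  assumes "i \<le> K" "t \<ge> 1" "l < i" "b < p"
  shows "regressor X D i t $ (p * l + b) = x b (int t - int (Suc l))"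
proof -
  have c: "dim_vec (lag_vec X (int t) i) = p * i"
    by (rule carrier_vecD, rule lag_vec_carrier) (rule lag_carrier, use assms in auto)
  have "regressor X D i t $ (p * l + b) = lag_vec X (int t) i $ (p * l + b)"
    unfolding regressor_def using block_index_less[OF assms(3,4)] c by (subst index_append_vec(1)) auto
  also have "\<dots> = X (int t - int (Suc l)) $ b"
    by (rule lag_vec_index) (auto intro: assms lag_carrier)
  also have "\<dots> = x b (int t - int (Suc l))"
    by (rule x_X[symmetric]) (use assms in linarith)+
  finally show ?thesis .
qed

lemma regressor_deterministic:
  assumes "i \<le> K" "t \<ge> 1" "c < d"
  shows "regressor X D i t $ (p * i + c) = Dx c (int t)"
proof -
  have "dim_vec (lag_vec X (int t) i) = p * i"
    by (rule carrier_vecD, rule lag_vec_carrier) (rule lag_carrier, use assms in auto)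
  moreover have "dim_vec (D t) = d" by (intro carrier_vecD D_carrier assms)
  ultimately have "regressor X D i t $ (p * i + c) = D t $ c"
    unfolding regressor_def using assms by (subst index_append_vec(1)) auto
  then show ?thesis using Dx_D assms by simp
qed

text \<open>The fitted autoregression in the form of \<open>Apoly\<close>, which makes its residual
  an instance of \<open>resid\<close>. Block \<open>l\<close> of the coefficient matrix belongs to
  lag \<open>Suc l\<close>.\<close>

definition ls_poly :: "nat \<Rightarrow> nat \<Rightarrow> nat \<Rightarrow> nat \<Rightarrow> real poly" where
  "ls_poly i T a b = (if a = b then 1 else 0) - (\<Sum>l<i. monom (ls_coeff p d X D i T $$ (a, p * l + b)) (Suc l))"

definition ls_drift :: "nat \<Rightarrow> nat \<Rightarrow> nat \<Rightarrow> nat \<Rightarrow> real" where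
  "ls_drift i T a c = ls_coeff p d X D i T $$ (a, p * i + c)"

definition r :: "nat \<Rightarrow> nat \<Rightarrow> nat \<Rightarrow> int \<Rightarrow> real" where
  "r i T a = resid (ls_poly i T a) (ls_drift i T a)"

definition \<Omega> :: "nat \<Rightarrow> nat \<Rightarrow> nat \<Rightarrow> nat \<Rightarrow> real" where
  "\<Omega> i T a b = mean T (\<lambda>t. r i T a t * r i T b t)"

lemma coeff_ls_poly_0: "coeff (ls_poly i T a b) 0 = (if a = b then 1 else 0)"
  by (simp add: ls_poly_def coeff_sum)

lemma coeff_ls_poly_eq_0: "n > i \<Longrightarrow> coeff (ls_poly i T a b) n = 0"
  by (auto simp: ls_poly_def coeff_sum intro!: sum.neutral)

lemma degree_ls_poly: "degree (ls_poly i T a b) \<le> i"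
  by (rule degree_le) (simp add: coeff_ls_poly_eq_0)

lemma r_eq:
  assumes "i \<le> K" "t \<ge> 1" "a < p"
  shows "r i T a (int t) = X (int t) $ a - (\<Sum>m<p * i + d. ls_coeff p d X D i T $$ (a, m) * regressor X D i t $ m)"
proof -
  define L where "L = ls_coeff p d X D i T"
  have "lag_op (ls_poly i T a b) (x b) (int t)
      = (if a = b then x b (int t) else 0) - (\<Sum>l<i. L $$ (a, p * l + b) * x b (int t - int (Suc l)))" for b
  proof -
    have "lag_op (ls_poly i T a b) (x b) (int t) + lag_op (\<Sum>l<i. monom (L $$ (a, p * l + b)) (Suc l)) (x b) (int t)
      = lag_op (if a = b then 1 else 0) (x b) (int t)"
      unfolding lag_op_add[symmetric] by (simp add: ls_poly_def L_def)
    also have "\<dots> = (if a = b then x b (int t) else 0)" by simp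
    finally show ?thesis unfolding lag_op_sum lag_op_monom by simp
  qed
  then have "r i T a (int t) = x a (int t) - (\<Sum>b<p. \<Sum>l<i. L $$ (a, p * l + b) * x b (int t - int (Suc l)))
      - (\<Sum>c<d. L $$ (a, p * i + c) * Dx c (int t))"
    using assms(3) by (simp add: r_def resid_def ls_drift_def L_def sum_subtractf del: of_nat_Suc)
  also have "(\<Sum>b<p. \<Sum>l<i. L $$ (a, p * l + b) * x b (int t - int (Suc l)))
      = (\<Sum>l<i. \<Sum>b<p. L $$ (a, p * l + b) * regressor X D i t $ (p * l + b))"
    unfolding sum.swap[of _ "{..<p}"] using assms by (intro sum.cong refl) (simp add: regressor_lag del: of_nat_Suc)
  also have "(\<Sum>c<d. L $$ (a, p * i + c) * Dx c (int t)) = (\<Sum>c<d. L $$ (a, p * i + c) * regressor X D i t $ (p * i + c))"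
    using assms by (intro sum.cong refl) (simp add: regressor_deterministic)
  also have "x a (int t) = X (int t) $ a" by (rule x_X) (use assms in linarith)+
  finally show ?thesis unfolding L_def sum_block_index by linarith
qed

lemma residual_eq:
  assumes "i \<le> K" "t \<ge> 1" "t \<le> T" "a < p"
  shows "ls_residual p d X D i T t $ a = r i T a (int t)"
proof -
  have L: "ls_coeff p d X D i T \<in> carrier_mat p (p * i + d)"
    by (rule ls_coeff_normal_equations(1)) (auto intro!: X_carrier regressor_carrier assms)
  have R: "regressor X D i t \<in> carrier_vec (p * i + d)" using assms by (intro regressor_carrier)
  show ?thesis unfolding ls_residual_def r_eq[OF assms(1,2,4)]
    using L assms(4) by (subst index_minus_vec(1)) (auto simp: mult_mat_vec_index_sum[OF L R] simp del: index_mult_mat_vec)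
qed

lemma residual_orthogonal:
  assumes i: "i \<le> K" and a: "a < p"
  shows "b < p \<Longrightarrow> 1 \<le> l \<Longrightarrow> l \<le> i \<Longrightarrow> mean T (\<lambda>t. r i T a t * x b (t - int l)) = 0"
    and "c < d \<Longrightarrow> mean T (\<lambda>t. r i T a t * Dx c t) = 0"
proof -
  have *: "(\<Sum>t = 1..T. r i T a (int t) * regressor X D i t $ m) = 0" if "m < p * i + d" for m
  proof -
    have "(\<Sum>t = 1..T. (X (int t) $ a - (\<Sum>m<p * i + d. ls_coeff p d X D i T $$ (a, m) * regressor X D i t $ m))
        * regressor X D i t $ m) = 0"
      by (rule ls_coeff_normal_equations(2)) (auto intro!: X_carrier regressor_carrier i a that)
    then show ?thesis using i a by (simp add: r_eq)
  qed
  {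
    assume b: "b < p" and l: "1 \<le> l" "l \<le> i"
    then have "(\<Sum>t = 1..T. r i T a (int t) * regressor X D i t $ (p * (l - 1) + b)) = 0"
      using block_index_less[of "l - 1" i b p] by (intro * trans_less_add1) auto
    also have "(\<Sum>t = 1..T. r i T a (int t) * regressor X D i t $ (p * (l - 1) + b))
      = (\<Sum>t = 1..T. r i T a (int t) * x b (int t - int l))"
      using regressor_lag[OF i _ _ b, of _ "l - 1"] l by (intro sum.cong refl) simp
    finally show "mean T (\<lambda>t. r i T a t * x b (t - int l)) = 0" by (simp add: mean_def)
  next
    assume c: "c < d"
    then have "(\<Sum>t = 1..T. r i T a (int t) * regressor X D i t $ (p * i + c)) = 0" by (intro *) auto
    then show "mean T (\<lambda>t. r i T a t * Dx c t) = 0"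
      using c i by (simp add: mean_def regressor_deterministic)
  }
qed

text \<open>Without a lag-zero coefficient only lags 1 to \<open>k\<close> and the drift remain,
  that is, a combination of the order-\<open>k\<close> regressors.\<close>

lemma residual_orthogonal_resid:
  assumes a: "a < p" and Q: "\<And>b. b < p \<Longrightarrow> degree (Q b) \<le> k" "\<And>b. b < p \<Longrightarrow> coeff (Q b) 0 = 0"
  shows "mean T (\<lambda>t. r k T a t * resid Q \<nu> t) = 0"
proof -
  have "resid Q \<nu> t = (\<Sum>b<p. \<Sum>i\<le>k. coeff (Q b) i * x b (t - int i)) - (\<Sum>c<d. \<nu> c * Dx c t)" for t
    unfolding resid_def by (intro arg_cong2[where f = "(-)"] sum.cong refl lag_op_eq_sum Q(1)) auto
  then have "mean T (\<lambda>t. r k T a t * resid Q \<nu> t)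
    = (\<Sum>b<p. \<Sum>i\<le>k. coeff (Q b) i * mean T (\<lambda>t. r k T a t * x b (t - int i)))
      - (\<Sum>c<d. \<nu> c * mean T (\<lambda>t. r k T a t * Dx c t))"
    by (simp add: right_diff_distrib sum_distrib_left mean_diff mean_sum mult.left_commute[of "r k T a _"] mean_cmult)
  also have "(\<Sum>b<p. \<Sum>i\<le>k. coeff (Q b) i * mean T (\<lambda>t. r k T a t * x b (t - int i))) = 0"
  proof (intro sum.neutral ballI)
    fix b i assume "b \<in> {..<p}" "i \<in> {..k}"
    then show "coeff (Q b) i * mean T (\<lambda>t. r k T a t * x b (t - int i)) = 0"
      using Q(2)[of b] residual_orthogonal(1)[OF k_le a, of b i T] by (cases "i = 0") auto
  qed
  also have "(\<Sum>c<d. \<nu> c * mean T (\<lambda>t. r k T a t * Dx c t)) = 0"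
    using residual_orthogonal(2)[OF k_le a] by simp
  finally show ?thesis by simp
qed

lemma resid_diff: "resid Q \<nu> t - resid R \<mu>' t = resid (\<lambda>b. Q b - R b) (\<lambda>c. \<nu> c - \<mu>' c) t"
proof -
  have "lag_op (Q b - R b) (x b) t = lag_op (Q b) (x b) t - lag_op (R b) (x b) t" for b
    using lag_op_add[of "Q b - R b" "R b" "x b" t] by simp
  then show ?thesis by (simp add: resid_def sum_subtractf left_diff_distrib)
qed

lemma residual_orthogonal_diff:
  assumes a: "a < p" and b: "b < p"
    and Q: "\<And>c. c < p \<Longrightarrow> degree (Q c) \<le> k" "\<And>c. c < p \<Longrightarrow> coeff (Q c) 0 = (if b = c then 1 else 0)"
  shows "mean T (\<lambda>t. r k T a t * (resid Q \<nu> t - r k T b t)) = 0"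
  unfolding r_def[of k T b] resid_diff
  by (rule residual_orthogonal_resid[OF a])
    (auto intro!: degree_diff_le simp: Q coeff_ls_poly_0 degree_ls_poly)

text \<open>The innovation is the residual at the true coefficients, so it differs from the fitted
  residual by an orthogonal component.\<close>

lemma mean_residual_le_noise:
  assumes a: "a < p"
  shows "mean T (\<lambda>t. (r k T a t)\<^sup>2) \<le> mean T (\<lambda>t. (e a t)\<^sup>2)"
proof -
  define q where "q t = resid (Apoly a) (mu a) t - r k T a t" for t
  have e: "e a t = r k T a t + q t" if "t \<ge> 1" for t
    using \<eta>_eq[OF a that] by (simp add: q_def resid_def \<eta>_def)
  have "mean T (\<lambda>t. (e a t)\<^sup>2) = mean T (\<lambda>t. (r k T a t)\<^sup>2 + (2 * (r k T a t * q t) + (q t)\<^sup>2))"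
    by (intro mean_cong) (simp add: e power2_sum)
  also have "\<dots> = mean T (\<lambda>t. (r k T a t)\<^sup>2) + (2 * mean T (\<lambda>t. r k T a t * q t) + mean T (\<lambda>t. (q t)\<^sup>2))"
    by (simp add: mean_add mean_cmult)
  also have "mean T (\<lambda>t. r k T a t * q t) = 0" unfolding q_def
    by (rule residual_orthogonal_diff[OF a a]) (auto simp: degree_Apoly coeff_Apoly)
  finally show ?thesis using mean_nonneg[of T "\<lambda>t. (q t)\<^sup>2"] by simp
qed

text \<open>Residuals of orders \<open>j\<close> and \<open>k\<close> differ by a combination of the
  order-\<open>k\<close> regressors, orthogonal to the order-\<open>k\<close> residual; the cross
  terms vanish.\<close>

lemma \<Omega>_decomposition:
  assumes "j \<le> k" "a < p" "b < p"
  shows "\<Omega> j T a b = \<Omega> k T a b + mean T (\<lambda>t. (r j T a t - r k T a t) * (r j T b t - r k T b t))"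
proof -
  have o: "mean T (\<lambda>t. r k T a t * (r j T b t - r k T b t)) = 0" if "a < p" "b < p" for a b
    unfolding r_def[of j T b]
    by (rule residual_orthogonal_diff[OF that])
      (auto simp: coeff_ls_poly_0 intro: order.trans[OF degree_ls_poly assms(1)])
  have "r j T a t * r j T b t = r k T a t * r k T b t + (r k T a t * (r j T b t - r k T b t) +
      (r k T b t * (r j T a t - r k T a t) + (r j T a t - r k T a t) * (r j T b t - r k T b t)))" for t
    by (simp add: algebra_simps)
  then show ?thesis unfolding \<Omega>_def by (simp add: mean_add o assms(2,3))
qed

text \<open>A combination \<open>u\<close> of residual components has lag-zero coefficients
  \<open>u\<close>, preserved by the filter, so the uniform bound for \<open>resid\<close> applies
  with one constant for all orders up to \<open>k\<close>.\<close>

lemma \<Omega>_pd: "\<exists>c>0. \<forall>\<^sub>F T in sequentially. \<forall>i\<le>k. pd_form p c (\<Omega> i T)"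
proof -
  obtain c where c: "c > 0" and ev: "\<forall>\<^sub>F T in sequentially. \<forall>Q \<nu>. (\<forall>b<p. degree (Q b) \<le> k) \<longrightarrow>
     c * (\<Sum>i\<le>m_deg. \<Sum>a<p. (coeff (filt Q a) i)\<^sup>2) \<le> mean T (\<lambda>t. (resid Q \<nu> t)\<^sup>2)"
    using resid_pd by auto
  have "\<forall>\<^sub>F T in sequentially. \<forall>i\<le>k. pd_form p c (\<Omega> i T)"
    using ev
  proof eventually_elim
    case (elim T)
    show ?case unfolding pd_form_def
    proof (intro allI impI conjI)
      fix i a b show "\<Omega> i T a b = \<Omega> i T b a" by (simp add: \<Omega>_def mult.commute)
    next
      fix i u assume i: "i \<le> k"
      define Q where "Q b = (\<Sum>a<p. Polynomial.smult (u a) (ls_poly i T a b))" for b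
      have dQ: "degree (Q b) \<le> k" for b unfolding Q_def
        by (intro degree_sum_le) (auto intro!: order.trans[OF degree_smult_le] order.trans[OF degree_ls_poly i])
      have Q0: "coeff (Q b) 0 = u b" if "b < p" for b
      proof -
        have "coeff (Q b) 0 = (\<Sum>a<p. if a = b then u a else 0)"
          unfolding Q_def coeff_sum by (intro sum.cong refl) (simp add: coeff_ls_poly_0)
        then show ?thesis using that by simp
      qed
      have "(\<Sum>a<p. (u a)\<^sup>2) = (\<Sum>a<p. (coeff (filt Q a) 0)\<^sup>2)"
        by (intro sum.cong refl) (simp add: filt_0 Q0)
      also have "\<dots> \<le> (\<Sum>i\<le>m_deg. \<Sum>a<p. (coeff (filt Q a) i)\<^sup>2)"
        by (rule member_le_sum[of 0 _ "\<lambda>i. \<Sum>a<p. (coeff (filt Q a) i)\<^sup>2"]) (auto intro: sum_nonneg)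
      finally have "c * (\<Sum>a<p. (u a)\<^sup>2) \<le> c * (\<Sum>i\<le>m_deg. \<Sum>a<p. (coeff (filt Q a) i)\<^sup>2)"
        using c by simp
      also have "\<dots> \<le> mean T (\<lambda>t. (resid Q (\<lambda>c. \<Sum>a<p. u a * ls_drift i T a c) t)\<^sup>2)"
        using elim dQ by blast
      also have "\<dots> = (\<Sum>a<p. \<Sum>b<p. u a * u b * \<Omega> i T a b)"
        unfolding Q_def resid_lincomb r_def[symmetric] \<Omega>_def by (rule mean_square_sum)
      finally show "c * (\<Sum>a<p. (u a)\<^sup>2) \<le> (\<Sum>a<p. \<Sum>b<p. u a * u b * \<Omega> i T a b)" .
    qed
  qed
  with c show ?thesis by blast
qed

lemma mean_mult_eq_gram:
  assumes "T \<ge> 1"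
  shows "mean T (\<lambda>t. w a t * w b t) = (\<Sum>t = 1..T. (w a (int t) / sqrt (real T)) * (w b (int t) / sqrt (real T)))"
  using assms by (simp add: mean_def sum_divide_distrib)

text \<open>A positive determinant keeps the criterion off the branch with value minus infinity, so
  it can be compared by real arithmetic.\<close>

lemma log_det_Omega_hat:
  assumes "i \<le> K" "det_fun p (\<Omega> i T) > 0"
  shows "log_det (Omega_hat p d X D i T) = ereal (ln (det_fun p (\<Omega> i T)))"
proof -
  have "Omega_hat p d X D i T = mat p p (\<lambda>(a, b). \<Omega> i T a b)"
    unfolding Omega_hat_def \<Omega>_def mean_def
    by (intro cong_mat refl) (use assms(1) in \<open>auto simp: residual_eq intro!: arg_cong2[where f = "(/)"] sum.cong\<close>)
  then show ?thesis using assms(2) by (simp add: log_det_def det_fun_def)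
qed

text \<open>By the orthogonal decomposition the order-\<open>j\<close> matrix is the
  order-\<open>k\<close> matrix plus a Gram matrix of residual differences. Dividing by
  \<open>sqrt (real T)\<close> turns sample means into plain sums of outer products.\<close>

lemma det_trace_ratio:
  assumes pd: "pd_form p c (\<Omega> k T)" "c > 0" and j: "j \<le> k" and T: "T \<ge> 1"
  shows "det_fun p (\<Omega> k T) > 0" "det_fun p (\<Omega> j T) > 0"
    and "det_fun p (\<Omega> k T) * (\<Sum>a<p. \<Omega> j T a a) \<le> det_fun p (\<Omega> j T) * (\<Sum>a<p. \<Omega> k T a a)"
proof -
  define v where "v t a = r k T a (int t) / sqrt (real T)" for t a
  define w where "w t a = (r j T a (int t) - r k T a (int t)) / sqrt (real T)" for t a
  have k: "\<Omega> k T = (\<lambda>a b. \<Sum>t = 1..T. v t a * v t b)"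
    unfolding \<Omega>_def v_def by (intro ext mean_mult_eq_gram[OF T])
  show pos: "det_fun p (\<Omega> k T) > 0" unfolding k by (rule det_fun_gram_pos) (use pd p_pos k in auto)
  have jd: "\<Omega> j T a b = \<Omega> k T a b + (\<Sum>t = 1..T. w t a * w t b)" if "a < p" "b < p" for a b
    unfolding \<Omega>_decomposition[OF j that] w_def
    using mean_mult_eq_gram[OF T, of "\<lambda>a t. r j T a t - r k T a t" a b] by simp
  then have "det_fun p (\<Omega> j T) = det_fun p (\<lambda>a b. \<Omega> k T a b + (\<Sum>t = 1..T. w t a * w t b))"
    by (rule det_fun_cong)
  moreover have "(\<Sum>a<p. \<Omega> j T a a) = (\<Sum>a<p. \<Omega> k T a a + (\<Sum>t = 1..T. w t a * w t a))"
    by (intro sum.cong refl jd) auto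
  ultimately show "det_fun p (\<Omega> j T) > 0"
    "det_fun p (\<Omega> k T) * (\<Sum>a<p. \<Omega> j T a a) \<le> det_fun p (\<Omega> j T) * (\<Sum>a<p. \<Omega> k T a a)"
    using det_fun_gram_update_ge[OF pd p_pos pos, where T = T and w = w] by (simp_all only:)
qed

lemma info_criterion_less:
  assumes f: "(\<lambda>T. f T / real T) \<longlonglongrightarrow> 0" and j: "j < k"
    and ab: "a0 < p" "b0 < p" and Ak: "A k a0 b0 \<noteq> 0"
  shows "\<forall>\<^sub>F T in sequentially. info_criterion p d X D f T k < info_criterion p d X D f T j"
proof (rule ccontr)
  assume "\<not> ?thesis"
  from not_eventually_sequentiallyD[OF this]
  obtain \<sigma> :: "nat \<Rightarrow> nat" where \<sigma>: "strict_mono \<sigma>"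
    and le: "\<And>n. \<not> info_criterion p d X D f (\<sigma> n) k < info_criterion p d X D f (\<sigma> n) j" by auto
  have \<sigma>_top: "filterlim \<sigma> at_top sequentially" by (rule filterlim_subseq[OF \<sigma>])
  obtain c where c: "c > 0" "\<forall>\<^sub>F T in sequentially. \<forall>i\<le>k. pd_form p c (\<Omega> i T)" using \<Omega>_pd by auto
  obtain R where R: "\<forall>\<^sub>F T in sequentially. \<forall>a<p. mean T (\<lambda>t. (e a t)\<^sup>2) \<le> R" using noise_bounded by auto
  define m where "m T = (\<Sum>a<p. mean T (\<lambda>t. (r j T a t - r k T a t)\<^sup>2))" for T
  define tr where "tr i T = (\<Sum>a<p. \<Omega> i T a a)" for i T
  \<comment> \<open>The difference of the two penalties. If order \<open>j\<close> is preferred, the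
    determinant ratio is at most \<open>exp (y n)\<close>.\<close>
  define y where "y n = real (k - j) * (f (\<sigma> n) / real (\<sigma> n))" for n
  have trj: "tr j T = tr k T + m T" for T
    unfolding tr_def m_def sum.distrib[symmetric] power2_eq_square
    by (intro sum.cong refl \<Omega>_decomposition) (use j in auto)
  have term_nonneg: "0 \<le> mean T (\<lambda>t. (r j T a t - r k T a t)\<^sup>2)" for a T by (rule mean_nonneg) simp
  have m0: "0 \<le> m T" for T unfolding m_def by (intro sum_nonneg term_nonneg)
  have \<Omega>0: "0 \<le> \<Omega> i T a a" for i T a unfolding \<Omega>_def by (rule mean_nonneg) simp
  have tr0: "0 \<le> tr i T" for i T unfolding tr_def by (intro sum_nonneg \<Omega>0)
  have ev: "\<forall>\<^sub>F n in sequentially. (\<forall>i\<le>k. pd_form p c (\<Omega> i (\<sigma> n))) \<and>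
      (\<forall>a<p. mean (\<sigma> n) (\<lambda>t. (e a t)\<^sup>2) \<le> R) \<and> \<sigma> n \<ge> 1"
    by (rule eventually_compose_filterlim[OF _ \<sigma>_top]) (intro eventually_conj c R eventually_ge_at_top)
  \<comment> \<open>The trace ratio inherits the bound \<open>exp (y n)\<close>, so the mean square
    difference \<open>m\<close> is at most the order-\<open>k\<close> trace times
    \<open>exp (y n) - 1\<close>; that trace is bounded by the noise.\<close>
  have key: "\<forall>\<^sub>F n in sequentially. tr k (\<sigma> n) \<le> real p * R \<and> m (\<sigma> n) \<le> real p * R * \<bar>exp (y n) - 1\<bar>"
    using ev
  proof eventually_elim
    case (elim n)
    define T where "T = \<sigma> n"
    have pd: "pd_form p c (\<Omega> k T)" and e: "\<And>a. a < p \<Longrightarrow> mean T (\<lambda>t. (e a t)\<^sup>2) \<le> R" and T: "T \<ge> 1"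
      using elim by (auto simp: T_def)
    note ratio = det_trace_ratio[OF pd c(1) less_imp_le[OF j] T]
    have trk: "tr k T \<le> real p * R"
    proof -
      have "tr k T \<le> (\<Sum>a<p. R)" unfolding tr_def
      proof (rule sum_mono)
        fix a assume "a \<in> {..<p}"
        then show "\<Omega> k T a a \<le> R"
          using mean_residual_le_noise[of a T] e[of a] by (simp add: \<Omega>_def power2_eq_square)
      qed
      then show ?thesis by simp
    qed
    have lj: "log_det (Omega_hat p d X D j T) = ereal (ln (det_fun p (\<Omega> j T)))"
      using j k_le ratio(2) by (intro log_det_Omega_hat) auto
    have lk: "log_det (Omega_hat p d X D k T) = ereal (ln (det_fun p (\<Omega> k T)))"
      using k_le ratio(1) by (intro log_det_Omega_hat)
    have "ln (det_fun p (\<Omega> j T)) + real j * f T / real T \<le> ln (det_fun p (\<Omega> k T)) + real k * f T / real T"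
      using le[of n] unfolding info_criterion_def T_def[symmetric] lj lk by simp
    also have "real k * f T / real T = real j * f T / real T + y n"
      using j by (simp add: y_def T_def of_nat_diff left_diff_distrib diff_divide_distrib)
    finally have "ln (det_fun p (\<Omega> j T)) \<le> ln (det_fun p (\<Omega> k T)) + y n" by simp
    then have "exp (ln (det_fun p (\<Omega> j T))) \<le> exp (ln (det_fun p (\<Omega> k T)) + y n)" by simp
    then have "det_fun p (\<Omega> j T) \<le> det_fun p (\<Omega> k T) * exp (y n)" using ratio(1,2) by (simp add: exp_add)
    then have "det_fun p (\<Omega> j T) * tr k T \<le> det_fun p (\<Omega> k T) * exp (y n) * tr k T"
      by (rule mult_right_mono[OF _ tr0])
    with ratio(3) have "det_fun p (\<Omega> k T) * tr j T \<le> det_fun p (\<Omega> k T) * (exp (y n) * tr k T)"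
      unfolding tr_def by (simp add: mult.assoc)
    then have "tr j T \<le> exp (y n) * tr k T" using ratio(1) by simp
    then have "m T \<le> tr k T * (exp (y n) - 1)" by (simp add: trj algebra_simps)
    also have "\<dots> \<le> tr k T * \<bar>exp (y n) - 1\<bar>" by (intro mult_left_mono tr0) simp
    also have "\<dots> \<le> real p * R * \<bar>exp (y n) - 1\<bar>" by (intro mult_right_mono trk) simp
    finally show ?case using trk by (simp add: T_def)
  qed
  have "y \<longlonglongrightarrow> 0" unfolding y_def
    by (rule tendsto_mult_right_zero) (rule filterlim_compose[OF f \<sigma>_top])
  then have "(\<lambda>n. real p * R * \<bar>exp (y n) - 1\<bar>) \<longlonglongrightarrow> real p * R * \<bar>exp 0 - 1\<bar>"
    by (intro tendsto_intros)
  then have lim: "(\<lambda>n. real p * R * \<bar>exp (y n) - 1\<bar>) \<longlonglongrightarrow> 0" by simp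
  have m_lim: "(\<lambda>n. m (\<sigma> n)) \<longlonglongrightarrow> 0"
    by (rule tendsto_sandwich[OF _ _ tendsto_const lim]) (use key m0 in \<open>auto elim: eventually_mono\<close>)
  have term_le: "mean T (\<lambda>t. (r j T a t - r k T a t)\<^sup>2) \<le> m T" if "a < p" for a T
    unfolding m_def using that term_nonneg
    by (intro member_le_sum[where f = "\<lambda>a. mean T (\<lambda>t. (r j T a t - r k T a t)\<^sup>2)"]) auto
  have "A k a0 b0 = 0"
  proof (rule lag_k_vanishes[where r = "\<lambda>n. r j (\<sigma> n)" and s = "\<lambda>n. r k (\<sigma> n)" and \<sigma> = \<sigma>
        and B = "\<lambda>n. ls_poly j (\<sigma> n)" and \<nu> = "\<lambda>n. ls_drift j (\<sigma> n)" and R = "real p * R + 1"])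
    show "r j (\<sigma> n) a = resid (ls_poly j (\<sigma> n) a) (ls_drift j (\<sigma> n) a)" for n a by (rule r_def)
    show "filterlim \<sigma> at_top sequentially" by (rule \<sigma>_top)
    show "coeff (ls_poly j (\<sigma> n) a b) 0 = (if a = b then 1 else 0)" for n a b by (rule coeff_ls_poly_0)
    show "coeff (ls_poly j (\<sigma> n) a b) i = 0" if "i \<ge> k" for n a b i
      using j that by (intro coeff_ls_poly_eq_0) simp
    show "\<forall>\<^sub>F n in sequentially. mean (\<sigma> n) (\<lambda>t. (r j (\<sigma> n) a t)\<^sup>2) \<le> real p * R + 1" if a: "a < p" for a
    proof -
      have "\<forall>\<^sub>F n in sequentially. m (\<sigma> n) < 1" by (rule order_tendstoD(2)[OF m_lim]) simp
      then show ?thesis using key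
      proof eventually_elim
        case (elim n)
        have "\<Omega> j (\<sigma> n) a a \<le> tr j (\<sigma> n)"
          unfolding tr_def by (rule member_le_sum[where f = "\<lambda>a. \<Omega> j (\<sigma> n) a a"]) (use a \<Omega>0 in auto)
        then have "mean (\<sigma> n) (\<lambda>t. (r j (\<sigma> n) a t)\<^sup>2) \<le> tr j (\<sigma> n)"
          by (simp only: \<Omega>_def power2_eq_square)
        then show ?case using elim by (simp add: trj)
      qed
    qed
    show "mean (\<sigma> n) (\<lambda>t. r k (\<sigma> n) a t * x b (t - int i)) = 0" if "a < p" "b < p" "1 \<le> i" "i \<le> k" for n a b i
      using that by (intro residual_orthogonal(1) k_le)
    show "mean (\<sigma> n) (\<lambda>t. r k (\<sigma> n) a t * Dx c t) = 0" if "a < p" "c < d" for n a c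
      using that by (intro residual_orthogonal(2) k_le)
    show "(\<lambda>n. mean (\<sigma> n) (\<lambda>t. (r j (\<sigma> n) a t - r k (\<sigma> n) a t)\<^sup>2)) \<longlonglongrightarrow> 0" if "a < p" for a
      by (rule tendsto_sandwich[OF _ _ tendsto_const m_lim]) (use term_le[OF that] term_nonneg in auto)
  qed (rule ab)+
  with Ak show False by simp
qed

end

lemma AE_cond_moment_bound:
  assumes "martingale_noise M F p \<epsilon> s" and carrier: "\<And>t \<omega>. t \<ge> 1 \<Longrightarrow> \<omega> \<in> space M \<Longrightarrow> eps t \<omega> \<in> carrier_vec p"
    and \<epsilon>: "\<epsilon> = (\<lambda>t a \<omega>. eps t \<omega> $ a)"
    and bound: "AE \<omega> in M. (SUP t\<in>{1..}. nn_cond_exp M (F (t - 1))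
      (\<lambda>\<omega>'. ennreal (scalar_prod (eps t \<omega>') (eps t \<omega>') powr s)) \<omega>) < \<infinity>"
  shows "AE \<omega> in M. (SUP t\<in>{1..}. martingale_noise.cmom M F p \<epsilon> s t \<omega>) < \<infinity>"
proof -
  interpret martingale_noise M F p \<epsilon> s by fact
  have sq: "scalar_prod (eps t \<omega>) (eps t \<omega>) = sqn t \<omega>" if "t \<ge> 1" "\<omega> \<in> space M" for t \<omega>
    unfolding scalar_prod_def carrier_vecD[OF carrier[OF that]] sqn_def power2_eq_square atLeast0LessThan
    by (simp only: \<epsilon>)
  \<comment> \<open>The two integrands agree only on \<open>space M\<close>. The conditional
    expectations are nevertheless equal as functions, because they depend on the integrand through
    its measurability and the density measure alone.\<close>
  have "nn_cond_exp M (F (t - 1)) (\<lambda>\<omega>'. ennreal (scalar_prod (eps t \<omega>') (eps t \<omega>') powr s)) = cmom t" if "t \<ge> 1" for t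
  proof -
    have "(\<lambda>\<omega>. ennreal (scalar_prod (eps t \<omega>) (eps t \<omega>) powr s)) \<in> borel_measurable M
        \<longleftrightarrow> (\<lambda>\<omega>. ennreal (sqn t \<omega> powr s)) \<in> borel_measurable M"
      by (rule measurable_cong) (simp only: sq[OF that])
    moreover have "density M (\<lambda>\<omega>. ennreal (scalar_prod (eps t \<omega>) (eps t \<omega>) powr s)) = density M (\<lambda>\<omega>. ennreal (sqn t \<omega> powr s))"
      unfolding density_def
      by (intro arg_cong2[where f = "measure_of (space M)"] refl ext nn_integral_cong) (simp only: sq[OF that])
    ultimately show ?thesis unfolding cmom_def nn_cond_exp_def by (simp only:)
  qed
  then have "(SUP t\<in>{1..}. nn_cond_exp M (F (t - 1)) (\<lambda>\<omega>'. ennreal (scalar_prod (eps t \<omega>') (eps t \<omega>') powr s)) \<omega>)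
    = (SUP t\<in>{1..}. cmom t \<omega>)" for \<omega> by (intro SUP_cong) auto
  then show ?thesis using bound by simp
qed

text \<open>A real \<open>c\<close> strictly between 0 and the limit inferior is eventually below
  the smallest eigenvalue, hence below the form on unit vectors.\<close>

lemma eventually_form_ge_smallest_eigenvalue:
  assumes p: "p \<ge> 1" and sym: "\<And>t a b. G t a b = G t b a"
    and pos: "liminf (\<lambda>t. ereal (smallest_eigenvalue (mat p p (\<lambda>(a, b). G t a b)))) > 0"
  shows "\<exists>c>0. \<forall>\<^sub>F t in sequentially. \<forall>u::nat \<Rightarrow> real. c * (\<Sum>a<p. (u a)\<^sup>2) \<le> (\<Sum>a<p. \<Sum>b<p. u a * u b * G t a b)"
proof -
  obtain c where c: "0 < ereal c" "ereal c < liminf (\<lambda>t. ereal (smallest_eigenvalue (mat p p (\<lambda>(a, b). G t a b))))"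
    using ereal_dense2[OF pos] by auto
  from less_LiminfD[OF c(2)]
  have "\<forall>\<^sub>F t in sequentially. \<forall>u::nat \<Rightarrow> real. c * (\<Sum>a<p. (u a)\<^sup>2) \<le> (\<Sum>a<p. \<Sum>b<p. u a * u b * G t a b)"
  proof eventually_elim
    case (elim t)
    show ?case
    proof
      fix u :: "nat \<Rightarrow> real"
      have "c * (\<Sum>a<p. (u a)\<^sup>2) \<le> smallest_eigenvalue (mat p p (\<lambda>(a, b). G t a b)) * (\<Sum>a<p. (u a)\<^sup>2)"
        using elim by (intro mult_right_mono sum_nonneg) auto
      also have "\<dots> \<le> (\<Sum>a<p. \<Sum>b<p. u a * u b * G t a b)" by (rule smallest_eigenvalue_le_form[OF p sym])
      finally show "c * (\<Sum>a<p. (u a)\<^sup>2) \<le> (\<Sum>a<p. \<Sum>b<p. u a * u b * G t a b)" .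
    qed
  qed
  with c(1) show ?thesis by (intro exI[of _ c]) simp
qed

theorem theorem2p4:
  fixes M :: "'w measure" and F :: "nat \<Rightarrow> 'w measure"
    and p K k0 d :: nat
    and X :: "int \<Rightarrow> 'w \<Rightarrow> real vec" and eps :: "nat \<Rightarrow> 'w \<Rightarrow> real vec"
    and A :: "nat \<Rightarrow> real mat" and mu :: "real mat"
    and Dmat :: "real mat" and D :: "nat \<Rightarrow> real vec"
    and lam :: real and f :: "nat \<Rightarrow> real" and khat :: "nat \<Rightarrow> 'w \<Rightarrow> nat"
  assumes "prob_space M"
    and "filtration (space M) F" and "\<And>t. subalgebra M (F t)"
    and "p \<ge> 1" and "K \<ge> 1"
    and "\<And>l. l \<in> {1..K} \<Longrightarrow> A l \<in> carrier_mat p p"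
    and "mu \<in> carrier_mat p d" and "Dmat \<in> carrier_mat d d"
    and "\<And>t. t \<ge> 1 \<Longrightarrow> D t \<in> carrier_vec d"
    and "\<And>t. t \<ge> 1 \<Longrightarrow> D (Suc t) = Dmat *\<^sub>v D t"
    and "\<And>t \<omega>. t \<ge> 1 - int K \<Longrightarrow> \<omega> \<in> space M \<Longrightarrow> X t \<omega> \<in> carrier_vec p"
    and "\<And>t i. t \<in> {1 - int K..0} \<Longrightarrow> i < p \<Longrightarrow> (\<lambda>\<omega>. X t \<omega> $ i) \<in> borel_measurable (F 0)"
    and "AE \<omega> in M. \<forall>t\<ge>1. \<forall>i<p.
           X (int t) \<omega> $ i
             = (\<Sum>l = 1..K. (A l *\<^sub>v X (int t - int l) \<omega>) $ i) + (mu *\<^sub>v D t) $ i + eps t \<omega> $ i"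
    and "k0 \<le> K" and "k0 \<ge> 1 \<Longrightarrow> A k0 \<noteq> 0\<^sub>m p p" and "\<And>l. l \<in> {k0<..K} \<Longrightarrow> A l = 0\<^sub>m p p"
    and "martingale_difference M F p eps" and "lam > 2"
    and "AE \<omega> in M. (SUP t\<in>{1..}. nn_cond_exp M (F (t - 1))
           (\<lambda>\<omega>'. ennreal (scalar_prod (eps t \<omega>') (eps t \<omega>') powr (lam / 2))) \<omega>) < \<infinity>"
    and "AE \<omega> in M. liminf (\<lambda>t. ereal (smallest_eigenvalue
           (cond_second_moment M (F (t - 1)) p (eps t) \<omega>))) > 0"
    and "\<And>z. eigenvalue (map_mat complex_of_real Dmat) z \<Longrightarrow> cmod z = 1"
    and "vec_space.rank d (mat_of_cols d (map D [1..<Suc d])) = d"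
    and "f \<in> o(\<lambda>T. real T)"
    and "\<And>T \<omega>. T \<ge> 1 \<Longrightarrow> \<omega> \<in> space M \<Longrightarrow>
           is_arg_min (info_criterion p d (\<lambda>t. X t \<omega>) D f T) (\<lambda>j. j \<le> K) (khat T \<omega>)"
  shows "AE \<omega> in M. liminf (\<lambda>T. ereal (real (khat T \<omega>))) \<ge> ereal (real k0)"
proof -
  define \<epsilon> where "\<epsilon> = (\<lambda>t a \<omega>. eps t \<omega> $ a)"
  have eps: "eps t \<omega> \<in> carrier_vec p" if "t \<ge> 1" "\<omega> \<in> space M" for t \<omega>
    using assms(17) that by (auto simp: martingale_difference_def)
  interpret filtration "space M" F by (rule assms(2))
  interpret prob_space M by (rule assms(1))
  have noise: "martingale_noise M F p \<epsilon> (lam / 2)"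
  proof (intro martingale_noise.intro martingale_noise_axioms.intro)
    show "prob_space M" by (rule assms(1))
    show "subalgebra M (F t)" for t by (rule assms(3))
    show "sets (F i) \<subseteq> sets (F j)" if "i \<le> j" for i j using that by (rule sets_F_mono)
    show "\<epsilon> t a \<in> borel_measurable (F t)" if "t \<ge> 1" "a < p" for t a
      using assms(17) that by (auto simp: martingale_difference_def \<epsilon>_def)
    show "AE \<omega> in M. real_cond_exp M (F (t - 1)) (\<epsilon> t a) \<omega> = 0" if "t \<ge> 1" "a < p" for t a
      using assms(17) that by (auto simp: martingale_difference_def \<epsilon>_def)
    show "lam / 2 > 1" using assms(18) by simp
  qed
  interpret mn: martingale_noise M F p \<epsilon> "lam / 2" by (rule noise)
  have "AE \<omega> in M. (SUP t\<in>{1..}. mn.cmom t \<omega>) < \<infinity>"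
    by (rule AE_cond_moment_bound[OF noise eps \<epsilon>_def assms(19)])
  moreover have "AE \<omega> in M. \<exists>c>0. \<forall>\<^sub>F t in sequentially. \<forall>u::nat \<Rightarrow> real. c * (\<Sum>a<p. (u a)\<^sup>2)
      \<le> (\<Sum>a<p. \<Sum>b<p. u a * u b * real_cond_exp M (F (t - 1)) (\<lambda>\<omega>. \<epsilon> t a \<omega> * \<epsilon> t b \<omega>) \<omega>)"
    using assms(20)
  proof eventually_elim
    case (elim \<omega>)
    then show ?case
      by (intro eventually_form_ge_smallest_eigenvalue[OF assms(4)])
        (simp_all add: cond_second_moment_def \<epsilon>_def mult.commute)
  qed
  ultimately have wn: "AE \<omega> in M. white_noise p (\<lambda>a t. if t \<le> 0 then 0 else \<epsilon> (nat t) a \<omega>)"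
    by (rule mn.AE_white_noise)
  have f: "(\<lambda>T. f T / real T) \<longlonglongrightarrow> 0" by (rule smalloD_tendsto[OF assms(23)])
  obtain Dx S PD where Dx: "\<And>c t. c < d \<Longrightarrow> t \<ge> 1 \<Longrightarrow> Dx c (int t) = D t $ c"
    and PD: "coeff PD 0 = 1" "\<And>c t. c < d \<Longrightarrow> lag_op PD (Dx c) t = 0"
    and S: "\<And>c t i. c < d \<Longrightarrow> Dx c (t - int i) = (\<Sum>c'<d. S i c c' * Dx c' t)"
    and growth: "\<exists>C m. \<forall>c<d. \<forall>n. \<bar>Dx c (- int n)\<bar> \<le> C * (1 + real n) ^ m"
  proof (rule deterministic_term_extension[OF assms(8,9,10,21,22)])
  qed (assumption | rule that)+
  \<comment> \<open>For \<open>k0 = 0\<close> there is nothing to show. Otherwise each of the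
    finitely many orders below \<open>k0\<close> is eventually beaten strictly by \<open>k0\<close>,
    which is admissible as \<open>k0 \<le> K\<close>, so none of them can be the minimiser.\<close>
  have order: "\<forall>\<^sub>F T in sequentially. k0 \<le> khat T \<omega>"
    if \<omega>: "\<omega> \<in> space M" and white: "white_noise p (\<lambda>a t. if t \<le> 0 then 0 else \<epsilon> (nat t) a \<omega>)"
      and model: "\<forall>t\<ge>1. \<forall>i<p. X (int t) \<omega> $ i
        = (\<Sum>l = 1..K. (A l *\<^sub>v X (int t - int l) \<omega>) $ i) + (mu *\<^sub>v D t) $ i + eps t \<omega> $ i"
    for \<omega>
  proof (cases "k0 \<ge> 1")
    case True
    define e where "e a t = (if t \<le> 0 then 0 else \<epsilon> (nat t) a \<omega>)" for a and t :: int
    define x where "x b t = (if t \<ge> 1 - int K then X t \<omega> $ b else 0)" for b t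
    note Xc = assms(11)[OF _ \<omega>]
    have x_eq: "x a t = (\<Sum>l = 1..k0. \<Sum>b<p. A l $$ (a, b) * x b (t - int l)) + (\<Sum>c<d. mu $$ (a, c) * Dx c t) + e a t"
      if a: "a < p" and t: "t \<ge> 1" for a t
    proof -
      define n where "n = nat t"
      have n: "n \<ge> 1" "t = int n" using t by (auto simp: n_def)
      have "(\<Sum>l = 1..K. (A l *\<^sub>v X (int n - int l) \<omega>) $ a) = (\<Sum>l = 1..K. \<Sum>b<p. A l $$ (a, b) * x b (t - int l))"
      proof (intro sum.cong refl)
        fix l assume l: "l \<in> {1..K}"
        then have "int n - int l \<ge> 1 - int K" using n(1) by auto
        then show "(A l *\<^sub>v X (int n - int l) \<omega>) $ a = (\<Sum>b<p. A l $$ (a, b) * x b (t - int l))"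
          using mult_mat_vec_index_sum[OF assms(6)[OF l] Xc a] n(2) by (simp add: x_def del: index_mult_mat_vec)
      qed
      also have "\<dots> = (\<Sum>l = 1..k0. \<Sum>b<p. A l $$ (a, b) * x b (t - int l))"
      proof (rule sum.mono_neutral_right)
        show "\<forall>l\<in>{1..K} - {1..k0}. (\<Sum>b<p. A l $$ (a, b) * x b (t - int l)) = 0"
          using assms(16) a by (auto intro!: sum.neutral)
      qed (use assms(14) in auto)
      finally have "(\<Sum>l = 1..K. (A l *\<^sub>v X (int n - int l) \<omega>) $ a) = (\<Sum>l = 1..k0. \<Sum>b<p. A l $$ (a, b) * x b (t - int l))" .
      moreover have "(mu *\<^sub>v D n) $ a = (\<Sum>c<d. mu $$ (a, c) * Dx c t)"
        unfolding mult_mat_vec_index_sum[OF assms(7) assms(9)[OF n(1)] a]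
        unfolding n(2) by (intro sum.cong refl) (simp add: Dx[OF _ n(1)])
      moreover have "x a t = X (int n) \<omega> $ a" using t n(2) by (simp add: x_def)
      moreover have "e a t = eps n \<omega> $ a" using t n(2) by (simp add: e_def \<epsilon>_def)
      ultimately show ?thesis using model n(1) a by simp
    qed
    interpret ls_path p e k0 d K x "\<lambda>l a b. A l $$ (a, b)" "\<lambda>a c. mu $$ (a, c)" Dx S PD "\<lambda>t. X t \<omega>" D
    proof (intro ls_path.intro var_path.intro var_path_axioms.intro ls_path_axioms.intro)
      show "white_noise p e" using white by (simp add: e_def[abs_def])
      show "x b t = 0" if "t \<le> - int K" for b t using that by (simp add: x_def)
      show "x b t = X t \<omega> $ b" if "t \<ge> 1 - int K" for b t using that by (simp add: x_def)
      show "X t \<omega> \<in> carrier_vec p" if "t \<ge> 1 - int K" for t using that by (rule Xc)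
      show "\<exists>C m. \<forall>c<d. \<forall>n. \<bar>Dx c (- int n)\<bar> \<le> C * (1 + real n) ^ m" by (rule growth)
    qed (use True x_eq PD S assms(4,9,14) Dx in \<open>auto\<close>)
    have "\<exists>a<p. \<exists>b<p. A k0 $$ (a, b) \<noteq> 0"
    proof (rule ccontr)
      assume "\<not> ?thesis"
      moreover have "A k0 \<in> carrier_mat p p" using True assms(14) by (intro assms(6)) simp
      ultimately have "A k0 = 0\<^sub>m p p" by (intro eq_matI) auto
      then show False using assms(15)[OF True] by simp
    qed
    then obtain a b where ab: "a < p" "b < p" "A k0 $$ (a, b) \<noteq> 0" by auto
    have "\<forall>\<^sub>F T in sequentially. \<forall>j\<in>{..<k0}. info_criterion p d (\<lambda>t. X t \<omega>) D f T k0 < info_criterion p d (\<lambda>t. X t \<omega>) D f T j"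
      by (rule eventually_ball_finite) (auto intro: info_criterion_less[OF f _ ab])
    then show ?thesis using eventually_ge_at_top[of 1]
    proof eventually_elim
      case (elim T)
      have "is_arg_min (info_criterion p d (\<lambda>t. X t \<omega>) D f T) (\<lambda>j. j \<le> K) (khat T \<omega>)"
        using elim(2) \<omega> by (rule assms(24))
      then have "\<not> info_criterion p d (\<lambda>t. X t \<omega>) D f T k0 < info_criterion p d (\<lambda>t. X t \<omega>) D f T (khat T \<omega>)"
        using assms(14) by (auto simp: is_arg_min_def)
      then show ?case using elim(1) by (meson lessThan_iff not_le)
    qed
  qed simp
  show ?thesis
    using AE_space wn assms(13)
  proof eventually_elim
    case (elim \<omega>)
    have "\<forall>\<^sub>F T in sequentially. ereal (real k0) \<le> ereal (real (khat T \<omega>))"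
      using order[OF elim] by eventually_elim simp
    then show ?case by (rule Liminf_bounded)
  qed
qed

end
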